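(* Let $P$ be a finite TAOS and let $Q=(Q_0,Q_1,s,t)$ be its Hasse quiver. Suppose $Q$ satisfies one of the following: (i) $Q$ is the Hasse quiver of an array TAOS; (ii) every algebraically connected component of $Q$ is the Hasse quiver of some array TAOS, and for any two distinct algebraically connected components $Q^i$ and $Q^j$ of $Q$ there do not exist paths $p_i$ in $Q^i$ and $p_j$ in $Q^j$, both of length at least two, such that $s(p_i)=s(p_j)$ and $t(p_i)=t(p_j)$. Let $Q'$ be the quiver $Q$ with some extra multiple arrows, i.e. a (finite) quiver with $Q'_0=Q_0$, $Q'_1=Q_1\sqcup E$, such that for every arrow $\alpha_1\in E$ there is an arrow $\alpha_2\in Q_1$ with $s(\alpha_1)=s(\alpha_2)$ and $t(\alpha_1)=t(\alpha_2)$. Let $I$ be the ideal of $\mathfrak{n}_{Q'}$ generated by all differences $\omega_1-\omega_2$ of two paths $\omega_1,\omega_2$ in $Q'$ of length at least two that start at the same vertex and end at the same vertex. Then the simply-connected Lie group $G_{Q'}$ whose Lie algebra is $\mathfrak{n}_{Q'}/I$ admits a left-invariant Ricci soliton, i.e. a left-invariant Riemannian metric that is a Ricci soliton.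
   Context: A Riemannian metric $g$ on a manifold $M$ is a Ricci soliton if its Ricci tensor satisfies $\mathrm{ric}_g = c\, g + \mathcal{L}_X g$ for some constant $c\in\mathbb{R}$ and some vector field $X$ on $M$. A quiver is a quadruple $(Q_0,Q_1,s,t)$ with finite vertex set $Q_0$, finite arrow set $Q_1$, and maps $s,t:Q_1\to Q_0$ (start and terminal vertex); all quivers are finite and acyclic. For a path $p$, $s(p)$ and $t(p)$ are its starting and terminal vertices; its length is its number of arrows. A transitively and antisymmetrically ordered set (TAOS) is a set $P$ with a binary relation $\prec$ that is transitive and antisymmetric ($s\prec t$, $t\prec s$ imply $s=t$); it need be neither reflexive nor irreflexive. Hasse quiver of a TAOS $P$: the quiver with vertex set $P$ and with exactly one arrow from $a$ to $b$ whenever $a\prec b$, $a\neq b$, and there is no $t\in P\setminus\{a,b\}$ with $a\prec t\prec b$ (no other arrows). Path algebra: for a finite acyclic quiver $Q$, $\mathfrak{n}_Q$ is the real associative algebra with basis all paths of length $\ge 1$ in $Q$, with product given by concatenation of paths ($xy$ if $xy$ is a path, and $0$ otherwise). It, and its quotient by a two-sided ideal, are regarded as Lie algebras with $[x,y]=x\cdot y-y\cdot x$. Algebraic connectivity: a finite quiver $Q$ is algebraically connected if $\mathfrak{n}_Q$ is not isomorphic, as an associative algebra, to a direct sum of more than one (nonzero) path algebra of a quiver. In general $\mathfrak{n}_Q=\bigoplus_{i=1}^n \mathfrak{n}_{E_i}$ where the $E_i$ are algebraically connected subquivers of $Q$ (each having at least one arrow and no isolated vertices; the direct sum is internal, so the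 arrow sets of the $E_i$ partition the arrow set of $Q$, while different $E_i$ may share vertices). The $E_i$ are the algebraically connected components of $Q$. Array TAOS: given integers $k\ge 2$, $n_1,\dots,n_k\ge 1$, and $m_1,\dots,m_k$ with $1\le m_i\le n_i$, $m_1=n_1$, $m_k=n_k$, let $P$ be a set with $\sum_{i=1}^k n_i$ elements partitioned into $k$ columns, the $i$-th column having $n_i$ elements. For each $i=1,\dots,k-1$ choose $m_{i+1}$ elements of the $(i+1)$-th column and declare $\eta_i\prec\eta_{i+1}$ for each element $\eta_i$ of the $i$-th column and each of the $m_{i+1}$ chosen elements $\eta_{i+1}$ of the $(i+1)$-th column. The relation $\prec$ on $P$ is the transitive closure of these relations. *)

theory Defs
  imports "HOL-Analysis.Analysis"
begin

section \<open>Quivers and transitively antisymmetrically ordered sets\<close>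

record ('v, 'a) quiver =
  verts :: "'v set"
  arrows :: "'a set"
  src :: "'a \<Rightarrow> 'v"
  tgt :: "'a \<Rightarrow> 'v"

definition finite_acyclic_quiver :: "('v, 'a) quiver \<Rightarrow> bool" where
  "finite_acyclic_quiver Q \<longleftrightarrow>
     finite (verts Q) \<and> finite (arrows Q) \<and>
     src Q ` arrows Q \<subseteq> verts Q \<and> tgt Q ` arrows Q \<subseteq> verts Q \<and>
     acyclic ((\<lambda>a. (src Q a, tgt Q a)) ` arrows Q)"

text \<open>A path of length at least one is the nonempty list of its consecutive arrows.\<close>

definition is_path :: "('v, 'a) quiver \<Rightarrow> 'a list \<Rightarrow> bool" where
  "is_path Q p \<longleftrightarrow> p \<noteq> [] \<and> set p \<subseteq> arrows Q \<and> successively (\<lambda>a b. tgt Q a = src Q b) p"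

definition path_src :: "('v, 'a) quiver \<Rightarrow> 'a list \<Rightarrow> 'v" where
  "path_src Q p = src Q (hd p)"

definition path_tgt :: "('v, 'a) quiver \<Rightarrow> 'a list \<Rightarrow> 'v" where
  "path_tgt Q p = tgt Q (last p)"

definition taos :: "'v set \<Rightarrow> ('v \<times> 'v) set \<Rightarrow> bool" where
  "taos P r \<longleftrightarrow> r \<subseteq> P \<times> P \<and> trans r \<and> antisym r"

definition covers :: "'v set \<Rightarrow> ('v \<times> 'v) set \<Rightarrow> 'v \<Rightarrow> 'v \<Rightarrow> bool" where
  "covers P r a b \<longleftrightarrow> a \<in> P \<and> b \<in> P \<and> (a, b) \<in> r \<and> a \<noteq> b \<and>
     \<not> (\<exists>t \<in> P - {a, b}. (a, t) \<in> r \<and> (t, b) \<in> r)"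

text \<open>The names of the arrows are left open, so this is a predicate: \<open>Q\<close> is a Hasse quiver
  of \<open>(P, r)\<close>.\<close>

definition hasse_quiver :: "'v set \<Rightarrow> ('v \<times> 'v) set \<Rightarrow> ('v, 'a) quiver \<Rightarrow> bool" where
  "hasse_quiver P r Q \<longleftrightarrow>
     verts Q = P \<and>
     (\<forall>\<alpha> \<in> arrows Q. covers P r (src Q \<alpha>) (tgt Q \<alpha>)) \<and>
     (\<forall>a b. covers P r a b \<longrightarrow> (\<exists>!\<alpha>. \<alpha> \<in> arrows Q \<and> src Q \<alpha> = a \<and> tgt Q \<alpha> = b))"

text \<open>\<open>col i\<close> is the \<open>i\<close>-th column and \<open>ch i\<close> the set of the \<open>m i\<close> elements
  chosen in it; the condition \<open>m 1 = n 1\<close> is a convention, as nothing points into column 1.\<close>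

definition array_taos :: "'v set \<Rightarrow> ('v \<times> 'v) set \<Rightarrow> bool" where
  "array_taos P r \<longleftrightarrow>
     (\<exists>(k::nat) (n :: nat \<Rightarrow> nat) (m :: nat \<Rightarrow> nat) (col :: nat \<Rightarrow> 'v set) (ch :: nat \<Rightarrow> 'v set).
        2 \<le> k \<and>
        (\<forall>i \<in> {1..k}. 1 \<le> n i \<and> 1 \<le> m i \<and> m i \<le> n i) \<and> m 1 = n 1 \<and> m k = n k \<and>
        P = (\<Union>i \<in> {1..k}. col i) \<and> disjoint_family_on col {1..k} \<and>
        (\<forall>i \<in> {1..k}. finite (col i) \<and> card (col i) = n i) \<and>
        (\<forall>i \<in> {1..k}. ch i \<subseteq> col i \<and> card (ch i) = m i) \<and>
        r = (\<Union>i \<in> {1..<k}. col i \<times> ch (Suc i))\<^sup>+)"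

definition multiple_arrow_extension :: "('v, 'a) quiver \<Rightarrow> ('v, 'a) quiver \<Rightarrow> bool" where
  "multiple_arrow_extension Q Q' \<longleftrightarrow>
     verts Q' = verts Q \<and>
     (\<exists>E. finite E \<and> arrows Q \<inter> E = {} \<and> arrows Q' = arrows Q \<union> E \<and>
        (\<forall>\<alpha> \<in> arrows Q. src Q' \<alpha> = src Q \<alpha> \<and> tgt Q' \<alpha> = tgt Q \<alpha>) \<and>
        (\<forall>\<alpha>\<^sub>1 \<in> E. \<exists>\<alpha>\<^sub>2 \<in> arrows Q. src Q' \<alpha>\<^sub>1 = src Q \<alpha>\<^sub>2 \<and> tgt Q' \<alpha>\<^sub>1 = tgt Q \<alpha>\<^sub>2))"


section \<open>Real algebras\<close>

text \<open>A real vector space with a bilinear product, given by its carrier; associative algebras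
  and Lie algebras (where \<open>rmul\<close> is the bracket) are treated uniformly.\<close>

record 'x ralg =
  rcarrier :: "'x set"
  radd :: "'x \<Rightarrow> 'x \<Rightarrow> 'x"
  rscale :: "real \<Rightarrow> 'x \<Rightarrow> 'x"
  rmul :: "'x \<Rightarrow> 'x \<Rightarrow> 'x"

definition ralg_isomorphic :: "'x ralg \<Rightarrow> 'y ralg \<Rightarrow> bool" where
  "ralg_isomorphic A B \<longleftrightarrow>
     (\<exists>\<phi>. bij_betw \<phi> (rcarrier A) (rcarrier B) \<and>
        (\<forall>x \<in> rcarrier A. \<forall>y \<in> rcarrier A. \<phi> (radd A x y) = radd B (\<phi> x) (\<phi> y)) \<and>
        (\<forall>c. \<forall>x \<in> rcarrier A. \<phi> (rscale A c x) = rscale B c (\<phi> x)) \<and>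
        (\<forall>x \<in> rcarrier A. \<forall>y \<in> rcarrier A. \<phi> (rmul A x y) = rmul B (\<phi> x) (\<phi> y)))"

definition commutator_algebra :: "'x ralg \<Rightarrow> 'x ralg" where
  "commutator_algebra A = A \<lparr> rmul := (\<lambda>x y. radd A (rmul A x y) (rscale A (- 1) (rmul A y x))) \<rparr>"

definition two_sided_ideal :: "'x ralg \<Rightarrow> 'x set \<Rightarrow> bool" where
  "two_sided_ideal A J \<longleftrightarrow>
     J \<noteq> {} \<and> J \<subseteq> rcarrier A \<and>
     (\<forall>x \<in> J. \<forall>y \<in> J. radd A x y \<in> J) \<and> (\<forall>c. \<forall>x \<in> J. rscale A c x \<in> J) \<and>
     (\<forall>a \<in> rcarrier A. \<forall>x \<in> J. rmul A a x \<in> J \<and> rmul A x a \<in> J)"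

definition ideal_generated :: "'x ralg \<Rightarrow> 'x set \<Rightarrow> 'x set" where
  "ideal_generated A S = \<Inter> {J. two_sided_ideal A J \<and> S \<subseteq> J}"

definition ralg_quotient :: "'x ralg \<Rightarrow> 'x set \<Rightarrow> 'x set ralg" where
  "ralg_quotient A J = \<lparr>
     rcarrier = (\<lambda>x. {radd A x j | j. j \<in> J}) ` rcarrier A,
     radd = (\<lambda>X Y. {radd A x y | x y. x \<in> X \<and> y \<in> Y}),
     rscale = (\<lambda>c X. {radd A (rscale A c x) j | x j. x \<in> X \<and> j \<in> J}),
     rmul = (\<lambda>X Y. {radd A (rmul A x y) j | x y j. x \<in> X \<and> y \<in> Y \<and> j \<in> J}) \<rparr>"

definition ralg_direct_sum :: "nat \<Rightarrow> (nat \<Rightarrow> 'x ralg) \<Rightarrow> (nat \<Rightarrow> 'x) ralg" where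
  "ralg_direct_sum n A = \<lparr>
     rcarrier = (\<Pi>\<^sub>E i \<in> {..<n}. rcarrier (A i)),
     radd = (\<lambda>x y. \<lambda>i \<in> {..<n}. radd (A i) (x i) (y i)),
     rscale = (\<lambda>c x. \<lambda>i \<in> {..<n}. rscale (A i) c (x i)),
     rmul = (\<lambda>x y. \<lambda>i \<in> {..<n}. rmul (A i) (x i) (y i)) \<rparr>"


section \<open>Path algebras\<close>

text \<open>An element is its coefficient function on paths; a finite acyclic quiver has only finitely
  many paths. The sum in the product runs over the ways to split \<open>p\<close> into two nonempty
  paths.\<close>

definition path_algebra :: "('v, 'a) quiver \<Rightarrow> ('a list \<Rightarrow> real) ralg" where
  "path_algebra Q = \<lparr>
     rcarrier = {x. \<forall>p. x p \<noteq> 0 \<longrightarrow> is_path Q p},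
     radd = (\<lambda>x y p. x p + y p),
     rscale = (\<lambda>c x p. c * x p),
     rmul = (\<lambda>x y p. if is_path Q p then \<Sum>i \<in> {1..<length p}. x (take i p) * y (drop i p) else 0) \<rparr>"

definition path_elem :: "'a list \<Rightarrow> 'a list \<Rightarrow> real" where
  "path_elem w = (\<lambda>p. if p = w then 1 else 0)"

definition parallel_path_ideal :: "('v, 'a) quiver \<Rightarrow> ('a list \<Rightarrow> real) set" where
  "parallel_path_ideal Q = ideal_generated (path_algebra Q)
     {(\<lambda>p. path_elem w\<^sub>1 p - path_elem w\<^sub>2 p) | w\<^sub>1 w\<^sub>2.
        is_path Q w\<^sub>1 \<and> is_path Q w\<^sub>2 \<and> 2 \<le> length w\<^sub>1 \<and> 2 \<le> length w\<^sub>2 \<and>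
        path_src Q w\<^sub>1 = path_src Q w\<^sub>2 \<and> path_tgt Q w\<^sub>1 = path_tgt Q w\<^sub>2}"

definition quotient_lie_algebra :: "('v, 'a) quiver \<Rightarrow> ('a list \<Rightarrow> real) set ralg" where
  "quotient_lie_algebra Q =
     commutator_algebra (ralg_quotient (path_algebra Q) (parallel_path_ideal Q))"

text \<open>Every finite quiver is isomorphic to one whose vertices and arrows are natural numbers,
  so it is enough to let the summands range over these.\<close>

definition algebraically_connected :: "('v, 'a) quiver \<Rightarrow> bool" where
  "algebraically_connected Q \<longleftrightarrow>
     \<not> (\<exists>(n::nat) (R :: nat \<Rightarrow> (nat, nat) quiver).
          2 \<le> n \<and>
          (\<forall>i<n. finite_acyclic_quiver (R i) \<and> rcarrier (path_algebra (R i)) \<noteq> {\<lambda>_. 0}) \<and>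
          ralg_isomorphic (path_algebra Q) (ralg_direct_sum n (\<lambda>i. path_algebra (R i))))"

text \<open>A subquiver without isolated vertices is determined by its set of arrows.\<close>

definition arrow_subquiver :: "('v, 'a) quiver \<Rightarrow> 'a set \<Rightarrow> ('v, 'a) quiver" where
  "arrow_subquiver Q B = Q \<lparr> verts := src Q ` B \<union> tgt Q ` B, arrows := B \<rparr>"

text \<open>\<open>C\<close> is the set of the arrow sets of the algebraically connected components of \<open>Q\<close>;
  the last two conditions say that \<open>path_algebra Q\<close> is the internal direct sum, as an
  algebra, of the path algebras of the components.\<close>

definition algebraic_components :: "('v, 'a) quiver \<Rightarrow> 'a set set \<Rightarrow> bool" where
  "algebraic_components Q C \<longleftrightarrow>
     \<Union> C = arrows Q \<and> disjoint C \<and> {} \<notin> C \<and>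
     (\<forall>B \<in> C. algebraically_connected (arrow_subquiver Q B)) \<and>
     (\<forall>x \<in> rcarrier (path_algebra Q).
        \<exists>!f. f \<in> (\<Pi>\<^sub>E B \<in> C. rcarrier (path_algebra (arrow_subquiver Q B))) \<and>
             x = (\<lambda>p. \<Sum>B \<in> C. f B p)) \<and>
     (\<forall>B \<in> C. \<forall>B' \<in> C. B \<noteq> B' \<longrightarrow>
        (\<forall>x \<in> rcarrier (path_algebra (arrow_subquiver Q B)).
         \<forall>y \<in> rcarrier (path_algebra (arrow_subquiver Q B')). rmul (path_algebra Q) x y = (\<lambda>_. 0)))"

definition array_hasse_quiver :: "('v, 'a) quiver \<Rightarrow> bool" where
  "array_hasse_quiver Q \<longleftrightarrow> (\<exists>P r. array_taos P r \<and> hasse_quiver P r Q)"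

definition components_array_condition :: "('v, 'a) quiver \<Rightarrow> bool" where
  "components_array_condition Q \<longleftrightarrow>
     (\<exists>C. algebraic_components Q C \<and>
        (\<forall>B \<in> C. array_hasse_quiver (arrow_subquiver Q B)) \<and>
        (\<forall>B \<in> C. \<forall>B' \<in> C. B \<noteq> B' \<longrightarrow>
           \<not> (\<exists>p p'. is_path (arrow_subquiver Q B) p \<and> is_path (arrow_subquiver Q B') p' \<and>
                 2 \<le> length p \<and> 2 \<le> length p' \<and>
                 path_src Q p = path_src Q p' \<and> path_tgt Q p = path_tgt Q p')))"


section \<open>Smooth manifolds\<close>

text \<open>The model space \<open>V\<close> of a manifold is a subspace of a Euclidean space; it may be \<open>{0}\<close>,
  which a Euclidean space type itself cannot be. \<open>Ck_on k V U f\<close> means that \<open>f\<close> is of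
  class \<open>C\<^sup>k\<close> on the relatively open subset \<open>U\<close> of \<open>V\<close>.\<close>

fun Ck_on :: "nat \<Rightarrow> 'e set \<Rightarrow> 'e set \<Rightarrow> ('e::euclidean_space \<Rightarrow> 'f::real_normed_vector) \<Rightarrow> bool" where
  "Ck_on 0 V U f = continuous_on U f"
| "Ck_on (Suc k) V U f =
     (\<exists>f'. (\<forall>x \<in> U. (f has_derivative f' x) (at x within V)) \<and>
           (\<forall>v \<in> V. Ck_on k V U (\<lambda>x. f' x v)))"

definition smooth_on :: "'e set \<Rightarrow> 'e set \<Rightarrow> ('e::euclidean_space \<Rightarrow> 'f::real_normed_vector) \<Rightarrow> bool" where
  "smooth_on V U f \<longleftrightarrow> (\<forall>k. Ck_on k V U f)"

text \<open>The underlying set of a manifold is a whole type; a chart is a pair of its domain and its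
  coordinate map.\<close>

record ('m, 'e) manifold =
  model :: "'e set"
  charts :: "('m set \<times> ('m \<Rightarrow> 'e)) set"

definition smooth_manifold ::
    "('m::{t2_space, second_countable_topology}, 'e::euclidean_space) manifold \<Rightarrow> bool" where
  "smooth_manifold M \<longleftrightarrow>
     subspace (model M) \<and> \<Union> (fst ` charts M) = UNIV \<and>
     (\<forall>(U, \<phi>) \<in> charts M.
        open U \<and> openin (top_of_set (model M)) (\<phi> ` U) \<and> homeomorphism U (\<phi> ` U) \<phi> (inv_into U \<phi>)) \<and>
     (\<forall>(U, \<phi>) \<in> charts M. \<forall>(W, \<psi>) \<in> charts M.
        smooth_on (model M) (\<phi> ` (U \<inter> W)) (\<psi> \<circ> inv_into U \<phi>))"

definition product_manifold ::
    "('m, 'e) manifold \<Rightarrow> ('n, 'f) manifold \<Rightarrow> ('m \<times> 'n, 'e \<times> 'f) manifold" where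
  "product_manifold M N = \<lparr>
     model = model M \<times> model N,
     charts = {(U \<times> W, map_prod \<phi> \<psi>) | U \<phi> W \<psi>. (U, \<phi>) \<in> charts M \<and> (W, \<psi>) \<in> charts N} \<rparr>"

definition smooth_map ::
    "('m::topological_space, 'e::euclidean_space) manifold \<Rightarrow>
     ('n::topological_space, 'f::euclidean_space) manifold \<Rightarrow> ('m \<Rightarrow> 'n) \<Rightarrow> bool" where
  "smooth_map M N F \<longleftrightarrow>
     continuous_on UNIV F \<and>
     (\<forall>(U, \<phi>) \<in> charts M. \<forall>(W, \<psi>) \<in> charts N.
        smooth_on (model M) (\<phi> ` (U \<inter> F -` W)) (\<psi> \<circ> F \<circ> inv_into U \<phi>))"

definition smooth_functions :: "('m, 'e::euclidean_space) manifold \<Rightarrow> ('m \<Rightarrow> real) set" where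
  "smooth_functions M =
     {f. \<forall>(U, \<phi>) \<in> charts M. smooth_on (model M) (\<phi> ` U) (f \<circ> inv_into U \<phi>)}"

text \<open>Tangent vectors at \<open>p\<close> are the derivations at \<open>p\<close> of the algebra of smooth functions,
  taken to be \<open>0\<close> outside that algebra so that they are determined by their values on it.\<close>

type_synonym 'm tvector = "('m \<Rightarrow> real) \<Rightarrow> real"
type_synonym 'm vfield = "'m \<Rightarrow> 'm tvector"

definition tangent_space :: "('m, 'e::euclidean_space) manifold \<Rightarrow> 'm \<Rightarrow> 'm tvector set" where
  "tangent_space M p =
     {v. (\<forall>f \<in> smooth_functions M. \<forall>h \<in> smooth_functions M. v (\<lambda>x. f x + h x) = v f + v h) \<and>
         (\<forall>c. \<forall>f \<in> smooth_functions M. v (\<lambda>x. c * f x) = c * v f) \<and>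
         (\<forall>f \<in> smooth_functions M. \<forall>h \<in> smooth_functions M.
            v (\<lambda>x. f x * h x) = f p * v h + h p * v f) \<and>
         (\<forall>f. f \<notin> smooth_functions M \<longrightarrow> v f = 0)}"

definition vapp :: "'m vfield \<Rightarrow> ('m \<Rightarrow> real) \<Rightarrow> 'm \<Rightarrow> real" where
  "vapp X f = (\<lambda>p. X p f)"

definition vector_fields :: "('m, 'e::euclidean_space) manifold \<Rightarrow> 'm vfield set" where
  "vector_fields M =
     {X. (\<forall>p. X p \<in> tangent_space M p) \<and>
         (\<forall>f \<in> smooth_functions M. vapp X f \<in> smooth_functions M)}"

definition vadd :: "'m vfield \<Rightarrow> 'm vfield \<Rightarrow> 'm vfield" where
  "vadd X Y = (\<lambda>p f. X p f + Y p f)"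

definition vdiff :: "'m vfield \<Rightarrow> 'm vfield \<Rightarrow> 'm vfield" where
  "vdiff X Y = (\<lambda>p f. X p f - Y p f)"

definition vmult :: "('m \<Rightarrow> real) \<Rightarrow> 'm vfield \<Rightarrow> 'm vfield" where
  "vmult h X = (\<lambda>p f. h p * X p f)"

definition vbracket :: "'m vfield \<Rightarrow> 'm vfield \<Rightarrow> 'm vfield" where
  "vbracket X Y = (\<lambda>p f. X p (vapp Y f) - Y p (vapp X f))"


section \<open>Riemannian metrics and Ricci solitons\<close>

type_synonym 'm metric_tensor = "'m \<Rightarrow> 'm tvector \<Rightarrow> 'm tvector \<Rightarrow> real"

definition metric_on :: "'m metric_tensor \<Rightarrow> 'm vfield \<Rightarrow> 'm vfield \<Rightarrow> 'm \<Rightarrow> real" where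
  "metric_on g X Y = (\<lambda>p. g p (X p) (Y p))"

definition riemannian_metric ::
    "('m, 'e::euclidean_space) manifold \<Rightarrow> 'm metric_tensor \<Rightarrow> bool" where
  "riemannian_metric M g \<longleftrightarrow>
     (\<forall>p. \<forall>u \<in> tangent_space M p. \<forall>v \<in> tangent_space M p. \<forall>w \<in> tangent_space M p. \<forall>c.
        g p (\<lambda>f. u f + v f) w = g p u w + g p v w \<and>
        g p (\<lambda>f. c * u f) w = c * g p u w \<and>
        g p u w = g p w u \<and>
        (u \<noteq> (\<lambda>_. 0) \<longrightarrow> g p u u > 0)) \<and>
     (\<forall>X \<in> vector_fields M. \<forall>Y \<in> vector_fields M. metric_on g X Y \<in> smooth_functions M)"

definition levi_civita ::
    "('m, 'e::euclidean_space) manifold \<Rightarrow> 'm metric_tensor \<Rightarrow>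
     ('m vfield \<Rightarrow> 'm vfield \<Rightarrow> 'm vfield) \<Rightarrow> bool" where
  "levi_civita M g nab \<longleftrightarrow>
     (\<forall>X \<in> vector_fields M. \<forall>Y \<in> vector_fields M. nab X Y \<in> vector_fields M) \<and>
     (\<forall>X \<in> vector_fields M. \<forall>Y \<in> vector_fields M. \<forall>Z \<in> vector_fields M.
        nab (vadd X Y) Z = vadd (nab X Z) (nab Y Z) \<and>
        nab X (vadd Y Z) = vadd (nab X Y) (nab X Z) \<and>
        (\<forall>f \<in> smooth_functions M.
           nab (vmult f X) Y = vmult f (nab X Y) \<and>
           nab X (vmult f Y) = vadd (vmult (vapp X f) Y) (vmult f (nab X Y))) \<and>
        vdiff (nab X Y) (nab Y X) = vbracket X Y \<and>
        vapp X (metric_on g Y Z) = (\<lambda>p. metric_on g (nab X Y) Z p + metric_on g Y (nab X Z) p))"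

definition curvature ::
    "('m vfield \<Rightarrow> 'm vfield \<Rightarrow> 'm vfield) \<Rightarrow> 'm vfield \<Rightarrow> 'm vfield \<Rightarrow> 'm vfield \<Rightarrow> 'm vfield" where
  "curvature nab X Y Z = vdiff (vdiff (nab X (nab Y Z)) (nab Y (nab X Z))) (nab (vbracket X Y) Z)"

definition orthonormal_frame_at ::
    "('m, 'e::euclidean_space) manifold \<Rightarrow> 'm metric_tensor \<Rightarrow> 'm \<Rightarrow> nat \<times> (nat \<Rightarrow> 'm vfield) \<Rightarrow> bool" where
  "orthonormal_frame_at M g p = (\<lambda>(n, E).
     (\<forall>i<n. E i \<in> vector_fields M) \<and>
     (\<forall>i<n. \<forall>j<n. g p (E i p) (E j p) = (if i = j then 1 else 0)) \<and>
     (\<forall>v \<in> tangent_space M p. \<exists>c. v = (\<lambda>f. \<Sum>i<n. c i * E i p f)))"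

text \<open>\<open>ric(Y, Z)\<close> at \<open>p\<close> is the trace of \<open>X \<mapsto> R(X, Y)Z\<close> on the tangent space at \<open>p\<close>. It is
  computed in vector fields that are orthonormal at \<open>p\<close>; their choice does not matter, since
  \<open>R\<close> is tensorial.\<close>

definition ricci ::
    "('m, 'e::euclidean_space) manifold \<Rightarrow> 'm metric_tensor \<Rightarrow>
     ('m vfield \<Rightarrow> 'm vfield \<Rightarrow> 'm vfield) \<Rightarrow> 'm vfield \<Rightarrow> 'm vfield \<Rightarrow> 'm \<Rightarrow> real" where
  "ricci M g nab Y Z p =
     (let (n, E) = (SOME F. orthonormal_frame_at M g p F)
      in \<Sum>i<n. metric_on g (curvature nab (E i) Y Z) (E i) p)"

definition lie_derivative_metric ::
    "'m metric_tensor \<Rightarrow> 'm vfield \<Rightarrow> 'm vfield \<Rightarrow> 'm vfield \<Rightarrow> 'm \<Rightarrow> real" where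
  "lie_derivative_metric g X Y Z p =
     vapp X (metric_on g Y Z) p - metric_on g (vbracket X Y) Z p - metric_on g Y (vbracket X Z) p"

definition ricci_soliton ::
    "('m, 'e::euclidean_space) manifold \<Rightarrow> 'm metric_tensor \<Rightarrow> bool" where
  "ricci_soliton M g \<longleftrightarrow>
     riemannian_metric M g \<and>
     (\<exists>nab. levi_civita M g nab \<and>
       (\<exists>(c::real). \<exists>X \<in> vector_fields M. \<forall>Y \<in> vector_fields M. \<forall>Z \<in> vector_fields M. \<forall>p.
          ricci M g nab Y Z p = c * metric_on g Y Z p + lie_derivative_metric g X Y Z p))"


section \<open>Lie groups\<close>

text \<open>The locale \<open>group\<close> is the one from \<open>HOL.Groups\<close>, with the whole type as carrier.\<close>

definition lie_group ::
    "('g::{t2_space, second_countable_topology}, 'e::euclidean_space) manifold \<Rightarrow>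
     ('g \<Rightarrow> 'g \<Rightarrow> 'g) \<Rightarrow> 'g \<Rightarrow> ('g \<Rightarrow> 'g) \<Rightarrow> bool" where
  "lie_group G mul e iv \<longleftrightarrow>
     smooth_manifold G \<and> group mul e iv \<and>
     smooth_map (product_manifold G G) G (\<lambda>(a, b). mul a b) \<and> smooth_map G G iv"

text \<open>The differential of the left translation by \<open>a\<close>.\<close>

definition left_push :: "('g \<Rightarrow> 'g \<Rightarrow> 'g) \<Rightarrow> 'g \<Rightarrow> 'g tvector \<Rightarrow> 'g tvector" where
  "left_push mul a v = (\<lambda>f. v (f \<circ> mul a))"

definition left_invariant_fields ::
    "('g, 'e::euclidean_space) manifold \<Rightarrow> ('g \<Rightarrow> 'g \<Rightarrow> 'g) \<Rightarrow> 'g vfield set" where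
  "left_invariant_fields G mul =
     {X \<in> vector_fields G. \<forall>a p. X (mul a p) = left_push mul a (X p)}"

definition lie_algebra_of ::
    "('g, 'e::euclidean_space) manifold \<Rightarrow> ('g \<Rightarrow> 'g \<Rightarrow> 'g) \<Rightarrow> 'g vfield ralg" where
  "lie_algebra_of G mul = \<lparr>
     rcarrier = left_invariant_fields G mul,
     radd = vadd,
     rscale = (\<lambda>c. vmult (\<lambda>_. c)),
     rmul = vbracket \<rparr>"

definition left_invariant_metric ::
    "('g, 'e::euclidean_space) manifold \<Rightarrow> ('g \<Rightarrow> 'g \<Rightarrow> 'g) \<Rightarrow> 'g metric_tensor \<Rightarrow> bool" where
  "left_invariant_metric G mul g \<longleftrightarrow>
     riemannian_metric G g \<and>
     (\<forall>a p. \<forall>u \<in> tangent_space G p. \<forall>v \<in> tangent_space G p.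
        g (mul a p) (left_push mul a u) (left_push mul a v) = g p u v)"

end

theory Submission
  imports Defs
begin

text \<open>
The arrows of \<open>Q\<close> generate a strict order on the vertices, and modulo \<open>I\<close> a path of length at
least two is determined by its end points. So the Lie algebra has a basis of elements \<open>E\<^bsub>ab\<^esub>\<close> for
\<open>a < b\<close> with \<open>E\<^bsub>ab\<^esub> E\<^bsub>bc\<^esub> = E\<^bsub>ac\<^esub>\<close> and, for each extra arrow \<open>\<epsilon>\<close>, of a difference \<open>\<epsilon> - \<alpha>\<close> of parallel
elements, which annihilates everything: extra arrows contribute a central abelian factor.

In the order of an array quiver, or of components as in (ii), two incomparable elements of an
interval \<open>{x. a < x < c}\<close> have the same predecessors and the same successors. Hence the weights
\<open>\<tau>\<^bsub>b\<^esub> = 1 / (#predecessors + #successors + #siblings)\<close> of the vertices admit factors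
\<open>w\<^bsub>ab\<^esub>\<close> with \<open>w\<^bsub>ac\<^esub> = \<tau>\<^bsub>b\<^esub> w\<^bsub>ab\<^esub> w\<^bsub>bc\<^esub>\<close>. Declaring the \<open>E\<^bsub>ab\<^esub> / sqrt w\<^bsub>ab\<^esub>\<close> and the differences \<open>\<epsilon> - \<alpha>\<close>
orthonormal makes the Ricci operator equal to \<open>- 1/2 + D\<close> for a diagonal derivation \<open>D\<close>: the choice of
\<open>\<tau>\<close> is exactly what makes the eigenvalues of \<open>D\<close> additive along \<open>a < b < c\<close>.

It remains to find a vector field \<open>X\<close> whose bracket with the left-invariant frame \<open>e\<^bsub>j\<^esub>\<close> is
\<open>- D\<^bsub>j\<^esub> / 2\<close> times \<open>e\<^bsub>j\<^esub>\<close>. Its coefficients are primitives of one-forms that are closed because \<open>D\<close> is a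
derivation. As the Lie algebra is nilpotent they can be found one after the other, and global
primitives exist because the group is simply connected.
\<close>

section \<open>Smooth functions on subspaces\<close>

text \<open>In an orthonormal basis of a nilpotent Lie algebra the Ricci tensor is
  \<open>sum c i m b * c i m n / 4 - sum c b i m * c n i m / 2\<close>. If every product
  \<open>E_ab E_bc\<close> of normalised elements has coefficient \<open>sqrt (\<tau> b)\<close>,
  then \<open>E_ab\<close> has Ricci eigenvalue half of: the sum of \<tau> over the open interval,
  minus #successors(b) times \<open>\<tau> b\<close>, minus #predecessors(a) times
  \<open>\<tau> a\<close>. After adding 1/2, the defect from additivity along
  \<open>a < b < c\<close> is \<open>(1 - \<tau> b * (#predecessors + #successors + #siblings)) /
  2\<close>, because the long interval exceeds the two short ones by the siblings of
  \<open>b\<close>. This dictates \<tau>, up to the scale fixed by -1/2. The obstacle on the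
  algebraic side is that \<open>w a c\<close> must come out the same for every intermediate
  \<open>b\<close>; the condition on incomparable elements secures it. On the geometric side tangent
  vectors are derivations and the Ricci tensor uses an arbitrarily chosen frame, so coordinates and
  smooth coefficients must be recovered from these. The soliton field is not left-invariant unless
  \<open>D = 0\<close>; it comes from a triangular system of differential equations rather than from
  a flow of automorphisms.\<close>

definition dd :: "'e \<Rightarrow> ('e::euclidean_space \<Rightarrow> 'f::real_normed_vector) \<Rightarrow> 'e \<Rightarrow> 'f" where
  "dd v f x = vector_derivative (\<lambda>t. f (x + t *\<^sub>R v)) (at 0)"

lemma at_within_openin:
  assumes "openin (top_of_set V) U" "x \<in> U"
  shows "at x within U = at x within V"
proof -
  obtain T where T: "open T" "U = V \<inter> T"
    using assms(1) by (auto simp: openin_open)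
  show ?thesis
    by (rule at_within_nhd[of x T]) (use T assms in auto)
qed

text \<open>Within a proper subspace a derivative is pinned down only on \<open>V\<close> itself. A
  line in a direction of \<open>V\<close> stays in \<open>V\<close>, so \<open>dd\<close> reads off
  exactly these determined values and serves as a canonical derivative.\<close>

lemma has_derivative_dd:
  assumes V: "subspace V" "x \<in> V" "v \<in> V" and f: "(f has_derivative f') (at x within V)"
  shows "dd v f x = f' v" "((\<lambda>t. f (x + t *\<^sub>R v)) has_vector_derivative f' v) (at 0)"
proof -
  have g: "((\<lambda>t::real. x + t *\<^sub>R v) has_derivative (\<lambda>t. t *\<^sub>R v)) (at 0)"
    by (auto intro!: derivative_eq_intros)
  have sub: "range (\<lambda>t::real. x + t *\<^sub>R v) \<subseteq> V"
    using V by (auto intro: subspace_add subspace_scale)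
  have "(f has_derivative f') (at (x + 0 *\<^sub>R v) within range (\<lambda>t::real. x + t *\<^sub>R v))"
    using has_derivative_subset[OF f sub] by simp
  from diff_chain_within[OF g this]
  have "((\<lambda>t. f (x + t *\<^sub>R v)) has_derivative (\<lambda>t. f' (t *\<^sub>R v))) (at 0)"
    by (simp add: o_def)
  moreover have "f' (t *\<^sub>R v) = t *\<^sub>R f' v" for t
    using has_derivative_bounded_linear[OF f] by (simp add: bounded_linear.linear linear_scale)
  ultimately show "((\<lambda>t. f (x + t *\<^sub>R v)) has_vector_derivative f' v) (at 0)"
    by (simp add: has_vector_derivative_def)
  then show "dd v f x = f' v"
    by (simp add: dd_def vector_derivative_at)
qed

lemma has_derivative_cong_openin:
  assumes "openin (top_of_set V) U" "x \<in> U" "\<And>y. y \<in> U \<Longrightarrow> f y = g y"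
  shows "(f has_derivative f') (at x within V) \<longleftrightarrow> (g has_derivative f') (at x within V)"
proof -
  have "(f has_derivative f') (at x within U) \<longleftrightarrow> (g has_derivative f') (at x within U)"
    using assms by (metis has_derivative_transform)
  then show ?thesis using at_within_openin[OF assms(1,2)] by simp
qed

lemma Ck_on_cong:
  assumes "openin (top_of_set V) U" "\<And>y. y \<in> U \<Longrightarrow> f y = g y"
  shows "Ck_on k V U f \<longleftrightarrow> Ck_on k V U g"
proof (cases k)
  case 0
  then show ?thesis using assms by (auto intro: continuous_on_cong)
next
  case (Suc n)
  then show ?thesis using has_derivative_cong_openin[OF assms(1) _ assms(2)] by simp
qed

lemma Ck_on_subset: "Ck_on k V U f \<Longrightarrow> U' \<subseteq> U \<Longrightarrow> Ck_on k V U' f"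
proof (induction k arbitrary: f)
  case 0
  then show ?case by (auto intro: continuous_on_subset)
next
  case (Suc k)
  then show ?case by simp (meson subsetD)
qed

text \<open>\<open>Ck_on\<close> quantifies existentially over a derivative. Trading it for the
  canonical \<open>dd\<close> turns smoothness into a condition that \<open>dd\<close> inherits and
  that can be checked locally.\<close>

lemma Ck_on_Suc_iff:
  assumes V: "subspace V" and U: "openin (top_of_set V) U"
  shows "Ck_on (Suc k) V U f \<longleftrightarrow>
    (\<forall>x\<in>U. f differentiable (at x within V)) \<and> (\<forall>v\<in>V. Ck_on k V U (dd v f))"
proof -
  have UV: "U \<subseteq> V" using U by (rule openin_imp_subset)
  show ?thesis
  proof
    assume "Ck_on (Suc k) V U f"
    then obtain f' where f': "\<And>x. x\<in>U \<Longrightarrow> (f has_derivative f' x) (at x within V)"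
      and c: "\<And>v. v \<in> V \<Longrightarrow> Ck_on k V U (\<lambda>x. f' x v)" by auto
    have "Ck_on k V U (dd v f)" if v: "v \<in> V" for v
      using c[OF v] Ck_on_cong[OF U, of "\<lambda>x. f' x v" "dd v f" k] has_derivative_dd(1)[OF V _ v f'] UV
      by (metis subsetD)
    then show "(\<forall>x\<in>U. f differentiable (at x within V)) \<and> (\<forall>v\<in>V. Ck_on k V U (dd v f))"
      using f' by (auto simp: differentiable_def)
  next
    assume *: "(\<forall>x\<in>U. f differentiable (at x within V)) \<and> (\<forall>v\<in>V. Ck_on k V U (dd v f))"
    then obtain f' where f': "\<And>x. x\<in>U \<Longrightarrow> (f has_derivative f' x) (at x within V)"
      unfolding differentiable_def by metis
    have "Ck_on k V U (\<lambda>x. f' x v)" if v: "v \<in> V" for v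
      using * v Ck_on_cong[OF U, of "\<lambda>x. f' x v" "dd v f" k] has_derivative_dd(1)[OF V _ v f'] UV
      by (metis subsetD)
    then show "Ck_on (Suc k) V U f" using f' by auto
  qed
qed

lemma continuous_on_differentiable_within:
  assumes "U \<subseteq> V" "\<forall>x\<in>U. f differentiable (at x within V)"
  shows "continuous_on U f"
  by (meson assms continuous_on_eq_continuous_within continuous_within_subset differentiable_imp_continuous_within)

lemma Ck_on_Suc_D:
  assumes V: "subspace V" and U: "openin (top_of_set V) U"
  shows "Ck_on (Suc k) V U f \<Longrightarrow> Ck_on k V U f"
proof (induction k arbitrary: f)
  case 0
  then show ?case
    using Ck_on_Suc_iff[OF V U, of 0 f] continuous_on_differentiable_within[OF openin_imp_subset[OF U], of f] by auto
next
  case (Suc k)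
  then show ?case using Ck_on_Suc_iff[OF V U] by blast
qed

lemma Ck_on_local:
  assumes V: "subspace V" and U: "openin (top_of_set V) U"
    and loc: "\<And>x. x \<in> U \<Longrightarrow> \<exists>N. openin (top_of_set V) N \<and> x \<in> N \<and> N \<subseteq> U \<and> Ck_on k V N f"
  shows "Ck_on k V U f"
  using loc
proof (induction k arbitrary: f)
  case 0
  have "continuous (at x within U) f" if x: "x \<in> U" for x
  proof -
    obtain N where N: "openin (top_of_set V) N" "x \<in> N" "N \<subseteq> U" "continuous_on N f" using 0 x by auto
    then have "continuous (at x within N) f" by (simp add: continuous_on_eq_continuous_within)
    then show ?thesis using at_within_openin[OF N(1,2)] at_within_openin[OF U x] by simp
  qed
  then show ?case by (simp add: continuous_on_eq_continuous_within)
next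
  case (Suc k)
  have "f differentiable (at x within V)" if "x \<in> U" for x
    using Suc.prems[OF that] Ck_on_Suc_iff[OF V] by blast
  moreover have "Ck_on k V U (dd v f)" if v: "v \<in> V" for v
  proof (rule Suc.IH)
    fix x assume "x \<in> U"
    from Suc.prems[OF this] obtain N where N: "openin (top_of_set V) N" "x \<in> N" "N \<subseteq> U" "Ck_on (Suc k) V N f"
      by blast
    then have "Ck_on k V N (dd v f)" using Ck_on_Suc_iff[OF V N(1)] v by blast
    with N show "\<exists>N. openin (top_of_set V) N \<and> x \<in> N \<and> N \<subseteq> U \<and> Ck_on k V N (dd v f)"
      by blast
  qed
  ultimately show ?case using Ck_on_Suc_iff[OF V U] by blast
qed

lemma Ck_on_const: "Ck_on k V U (\<lambda>x. c)"
proof (induction k arbitrary: c)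
  case (Suc k)
  then show ?case by (simp, intro exI[of _ "\<lambda>x v. 0"]) simp
qed simp

lemma Ck_on_bounded_linear: "bounded_linear h \<Longrightarrow> Ck_on k V U h"
proof (cases k)
  case (Suc n)
  assume "bounded_linear h"
  then show ?thesis unfolding Suc Ck_on.simps
    by (intro exI[of _ "\<lambda>x. h"] conjI ballI bounded_linear_imp_has_derivative Ck_on_const)
qed (simp add: linear_continuous_on)

lemma Ck_on_add: "Ck_on k V U f \<Longrightarrow> Ck_on k V U g \<Longrightarrow> Ck_on k V U (\<lambda>x. f x + g x)"
proof (induction k arbitrary: f g)
  case 0
  then show ?case by (auto intro: continuous_on_add)
next
  case (Suc k)
  from Suc.prems obtain f' g' where "\<forall>x \<in> U. (f has_derivative f' x) (at x within V)" "\<forall>v \<in> V. Ck_on k V U (\<lambda>x. f' x v)"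
   "\<forall>x \<in> U. (g has_derivative g' x) (at x within V)" "\<forall>v \<in> V. Ck_on k V U (\<lambda>x. g' x v)" by auto
  then show ?case unfolding Ck_on.simps
    by (intro exI[of _ "\<lambda>x v. f' x v + g' x v"] conjI ballI Suc.IH has_derivative_add) auto
qed

lemma Ck_on_linear: "bounded_linear h \<Longrightarrow> Ck_on k V U f \<Longrightarrow> Ck_on k V U (\<lambda>x. h (f x))"
proof (induction k arbitrary: f)
  case 0
  then show ?case by (auto intro: bounded_linear.continuous_on)
next
  case (Suc k)
  from Suc.prems obtain f' where "\<forall>x \<in> U. (f has_derivative f' x) (at x within V)" "\<forall>v \<in> V. Ck_on k V U (\<lambda>x. f' x v)"
    by auto
  with Suc show ?case unfolding Ck_on.simps
    by (intro exI[of _ "\<lambda>x v. h (f' x v)"] conjI ballI bounded_linear.has_derivative[of h] Suc.IH) auto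
qed

lemma Ck_on_bilinear:
  assumes h: "bounded_bilinear h" and V: "subspace V" and U: "openin (top_of_set V) U"
  shows "Ck_on k V U f \<Longrightarrow> Ck_on k V U g \<Longrightarrow> Ck_on k V U (\<lambda>x. h (f x) (g x))"
proof (induction k arbitrary: f g)
  case 0
  then show ?case using bounded_bilinear.continuous_on[OF h] by auto
next
  case (Suc k)
  from Suc.prems obtain f' g' where *: "\<forall>x \<in> U. (f has_derivative f' x) (at x within V)" "\<forall>v \<in> V. Ck_on k V U (\<lambda>x. f' x v)"
   "\<forall>x \<in> U. (g has_derivative g' x) (at x within V)" "\<forall>v \<in> V. Ck_on k V U (\<lambda>x. g' x v)" by auto
  \<comment> \<open>The product rule brings back \<open>f\<close> and \<open>g\<close> themselves,
    hence the descent from class \<open>Suc k\<close> to class \<open>k\<close>.\<close>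
  have "Ck_on k V U f" "Ck_on k V U g" using Suc.prems Ck_on_Suc_D[OF V U] by blast+
  with * show ?case unfolding Ck_on.simps
    by (intro exI[of _ "\<lambda>x v. h (f x) (g' x v) + h (f' x v) (g x)"] conjI ballI Suc.IH Ck_on_add
         bounded_bilinear.FDERIV[OF h]) auto
qed

lemma Ck_on_sum: "(\<And>i. i \<in> A \<Longrightarrow> Ck_on k V U (f i)) \<Longrightarrow> Ck_on k V U (\<lambda>x. \<Sum>i\<in>A. f i x)"
  by (induction A rule: infinite_finite_induct) (auto intro: Ck_on_const Ck_on_add)

lemmas Ck_on_mult = Ck_on_bilinear[OF bounded_bilinear_mult]
lemmas Ck_on_scaleR = Ck_on_bilinear[OF bounded_bilinear_scaleR]

lemma Ck_on_cmult: "Ck_on k V U f \<Longrightarrow> Ck_on k V U (\<lambda>x. c * f x :: real)"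
  by (rule Ck_on_linear[OF bounded_linear_mult_right])

lemma Ck_on_inverse:
  fixes f :: "'e::euclidean_space \<Rightarrow> real"
  assumes V: "subspace V" and U: "openin (top_of_set V) U" and nz: "\<And>x. x \<in> U \<Longrightarrow> f x \<noteq> 0"
  shows "Ck_on k V U f \<Longrightarrow> Ck_on k V U (\<lambda>x. inverse (f x))"
proof (induction k)
  case 0
  then show ?case using nz by (auto intro: continuous_on_inverse)
next
  case (Suc k)
  from Suc.prems obtain f' where *: "\<forall>x \<in> U. (f has_derivative f' x) (at x within V)" "\<forall>v \<in> V. Ck_on k V U (\<lambda>x. f' x v)"
    by auto
  have c: "Ck_on k V U (\<lambda>x. inverse (f x))" using Suc Ck_on_Suc_D[OF V U] by blast
  show ?case
  proof (unfold Ck_on.simps, intro exI conjI ballI)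
    fix x assume "x \<in> U"
    then show "((\<lambda>x. inverse (f x)) has_derivative (\<lambda>v. - 1 * (inverse (f x) * f' x v * inverse (f x)))) (at x within V)"
      using * nz Deriv.has_derivative_inverse[of f x "f' x" V] by simp
  next
    fix v assume "v \<in> V"
    then show "Ck_on k V U (\<lambda>x. - 1 * (inverse (f x) * f' x v * inverse (f x)))"
      using * c by (intro Ck_on_cmult Ck_on_mult[OF V U]) auto
  qed
qed

text \<open>Difference quotients taken inside \<open>U\<close> lie in \<open>W\<close>, and
  \<open>W\<close> is closed. The chain rule depends on this, since there the outer map is
  differentiable only within \<open>W\<close>.\<close>

lemma has_derivative_in_subspace:
  fixes f :: "'e::euclidean_space \<Rightarrow> 'f::euclidean_space"
  assumes V: "subspace V" and U: "openin (top_of_set V) U" and x: "x \<in> U" and v: "v \<in> V"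
    and W: "subspace W" and fW: "f ` U \<subseteq> W" and f: "(f has_derivative f') (at x within V)"
  shows "f' v \<in> W"
proof -
  have xV: "x \<in> V" using x openin_imp_subset[OF U] by auto
  obtain T where T: "open T" "U = V \<inter> T" using U by (auto simp: openin_open)
  have "((\<lambda>t. f (x + t *\<^sub>R v)) has_vector_derivative f' v) (at 0)"
    using has_derivative_dd(2)[OF V xV v f] .
  then have "((\<lambda>t. norm ((f (x + t *\<^sub>R v) - f x) - t *\<^sub>R f' v) / norm t) \<longlongrightarrow> 0) (at 0)"
    by (simp add: has_vector_derivative_def has_derivative_iff_norm)
  then have "((\<lambda>t. norm ((f (x + t *\<^sub>R v) - f x) /\<^sub>R t - f' v)) \<longlongrightarrow> 0) (at 0)"
  proof (rule Lim_transform_eventually)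
    have "norm ((f (x + t *\<^sub>R v) - f x) - t *\<^sub>R f' v) / norm t = norm ((f (x + t *\<^sub>R v) - f x) /\<^sub>R t - f' v)"
      if "t \<noteq> 0" for t
    proof -
      have "(f (x + t *\<^sub>R v) - f x) /\<^sub>R t - f' v = ((f (x + t *\<^sub>R v) - f x) - t *\<^sub>R f' v) /\<^sub>R t"
        using that by (simp add: scaleR_diff_right)
      then show ?thesis by (simp add: divide_inverse_commute)
    qed
    then show "\<forall>\<^sub>F t in at 0. norm ((f (x + t *\<^sub>R v) - f x) - t *\<^sub>R f' v) / norm t
        = norm ((f (x + t *\<^sub>R v) - f x) /\<^sub>R t - f' v)"
      by (auto simp: eventually_at_filter)
  qed
  then have lim: "((\<lambda>t. (f (x + t *\<^sub>R v) - f x) /\<^sub>R t) \<longlongrightarrow> f' v) (at 0)"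
    using Lim_null tendsto_norm_zero_iff by blast
  have "((\<lambda>t::real. x + t *\<^sub>R v) \<longlongrightarrow> x + 0 *\<^sub>R v) (at 0)"
    by (intro tendsto_intros)
  then have "\<forall>\<^sub>F t::real in at 0. x + t *\<^sub>R v \<in> T"
    using T x by (auto dest!: topological_tendstoD[where S=T])
  then have "\<forall>\<^sub>F t::real in at 0. (f (x + t *\<^sub>R v) - f x) /\<^sub>R t \<in> W"
  proof (rule eventually_mono)
    fix t :: real assume "x + t *\<^sub>R v \<in> T"
    then have "x + t *\<^sub>R v \<in> U" using T V xV v by (auto intro: subspace_add subspace_scale)
    then show "(f (x + t *\<^sub>R v) - f x) /\<^sub>R t \<in> W"
      using fW x by (intro subspace_scale[OF W] subspace_diff[OF W]) auto
  qed
  then show ?thesis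
    by (rule Lim_in_closed_set[OF closed_subspace[OF W] _ _ lim]) simp
qed

lemma orthonormal_basis_of_subspace:
  fixes W :: "'f::euclidean_space set"
  assumes "subspace W"
  obtains B where "finite B" "B \<subseteq> W" "pairwise orthogonal B" "\<And>b. b \<in> B \<Longrightarrow> norm b = 1"
    "\<And>w. w \<in> W \<Longrightarrow> w = (\<Sum>b\<in>B. (w \<bullet> b) *\<^sub>R b)"
    "\<And>b c. b \<in> B \<Longrightarrow> c \<in> B \<Longrightarrow> b \<bullet> c = (if b = c then 1 else 0)"
proof -
  obtain B where B: "B \<subseteq> W" "pairwise orthogonal B" "\<And>b. b \<in> B \<Longrightarrow> norm b = 1" "independent B" "card B = dim W" "span B = W"
    using orthonormal_basis_subspace[OF assms] by metis
  have fin: "finite B" using B(4) independent_imp_finite by blast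
  have *: "b \<bullet> c = (if b = c then 1 else 0)" if "b \<in> B" "c \<in> B" for b c
    using B(2,3) that by (auto simp: pairwise_def orthogonal_def norm_eq_1)
  have "w = (\<Sum>b\<in>B. (w \<bullet> b) *\<^sub>R b)" if "w \<in> W" for w
  proof -
    from that B(6) obtain u where u: "w = (\<Sum>b\<in>B. u b *\<^sub>R b)"
      using span_finite[OF fin] by auto
    have "w \<bullet> c = u c" if "c \<in> B" for c
    proof -
      have "w \<bullet> c = (\<Sum>b\<in>B. u b * (b \<bullet> c))" unfolding u by (simp add: inner_sum_left)
      also have "\<dots> = (\<Sum>b\<in>B. if b = c then u b else 0)" using that * by (intro sum.cong) auto
      finally show ?thesis using that fin by simp
    qed
    then show ?thesis by (subst u) (auto intro: sum.cong)
  qed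
  with B fin * show ?thesis using that by blast
qed

lemma Ck_on_compose:
  fixes f :: "'e::euclidean_space \<Rightarrow> 'f::euclidean_space" and g :: "'f \<Rightarrow> 'h::real_normed_vector"
  assumes V: "subspace V" and U: "openin (top_of_set V) U" and W: "subspace W" and U': "openin (top_of_set W) U'"
    and fU: "f ` U \<subseteq> U'"
  shows "Ck_on k V U f \<Longrightarrow> Ck_on k W U' g \<Longrightarrow> Ck_on k V U (\<lambda>x. g (f x))"
proof (induction k arbitrary: g)
  case 0
  then show ?case using fU by (auto intro: continuous_on_compose2)
next
  case (Suc k)
  from Suc.prems obtain f' g' where *: "\<forall>x \<in> U. (f has_derivative f' x) (at x within V)" "\<forall>v \<in> V. Ck_on k V U (\<lambda>x. f' x v)"
   "\<forall>x \<in> U'. (g has_derivative g' x) (at x within W)" "\<forall>v \<in> W. Ck_on k W U' (\<lambda>x. g' x v)" by auto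
  have UW: "U' \<subseteq> W" using U' by (rule openin_imp_subset)
  obtain B where B: "finite B" "B \<subseteq> W" "\<And>w. w \<in> W \<Longrightarrow> w = (\<Sum>b\<in>B. (w \<bullet> b) *\<^sub>R b)"
    using orthonormal_basis_of_subspace[OF W] by metis
  have f: "Ck_on k V U f" using Suc.prems Ck_on_Suc_D[OF V U] by blast
  have der: "((\<lambda>x. g (f x)) has_derivative (\<lambda>v. g' (f x) (f' x v))) (at x within V)" if x: "x \<in> U" for x
  proof -
    have 1: "(f has_derivative f' x) (at x within U)" using * x at_within_openin[OF U x] by simp
    have "f ` U \<subseteq> W" using fU UW by auto
    then have 2: "(g has_derivative g' (f x)) (at (f x) within f ` U)"
      using * x fU by (metis has_derivative_subset image_subset_iff)
    show ?thesis using diff_chain_within[OF 1 2] at_within_openin[OF U x] by (simp add: o_def)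
  qed
  have "Ck_on k V U (\<lambda>x. g' (f x) (f' x v))" if v: "v \<in> V" for v
  proof -
    \<comment> \<open>The direction \<open>f' x v\<close> moves with \<open>x\<close>, whereas
      \<open>Ck_on\<close> controls \<open>g'\<close> only in fixed directions. Expanding in an
      orthonormal basis of \<open>W\<close> moves the dependence on \<open>x\<close> into scalar
      coefficients.\<close>
    have eq: "g' (f x) (f' x v) = (\<Sum>b\<in>B. (f' x v \<bullet> b) *\<^sub>R g' (f x) b)" if x: "x \<in> U" for x
    proof -
      have "f' x v \<in> W"
        by (rule has_derivative_in_subspace[OF V U x v W, of f]) (use fU UW * x in auto)
      from B(3)[OF this] have "g' (f x) (f' x v) = g' (f x) (\<Sum>b\<in>B. (f' x v \<bullet> b) *\<^sub>R b)" by simp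
      moreover have "linear (g' (f x))"
        using * x fU by (meson bounded_linear.linear has_derivative_bounded_linear image_subset_iff)
      ultimately show ?thesis by (simp add: linear_sum linear_scale)
    qed
    have "Ck_on k V U (\<lambda>x. \<Sum>b\<in>B. (f' x v \<bullet> b) *\<^sub>R g' (f x) b)"
    proof (intro Ck_on_sum Ck_on_scaleR[OF V U])
      fix b assume "b \<in> B"
      then show "Ck_on k V U (\<lambda>x. g' (f x) b)"
        using Suc.IH[OF f, of "\<lambda>y. g' y b"] * B by auto
      show "Ck_on k V U (\<lambda>x. f' x v \<bullet> b)"
        by (rule Ck_on_linear[OF bounded_linear_inner_left]) (use * v in auto)
    qed
    then show ?thesis using Ck_on_cong[OF U eq] by simp
  qed
  with der show ?case unfolding Ck_on.simps
    by (intro exI[of _ "\<lambda>x v. g' (f x) (f' x v)"] conjI ballI)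
qed

section \<open>Closure properties of smooth functions and rules for directional derivatives\<close>

lemma smooth_on_cong:
  assumes "openin (top_of_set V) U" "\<And>y. y \<in> U \<Longrightarrow> f y = g y"
  shows "smooth_on V U f \<longleftrightarrow> smooth_on V U g"
  using Ck_on_cong[OF assms] by (simp add: smooth_on_def)

lemma smooth_on_subset: "smooth_on V U f \<Longrightarrow> U' \<subseteq> U \<Longrightarrow> smooth_on V U' f"
  unfolding smooth_on_def using Ck_on_subset by blast

lemma smooth_on_dd:
  assumes "subspace V" "openin (top_of_set V) U" "smooth_on V U f" "v \<in> V"
  shows "smooth_on V U (dd v f)"
  using assms Ck_on_Suc_iff[OF assms(1,2)] unfolding smooth_on_def by blast

lemma smooth_on_differentiable:
  assumes "subspace V" "openin (top_of_set V) U" "smooth_on V U f" "x \<in> U"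
  shows "f differentiable (at x within V)"
  using assms Ck_on_Suc_iff[OF assms(1,2)] unfolding smooth_on_def by blast

lemma smooth_on_continuous: "smooth_on V U f \<Longrightarrow> continuous_on U f"
  unfolding smooth_on_def by (metis Ck_on.simps(1))

lemma smooth_on_local:
  assumes V: "subspace V" and U: "openin (top_of_set V) U"
    and "\<And>x. x \<in> U \<Longrightarrow> \<exists>N. openin (top_of_set V) N \<and> x \<in> N \<and> N \<subseteq> U \<and> smooth_on V N f"
  shows "smooth_on V U f"
  unfolding smooth_on_def
proof
  fix k
  show "Ck_on k V U f"
    using assms(3) by (intro Ck_on_local[OF V U]) (meson smooth_on_def)
qed

lemma smooth_on_const: "smooth_on V U (\<lambda>x. c)"
  by (simp add: smooth_on_def Ck_on_const)

lemma smooth_on_add: "smooth_on V U f \<Longrightarrow> smooth_on V U g \<Longrightarrow> smooth_on V U (\<lambda>x. f x + g x)"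
  by (simp add: smooth_on_def Ck_on_add)

lemma smooth_on_sum: "(\<And>i. i \<in> A \<Longrightarrow> smooth_on V U (f i)) \<Longrightarrow> smooth_on V U (\<lambda>x. \<Sum>i\<in>A. f i x)"
  by (simp add: smooth_on_def Ck_on_sum)

lemma smooth_on_mult:
  fixes f g :: "'e::euclidean_space \<Rightarrow> real"
  shows "subspace V \<Longrightarrow> openin (top_of_set V) U \<Longrightarrow> smooth_on V U f \<Longrightarrow> smooth_on V U g
    \<Longrightarrow> smooth_on V U (\<lambda>x. f x * g x)"
  by (simp add: smooth_on_def Ck_on_mult)

lemma smooth_on_cmult: "smooth_on V U f \<Longrightarrow> smooth_on V U (\<lambda>x. c * f x :: real)"
  by (simp add: smooth_on_def Ck_on_cmult)

lemma smooth_on_inverse: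
  fixes f :: "'e::euclidean_space \<Rightarrow> real"
  assumes "subspace V" "openin (top_of_set V) U" "\<And>x. x \<in> U \<Longrightarrow> f x \<noteq> 0" "smooth_on V U f"
  shows "smooth_on V U (\<lambda>x. inverse (f x))"
  using assms by (simp add: smooth_on_def Ck_on_inverse)

lemma smooth_on_bounded_linear: "bounded_linear h \<Longrightarrow> smooth_on V U h"
  by (simp add: smooth_on_def Ck_on_bounded_linear)

lemma smooth_on_linear: "bounded_linear h \<Longrightarrow> smooth_on V U f \<Longrightarrow> smooth_on V U (\<lambda>x. h (f x))"
  by (simp add: smooth_on_def Ck_on_linear)

lemma smooth_on_compose:
  fixes f :: "'e::euclidean_space \<Rightarrow> 'f::euclidean_space"
  assumes "subspace V" "openin (top_of_set V) U" "subspace W" "openin (top_of_set W) U'"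
    "f ` U \<subseteq> U'" "smooth_on V U f" "smooth_on W U' g"
  shows "smooth_on V U (\<lambda>x. g (f x))"
  using assms(6,7) Ck_on_compose[OF assms(1-5)] unfolding smooth_on_def by blast

lemma dd_add:
  assumes "subspace V" "x \<in> V" "v \<in> V" "f differentiable (at x within V)" "g differentiable (at x within V)"
  shows "dd v (\<lambda>x. f x + g x) x = dd v f x + dd v g x"
proof -
  obtain f' g' where d: "(f has_derivative f') (at x within V)" "(g has_derivative g') (at x within V)"
    using assms by (auto simp: differentiable_def)
  show ?thesis
    using has_derivative_dd(1)[OF assms(1-3)] d has_derivative_add[OF d] by metis
qed

lemma dd_mult:
  fixes f g :: "'e::euclidean_space \<Rightarrow> real"
  assumes "subspace V" "x \<in> V" "v \<in> V" "f differentiable (at x within V)" "g differentiable (at x within V)"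
  shows "dd v (\<lambda>x. f x * g x) x = f x * dd v g x + dd v f x * g x"
proof -
  obtain f' g' where d: "(f has_derivative f') (at x within V)" "(g has_derivative g') (at x within V)"
    using assms by (auto simp: differentiable_def)
  show ?thesis
    using has_derivative_dd(1)[OF assms(1-3)] d has_derivative_mult[OF d] by metis
qed

lemma dd_const [simp]: "dd v (\<lambda>x. c) x = 0"
  by (simp add: dd_def)

lemma dd_bounded_linear:
  assumes "bounded_linear h"
  shows "dd v h x = h v"
  using has_derivative_dd(1)[OF subspace_UNIV, of x v h h] bounded_linear_imp_has_derivative[OF assms] by simp

lemma dd_cong:
  assumes V: "subspace V" and U: "openin (top_of_set V) U" "x \<in> U" "v \<in> V" and eq: "\<And>y. y \<in> U \<Longrightarrow> f y = g y"
  shows "dd v f x = dd v g x"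
proof -
  have xV: "x \<in> V" using U openin_imp_subset by blast
  obtain T where T: "open T" "U = V \<inter> T" using U by (auto simp: openin_open)
  have "((\<lambda>t::real. x + t *\<^sub>R v) \<longlongrightarrow> x + 0 *\<^sub>R v) (nhds 0)"
    by (intro tendsto_intros filterlim_ident)
  then have "\<forall>\<^sub>F t::real in nhds 0. x + t *\<^sub>R v \<in> T"
    using T U by (auto dest!: topological_tendstoD[where S=T])
  then have "\<forall>\<^sub>F t::real in nhds 0. f (x + t *\<^sub>R v) = g (x + t *\<^sub>R v)"
    by (rule eventually_mono) (use T V xV U eq in \<open>auto intro: subspace_add subspace_scale\<close>)
  then show ?thesis unfolding dd_def by (intro vector_derivative_cong_eq) (auto simp: eventually_mono)
qed

lemma dd_linear:
  assumes "subspace V" "x \<in> V" "f differentiable (at x within V)"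
  obtains f' where "bounded_linear f'" "(f has_derivative f') (at x within V)" "\<And>v. v \<in> V \<Longrightarrow> dd v f x = f' v"
  using assms has_derivative_dd(1)[OF assms(1,2)] has_derivative_bounded_linear
  by (metis differentiable_def)

lemma dd_sum_direction:
  assumes "subspace V" "x \<in> V" "f differentiable (at x within V)" "\<And>b. b \<in> B \<Longrightarrow> h b \<in> V"
  shows "dd (\<Sum>b\<in>B. c b *\<^sub>R h b) f x = (\<Sum>b\<in>B. c b *\<^sub>R dd (h b) f x)"
proof -
  obtain f' where f': "bounded_linear f'" "\<And>v. v \<in> V \<Longrightarrow> dd v f x = f' v"
    using dd_linear[OF assms(1-3)] by blast
  have "(\<Sum>b\<in>B. c b *\<^sub>R h b) \<in> V"
    by (intro subspace_sum[OF assms(1)] subspace_scale[OF assms(1)] assms(4))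
  then show ?thesis
    using f' assms(4) bounded_linear.linear[OF f'(1)] by (simp add: linear_sum linear_scale)
qed

section \<open>Bump functions\<close>

text \<open>All derivatives of \<open>exp (-1/t)\<close> are combinations of these functions, and they all vanish at \<open>0\<close>.\<close>

definition flat :: "nat \<Rightarrow> real \<Rightarrow> real" where
  "flat n t = (if t > 0 then exp (- inverse t) * inverse t ^ n else 0)"

lemma flat_tendsto_0: "(flat n \<longlongrightarrow> 0) (at 0)"
proof -
  have "((\<lambda>t. inverse t ^ n / exp (inverse t)) \<longlongrightarrow> 0) (at_right (0::real))"
    by (rule filterlim_compose[OF tendsto_power_div_exp_0 filterlim_inverse_at_top_right])
  then have "(flat n \<longlongrightarrow> 0) (at_right 0)"
    by (rule Lim_transform_eventually) (auto simp: eventually_at_filter flat_def exp_minus field_simps)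
  moreover have "(flat n \<longlongrightarrow> 0) (at_left 0)"
    by (rule Lim_transform_eventually[OF tendsto_const]) (auto simp: eventually_at_filter flat_def)
  ultimately show ?thesis by (simp add: filterlim_split_at)
qed

lemma flat_has_derivative:
  "(flat n has_real_derivative (flat (n+2) t - real n * flat (n+1) t)) (at t)"
proof -
  consider "t > 0" | "t < 0" | "t = 0" by linarith
  then show ?thesis
  proof cases
    case 1
    have "((\<lambda>t. exp (- inverse t) * inverse t ^ n) has_real_derivative (flat (n+2) t - real n * flat (n+1) t)) (at t)"
      using 1 by (auto intro!: derivative_eq_intros simp: flat_def field_simps power2_eq_square)
        (cases n; simp add: field_simps)
    then show ?thesis
      by (rule has_field_derivative_transform_within_open[of _ _ _ "{0<..}"]) (use 1 in \<open>auto simp: flat_def\<close>)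
  next
    case 2
    have "((\<lambda>t. 0) has_real_derivative (flat (n+2) t - real n * flat (n+1) t)) (at t)"
      using 2 by (simp add: flat_def)
    then show ?thesis
      by (rule has_field_derivative_transform_within_open[of _ _ _ "{..<0}"]) (use 2 in \<open>auto simp: flat_def\<close>)
  next
    case 3
    \<comment> \<open>For \<open>h > 0\<close> the difference quotient equals
      \<open>flat (n+1) h\<close>, and for \<open>h < 0\<close> both are 0.\<close>
    have "((\<lambda>h. (flat n (0 + h) - flat n 0) / h) \<longlongrightarrow> 0) (at 0)"
      by (rule Lim_transform_eventually[OF flat_tendsto_0[of "n+1"]])
         (auto simp: eventually_at_filter flat_def field_simps)
    then show ?thesis using 3 by (simp add: DERIV_def flat_def)
  qed
qed

lemma Ck_on_flat: "Ck_on k UNIV UNIV (flat n)"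
proof (induction k arbitrary: n)
  case 0
  have "isCont (flat n) t" for t by (rule DERIV_isCont[OF flat_has_derivative])
  then show ?case by (simp add: continuous_on_eq_continuous_at)
next
  case (Suc k)
  show ?case unfolding Ck_on.simps
  proof (intro exI conjI ballI)
    fix t show "(flat n has_derivative (\<lambda>v. (flat (n+2) t + (- real n) * flat (n+1) t) * v)) (at t)"
      using flat_has_derivative[of n t] by (simp add: has_field_derivative_def)
  next
    fix v show "Ck_on k UNIV UNIV (\<lambda>t. (flat (n+2) t + (- real n) * flat (n+1) t) * v)"
      by (intro Ck_on_linear[OF bounded_linear_mult_left] Ck_on_add Ck_on_cmult Suc.IH)
  qed
qed

definition step :: "real \<Rightarrow> real" where
  "step t = flat 0 t / (flat 0 t + flat 0 (1 - t))"

lemma smooth_on_step: "smooth_on UNIV UNIV step"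
proof -
  \<comment> \<open>For every \<open>t\<close> at least one of \<open>t\<close> and
    \<open>1 - t\<close> is positive, so one of the two nonnegative summands is an
    exponential.\<close>
  have pos: "flat 0 t + flat 0 (1 - t) \<noteq> 0" for t
    using exp_gt_zero[of "- inverse t"] exp_gt_zero[of "- inverse (1 - t)"] by (auto simp: flat_def simp del: exp_gt_zero)
  have f: "smooth_on UNIV UNIV (flat 0)" by (simp add: smooth_on_def Ck_on_flat)
  have l: "smooth_on UNIV UNIV (\<lambda>t::real. 1 + (- 1) * t)"
    by (intro smooth_on_add smooth_on_const smooth_on_cmult smooth_on_bounded_linear[OF bounded_linear_ident])
  have g: "smooth_on UNIV UNIV (\<lambda>t. flat 0 (1 + (- 1) * t))"
    by (rule smooth_on_compose[OF _ _ _ _ _ l f]) auto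
  have "smooth_on UNIV UNIV (\<lambda>t. flat 0 t * inverse (flat 0 t + flat 0 (1 + (- 1) * t)))"
    by (intro smooth_on_mult smooth_on_inverse smooth_on_add f g) (use pos in auto)
  then show ?thesis by (simp add: step_def[abs_def] divide_inverse)
qed

lemma step_0: "t \<le> 0 \<Longrightarrow> step t = 0"
  and step_1: "t \<ge> 1 \<Longrightarrow> step t = 1"
  and step_nonneg: "step t \<ge> 0" and step_le_1: "step t \<le> 1"
proof -
  have "exp (- inverse t) \<le> exp (- inverse t) + exp (- inverse (1 - t))" "0 < exp (- inverse t) + exp (- inverse (1 - t))"
    by (simp_all add: add_pos_pos)
  then show "step t \<le> 1" by (auto simp: step_def flat_def divide_le_eq)
qed (auto simp: step_def flat_def)

text \<open>The squared distance keeps the function smooth at the centre. For \<open>s > 0\<close>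
  the argument of \<open>step\<close> is at least 1 up to distance \<open>s\<close> and at most 0
  from distance \<open>sqrt 2 * s\<close> on, in particular from \<open>2 * s\<close> on.\<close>

definition bump :: "'e::euclidean_space \<Rightarrow> real \<Rightarrow> 'e \<Rightarrow> real" where
  "bump x0 s x = step (2 - (x - x0) \<bullet> (x - x0) / s\<^sup>2)"

lemma smooth_on_bump:
  assumes V: "subspace V"
  shows "smooth_on V V (bump x0 s)"
proof -
  have o: "openin (top_of_set V) V" by simp
  have d: "smooth_on V V (\<lambda>x. x + (- x0))"
    by (intro smooth_on_add smooth_on_const smooth_on_bounded_linear[OF bounded_linear_ident])
  have "smooth_on V V (\<lambda>x. (x + (- x0)) \<bullet> (x + (- x0)))"
    using d unfolding smooth_on_def by (intro allI Ck_on_bilinear[OF bounded_bilinear_inner V o]) blast+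
  then have q: "smooth_on V V (\<lambda>x. 2 + (- 1 / s\<^sup>2) * ((x + (- x0)) \<bullet> (x + (- x0))))"
    by (intro smooth_on_add smooth_on_const smooth_on_cmult)
  have "smooth_on V V (\<lambda>x. step (2 + (- 1 / s\<^sup>2) * ((x + (- x0)) \<bullet> (x + (- x0)))))"
    by (rule smooth_on_compose[OF V o _ _ _ q smooth_on_step]) auto
  then show ?thesis by (simp add: bump_def[abs_def])
qed

lemma bump_1: "norm (x - x0) \<le> s \<Longrightarrow> s > 0 \<Longrightarrow> bump x0 s x = 1"
  unfolding bump_def
  by (rule step_1) (simp add: dot_square_norm divide_le_eq power_mono)

lemma bump_0: "norm (x - x0) \<ge> 2 * s \<Longrightarrow> s > 0 \<Longrightarrow> bump x0 s x = 0"
  unfolding bump_def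
proof (rule step_0)
  assume *: "norm (x - x0) \<ge> 2 * s" "s > 0"
  then have "(2 * s)\<^sup>2 \<le> (norm (x - x0))\<^sup>2" by (intro power_mono) auto
  moreover have "2 * s\<^sup>2 \<le> (2 * s)\<^sup>2" by (simp add: power_mult_distrib)
  ultimately have "2 * s\<^sup>2 \<le> (norm (x - x0))\<^sup>2" by linarith
  then show "2 - (x - x0) \<bullet> (x - x0) / s\<^sup>2 \<le> 0" using * by (simp add: dot_square_norm le_divide_eq)
qed

section \<open>Integrals along rays and the Poincare lemma\<close>

text \<open>Difference quotients within \<open>W\<close> feed only increments from \<open>V\<close>
  into the derivative. So a derivative may be exchanged for one that depends continuously on the
  point, as differentiation under the integral requires.\<close>

lemma has_derivative_agree_on_subspace:
  assumes V: "subspace V" and W: "W \<subseteq> V" and x: "x \<in> W" and f: "(f has_derivative L) (at x within W)"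
    and L': "bounded_linear L'" "\<And>v. v \<in> V \<Longrightarrow> L v = L' v"
  shows "(f has_derivative L') (at x within W)"
proof -
  have "L (y - x) = L' (y - x)" if "y \<in> W" for y
    using L'(2) that W x V subspace_diff by blast
  then show ?thesis using f L'(1) unfolding has_derivative_within_alt by auto
qed

lemma line_has_real_derivative:
  fixes f :: "'e::euclidean_space \<Rightarrow> real"
  assumes "subspace V" "x \<in> V" "v \<in> V" "f differentiable (at (x + s *\<^sub>R v) within V)"
  shows "((\<lambda>s. f (x + s *\<^sub>R v)) has_real_derivative dd v f (x + s *\<^sub>R v)) (at s)"
proof -
  obtain f' where f': "(f has_derivative f') (at (x + s *\<^sub>R v) within V)"
    using assms by (auto simp: differentiable_def)
  have y: "x + s *\<^sub>R v \<in> V" using assms by (auto intro: subspace_add subspace_scale)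
  have "((\<lambda>t. f (x + s *\<^sub>R v + t *\<^sub>R v)) has_vector_derivative dd v f (x + s *\<^sub>R v)) (at 0)"
    using has_derivative_dd[OF assms(1) y assms(3) f'] by simp
  then have "((\<lambda>t. f (x + (t + s) *\<^sub>R v)) has_real_derivative dd v f (x + s *\<^sub>R v)) (at 0)"
    by (simp add: has_real_derivative_iff_has_vector_derivative scaleR_add_left add_ac)
  then show ?thesis
    using DERIV_shift[of "\<lambda>s. f (x + s *\<^sub>R v)" "dd v f (x + s *\<^sub>R v)" 0 s] by simp
qed

lemma ftc_real:
  fixes f :: "real \<Rightarrow> real"
  assumes "a \<le> b" "\<And>t. t \<in> {a..b} \<Longrightarrow> (f has_real_derivative g t) (at t)"
  shows "(g has_integral f b - f a) {a..b}"
proof (rule fundamental_theorem_of_calculus[OF assms(1)])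
  fix t assume "t \<in> {a..b}"
  then show "(f has_vector_derivative g t) (at t within {a..b})"
    using has_field_derivative_at_within[OF assms(2)] has_real_derivative_iff_has_vector_derivative by blast
qed

text \<open>The radial homotopy operator with centre \<open>x0\<close>. The weight
  \<open>t ^ m\<close> is there because each differentiation of
  \<open>f (x0 + t *\<^sub>R (x - x0))\<close> in \<open>x\<close> produces another factor
  \<open>t\<close>.\<close>

definition ray_integral :: "'e::euclidean_space \<Rightarrow> nat \<Rightarrow> ('e \<Rightarrow> real) \<Rightarrow> 'e \<Rightarrow> real" where
  "ray_integral x0 m f x = integral {0..1} (\<lambda>t. t ^ m * f (x0 + t *\<^sub>R (x - x0)))"

context
  fixes V :: "'e::euclidean_space set" and x0 :: 'e and R :: real and W :: "'e set"
  assumes V: "subspace V" and x0: "x0 \<in> V" and W_def: "W = V \<inter> ball x0 R"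
begin

lemma W_open: "openin (top_of_set V) W"
  unfolding W_def by (simp add: openin_open_Int)

lemma W_sub: "W \<subseteq> V" by (auto simp: W_def)

lemma W_convex: "convex W"
  unfolding W_def by (intro convex_Int subspace_imp_convex V convex_ball)

lemma ray_in_W: "x \<in> W \<Longrightarrow> t \<in> {0..1} \<Longrightarrow> x0 + t *\<^sub>R (x - x0) \<in> W"
proof -
  assume x: "x \<in> W" and t: "t \<in> {0..1}"
  have "\<bar>t\<bar> * norm (x - x0) \<le> 1 * norm (x - x0)" using t by (intro mult_right_mono) auto
  then have "norm (t *\<^sub>R (x - x0)) < R" using x by (auto simp: W_def dist_norm norm_minus_commute)
  then show ?thesis using x x0 V
    by (auto simp: W_def dist_norm intro: subspace_add subspace_scale subspace_diff)
qed

lemma continuous_ray: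
  fixes h :: "'e \<Rightarrow> 'b::real_normed_vector"
  assumes "continuous_on W h"
  shows "continuous_on (W \<times> {0..1}) (\<lambda>(x, t). t ^ m *\<^sub>R h (x0 + t *\<^sub>R (x - x0)))"
proof -
  have "continuous_on (W \<times> {0..1}) (\<lambda>p. h (x0 + snd p *\<^sub>R (fst p - x0)))"
    by (rule continuous_on_compose2[OF assms]) (auto intro!: continuous_intros ray_in_W)
  then have "continuous_on (W \<times> {0..1}) (\<lambda>p. snd p ^ m *\<^sub>R h (x0 + snd p *\<^sub>R (fst p - x0)))"
    by (intro continuous_intros)
  then show ?thesis by (simp add: case_prod_unfold)
qed

lemma continuous_ray_fixed:
  fixes h :: "'e \<Rightarrow> 'b::real_normed_vector"
  assumes "continuous_on W h" "x \<in> W"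
  shows "continuous_on {0..1} (\<lambda>t. t ^ m *\<^sub>R h (x0 + t *\<^sub>R (x - x0)))"
proof -
  have "continuous_on {0..1} (\<lambda>t. h (x0 + t *\<^sub>R (x - x0)))"
    by (rule continuous_on_compose2[OF assms(1)]) (auto intro!: continuous_intros ray_in_W assms(2))
  then show ?thesis by (intro continuous_intros)
qed

lemma ray_integral_has_derivative:
  assumes f: "Ck_on 1 V W f" and x: "x \<in> W"
  shows "ray_integral x0 m f differentiable (at x within V)"
    "v \<in> V \<Longrightarrow> dd v (ray_integral x0 m f) x = ray_integral x0 (Suc m) (dd v f) x"
proof -
  obtain B where B: "finite B" "B \<subseteq> V" "\<And>w. w \<in> V \<Longrightarrow> w = (\<Sum>b\<in>B. (w \<bullet> b) *\<^sub>R b)"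
    using orthonormal_basis_of_subspace[OF V] by metis
  have dif: "f differentiable (at y within V)" if "y \<in> W" for y
    using f Ck_on_Suc_iff[OF V W_open, of 0 f] that by simp
  have cdd: "continuous_on W (dd v f)" if "v \<in> V" for v
    using f Ck_on_Suc_iff[OF V W_open, of 0 f] that by simp
  have cf: "continuous_on W f"
    using continuous_on_differentiable_within[OF W_sub] dif by blast
  \<comment> \<open>The gradient of \<open>f\<close> along \<open>V\<close>, as a bounded linear
    functional vanishing on the orthogonal complement of \<open>V\<close>. Unlike an arbitrary
    choice of derivatives it is continuous in the point.\<close>
  define D where "D y = (\<Sum>b\<in>B. dd b f y *\<^sub>R blinfun_inner_left b)" for y
  have D: "blinfun_apply (D y) v = dd v f y" if "y \<in> W" "v \<in> V" for y v
  proof -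
    have "dd (\<Sum>b\<in>B. (v \<bullet> b) *\<^sub>R b) f y = (\<Sum>b\<in>B. (v \<bullet> b) *\<^sub>R dd b f y)"
      by (rule dd_sum_direction[OF V _ dif]) (use that W_sub B in auto)
    then show ?thesis using B(3)[OF that(2)]
      by (simp add: D_def blinfun.sum_left blinfun.scaleR_left blinfun_inner_left.rep_eq mult.commute inner_commute)
  qed
  have cD: "continuous_on W D" unfolding D_def using B cdd by (intro continuous_intros) auto
  define fx where "fx x t = t ^ Suc m *\<^sub>R D (x0 + t *\<^sub>R (x - x0))" for x t
  have der: "((\<lambda>x. t ^ m * f (x0 + t *\<^sub>R (x - x0))) has_derivative blinfun_apply (fx y t)) (at y within W)"
    if y: "y \<in> W" and t: "t \<in> cbox 0 1" for y t
  proof -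
    let ?g = "\<lambda>x. x0 + t *\<^sub>R (x - x0)"
    have gy: "?g y \<in> W" using ray_in_W y t by auto
    obtain f' where f': "bounded_linear f'" "(f has_derivative f') (at (?g y) within V)" "\<And>v. v \<in> V \<Longrightarrow> dd v f (?g y) = f' v"
      using dd_linear[OF V _ dif[OF gy]] gy W_sub by blast
    have g: "(?g has_derivative (\<lambda>h. t *\<^sub>R h)) (at y within W)" by (auto intro!: derivative_eq_intros)
    have "?g ` W \<subseteq> V" using W_sub V x0 by (auto intro!: subspace_add subspace_scale subspace_diff)
    then have "(f has_derivative f') (at (?g y) within ?g ` W)" using f'(2) has_derivative_subset by blast
    from diff_chain_within[OF g this]
    have "((\<lambda>x. f (?g x)) has_derivative (\<lambda>h. f' (t *\<^sub>R h))) (at y within W)" by (simp add: o_def)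
    then have "((\<lambda>x. t ^ m * f (?g x)) has_derivative (\<lambda>h. t ^ m * f' (t *\<^sub>R h))) (at y within W)"
      by (rule has_derivative_mult_right)
    then show ?thesis
    proof (rule has_derivative_agree_on_subspace[OF V W_sub y])
      fix v assume v: "v \<in> V"
      show "t ^ m * f' (t *\<^sub>R v) = blinfun_apply (fx y t) v"
        using D[OF gy v] f'(3)[OF v] linear_scale[OF bounded_linear.linear[OF f'(1)]]
        by (simp add: fx_def blinfun.scaleR_left)
    qed (rule blinfun.bounded_linear_right)
  qed
  have int: "(\<lambda>t. t ^ m * f (x0 + t *\<^sub>R (y - x0))) integrable_on cbox 0 1" if "y \<in> W" for y
    using integrable_continuous_real[OF continuous_ray_fixed[OF cf that, of m]] by simp
  have cont: "continuous_on (W \<times> cbox 0 1) (\<lambda>(x, t). fx x t)"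
    unfolding fx_def using continuous_ray[OF cD, of "Suc m"] by simp
  have main: "(ray_integral x0 m f has_derivative blinfun_apply (integral {0..1} (fx x))) (at x within V)"
    using leibniz_rule[OF der int cont x W_convex] at_within_openin[OF W_open x]
    by (simp add: ray_integral_def[abs_def])
  then show "ray_integral x0 m f differentiable (at x within V)" by (auto simp: differentiable_def)
  show "dd v (ray_integral x0 m f) x = ray_integral x0 (Suc m) (dd v f) x" if v: "v \<in> V"
  proof -
    have "dd v (ray_integral x0 m f) x = blinfun_apply (integral {0..1} (fx x)) v"
      using has_derivative_dd(1)[OF V _ v main] x W_sub by blast
    also have "\<dots> = integral {0..1} (\<lambda>t. blinfun_apply (fx x t) v)"
      unfolding fx_def by (rule blinfun_apply_integral[OF integrable_continuous_real[OF continuous_ray_fixed[OF cD x]]])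
    also have "\<dots> = ray_integral x0 (Suc m) (dd v f) x"
      unfolding ray_integral_def by (rule integral_cong) (simp add: fx_def blinfun.scaleR_left D ray_in_W x v)
    finally show ?thesis .
  qed
qed

lemma Ck_on_ray_integral: "Ck_on k V W f \<Longrightarrow> Ck_on k V W (ray_integral x0 m f)"
proof (induction k arbitrary: f m)
  case 0
  then have "continuous_on W f" by simp
  from continuous_ray[OF this, of m]
  have "continuous_on (W \<times> cbox 0 1) (\<lambda>(x, t). t ^ m * f (x0 + t *\<^sub>R (x - x0)))" by simp
  from integral_continuous_on_param[OF this]
  show ?case by (simp add: ray_integral_def[abs_def])
next
  case (Suc k)
  have "Ck_on 1 V W f"
    using Suc.prems
  proof (induction k)
    case (Suc k) then show ?case using Ck_on_Suc_D[OF V W_open] by blast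
  qed simp
  note d = ray_integral_has_derivative[OF this]
  have "Ck_on k V W (dd v (ray_integral x0 m f))" if v: "v \<in> V" for v
  proof -
    have "Ck_on k V W (ray_integral x0 (Suc m) (dd v f))"
      using Suc v Ck_on_Suc_iff[OF V W_open] by blast
    then show ?thesis using Ck_on_cong[OF W_open d(2)[OF _ v]] by simp
  qed
  with d(1) show ?case using Ck_on_Suc_iff[OF V W_open] by blast
qed

lemma smooth_on_ray_integral: "smooth_on V W f \<Longrightarrow> smooth_on V W (ray_integral x0 m f)"
  by (simp add: smooth_on_def Ck_on_ray_integral)

context
  fixes B :: "'e set"
  assumes B: "finite B" "B \<subseteq> V" "\<And>w. w \<in> V \<Longrightarrow> w = (\<Sum>b\<in>B. (w \<bullet> b) *\<^sub>R b)"
begin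

lemma ray_derivative:
  assumes f: "smooth_on V W f" and x: "x \<in> W" and t: "t \<in> {0..1}"
  shows "((\<lambda>t. f (x0 + t *\<^sub>R (x - x0))) has_real_derivative
     (\<Sum>b\<in>B. ((x - x0) \<bullet> b) * dd b f (x0 + t *\<^sub>R (x - x0)))) (at t)"
proof -
  have y: "x0 + t *\<^sub>R (x - x0) \<in> W" by (rule ray_in_W[OF x t])
  have v: "x - x0 \<in> V" using x W_sub x0 V by (auto intro: subspace_diff)
  have d: "f differentiable (at (x0 + t *\<^sub>R (x - x0)) within V)"
    by (rule smooth_on_differentiable[OF V W_open f y])
  have "dd (\<Sum>b\<in>B. ((x - x0) \<bullet> b) *\<^sub>R b) f (x0 + t *\<^sub>R (x - x0)) = (\<Sum>b\<in>B. ((x - x0) \<bullet> b) *\<^sub>R dd b f (x0 + t *\<^sub>R (x - x0)))"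
    by (rule dd_sum_direction[OF V _ d]) (use B y W_sub in auto)
  then show ?thesis
    using line_has_real_derivative[OF V x0 v d] B(3)[OF v] by simp
qed

lemma sum_ray_integral:
  assumes f: "\<And>b. b \<in> B \<Longrightarrow> smooth_on V W (f b)" and x: "x \<in> W"
  shows "(\<lambda>t. t ^ m * (\<Sum>b\<in>B. c b * f b (x0 + t *\<^sub>R (x - x0)))) integrable_on {0..1}"
    "integral {0..1} (\<lambda>t. t ^ m * (\<Sum>b\<in>B. c b * f b (x0 + t *\<^sub>R (x - x0)))) = (\<Sum>b\<in>B. c b * ray_integral x0 m (f b) x)"
proof -
  have i: "(\<lambda>t. t ^ m * f b (x0 + t *\<^sub>R (x - x0))) integrable_on {0..1}" if "b \<in> B" for b
    using integrable_continuous_real[OF continuous_ray_fixed[OF smooth_on_continuous[OF f[OF that]] x, of m]] by simp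
  have "((\<lambda>t. \<Sum>b\<in>B. c b * (t ^ m * f b (x0 + t *\<^sub>R (x - x0)))) has_integral (\<Sum>b\<in>B. c b * ray_integral x0 m (f b) x)) {0..1}"
    unfolding ray_integral_def
    by (intro has_integral_sum B has_integral_mult_right integrable_integral i)
  then have *: "((\<lambda>t. t ^ m * (\<Sum>b\<in>B. c b * f b (x0 + t *\<^sub>R (x - x0)))) has_integral (\<Sum>b\<in>B. c b * ray_integral x0 m (f b) x)) {0..1}"
    by (simp add: sum_distrib_left mult_ac)
  from * show "(\<lambda>t. t ^ m * (\<Sum>b\<in>B. c b * f b (x0 + t *\<^sub>R (x - x0)))) integrable_on {0..1}" by blast
  from * show "integral {0..1} (\<lambda>t. t ^ m * (\<Sum>b\<in>B. c b * f b (x0 + t *\<^sub>R (x - x0)))) = (\<Sum>b\<in>B. c b * ray_integral x0 m (f b) x)"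
    by (rule integral_unique)
qed

text \<open>Integrate the derivative of \<open>f\<close> along the segment from \<open>x0\<close> to
  \<open>x\<close>. The point is that the cofactors of the coordinates are again smooth, so that a
  derivation can be applied to the right-hand side.\<close>

lemma hadamard:
  assumes f: "smooth_on V W f" and x: "x \<in> W"
  shows "f x = f x0 + (\<Sum>b\<in>B. ((x - x0) \<bullet> b) * ray_integral x0 0 (dd b f) x)"
proof -
  have "((\<lambda>t. \<Sum>b\<in>B. ((x - x0) \<bullet> b) * dd b f (x0 + t *\<^sub>R (x - x0))) has_integral
      f (x0 + 1 *\<^sub>R (x - x0)) - f (x0 + 0 *\<^sub>R (x - x0))) {0..1}"
    by (rule ftc_real) (use ray_derivative[OF f x] in auto)
  then have "integral {0..1} (\<lambda>t. t ^ 0 * (\<Sum>b\<in>B. ((x - x0) \<bullet> b) * dd b f (x0 + t *\<^sub>R (x - x0)))) = f x - f x0"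
    by (simp add: integral_unique)
  moreover have "integral {0..1} (\<lambda>t. t ^ 0 * (\<Sum>b\<in>B. ((x - x0) \<bullet> b) * dd b f (x0 + t *\<^sub>R (x - x0)))) =
     (\<Sum>b\<in>B. ((x - x0) \<bullet> b) * ray_integral x0 0 (dd b f) x)"
    by (rule sum_ray_integral(2)) (use B smooth_on_dd[OF V W_open f] x in auto)
  ultimately show ?thesis by simp
qed

text \<open>Integrate the derivative of \<open>t * f (x0 + t *\<^sub>R (x - x0))\<close> over
  \<open>{0..1}\<close>; the boundary term at \<open>t = 0\<close> vanishes.\<close>

lemma ray_integral_by_parts:
  assumes f: "smooth_on V W f" and x: "x \<in> W"
  shows "ray_integral x0 0 f x + (\<Sum>b\<in>B. ((x - x0) \<bullet> b) * ray_integral x0 1 (dd b f) x) = f x"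
proof -
  let ?s = "\<lambda>t. \<Sum>b\<in>B. ((x - x0) \<bullet> b) * dd b f (x0 + t *\<^sub>R (x - x0))"
  have "((\<lambda>t. f (x0 + t *\<^sub>R (x - x0)) + t * ?s t) has_integral
      1 * f (x0 + 1 *\<^sub>R (x - x0)) - 0 * f (x0 + 0 *\<^sub>R (x - x0))) {0..1}"
  proof (rule ftc_real)
    fix t :: real assume t: "t \<in> {0..1}"
    show "((\<lambda>t. t * f (x0 + t *\<^sub>R (x - x0))) has_real_derivative (f (x0 + t *\<^sub>R (x - x0)) + t * ?s t)) (at t)"
      using DERIV_mult[OF DERIV_ident ray_derivative[OF f x t]] by (simp add: add.commute mult.commute)
  qed simp
  then have "integral {0..1} (\<lambda>t. f (x0 + t *\<^sub>R (x - x0)) + t * ?s t) = f x"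
    by (simp add: integral_unique)
  moreover have "integral {0..1} (\<lambda>t. f (x0 + t *\<^sub>R (x - x0)) + t * ?s t) =
     integral {0..1} (\<lambda>t. f (x0 + t *\<^sub>R (x - x0))) + integral {0..1} (\<lambda>t. t ^ 1 * ?s t)"
    using integral_add[OF integrable_continuous_real[OF continuous_ray_fixed[OF smooth_on_continuous[OF f] x, of 0]]
        sum_ray_integral(1)[of "\<lambda>b. dd b f" x 1 "\<lambda>b. (x - x0) \<bullet> b"]] B smooth_on_dd[OF V W_open f] x
    by auto
  moreover have "integral {0..1} (\<lambda>t. t ^ 1 * ?s t) = (\<Sum>b\<in>B. ((x - x0) \<bullet> b) * ray_integral x0 1 (dd b f) x)"
    by (rule sum_ray_integral(2)) (use B smooth_on_dd[OF V W_open f] x in auto)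
  ultimately show ?thesis by (simp add: ray_integral_def)
qed

text \<open>The primitive is the integral of the form along the segment from \<open>x0\<close>.
  Differentiating it produces the \<open>dd c\<close> of all components; closedness turns each into
  a \<open>dd b\<close> of the single component \<open>\<omega> c\<close>, and integration by parts
  collapses the sum to \<open>\<omega> c x\<close>.\<close>

lemma poincare:
  fixes \<omega> :: "'e \<Rightarrow> 'e \<Rightarrow> real"
  assumes w: "\<And>b. b \<in> B \<Longrightarrow> smooth_on V W (\<omega> b)"
    and closed: "\<And>b c x. b \<in> B \<Longrightarrow> c \<in> B \<Longrightarrow> x \<in> W \<Longrightarrow> dd c (\<omega> b) x = dd b (\<omega> c) x"
    and orth: "\<And>b c. b \<in> B \<Longrightarrow> c \<in> B \<Longrightarrow> b \<bullet> c = (if b = c then 1 else 0)"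
  obtains F where "smooth_on V W F" "\<And>c x. c \<in> B \<Longrightarrow> x \<in> W \<Longrightarrow> dd c F x = \<omega> c x"
proof -
  let ?l = "\<lambda>b x. (x - x0) \<bullet> b"
  have l: "smooth_on V W (?l b)" for b
    using smooth_on_linear[OF bounded_linear_inner_left, of V W "\<lambda>x. x + (- x0)" b]
      smooth_on_add[OF smooth_on_bounded_linear[OF bounded_linear_ident] smooth_on_const, of V W "- x0"] by simp
  have dl: "dd c (?l b) x = c \<bullet> b" for c b x
  proof -
    have "((\<lambda>x. (x - x0) \<bullet> b) has_derivative (\<lambda>h. h \<bullet> b)) (at x within UNIV)"
      by (auto intro!: derivative_eq_intros)
    from has_derivative_dd(1)[OF subspace_UNIV _ _ this] show ?thesis by simp
  qed
  have prod: "smooth_on V W (\<lambda>x. ?l b x * ray_integral x0 0 (\<omega> b) x)" if "b \<in> B" for b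
    by (intro smooth_on_mult[OF V W_open] l smooth_on_ray_integral w that)
  define F where "F x = (\<Sum>b\<in>B. ?l b x * ray_integral x0 0 (\<omega> b) x)" for x
  have F: "smooth_on V W F" unfolding F_def by (intro smooth_on_sum prod)
  have "dd c F x = \<omega> c x" if c: "c \<in> B" and x: "x \<in> W" for c x
  proof -
    have xV: "x \<in> V" and cV: "c \<in> V" using x W_sub c B by auto
    have C1: "Ck_on 1 V W (\<omega> b)" if "b \<in> B" for b using w[OF that] by (simp only: smooth_on_def)
    have ddsum: "dd c (\<lambda>x. \<Sum>b\<in>B'. h b x) x = (\<Sum>b\<in>B'. dd c (h b) x)"
      if "finite B'" "\<And>b. b \<in> B' \<Longrightarrow> smooth_on V W (h b)" for B' and h :: "'e \<Rightarrow> 'e \<Rightarrow> real"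
      using that
    proof (induction B')
      case (insert a A)
      have "dd c (\<lambda>x. h a x + (\<Sum>b\<in>A. h b x)) x = dd c (h a) x + dd c (\<lambda>x. \<Sum>b\<in>A. h b x) x"
        by (rule dd_add[OF V xV cV]) (use insert in \<open>auto intro!: smooth_on_differentiable[OF V W_open _ x] smooth_on_sum\<close>)
      with insert show ?case by simp
    qed simp
    have "dd c F x = (\<Sum>b\<in>B. dd c (\<lambda>x. ?l b x * ray_integral x0 0 (\<omega> b) x) x)"
      unfolding F_def by (rule ddsum[OF B(1) prod])
    also have "\<dots> = (\<Sum>b\<in>B. ?l b x * ray_integral x0 1 (dd b (\<omega> c)) x + (c \<bullet> b) * ray_integral x0 0 (\<omega> b) x)"
    proof (rule sum.cong)
      fix b assume b: "b \<in> B"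
      have "ray_integral x0 1 (dd c (\<omega> b)) x = ray_integral x0 1 (dd b (\<omega> c)) x"
        unfolding ray_integral_def by (rule integral_cong) (simp add: closed[OF b c] ray_in_W[OF x])
      then have "dd c (ray_integral x0 0 (\<omega> b)) x = ray_integral x0 1 (dd b (\<omega> c)) x"
        using ray_integral_has_derivative(2)[OF C1[OF b] x cV, of 0] by simp
      then show "dd c (\<lambda>x. ?l b x * ray_integral x0 0 (\<omega> b) x) x =
         ?l b x * ray_integral x0 1 (dd b (\<omega> c)) x + (c \<bullet> b) * ray_integral x0 0 (\<omega> b) x"
        using dd_mult[OF V xV cV smooth_on_differentiable[OF V W_open l x]
            smooth_on_differentiable[OF V W_open smooth_on_ray_integral[OF w[OF b]] x], of b 0] dl[of c b x] by simp
    qed simp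
    also have "\<dots> = (\<Sum>b\<in>B. ?l b x * ray_integral x0 1 (dd b (\<omega> c)) x) + (\<Sum>b\<in>B. if b = c then ray_integral x0 0 (\<omega> b) x else 0)"
      by (simp add: sum.distrib orth[OF c] if_distrib[of "\<lambda>a. a * _"] cong: if_cong)
         (auto intro!: sum.cong)
    also have "\<dots> = (\<Sum>b\<in>B. ?l b x * ray_integral x0 1 (dd b (\<omega> c)) x) + ray_integral x0 0 (\<omega> c) x"
      using c B(1) by simp
    also have "\<dots> = \<omega> c x" using ray_integral_by_parts[OF w[OF c] x] by simp
    finally show ?thesis .
  qed
  with F show ?thesis using that by blast
qed

end

end

section \<open>Symmetry of second derivatives\<close>

text \<open>Write \<open>f (x + s v + t w) - f (x + s v)\<close> as an integral of
  \<open>dd w f\<close> over \<open>{0..t}\<close>, differentiate under the integral in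
  \<open>s\<close> at 0, and then differentiate the resulting identity in \<open>t\<close> at
  0.\<close>

lemma dd_commute:
  fixes f :: "'e::euclidean_space \<Rightarrow> real"
  assumes V: "subspace V" and U: "openin (top_of_set V) U" and f: "smooth_on V U f" and x: "x \<in> U"
    and v: "v \<in> V" and w: "w \<in> V"
  shows "dd w (dd v f) x = dd v (dd w f) x"
proof -
  have UV: "U \<subseteq> V" using U by (rule openin_imp_subset)
  obtain T where T: "open T" "U = V \<inter> T" using U by (auto simp: openin_open)
  have "((\<lambda>p. x + fst p *\<^sub>R v + snd p *\<^sub>R w) \<longlongrightarrow> x + fst (0::real,0::real) *\<^sub>R v + snd (0::real,0::real) *\<^sub>R w) (nhds (0,0))"
    by (intro tendsto_intros filterlim_ident)
  then have "\<forall>\<^sub>F p::real\<times>real in nhds (0,0). x + fst p *\<^sub>R v + snd p *\<^sub>R w \<in> T"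
    using T x by (auto dest!: topological_tendstoD[where S=T])
  then obtain e where e: "e > 0" "\<And>p::real\<times>real. dist p (0,0) < e \<Longrightarrow> x + fst p *\<^sub>R v + snd p *\<^sub>R w \<in> T"
    by (auto simp: eventually_nhds_metric)
  \<comment> \<open>With a third of \<open>e\<close>, the sum of two parameters of size at most
    \<open>d\<close> stays below \<open>e\<close>.\<close>
  define d where "d = e / 3"
  have d: "d > 0" using e by (simp add: d_def)
  have inU: "x + s *\<^sub>R v + t *\<^sub>R w \<in> U" if "\<bar>s\<bar> \<le> d" "\<bar>t\<bar> \<le> d" for s t
  proof -
    have "dist (s, t) (0,0) \<le> \<bar>s\<bar> + \<bar>t\<bar>"
      by (simp add: dist_Pair_Pair sqrt_sum_squares_le_sum_abs)
    also have "\<dots> < e" using that d d_def by simp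
    finally show ?thesis using e(2)[of "(s,t)"] T V v w x
      by (auto intro!: subspace_add subspace_scale)
  qed
  let ?p = "\<lambda>s t. x + s *\<^sub>R v + t *\<^sub>R w"
  have dif: "h differentiable (at (?p s t) within V)" if "smooth_on V U h" "\<bar>s\<bar> \<le> d" "\<bar>t\<bar> \<le> d" for h :: "'e \<Rightarrow> real" and s t
    by (rule smooth_on_differentiable[OF V U that(1) inU[OF that(2,3)]])
  have xV: "x \<in> V" using x UV by auto
  have dv: "((\<lambda>s. h (?p s t)) has_real_derivative dd v h (?p s t)) (at s)"
    if "smooth_on V U h" "\<bar>s\<bar> \<le> d" "\<bar>t\<bar> \<le> d" for h s t
  proof -
    have "x + t *\<^sub>R w \<in> V" using xV w V by (auto intro!: subspace_add subspace_scale)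
    from line_has_real_derivative[OF V this v, of h s] dif[OF that]
    show ?thesis by (simp add: algebra_simps)
  qed
  have dw: "((\<lambda>t. h (?p s t)) has_real_derivative dd w h (?p s t)) (at t)"
    if "smooth_on V U h" "\<bar>s\<bar> \<le> d" "\<bar>t\<bar> \<le> d" for h s t
  proof -
    have "x + s *\<^sub>R v \<in> V" using xV v V by (auto intro!: subspace_add subspace_scale)
    from line_has_real_derivative[OF V this w, of h t] dif[OF that]
    show ?thesis by (simp add: algebra_simps)
  qed
  note sv = smooth_on_dd[OF V U f v] and sw = smooth_on_dd[OF V U f w]
  note svw = smooth_on_dd[OF V U sw v]
  have cont: "continuous_on ({-d..d} \<times> {-d..d}) (\<lambda>(s, t). h (?p s t))" if "smooth_on V U h" for h :: "'e \<Rightarrow> real"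
    unfolding case_prod_unfold
    by (rule continuous_on_compose2[OF smooth_on_continuous[OF that]]) (auto intro!: continuous_intros inU)
  have I: "((\<lambda>u. dd w f (?p s u)) has_integral (f (?p s t) - f (?p s 0))) {0..t}" if "\<bar>s\<bar> \<le> d" "0 \<le> t" "t \<le> d" for s t
    by (rule ftc_real[OF that(2)], rule dw[OF f that(1)]) (use that in auto)
  have J: "dd v f (?p 0 t) - dd v f (?p 0 0) = integral {0..t} (\<lambda>u. dd v (dd w f) (?p 0 u))" if t: "0 \<le> t" "t \<le> d" for t
  proof -
    have "((\<lambda>s. integral (cbox 0 t) (\<lambda>u. dd w f (?p s u))) has_field_derivative integral (cbox 0 t) (\<lambda>u. dd v (dd w f) (?p 0 u))) (at 0 within {-d..d})"
    proof (rule leibniz_rule_field_derivative)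
      fix s u assume "s \<in> {-d..d}" "u \<in> cbox 0 t"
      then have "((\<lambda>s. dd w f (?p s u)) has_real_derivative dd v (dd w f) (?p s u)) (at s)"
        using dv[OF sw, of s u] t by auto
      then show "((\<lambda>s. dd w f (?p s u)) has_field_derivative dd v (dd w f) (?p s u)) (at s within {-d..d})"
        by (rule has_field_derivative_at_within)
    next
      fix s assume "s \<in> {-d..d}"
      then show "(\<lambda>u. dd w f (?p s u)) integrable_on cbox 0 t"
        using has_integral_integrable[OF I[of s t]] t by auto
    next
      show "continuous_on ({-d..d} \<times> cbox 0 t) (\<lambda>(s, u). dd v (dd w f) (?p s u))"
        by (rule continuous_on_subset[OF cont[OF svw]]) (use t d in auto)
    qed (use d in auto)
    then have "((\<lambda>s. f (?p s t) - f (?p s 0)) has_field_derivative integral {0..t} (\<lambda>u. dd v (dd w f) (?p 0 u))) (at 0 within {-d..d})"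
      unfolding cbox_interval
    proof (rule has_field_derivative_transform_within[OF _ d])
      fix s assume "s \<in> {-d..d}"
      then show "integral {0..t} (\<lambda>u. dd w f (?p s u)) = f (?p s t) - f (?p s 0)"
        using integral_unique[OF I[OF _ t, of s]] by auto
    qed (use d in auto)
    moreover have "((\<lambda>s. f (?p s t) - f (?p s 0)) has_field_derivative dd v f (?p 0 t) - dd v f (?p 0 0)) (at 0 within {-d..d})"
    proof (rule has_field_derivative_at_within, rule DERIV_diff)
      show "((\<lambda>s. f (?p s t)) has_field_derivative dd v f (?p 0 t)) (at 0)" using dv[OF f, of 0 t] t d by simp
      show "((\<lambda>s. f (?p s 0)) has_field_derivative dd v f (?p 0 0)) (at 0)" using dv[OF f, of 0 0] d by simp
    qed
    moreover have "at 0 within {-d..d} = at (0::real)" using d by (intro at_within_interior) simp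
    ultimately show ?thesis by (simp only:) (rule DERIV_unique)
  qed
  \<comment> \<open>The identity \<open>J\<close> is available for \<open>0 \<le> t\<close> only, so
    one-sided derivatives at 0 are compared; they are unique because 0 is a limit point of
    \<open>{0..d}\<close>.\<close>
  have "((\<lambda>t. integral {0..t} (\<lambda>u. dd v (dd w f) (?p 0 u))) has_vector_derivative dd v (dd w f) (?p 0 0)) (at 0 within {0..d})"
  proof (rule integral_has_vector_derivative)
    show "continuous_on {0..d} (\<lambda>u. dd v (dd w f) (?p 0 u))"
    proof (rule continuous_on_compose2[OF smooth_on_continuous[OF svw]])
      show "continuous_on {0..d} (\<lambda>u. ?p 0 u)" by (intro continuous_intros)
      show "(\<lambda>u. ?p 0 u) ` {0..d} \<subseteq> U" using inU[of 0] d by fastforce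
    qed
  qed (use d in simp)
  then have "((\<lambda>t. dd v f (?p 0 t) - dd v f (?p 0 0)) has_vector_derivative dd v (dd w f) (?p 0 0)) (at 0 within {0..d})"
    by (rule has_vector_derivative_transform[rotated 2]) (use d J in auto)
  moreover have "((\<lambda>t. dd v f (?p 0 t) - dd v f (?p 0 0)) has_vector_derivative dd w (dd v f) (?p 0 0)) (at 0 within {0..d})"
    unfolding has_real_derivative_iff_has_vector_derivative[symmetric]
    by (rule has_field_derivative_at_within) (use dw[OF sv, of 0 0] d in \<open>auto intro!: derivative_eq_intros\<close>)
  moreover have "at 0 within {0..d} \<noteq> bot" using d by (simp add: trivial_limit_within islimpt_Icc)
  ultimately show ?thesis using vector_derivative_unique_within by fastforce
qed

section \<open>Smooth functions and tangent vectors of a manifold\<close>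

locale smooth_mfd =
  fixes M :: "('m::{t2_space, second_countable_topology}, 'e::euclidean_space) manifold"
  assumes M: "smooth_manifold M"
begin

abbreviation "V \<equiv> model M"
abbreviation "S \<equiv> smooth_functions M"
abbreviation "T \<equiv> tangent_space M"

lemma V: "subspace V" using M by (simp add: smooth_manifold_def)

lemma chart_at: obtains U \<phi> where "(U, \<phi>) \<in> charts M" "p \<in> U"
proof -
  have "p \<in> \<Union> (fst ` charts M)" using M by (simp add: smooth_manifold_def)
  then show ?thesis using that by force
qed

context
  fixes U \<phi>
  assumes c: "(U, \<phi>) \<in> charts M"
begin

lemma chart_open: "open U"
  and chart_image: "openin (top_of_set V) (\<phi> ` U)"
  and chart_homeo: "homeomorphism U (\<phi> ` U) \<phi> (inv_into U \<phi>)"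
  using M c by (auto simp: smooth_manifold_def)

lemma chart_inv [simp]: "q \<in> U \<Longrightarrow> inv_into U \<phi> (\<phi> q) = q"
  using homeomorphism_apply1[OF chart_homeo] .

lemma chart_inj: "inj_on \<phi> U"
  by (metis inj_onI chart_inv)

lemma chart_image_open: "open A \<Longrightarrow> openin (top_of_set V) (\<phi> ` (U \<inter> A))"
proof -
  assume "open A"
  then have "openin (top_of_set U) (U \<inter> A)" by (simp add: openin_open_Int)
  then have "openin (top_of_set (\<phi> ` U)) (\<phi> ` (U \<inter> A))"
    using homeomorphism_imp_open_map[OF chart_homeo] by blast
  then show ?thesis using openin_trans chart_image by blast
qed

lemma chart_image_open_sub: "open A \<Longrightarrow> A \<subseteq> U \<Longrightarrow> openin (top_of_set V) (\<phi> ` A)"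
  using chart_image_open[of A] by (simp add: Int_absorb1)

lemma chart_in_V: "q \<in> U \<Longrightarrow> \<phi> q \<in> V"
  using openin_imp_subset[OF chart_image] by auto

lemma chart_preimage_open: "open A \<Longrightarrow> open B \<Longrightarrow> B \<subseteq> U \<Longrightarrow> open {q \<in> B. \<phi> q \<in> A}"
proof -
  assume A: "open A" "open B" "B \<subseteq> U"
  have "continuous_on B \<phi>" using homeomorphism_cont1[OF chart_homeo] A(3) continuous_on_subset by blast
  then have "open (\<phi> -` A \<inter> B)" using A continuous_on_open_vimage by blast
  moreover have "\<phi> -` A \<inter> B = {q \<in> B. \<phi> q \<in> A}" by auto
  ultimately show ?thesis by simp
qed

lemma smooth_in_chart:
  assumes D: "open D" "D \<subseteq> U" and g: "smooth_on V (\<phi> ` D) g" and W: "(W, \<psi>) \<in> charts M"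
    and f: "\<And>q. q \<in> D \<Longrightarrow> f q = g (\<phi> q)" and M': "smooth_manifold M" and WD: "openin (top_of_set V) (\<psi> ` (W \<inter> D))"
    and injW: "\<And>q. q \<in> W \<Longrightarrow> inv_into W \<psi> (\<psi> q) = q"
  shows "smooth_on V (\<psi> ` (W \<inter> D)) (f \<circ> inv_into W \<psi>)"
proof -
  have t: "smooth_on V (\<psi> ` (W \<inter> U)) (\<phi> \<circ> inv_into W \<psi>)"
    using M c W unfolding smooth_manifold_def by auto
  have t': "smooth_on V (\<psi> ` (W \<inter> D)) (\<phi> \<circ> inv_into W \<psi>)"
    using smooth_on_subset[OF t] D(2) by (meson image_mono inf_mono order_refl)
  have "smooth_on V (\<psi> ` (W \<inter> D)) (\<lambda>x. g ((\<phi> \<circ> inv_into W \<psi>) x))"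
    by (rule smooth_on_compose[OF V WD V chart_image_open_sub[OF D] _ t' g]) (use injW in auto)
  then show ?thesis
    by (rule iffD1[OF smooth_on_cong[OF WD], rotated]) (use injW f in auto)
qed

end

lemma smooth_functions_localI:
  assumes "\<And>p. \<exists>N. open N \<and> p \<in> N \<and> (\<forall>(W, \<psi>) \<in> charts M. smooth_on V (\<psi> ` (W \<inter> N)) (f \<circ> inv_into W \<psi>))"
  shows "f \<in> S"
  unfolding smooth_functions_def
proof safe
  fix W \<psi> assume W: "(W, \<psi>) \<in> charts M"
  show "smooth_on V (\<psi> ` W) (f \<circ> inv_into W \<psi>)"
  proof (rule smooth_on_local[OF V chart_image[OF W]])
    fix x assume "x \<in> \<psi> ` W"
    then obtain q where q: "q \<in> W" "x = \<psi> q" by auto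
    obtain N where N: "open N" "q \<in> N" "smooth_on V (\<psi> ` (W \<inter> N)) (f \<circ> inv_into W \<psi>)"
      using assms[of q] W by blast
    then show "\<exists>N. openin (top_of_set V) N \<and> x \<in> N \<and> N \<subseteq> \<psi> ` W \<and> smooth_on V N (f \<circ> inv_into W \<psi>)"
      using chart_image_open[OF W N(1)] q by (intro exI[of _ "\<psi> ` (W \<inter> N)"]) auto
  qed
qed

lemma S_D: "f \<in> S \<Longrightarrow> (W, \<psi>) \<in> charts M \<Longrightarrow> smooth_on V (\<psi> ` W) (f \<circ> inv_into W \<psi>)"
  unfolding smooth_functions_def by blast

lemma S_local:
  assumes "\<And>p. \<exists>N h. open N \<and> p \<in> N \<and> h \<in> S \<and> (\<forall>q \<in> N. f q = h q)"
  shows "f \<in> S"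
proof (rule smooth_functions_localI)
  fix p
  obtain N h where N: "open N" "p \<in> N" "h \<in> S" "\<forall>q \<in> N. f q = h q" using assms by blast
  have "smooth_on V (\<psi> ` (W \<inter> N)) (f \<circ> inv_into W \<psi>)" if W: "(W, \<psi>) \<in> charts M" for W \<psi>
  proof -
    have "smooth_on V (\<psi> ` (W \<inter> N)) (h \<circ> inv_into W \<psi>)"
      using S_D[OF N(3) W] by (rule smooth_on_subset) auto
    then show ?thesis
      by (rule iffD1[OF smooth_on_cong[OF chart_image_open[OF W N(1)]], rotated]) (use N(4) chart_inv[OF W] in auto)
  qed
  then show "\<exists>N. open N \<and> p \<in> N \<and> (\<forall>(W, \<psi>) \<in> charts M. smooth_on V (\<psi> ` (W \<inter> N)) (f \<circ> inv_into W \<psi>))"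
    using N(1,2) by blast
qed

lemma S_const [simp]: "(\<lambda>x. c) \<in> S"
  by (auto simp: smooth_functions_def o_def smooth_on_const)

lemma S_add: "f \<in> S \<Longrightarrow> h \<in> S \<Longrightarrow> (\<lambda>x. f x + h x) \<in> S"
  by (auto simp: smooth_functions_def o_def intro!: smooth_on_add)

lemma S_mult: "f \<in> S \<Longrightarrow> h \<in> S \<Longrightarrow> (\<lambda>x. f x * h x) \<in> S"
  using chart_image V by (fastforce simp: smooth_functions_def o_def intro!: smooth_on_mult)

lemma S_cmult: "f \<in> S \<Longrightarrow> (\<lambda>x. c * f x) \<in> S"
  by (auto simp: smooth_functions_def o_def intro!: smooth_on_cmult)

lemma S_uminus: "f \<in> S \<Longrightarrow> (\<lambda>x. - f x) \<in> S"
  using S_cmult[of f "-1"] by simp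

lemma S_diff: "f \<in> S \<Longrightarrow> h \<in> S \<Longrightarrow> (\<lambda>x. f x - h x) \<in> S"
  using S_add[OF _ S_uminus] by fastforce

lemma S_sum: "(\<And>i. i \<in> A \<Longrightarrow> f i \<in> S) \<Longrightarrow> (\<lambda>x. \<Sum>i\<in>A. f i x) \<in> S"
  by (induction A rule: infinite_finite_induct) (auto intro: S_add)

lemma S_inverse:
  assumes "f \<in> S" "\<And>x. f x \<noteq> 0"
  shows "(\<lambda>x. inverse (f x)) \<in> S"
  unfolding smooth_functions_def
proof safe
  fix U \<phi> assume c: "(U, \<phi>) \<in> charts M"
  have "smooth_on V (\<phi> ` U) (\<lambda>x. inverse ((f \<circ> inv_into U \<phi>) x))"
    by (rule smooth_on_inverse[OF V chart_image[OF c] _ S_D[OF assms(1) c]]) (use assms(2) in auto)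
  then show "smooth_on V (\<phi> ` U) ((\<lambda>x. inverse (f x)) \<circ> inv_into U \<phi>)" by (simp add: o_def)
qed

text \<open>Besides a cut-off function this supplies the extension of a function on part of a chart
  to an element of \<open>S\<close>. All of \<open>S\<close> consists of globally defined functions,
  so every local construction passes through here.\<close>

lemma manifold_bump:
  assumes c: "(U, \<phi>) \<in> charts M" and D: "open D" "D \<subseteq> U" "p \<in> D"
  obtains \<eta> N where "\<eta> \<in> S" "open N" "p \<in> N" "N \<subseteq> D" "\<And>q. q \<in> N \<Longrightarrow> \<eta> q = 1" "\<And>q. q \<notin> D \<Longrightarrow> \<eta> q = 0"
    "\<And>q. 0 \<le> \<eta> q" "\<And>q. \<eta> q \<le> 1"
    "\<And>g. smooth_on V (\<phi> ` D) g \<Longrightarrow> (\<lambda>q. if q \<in> D then \<eta> q * g (\<phi> q) else 0) \<in> S"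
proof -
  have oD: "openin (top_of_set V) (\<phi> ` D)" using chart_image_open_sub[OF c D(1,2)] .
  obtain e where e: "e > 0" "V \<inter> ball (\<phi> p) e \<subseteq> \<phi> ` D"
    using oD D(3) unfolding openin_contains_ball by (metis Int_commute imageI)
  define s where "s = e / 3"
  have s: "s > 0" using e by (simp add: s_def)
  have "cball (\<phi> p) (2 * s) \<subseteq> ball (\<phi> p) e" using e by (auto simp: s_def)
  then have cb: "V \<inter> cball (\<phi> p) (2 * s) \<subseteq> \<phi> ` D" using e by blast
  define K where "K = inv_into U \<phi> ` (V \<inter> cball (\<phi> p) (2 * s))"
  have K_eq: "K = {q \<in> D. \<phi> q \<in> cball (\<phi> p) (2 * s)}"
  proof (intro equalityI subsetI)
    fix q assume "q \<in> K"
    then obtain x where x: "x \<in> V \<inter> cball (\<phi> p) (2 * s)" "q = inv_into U \<phi> x" by (auto simp: K_def)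
    then obtain q' where "q' \<in> D" "x = \<phi> q'" using cb by blast
    then show "q \<in> {q \<in> D. \<phi> q \<in> cball (\<phi> p) (2 * s)}" using x chart_inv[OF c] D by auto
  next
    fix q assume "q \<in> {q \<in> D. \<phi> q \<in> cball (\<phi> p) (2 * s)}"
    then show "q \<in> K" using chart_inv[OF c] chart_in_V[OF c] D(2) unfolding K_def
      by (intro image_eqI[of _ _ "\<phi> q"]) auto
  qed
  have "compact (V \<inter> cball (\<phi> p) (2 * s))" using V by (simp add: closed_subspace closed_Int_compact)
  moreover have "continuous_on (V \<inter> cball (\<phi> p) (2 * s)) (inv_into U \<phi>)"
    using homeomorphism_cont2[OF chart_homeo[OF c]] by (rule continuous_on_subset) (use cb D in auto)
  ultimately have "compact K" unfolding K_def by (rule compact_continuous_image[rotated])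
  \<comment> \<open>Here the manifold has to be Hausdorff: \<open>K\<close> is the image of a
    compact set, hence closed. On its open complement the extension is identically 0, and together
    with \<open>D\<close> this complement covers the manifold.\<close>
  then have clK: "closed K" by (rule compact_imp_closed)
  define \<eta> where "\<eta> q = (if q \<in> D then bump (\<phi> p) s (\<phi> q) else 0)" for q
  have \<eta>K: "\<eta> q = 0" if "q \<notin> K" for q
    using that s bump_0[of s "\<phi> q" "\<phi> p"] unfolding K_eq \<eta>_def by (auto simp: dist_norm norm_minus_commute)
  have main: "(\<lambda>q. if q \<in> D then \<eta> q * g (\<phi> q) else 0) \<in> S" (is "?F \<in> S") if g: "smooth_on V (\<phi> ` D) g" for g
  proof (rule smooth_functions_localI)
    fix p'
    have sb: "smooth_on V (\<phi> ` D) (\<lambda>x. bump (\<phi> p) s x * g x)"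
      using smooth_on_mult[OF V oD smooth_on_subset[OF smooth_on_bump[OF V]] g] openin_imp_subset[OF oD] by blast
    have 1: "smooth_on V (\<psi> ` (W \<inter> D)) (?F \<circ> inv_into W \<psi>)" if W: "(W, \<psi>) \<in> charts M" for W \<psi>
      by (rule smooth_in_chart[OF c D(1,2) sb W _ M chart_image_open[OF W D(1)] chart_inv[OF W]]) (auto simp: \<eta>_def)
    have 2: "smooth_on V (\<psi> ` (W \<inter> - K)) (?F \<circ> inv_into W \<psi>)" if W: "(W, \<psi>) \<in> charts M" for W \<psi>
      by (rule iffD1[OF smooth_on_cong[OF chart_image_open[OF W]] smooth_on_const[of _ _ 0]])
         (use clK \<eta>K chart_inv[OF W] in auto)
    show "\<exists>N. open N \<and> p' \<in> N \<and> (\<forall>(W, \<psi>)\<in>charts M. smooth_on V (\<psi> ` (W \<inter> N)) (?F \<circ> inv_into W \<psi>))"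
    proof (cases "p' \<in> D")
      case True then show ?thesis using 1 D(1) by blast
    next
      case False
      then have "p' \<in> - K" by (auto simp: K_eq)
      then show ?thesis using 2 clK by blast
    qed
  qed
  have "\<eta> \<in> S"
  proof -
    have "(\<lambda>q. if q \<in> D then \<eta> q * 1 else 0) = \<eta>" by (auto simp: \<eta>_def)
    then show ?thesis using main[OF smooth_on_const[of _ _ 1]] by simp
  qed
  moreover have "open {q \<in> D. \<phi> q \<in> ball (\<phi> p) s}" using chart_preimage_open[OF c open_ball D(1,2)] .
  moreover have "\<eta> q = 1" if "q \<in> {q \<in> D. \<phi> q \<in> ball (\<phi> p) s}" for q
    using that s bump_1[of "\<phi> q" "\<phi> p" s] unfolding \<eta>_def by (auto simp: dist_norm norm_minus_commute)
  moreover have "0 \<le> \<eta> q" "\<eta> q \<le> 1" for q by (auto simp: \<eta>_def bump_def step_nonneg step_le_1)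
  ultimately show ?thesis
    using that[of \<eta> "{q \<in> D. \<phi> q \<in> ball (\<phi> p) s}"] main D s by (auto simp: \<eta>_def)
qed

lemma T_D:
  assumes "v \<in> T p"
  shows "f \<in> S \<Longrightarrow> h \<in> S \<Longrightarrow> v (\<lambda>x. f x + h x) = v f + v h"
    "f \<in> S \<Longrightarrow> v (\<lambda>x. c * f x) = c * v f"
    "f \<in> S \<Longrightarrow> h \<in> S \<Longrightarrow> v (\<lambda>x. f x * h x) = f p * v h + h p * v f"
    "f \<notin> S \<Longrightarrow> v f = 0"
  using assms unfolding tangent_space_def by blast+

lemma T_uminus: "v \<in> T p \<Longrightarrow> f \<in> S \<Longrightarrow> v (\<lambda>x. - f x) = - v f"
  using T_D(2)[of v p f "-1"] by simp

lemma T_diff: "v \<in> T p \<Longrightarrow> f \<in> S \<Longrightarrow> h \<in> S \<Longrightarrow> v (\<lambda>x. f x - h x) = v f - v h"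
  using T_D(1)[of v p f "\<lambda>x. - h x"] T_uminus S_uminus by simp

lemma T_const [simp]: "v \<in> T p \<Longrightarrow> v (\<lambda>x. c) = 0"
proof -
  assume v: "v \<in> T p"
  have "v (\<lambda>x. 1 * 1) = 1 * v (\<lambda>x. 1) + 1 * v (\<lambda>x. 1)" by (rule T_D(3)[OF v]) auto
  then have "v (\<lambda>x. 1) = 0" by simp
  then show ?thesis using T_D(2)[OF v S_const, of c 1] by simp
qed

lemma T_sum: "v \<in> T p \<Longrightarrow> (\<And>i. i \<in> A \<Longrightarrow> f i \<in> S) \<Longrightarrow> v (\<lambda>x. \<Sum>i\<in>A. f i x) = (\<Sum>i\<in>A. v (f i))"
proof (induction A rule: infinite_finite_induct)
  case (insert a A)
  have "v (\<lambda>x. f a x + (\<Sum>i\<in>A. f i x)) = v (f a) + v (\<lambda>x. \<Sum>i\<in>A. f i x)"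
    by (rule T_D(1)) (use insert in \<open>auto intro: S_sum\<close>)
  with insert show ?case by simp
qed auto

text \<open>With a bump function supported where \<open>f = h\<close>, the product
  \<open>\<eta> * (f - h)\<close> vanishes identically. Applying the Leibniz rule at
  \<open>p\<close>, where \<open>\<eta> = 1\<close> and \<open>f - h = 0\<close>, leaves
  \<open>v f - v h = 0\<close>.\<close>

lemma T_local:
  assumes v: "v \<in> T p" and f: "f \<in> S" "h \<in> S" and N: "open N" "p \<in> N" "\<And>q. q \<in> N \<Longrightarrow> f q = h q"
  shows "v f = v h"
proof -
  obtain U \<phi> where c: "(U, \<phi>) \<in> charts M" "p \<in> U" using chart_at .
  obtain \<eta> N' where \<eta>: "\<eta> \<in> S" "p \<in> N'" "\<And>q. q \<in> N' \<Longrightarrow> \<eta> q = 1" "\<And>q. q \<notin> U \<inter> N \<Longrightarrow> \<eta> q = 0"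
    by (rule manifold_bump[OF c(1), of "U \<inter> N" p]) (use c N chart_open in auto)
  have "(\<lambda>x. \<eta> x * (f x - h x)) = (\<lambda>x. 0)" using \<eta>(4) N(3) by fastforce
  then have "0 = v (\<lambda>x. \<eta> x * (f x - h x))" using T_const[OF v, of 0] by simp
  also have "\<dots> = \<eta> p * v (\<lambda>x. f x - h x) + (f p - h p) * v \<eta>" by (rule T_D(3)[OF v \<eta>(1) S_diff[OF f]])
  also have "\<dots> = v f - v h" using \<eta> N T_diff[OF v f] by simp
  finally show ?thesis by simp
qed

lemma chart_derivation:
  assumes c: "(U, \<phi>) \<in> charts M" and p: "p \<in> U" and w: "w \<in> V"
  shows "(\<lambda>f. if f \<in> S then dd w (f \<circ> inv_into U \<phi>) (\<phi> p) else 0) \<in> T p"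
proof -
  have dif: "(f \<circ> inv_into U \<phi>) differentiable (at (\<phi> p) within V)" if "f \<in> S" for f
    by (rule smooth_on_differentiable[OF V chart_image[OF c] S_D[OF that c]]) (use p in auto)
  have pV: "\<phi> p \<in> V" by (rule chart_in_V[OF c p])
  have 1: "dd w ((\<lambda>x. f x + h x) \<circ> inv_into U \<phi>) (\<phi> p) = dd w (f \<circ> inv_into U \<phi>) (\<phi> p) + dd w (h \<circ> inv_into U \<phi>) (\<phi> p)"
    if "f \<in> S" "h \<in> S" for f h
    using dd_add[OF V pV w dif[OF that(1)] dif[OF that(2)]] by (simp add: o_def)
  have 2: "dd w ((\<lambda>x. f x * h x) \<circ> inv_into U \<phi>) (\<phi> p)
     = f p * dd w (h \<circ> inv_into U \<phi>) (\<phi> p) + h p * dd w (f \<circ> inv_into U \<phi>) (\<phi> p)"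
    if "f \<in> S" "h \<in> S" for f h
    using dd_mult[OF V pV w dif[OF that(1)] dif[OF that(2)]] chart_inv[OF c p] by (simp add: o_def mult.commute)
  have 3: "dd w ((\<lambda>x. k * f x) \<circ> inv_into U \<phi>) (\<phi> p) = k * dd w (f \<circ> inv_into U \<phi>) (\<phi> p)" if "f \<in> S" for f k
    using 2[OF S_const[of k] that] by (simp add: o_def)
  have S_cmult_iff: "(\<lambda>x. k * f x) \<in> S \<longleftrightarrow> f \<in> S \<or> k = 0" for k f
    using S_cmult[of f k] S_cmult[of "\<lambda>x. k * f x" "inverse k"]
    by (cases "k = 0") (auto simp: mult.assoc[symmetric])
  show ?thesis unfolding tangent_space_def using 1 2 3 by (auto simp: S_add S_mult S_cmult)
qed

text \<open>By Hadamard, near \<open>p\<close> every \<open>f\<close> is \<open>f p\<close> plus a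
  sum of coordinate functions vanishing at \<open>p\<close> times smooth cofactors. The derivation
  kills the constant and sees each product only through the value on the coordinate and the cofactor
  at \<open>p\<close>, which is a partial derivative.\<close>

lemma tangent_vector_in_chart:
  assumes v: "v \<in> T p" and c: "(U, \<phi>) \<in> charts M" and p: "p \<in> U"
  obtains w where "w \<in> V" "\<And>f. f \<in> S \<Longrightarrow> v f = dd w (f \<circ> inv_into U \<phi>) (\<phi> p)"
proof -
  obtain B where B: "finite B" "B \<subseteq> V" "\<And>w. w \<in> V \<Longrightarrow> w = (\<Sum>b\<in>B. (w \<bullet> b) *\<^sub>R b)"
    "\<And>b c. b \<in> B \<Longrightarrow> c \<in> B \<Longrightarrow> b \<bullet> c = (if b = c then 1 else 0)"
    using orthonormal_basis_of_subspace[OF V] by metis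
  have oU: "openin (top_of_set V) (\<phi> ` U)" using chart_image[OF c] .
  obtain e where e: "e > 0" "V \<inter> ball (\<phi> p) e \<subseteq> \<phi> ` U"
    using oU p unfolding openin_contains_ball by (metis Int_commute imageI)
  define W where "W = V \<inter> ball (\<phi> p) e"
  have pV: "\<phi> p \<in> V" by (rule chart_in_V[OF c p])
  define D where "D = {q \<in> U. \<phi> q \<in> ball (\<phi> p) e}"
  have D: "open D" "D \<subseteq> U" "p \<in> D"
    using chart_preimage_open[OF c open_ball chart_open[OF c] order_refl] p e unfolding D_def by auto
  have DW: "\<phi> ` D = W"
    unfolding D_def W_def using chart_in_V[OF c] e by fastforce
  obtain \<eta> N where \<eta>: "open N" "p \<in> N" "N \<subseteq> D" "\<And>q. q \<in> N \<Longrightarrow> \<eta> q = 1"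
    and ext: "\<And>g. smooth_on V (\<phi> ` D) g \<Longrightarrow> (\<lambda>q. if q \<in> D then \<eta> q * g (\<phi> q) else 0) \<in> S"
    by (rule manifold_bump[OF c D]) blast
  define E where "E g q = (if q \<in> D then \<eta> q * g (\<phi> q) else 0)" for g q
  have ES: "E g \<in> S" if "smooth_on V W g" for g using ext that unfolding E_def DW by blast
  have EN: "E g q = g (\<phi> q)" if "q \<in> N" for g q using that \<eta> by (auto simp: E_def)
  have lin: "smooth_on V W (\<lambda>x. (x - \<phi> p) \<bullet> b)" for b
    using smooth_on_linear[OF bounded_linear_inner_left, of V W "\<lambda>x. x + (- \<phi> p)" b]
      smooth_on_add[OF smooth_on_bounded_linear[OF bounded_linear_ident] smooth_on_const, of V W "- \<phi> p"] by simp
  define X where "X b = E (\<lambda>x. (x - \<phi> p) \<bullet> b)" for b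
  \<comment> \<open>The components of a tangent vector in a chart are its values on the coordinate
    functions, here cut off to be globally smooth.\<close>
  define w where "w = (\<Sum>b\<in>B. v (X b) *\<^sub>R b)"
  have "w \<in> V" unfolding w_def using B by (intro subspace_sum[OF V] subspace_scale[OF V]) auto
  moreover have "v f = dd w (f \<circ> inv_into U \<phi>) (\<phi> p)" if f: "f \<in> S" for f
  proof -
    let ?f = "f \<circ> inv_into U \<phi>"
    have sf: "smooth_on V W ?f" using S_D[OF f c] by (rule smooth_on_subset) (use e W_def in auto)
    have oW: "openin (top_of_set V) W" using W_open[OF V pV W_def] .
    define G where "G b = ray_integral (\<phi> p) 0 (dd b ?f)" for b
    have sG: "smooth_on V W (G b)" if "b \<in> B" for b
      unfolding G_def by (rule smooth_on_ray_integral[OF V pV W_def smooth_on_dd[OF V oW sf]]) (use B that in auto)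
    have pW: "\<phi> p \<in> W" using pV e by (simp add: W_def)
    have Gp: "G b (\<phi> p) = dd b ?f (\<phi> p)" for b by (simp add: G_def ray_integral_def)
    have XS: "X b \<in> S" for b unfolding X_def by (rule ES[OF lin])
    have Xp: "X b p = 0" for b unfolding X_def EN[OF \<eta>(2)] by simp
    have "v f = v (\<lambda>q. f p + (\<Sum>b\<in>B. X b q * E (G b) q))"
    proof (rule T_local[OF v f _ \<eta>(1,2)])
      show "(\<lambda>q. f p + (\<Sum>b\<in>B. X b q * E (G b) q)) \<in> S"
        by (intro S_add S_const S_sum S_mult XS ES sG)
      fix q assume q: "q \<in> N"
      then have "q \<in> U" "\<phi> q \<in> W" using \<eta>(3) D(2) DW by auto
      then show "f q = f p + (\<Sum>b\<in>B. X b q * E (G b) q)"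
        using hadamard[OF V pV W_def B(1-3) sf, of "\<phi> q"] chart_inv[OF c] p
        by (simp add: X_def EN[OF q] G_def)
    qed
    also have "\<dots> = v (\<lambda>q. f p) + v (\<lambda>q. \<Sum>b\<in>B. X b q * E (G b) q)"
      by (rule T_D(1)[OF v]) (intro S_const S_sum S_mult XS ES sG)+
    also have "\<dots> = v (\<lambda>q. \<Sum>b\<in>B. X b q * E (G b) q)" using v by simp
    also have "\<dots> = (\<Sum>b\<in>B. v (\<lambda>q. X b q * E (G b) q))"
      by (rule T_sum[OF v]) (intro S_mult XS ES sG)
    also have "\<dots> = (\<Sum>b\<in>B. v (X b) *\<^sub>R dd b ?f (\<phi> p))"
    proof (rule sum.cong)
      fix b assume "b \<in> B"
      then show "v (\<lambda>q. X b q * E (G b) q) = v (X b) *\<^sub>R dd b ?f (\<phi> p)"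
        using T_D(3)[OF v XS ES[OF sG]] EN[OF \<eta>(2)] by (simp add: Xp Gp)
    qed simp
    also have "\<dots> = dd w ?f (\<phi> p)"
      unfolding w_def by (rule dd_sum_direction[symmetric, OF V pV smooth_on_differentiable[OF V oW sf pW]]) (use B in auto)
    finally show ?thesis .
  qed
  ultimately show ?thesis using that by blast
qed

end

section \<open>Global frames\<close>

lemma dual_functionals:
  fixes \<epsilon> :: "'j \<Rightarrow> 'e::euclidean_space"
  assumes J: "finite J" and ind: "\<And>c j. (\<Sum>j\<in>J. c j *\<^sub>R \<epsilon> j) = 0 \<Longrightarrow> j \<in> J \<Longrightarrow> c j = 0"
  obtains l :: "'j \<Rightarrow> 'e \<Rightarrow> real" where "\<And>i. linear (l i)" "\<And>i j. i \<in> J \<Longrightarrow> j \<in> J \<Longrightarrow> l i (\<epsilon> j) = (if i = j then 1 else 0)"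
proof -
  have inj: "inj_on \<epsilon> J"
  proof (rule inj_onI, rule ccontr)
    fix i j assume ij: "i \<in> J" "j \<in> J" "\<epsilon> i = \<epsilon> j" "i \<noteq> j"
    have "(\<Sum>k\<in>J. ((if k = i then 1 else 0) + (if k = j then - 1 else 0)) *\<^sub>R \<epsilon> k) = 0"
      using ij J by (simp add: scaleR_add_left sum.distrib if_distrib[of "\<lambda>a. a *\<^sub>R _"] cong: if_cong)
    from ind[OF this, of i] ij show False by simp
  qed
  have "independent (\<epsilon> ` J)"
  proof (rule independent_if_scalars_zero)
    fix f x assume *: "(\<Sum>x\<in>\<epsilon> ` J. f x *\<^sub>R x) = 0" "x \<in> \<epsilon> ` J"
    then have "(\<Sum>j\<in>J. f (\<epsilon> j) *\<^sub>R \<epsilon> j) = 0" using inj by (simp add: sum.reindex)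
    then show "f x = 0" using ind[of "\<lambda>j. f (\<epsilon> j)"] * by blast
  qed (simp add: J)
  then have "\<exists>g. linear g \<and> (\<forall>x\<in>\<epsilon> ` J. g x = (if inv_into J \<epsilon> x = i then 1 else 0 :: real))" for i
    by (rule linear_independent_extend)
  then obtain l where l: "\<And>i. linear (l i)" "\<And>i x. x \<in> \<epsilon> ` J \<Longrightarrow> l i x = (if inv_into J \<epsilon> x = i then 1 else 0 :: real)"
    by metis
  show ?thesis
    by (rule that[of l]) (use l inj in auto)
qed

text \<open>A global trivialisation of the tangent bundle. Independence is required at every point
  and tested on smooth functions only, because tangent vectors are 0 on all other functions by
  convention.\<close>

locale frame_mfd = smooth_mfd M
  for M :: "('m::{t2_space, second_countable_topology}, 'e::euclidean_space) manifold" +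
  fixes J :: "'j set" and E :: "'j \<Rightarrow> 'm vfield"
  assumes finJ: "finite J"
    and E_vf: "j \<in> J \<Longrightarrow> E j \<in> vector_fields M"
    and E_span: "v \<in> tangent_space M p \<Longrightarrow> \<exists>c. v = (\<lambda>f. \<Sum>j\<in>J. c j * E j p f)"
    and E_indep: "(\<And>f. f \<in> smooth_functions M \<Longrightarrow> (\<Sum>j\<in>J. c j * E j p f) = 0) \<Longrightarrow> j \<in> J \<Longrightarrow> c j = 0"

section \<open>Germs of smooth functions and the module of vector fields\<close>

context smooth_mfd
begin

abbreviation "VF \<equiv> vector_fields M"

lemma VF_T: "X \<in> VF \<Longrightarrow> X p \<in> T p" and VF_S: "X \<in> VF \<Longrightarrow> f \<in> S \<Longrightarrow> (\<lambda>p. X p f) \<in> S"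
  by (auto simp: vector_fields_def vapp_def)

lemma S_isCont: "f \<in> S \<Longrightarrow> isCont f p"
proof -
  assume f: "f \<in> S"
  obtain U \<phi> where c: "(U, \<phi>) \<in> charts M" "p \<in> U" using chart_at .
  have "continuous_on U (\<lambda>q. (f \<circ> inv_into U \<phi>) (\<phi> q))"
    using smooth_on_continuous[OF S_D[OF f c(1)]] homeomorphism_cont1[OF chart_homeo[OF c(1)]]
    by (rule continuous_on_compose2) auto
  then have "continuous_on U f" using chart_inv[OF c(1)] by (simp cong: continuous_on_cong)
  then show ?thesis using chart_open[OF c(1)] c(2) continuous_on_eq_continuous_at by blast
qed

text \<open>Smoothness of a germ, phrased through global representatives since \<open>S\<close>
  contains only global functions. Quotients and solutions of linear systems exist only near
  \<open>p\<close>, so the algebra is done at this level.\<close>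

definition smooth_near where
  "smooth_near p f \<longleftrightarrow> (\<exists>h\<in>S. \<forall>\<^sub>F q in nhds p. f q = h q)"

lemma smooth_near_S: "f \<in> S \<Longrightarrow> smooth_near p f"
  unfolding smooth_near_def by (rule bexI[of _ f]) auto

lemma S_smooth_near: "(\<And>p. smooth_near p f) \<Longrightarrow> f \<in> S"
  by (rule S_local) (fastforce simp: smooth_near_def eventually_nhds)

lemma smooth_near_cong: "smooth_near p f \<Longrightarrow> \<forall>\<^sub>F q in nhds p. g q = f q \<Longrightarrow> smooth_near p g"
proof -
  assume "smooth_near p f" and g: "\<forall>\<^sub>F q in nhds p. g q = f q"
  then obtain h where h: "h \<in> S" "\<forall>\<^sub>F q in nhds p. f q = h q" by (auto simp: smooth_near_def)
  have "\<forall>\<^sub>F q in nhds p. g q = h q" using g h(2) by eventually_elim simp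
  with h(1) show ?thesis unfolding smooth_near_def by blast
qed

lemma smooth_near_add: "smooth_near p f \<Longrightarrow> smooth_near p g \<Longrightarrow> smooth_near p (\<lambda>q. f q + g q)"
  unfolding smooth_near_def
proof safe
  fix h k assume "h \<in> S" "k \<in> S" "\<forall>\<^sub>F q in nhds p. f q = h q" "\<forall>\<^sub>F q in nhds p. g q = k q"
  then show "\<exists>h\<in>S. \<forall>\<^sub>F q in nhds p. f q + g q = h q"
    by (intro bexI[OF _ S_add[of h k]]) (auto elim: eventually_elim2)
qed

lemma smooth_near_mult: "smooth_near p f \<Longrightarrow> smooth_near p g \<Longrightarrow> smooth_near p (\<lambda>q. f q * g q)"
  unfolding smooth_near_def
proof safe
  fix h k assume "h \<in> S" "k \<in> S" "\<forall>\<^sub>F q in nhds p. f q = h q" "\<forall>\<^sub>F q in nhds p. g q = k q"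
  then show "\<exists>h\<in>S. \<forall>\<^sub>F q in nhds p. f q * g q = h q"
    by (intro bexI[OF _ S_mult[of h k]]) (auto elim: eventually_elim2)
qed

lemma smooth_near_const: "smooth_near p (\<lambda>q. c)"
  by (rule smooth_near_S) simp

lemma smooth_near_diff: "smooth_near p f \<Longrightarrow> smooth_near p g \<Longrightarrow> smooth_near p (\<lambda>q. f q - g q)"
  using smooth_near_add[OF _ smooth_near_mult[OF smooth_near_const[of p "-1"]], of f g] by simp

lemma smooth_near_sum: "(\<And>i. i \<in> A \<Longrightarrow> smooth_near p (f i)) \<Longrightarrow> smooth_near p (\<lambda>q. \<Sum>i\<in>A. f i q)"
  by (induction A rule: infinite_finite_induct) (auto intro: smooth_near_add smooth_near_const)

lemma smooth_near_isCont: "smooth_near p f \<Longrightarrow> isCont f p"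
  using S_isCont isCont_cong unfolding smooth_near_def by blast

text \<open>The inverse must agree near \<open>p\<close> with the inverse of a function in
  \<open>S\<close> without zeros. Such a function is obtained by interpolating between a positive
  multiple of the representative and the constant 1.\<close>

lemma smooth_near_inverse:
  assumes "smooth_near p f" "f p \<noteq> 0"
  shows "smooth_near p (\<lambda>q. inverse (f q))"
proof -
  obtain h where h: "h \<in> S" "\<forall>\<^sub>F q in nhds p. f q = h q" using assms(1) by (auto simp: smooth_near_def)
  have hp: "h p = f p" using eventually_nhds_x_imp_x[OF h(2)] by simp
  define c where "c = inverse (h p)"
  obtain U \<phi> where ch: "(U, \<phi>) \<in> charts M" "p \<in> U" using chart_at .
  have "continuous_on UNIV (\<lambda>q. c * h q)"
    using S_isCont[OF S_cmult[OF h(1)]] by (simp add: continuous_on_eq_continuous_at)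
  then have "open ((\<lambda>q. c * h q) -` {0<..})" by (intro open_vimage) auto
  then have D: "open (U \<inter> (\<lambda>q. c * h q) -` {0<..})" using chart_open[OF ch(1)] by blast
  obtain \<eta> N where \<eta>: "\<eta> \<in> S" "open N" "p \<in> N" "\<And>q. q \<in> N \<Longrightarrow> \<eta> q = 1"
     "\<And>q. q \<notin> U \<inter> (\<lambda>q. c * h q) -` {0<..} \<Longrightarrow> \<eta> q = 0" "\<And>q. 0 \<le> \<eta> q" "\<And>q. \<eta> q \<le> 1"
    by (rule manifold_bump[OF ch(1) D, of p]) (use ch hp assms(2) in \<open>auto simp: c_def\<close>)
  \<comment> \<open>The constant \<open>c\<close> makes \<open>c * h\<close> equal to 1 at
    \<open>p\<close>, and the bump function is supported where \<open>c * h > 0\<close>. So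
    \<open>k\<close> is a convex combination of positive numbers there and equals 1
    elsewhere.\<close>
  define k where "k q = \<eta> q * (c * h q) + (1 - \<eta> q)" for q
  have k: "k \<in> S" unfolding k_def by (intro S_add S_mult S_diff S_cmult S_const \<eta> h)
  have "k q > 0" for q
  proof (cases "\<eta> q = 0")
    case False
    then have "c * h q > 0" "\<eta> q > 0" using \<eta>(5)[of q] \<eta>(6)[of q] by auto
    then have "\<eta> q * (c * h q) > 0" by simp
    then show ?thesis using \<eta>(7)[of q] unfolding k_def by linarith
  qed (simp add: k_def)
  then have "(\<lambda>q. c * inverse (k q)) \<in> S" by (intro S_cmult S_inverse k) (metis less_irrefl)
  moreover have "\<forall>\<^sub>F q in nhds p. q \<in> N" using \<eta> by (auto simp: eventually_nhds)
  then have "\<forall>\<^sub>F q in nhds p. inverse (f q) = c * inverse (k q)"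
    using h(2)
  proof eventually_elim
    case (elim q)
    then show ?case using \<eta>(4) hp assms(2) by (simp add: k_def c_def)
  qed
  ultimately show ?thesis unfolding smooth_near_def by (intro bexI[where x = "\<lambda>q. c * inverse (k q)"])
qed

text \<open>Gaussian elimination, with \<open>a p\<close> the identity matrix.\<close>

lemma smooth_near_linear_system:
  assumes "finite I"
    and "\<And>i j. i \<in> I \<Longrightarrow> j \<in> I \<Longrightarrow> smooth_near p (a i j)"
    and "\<And>i j. i \<in> I \<Longrightarrow> j \<in> I \<Longrightarrow> a i j p = (if i = j then 1 else 0)"
    and "\<And>i. i \<in> I \<Longrightarrow> smooth_near p (b i)"
    and "\<And>i. i \<in> I \<Longrightarrow> \<forall>\<^sub>F q in nhds p. (\<Sum>j\<in>I. a i j q * y j q) = b i q"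
    and "j \<in> I"
  shows "smooth_near p (y j)"
  using assms
proof (induction I arbitrary: a b j rule: finite_induct)
  case (insert n I)
  have an: "smooth_near p (a n n)" "a n n p = 1" using insert.prems(1,2) by auto
  then have inv: "smooth_near p (\<lambda>q. inverse (a n n q))" by (intro smooth_near_inverse) auto
  have nz: "\<forall>\<^sub>F q in nhds p. a n n q \<noteq> 0"
  proof -
    have "a n n \<midarrow>p\<rightarrow> a n n p" using smooth_near_isCont[OF an(1)] by (simp add: isCont_def)
    then have "filterlim (a n n) (nhds (a n n p)) (nhds p)" by (simp add: tendsto_at_iff_tendsto_nhds)
    then have "\<forall>\<^sub>F q in nhds p. a n n q \<in> - {0}"
      by (rule topological_tendstoD) (use an(2) in auto)
    then show ?thesis by simp
  qed
  have sys_n: "\<forall>\<^sub>F q in nhds p. a n n q * y n q + (\<Sum>j\<in>I. a n j q * y j q) = b n q"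
    using insert.prems(4)[of n] insert.hyps by simp
  \<comment> \<open>Elimination of the unknown \<open>y n\<close>. At \<open>p\<close> the entries
    \<open>a i n\<close> with \<open>i \<noteq> n\<close> vanish, so the reduced matrix is again the
    identity there and the induction hypothesis applies.\<close>
  define a' where "a' i j q = a i j q - a i n q * a n j q * inverse (a n n q)" for i j q
  define b' where "b' i q = b i q - a i n q * b n q * inverse (a n n q)" for i q
  have y: "smooth_near p (y j)" if "j \<in> I" for j
  proof (rule insert.IH[of a' b', OF _ _ _ _ that])
    fix i j assume ij: "i \<in> I" "j \<in> I"
    show "smooth_near p (a' i j)" unfolding a'_def
      by (intro smooth_near_diff smooth_near_mult inv insert.prems(1)) (use ij in auto)
    have "i \<noteq> n" using ij insert.hyps by auto
    then show "a' i j p = (if i = j then 1 else 0)"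
      unfolding a'_def using insert.prems(2)[of i n] insert.prems(2)[of i j] ij by simp
  next
    fix i assume i: "i \<in> I"
    show "smooth_near p (b' i)" unfolding b'_def
      by (intro smooth_near_diff smooth_near_mult inv insert.prems(1,3)) (use i in auto)
    have "\<forall>\<^sub>F q in nhds p. a i n q * y n q + (\<Sum>j\<in>I. a i j q * y j q) = b i q"
      using insert.prems(4)[of i] i insert.hyps by simp
    with sys_n nz show "\<forall>\<^sub>F q in nhds p. (\<Sum>j\<in>I. a' i j q * y j q) = b' i q"
    proof eventually_elim
      case (elim q)
      let ?m = "a i n q * inverse (a n n q)"
      have "(\<Sum>j\<in>I. a' i j q * y j q) = (\<Sum>j\<in>I. a i j q * y j q) - ?m * (\<Sum>j\<in>I. a n j q * y j q)"
        unfolding a'_def sum_distrib_left by (simp add: algebra_simps flip: sum_subtractf)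
      also have "(\<Sum>j\<in>I. a n j q * y j q) = b n q - a n n q * y n q" using elim by simp
      also have "(\<Sum>j\<in>I. a i j q * y j q) = b i q - a i n q * y n q" using elim by simp
      finally show ?case using elim by (simp add: b'_def algebra_simps)
    qed
  qed
  have "smooth_near p (\<lambda>q. (b n q - (\<Sum>j\<in>I. a n j q * y j q)) * inverse (a n n q))"
    by (intro smooth_near_mult smooth_near_diff smooth_near_sum inv y insert.prems(1,3)) auto
  moreover have "\<forall>\<^sub>F q in nhds p. y n q = (b n q - (\<Sum>j\<in>I. a n j q * y j q)) * inverse (a n n q)"
    using sys_n nz
  proof eventually_elim
    case (elim q)
    then have "b n q - (\<Sum>j\<in>I. a n j q * y j q) = a n n q * y n q" by simp
    then have "(b n q - (\<Sum>j\<in>I. a n j q * y j q)) * inverse (a n n q) = a n n q * y n q * inverse (a n n q)"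
      by (simp only:)
    then show ?case using elim(2) by simp
  qed
  ultimately have "smooth_near p (y n)" by (rule smooth_near_cong)
  with y insert.prems(5) show ?case by auto
qed auto

lemma T_zero: "(\<lambda>f. 0) \<in> T p"
  by (simp add: tangent_space_def)

lemma T_add: "u \<in> T p \<Longrightarrow> v \<in> T p \<Longrightarrow> (\<lambda>f. u f + v f) \<in> T p"
  by (simp add: tangent_space_def algebra_simps)

lemma T_scale: "v \<in> T p \<Longrightarrow> (\<lambda>f. c * v f) \<in> T p"
  by (simp add: tangent_space_def algebra_simps)

lemma T_sum_mem: "(\<And>i. i \<in> A \<Longrightarrow> v i \<in> T p) \<Longrightarrow> (\<lambda>f. \<Sum>i\<in>A. c i * v i f) \<in> T p"
  by (induction A rule: infinite_finite_induct) (auto intro!: T_zero T_add T_scale)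

lemma VF_sum:
  assumes "\<And>i. i \<in> A \<Longrightarrow> x i \<in> S" "\<And>i. i \<in> A \<Longrightarrow> X i \<in> VF"
  shows "(\<lambda>p f. \<Sum>i\<in>A. x i p * X i p f) \<in> VF"
  unfolding vector_fields_def vapp_def
proof (intro CollectI conjI allI ballI)
  fix p show "(\<lambda>f. \<Sum>i\<in>A. x i p * X i p f) \<in> T p" by (intro T_sum_mem VF_T assms)
next
  fix f assume "f \<in> S"
  then show "(\<lambda>p. \<Sum>i\<in>A. x i p * X i p f) \<in> S"
    using S_mult[OF assms(1) VF_S[OF assms(2)]] by (intro S_sum)
qed

lemma VF_vadd: "X \<in> VF \<Longrightarrow> Y \<in> VF \<Longrightarrow> vadd X Y \<in> VF"
  unfolding vector_fields_def vapp_def vadd_def by (auto intro!: T_add S_add)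

lemma VF_vmult: "h \<in> S \<Longrightarrow> X \<in> VF \<Longrightarrow> vmult h X \<in> VF"
  unfolding vector_fields_def vapp_def vmult_def by (auto intro!: T_scale S_mult)

text \<open>In the Leibniz rule the mixed terms of the shape \<open>X f * Y h\<close> are symmetric
  in \<open>X\<close> and \<open>Y\<close> and cancel.\<close>

lemma VF_vbracket:
  assumes X: "X \<in> VF" and Y: "Y \<in> VF"
  shows "vbracket X Y \<in> VF"
proof -
  have XT: "X p \<in> T p" and YT: "Y p \<in> T p" for p using VF_T X Y by auto
  have XS: "(\<lambda>p. X p f) \<in> S" and YS: "(\<lambda>p. Y p f) \<in> S" if "f \<in> S" for f using VF_S X Y that by auto
  have "vbracket X Y p \<in> T p" for p
    unfolding tangent_space_def
  proof (intro CollectI conjI ballI allI impI)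
    fix f h assume f: "f \<in> S" and h: "h \<in> S"
    show "vbracket X Y p (\<lambda>x. f x + h x) = vbracket X Y p f + vbracket X Y p h"
      by (simp add: vbracket_def vapp_def T_D(1)[OF XT f h] T_D(1)[OF YT f h] T_D(1)[OF XT] T_D(1)[OF YT] XS YS f h)
    show "vbracket X Y p (\<lambda>x. f x * h x) = f p * vbracket X Y p h + h p * vbracket X Y p f"
      by (simp add: vbracket_def vapp_def T_D(3)[OF XT f h] T_D(3)[OF YT f h] T_D(1)[OF XT] T_D(1)[OF YT]
          T_D(3)[OF XT] T_D(3)[OF YT] S_mult XS YS f h algebra_simps)
  next
    fix c f assume f: "f \<in> S"
    show "vbracket X Y p (\<lambda>x. c * f x) = c * vbracket X Y p f"
      by (simp add: vbracket_def vapp_def T_D(2)[OF XT f] T_D(2)[OF YT f] T_D(2)[OF XT] T_D(2)[OF YT] XS YS f algebra_simps)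
  next
    fix f assume "f \<notin> S"
    then show "vbracket X Y p f = 0"
      by (simp add: vbracket_def vapp_def T_D(4)[OF XT] T_D(4)[OF YT] T_const[OF XT] T_const[OF YT])
  qed
  moreover have "vapp (vbracket X Y) f \<in> S" if f: "f \<in> S" for f
    unfolding vbracket_def vapp_def by (rule S_diff[OF VF_S[OF X YS[OF f]] VF_S[OF Y XS[OF f]]])
  ultimately show ?thesis unfolding vector_fields_def by blast
qed

end

section \<open>Coefficients of tangent vectors and vector fields in a global frame\<close>

context frame_mfd
begin

text \<open>The components of the frame at \<open>p\<close> in a chart are linearly independent, so
  there are linear functionals dual to them. Composed with the chart and cut off, these become the
  wanted functions; duality is claimed at the single point \<open>p\<close>.\<close>

lemma dual_functions:
  obtains u where "\<And>i. i \<in> J \<Longrightarrow> u i \<in> S" "\<And>i j. i \<in> J \<Longrightarrow> j \<in> J \<Longrightarrow> E j p (u i) = (if i = j then 1 else 0)"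
proof -
  obtain U \<phi> where c: "(U, \<phi>) \<in> charts M" "p \<in> U" using chart_at .
  have "\<forall>j\<in>J. \<exists>w. w \<in> V \<and> (\<forall>f\<in>S. E j p f = dd w (f \<circ> inv_into U \<phi>) (\<phi> p))"
    using tangent_vector_in_chart[OF VF_T[OF E_vf] c] by metis
  then obtain \<epsilon> where \<epsilon>: "\<And>j. j \<in> J \<Longrightarrow> \<epsilon> j \<in> V" "\<And>j f. j \<in> J \<Longrightarrow> f \<in> S \<Longrightarrow> E j p f = dd (\<epsilon> j) (f \<circ> inv_into U \<phi>) (\<phi> p)"
    by metis
  have pV: "\<phi> p \<in> V" by (rule chart_in_V[OF c])
  have pU: "\<phi> p \<in> \<phi> ` U" using c by auto
  have ind: "a j = 0" if "(\<Sum>j\<in>J. a j *\<^sub>R \<epsilon> j) = 0" "j \<in> J" for a j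
  proof (rule E_indep[OF _ that(2)])
    fix f assume f: "f \<in> S"
    have "(\<Sum>j\<in>J. a j * E j p f) = (\<Sum>j\<in>J. a j *\<^sub>R dd (\<epsilon> j) (f \<circ> inv_into U \<phi>) (\<phi> p))"
      using \<epsilon>(2)[OF _ f] by simp
    also have "\<dots> = dd (\<Sum>j\<in>J. a j *\<^sub>R \<epsilon> j) (f \<circ> inv_into U \<phi>) (\<phi> p)"
      by (rule dd_sum_direction[symmetric, OF V pV smooth_on_differentiable[OF V chart_image[OF c(1)] S_D[OF f c(1)] pU]])
         (use \<epsilon> in auto)
    also have "\<dots> = 0" by (simp add: that(1) dd_def)
    finally show "(\<Sum>j\<in>J. a j * E j p f) = 0" .
  qed
  obtain l where l: "\<And>i. linear (l i)" "\<And>i j. i \<in> J \<Longrightarrow> j \<in> J \<Longrightarrow> l i (\<epsilon> j) = (if i = j then 1 else 0 :: real)"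
  proof (rule dual_functionals[OF finJ, of \<epsilon>])
    show "a j = 0" if "(\<Sum>j\<in>J. a j *\<^sub>R \<epsilon> j) = 0" "j \<in> J" for a j by (rule ind[OF that])
  qed blast
  have bl: "bounded_linear (l i)" for i using l(1) by (simp add: linear_conv_bounded_linear)
  obtain \<eta> N where \<eta>: "open N" "p \<in> N" "N \<subseteq> U" "\<And>q. q \<in> N \<Longrightarrow> \<eta> q = 1"
    and ext: "\<And>g. smooth_on V (\<phi> ` U) g \<Longrightarrow> (\<lambda>q. if q \<in> U then \<eta> q * g (\<phi> q) else 0) \<in> S"
    by (rule manifold_bump[OF c(1) chart_open[OF c(1)] order_refl c(2)]) blast
  define u where "u i q = (if q \<in> U then \<eta> q * l i (\<phi> q) else 0)" for i q
  have uS: "u i \<in> S" for i unfolding u_def by (rule ext[OF smooth_on_bounded_linear[OF bl]])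
  have "E j p (u i) = (if i = j then 1 else 0)" if ij: "i \<in> J" "j \<in> J" for i j
  proof -
    have "E j p (u i) = dd (\<epsilon> j) (u i \<circ> inv_into U \<phi>) (\<phi> p)" by (rule \<epsilon>(2)[OF ij(2) uS])
    also have "\<dots> = dd (\<epsilon> j) (l i) (\<phi> p)"
      by (rule dd_cong[OF V chart_image_open_sub[OF c(1) \<eta>(1,3)]]) (use \<eta> \<epsilon> ij chart_inv[OF c(1)] in \<open>auto simp: u_def\<close>)
    also have "\<dots> = l i (\<epsilon> j)" by (rule dd_bounded_linear[OF bl])
    finally show ?thesis using l(2)[OF ij] by simp
  qed
  then show ?thesis using that[of u] uS by blast
qed

definition tc :: "'m \<Rightarrow> 'm tvector \<Rightarrow> 'j \<Rightarrow> real" where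
  "tc p v = (SOME c. v = (\<lambda>f. \<Sum>j\<in>J. c j * E j p f))"

lemma tc: "v \<in> T p \<Longrightarrow> v f = (\<Sum>j\<in>J. tc p v j * E j p f)"
proof -
  assume "v \<in> T p"
  then have "v = (\<lambda>f. \<Sum>j\<in>J. tc p v j * E j p f)" unfolding tc_def by (rule someI_ex[OF E_span])
  then show ?thesis by metis
qed

lemma tc_unique:
  assumes "\<And>f. f \<in> S \<Longrightarrow> v f = (\<Sum>j\<in>J. c j * E j p f)" "v \<in> T p" "j \<in> J"
  shows "tc p v j = c j"
proof -
  have "tc p v j - c j = 0"
  proof (rule E_indep[of "\<lambda>j. tc p v j - c j" p, OF _ assms(3)])
    fix f assume "f \<in> S"
    then show "(\<Sum>j\<in>J. (tc p v j - c j) * E j p f) = 0"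
      using assms(1)[of f] tc[OF assms(2), of f] by (simp add: left_diff_distrib sum_subtractf)
  qed
  then show ?thesis by simp
qed

definition co :: "'m vfield \<Rightarrow> 'j \<Rightarrow> 'm \<Rightarrow> real" where
  "co X j p = tc p (X p) j"

lemma co: "X \<in> VF \<Longrightarrow> X p f = (\<Sum>j\<in>J. co X j p * E j p f)"
  unfolding co_def by (rule tc[OF VF_T])

lemma co_unique:
  "X \<in> VF \<Longrightarrow> (\<And>f. f \<in> S \<Longrightarrow> X p f = (\<Sum>j\<in>J. c j * E j p f)) \<Longrightarrow> j \<in> J \<Longrightarrow> co X j p = c j"
  unfolding co_def by (rule tc_unique[OF _ VF_T])

text \<open>Testing \<open>X\<close> on functions dual to the frame at \<open>p\<close> gives a
  linear system for the coefficients. Its matrix has smooth entries and is the identity at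
  \<open>p\<close>, so its solution is smooth near \<open>p\<close>.\<close>

lemma co_S:
  assumes X: "X \<in> VF" and j: "j \<in> J"
  shows "co X j \<in> S"
proof (rule S_smooth_near)
  fix p
  obtain u where u: "\<And>i. i \<in> J \<Longrightarrow> u i \<in> S" "\<And>i j. i \<in> J \<Longrightarrow> j \<in> J \<Longrightarrow> E j p (u i) = (if i = j then 1 else 0)"
    using dual_functions[of p] by blast
  have XS: "X q (u i) = X q (u i)" and ES: "i \<in> J \<Longrightarrow> j \<in> J \<Longrightarrow> smooth_near p (\<lambda>q. E j q (u i))"
    and XS: "i \<in> J \<Longrightarrow> smooth_near p (\<lambda>q. X q (u i))" for i j q
    using smooth_near_S[OF VF_S[OF E_vf u(1)]] smooth_near_S[OF VF_S[OF X u(1)]] by auto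
  show "smooth_near p (co X j)"
  proof (rule smooth_near_linear_system[OF finJ, of p "\<lambda>i j q. E j q (u i)" "\<lambda>i q. X q (u i)" "co X", OF _ _ _ _ j])
    fix i assume "i \<in> J"
    then show "\<forall>\<^sub>F q in nhds p. (\<Sum>j\<in>J. E j q (u i) * co X j q) = X q (u i)"
      using co[OF X] by (simp add: mult.commute)
  qed (use u ES XS in auto)
qed

lemma VF_eqI:
  assumes X: "X \<in> VF" and Y: "Y \<in> VF" and "\<And>j p. j \<in> J \<Longrightarrow> co X j p = co Y j p"
  shows "X = Y"
proof (intro ext)
  fix p f show "X p f = Y p f" using co[OF X, of p f] co[OF Y, of p f] assms(3) by simp
qed

definition comb :: "('j \<Rightarrow> 'm \<Rightarrow> real) \<Rightarrow> 'm vfield" where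
  "comb x = (\<lambda>p f. \<Sum>j\<in>J. x j p * E j p f)"

lemma comb_VF: "(\<And>j. j \<in> J \<Longrightarrow> x j \<in> S) \<Longrightarrow> comb x \<in> VF"
  unfolding comb_def by (intro VF_sum E_vf)

lemma co_comb: "(\<And>j. j \<in> J \<Longrightarrow> x j \<in> S) \<Longrightarrow> j \<in> J \<Longrightarrow> co (comb x) j p = x j p"
  by (rule co_unique[OF comb_VF]) (auto simp: comb_def)

lemma co_E: "i \<in> J \<Longrightarrow> j \<in> J \<Longrightarrow> co (E i) j p = (if i = j then 1 else 0)"
  by (rule co_unique[OF E_vf]) (auto simp: finJ if_distrib[of "\<lambda>a. a * _"] cong: if_cong)

lemma co_vadd:
  assumes X: "X \<in> VF" and Y: "Y \<in> VF" and j: "j \<in> J"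
  shows "co (vadd X Y) j p = co X j p + co Y j p"
proof (rule co_unique[OF VF_vadd[OF X Y] _ j])
  show "vadd X Y p f = (\<Sum>j\<in>J. (co X j p + co Y j p) * E j p f)" for f
    using co[OF X, of p f] co[OF Y, of p f] by (simp add: vadd_def distrib_right sum.distrib)
qed

lemma co_vmult:
  assumes h: "h \<in> S" and X: "X \<in> VF" and j: "j \<in> J"
  shows "co (vmult h X) j p = h p * co X j p"
proof (rule co_unique[OF VF_vmult[OF h X] _ j])
  show "vmult h X p f = (\<Sum>j\<in>J. (h p * co X j p) * E j p f)" for f
    using co[OF X, of p f] by (simp add: vmult_def sum_distrib_left mult.assoc)
qed

end

section \<open>The Ricci curvature in an orthonormal frame with constant structure coefficients\<close>

lemma sum_antisym_eq_0:
  fixes r :: "'a \<Rightarrow> 'a \<Rightarrow> real"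
  assumes "\<And>a m. a \<in> A \<Longrightarrow> m \<in> A \<Longrightarrow> r a m = - r m a"
  shows "(\<Sum>a\<in>A. \<Sum>m\<in>A. r a m) = 0"
proof -
  have "(\<Sum>a\<in>A. \<Sum>m\<in>A. r a m) = (\<Sum>a\<in>A. \<Sum>m\<in>A. - r m a)"
    by (rule sum.cong[OF refl], rule sum.cong[OF refl], rule assms)
  also have "\<dots> = - (\<Sum>a\<in>A. \<Sum>m\<in>A. r a m)" by (subst sum.swap) (simp add: sum_negf)
  finally show ?thesis by simp
qed

locale const_frame = frame_mfd +
  fixes c :: "'c \<Rightarrow> 'c \<Rightarrow> 'c \<Rightarrow> real"
  assumes vbracket_E: "i \<in> J \<Longrightarrow> j \<in> J \<Longrightarrow> vbracket (E i) (E j) p f = (\<Sum>k\<in>J. c i j k * E k p f)"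
begin

lemma co_vbracket_E: "i \<in> J \<Longrightarrow> j \<in> J \<Longrightarrow> k \<in> J \<Longrightarrow> co (vbracket (E i) (E j)) k p = c i j k"
  by (rule co_unique[OF VF_vbracket[OF E_vf E_vf]]) (auto simp: vbracket_E)

lemma vbracket_antisym: "vbracket X Y p f = - vbracket Y X p f"
  by (simp add: vbracket_def)

lemma c_antisym: "i \<in> J \<Longrightarrow> j \<in> J \<Longrightarrow> k \<in> J \<Longrightarrow> c i j k = - c j i k"
proof -
  assume ijk: "i \<in> J" "j \<in> J" "k \<in> J"
  have "co (vbracket (E i) (E j)) k p = - c j i k" for p
  proof (rule co_unique[OF VF_vbracket[OF E_vf E_vf]])
    show "vbracket (E i) (E j) p f = (\<Sum>k\<in>J. - c j i k * E k p f)" for f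
      using vbracket_antisym[of "E i" "E j" p f] vbracket_E[OF ijk(2,1), of p f] by (simp add: sum_negf)
  qed (use ijk in auto)
  then show ?thesis using co_vbracket_E[OF ijk] by simp
qed

lemma vbracket_expand:
  assumes X: "X \<in> VF" and Y: "Y \<in> VF" and f: "f \<in> S"
  shows "vbracket X Y p f = (\<Sum>j\<in>J. X p (co Y j) * E j p f) + (\<Sum>j\<in>J. co Y j p * vbracket X (E j) p f)"
proof -
  have XT: "X p \<in> T p" by (rule VF_T[OF X])
  have "X p (vapp Y f) = X p (\<lambda>q. \<Sum>j\<in>J. co Y j q * E j q f)"
    using co[OF Y, of _ f] by (simp add: vapp_def)
  also have "\<dots> = (\<Sum>j\<in>J. X p (\<lambda>q. co Y j q * E j q f))"
    by (rule T_sum[OF XT]) (use S_mult[OF co_S[OF Y] VF_S[OF E_vf f]] in auto)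
  also have "\<dots> = (\<Sum>j\<in>J. co Y j p * X p (vapp (E j) f) + E j p f * X p (co Y j))"
    using T_D(3)[OF XT co_S[OF Y] VF_S[OF E_vf f]] by (intro sum.cong) (auto simp: vapp_def)
  finally have 1: "X p (vapp Y f) = (\<Sum>j\<in>J. co Y j p * X p (vapp (E j) f) + E j p f * X p (co Y j))" .
  have 2: "Y p (vapp X f) = (\<Sum>j\<in>J. co Y j p * E j p (vapp X f))" by (rule co[OF Y])
  show ?thesis
    unfolding vbracket_def[of X Y] vbracket_def[of X "E _"] 1 2
    by (simp add: sum.distrib right_diff_distrib sum_subtractf mult.commute)
qed

text \<open>The Leibniz rule is applied in both arguments. From here on brackets are computed with
  derivatives of coefficients and the constants \<open>c\<close> only.\<close>

lemma co_vbracket: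
  assumes X: "X \<in> VF" and Y: "Y \<in> VF" and k: "k \<in> J"
  shows "co (vbracket X Y) k p = X p (co Y k) - Y p (co X k) + (\<Sum>i\<in>J. \<Sum>j\<in>J. co X i p * co Y j p * c i j k)"
proof (rule co_unique[OF VF_vbracket[OF X Y] _ k])
  fix f assume f: "f \<in> S"
  have *: "vbracket X (E j) p f = - (\<Sum>i\<in>J. E j p (co X i) * E i p f) + (\<Sum>i\<in>J. co X i p * (\<Sum>k\<in>J. c i j k * E k p f))"
    if j: "j \<in> J" for j
  proof -
    have "vbracket X (E j) p f = - vbracket (E j) X p f" by (rule vbracket_antisym)
    also have "\<dots> = - (\<Sum>i\<in>J. E j p (co X i) * E i p f) + (\<Sum>i\<in>J. co X i p * vbracket (E i) (E j) p f)"
      unfolding vbracket_expand[OF E_vf[OF j] X f] using vbracket_antisym[of "E j" "E _" p f] by (simp add: sum_negf)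
    finally show ?thesis using j by (simp add: vbracket_E)
  qed
  have "vbracket X Y p f = (\<Sum>j\<in>J. X p (co Y j) * E j p f)
     + ((\<Sum>j\<in>J. co Y j p * - (\<Sum>i\<in>J. E j p (co X i) * E i p f))
     + (\<Sum>j\<in>J. co Y j p * (\<Sum>i\<in>J. co X i p * (\<Sum>k\<in>J. c i j k * E k p f))))"
    unfolding vbracket_expand[OF X Y f] sum.distrib[symmetric] distrib_left[symmetric]
    by (intro arg_cong2[of _ _ _ _ "(+)"] sum.cong refl) (simp add: *)
  also have "(\<Sum>j\<in>J. co Y j p * - (\<Sum>i\<in>J. E j p (co X i) * E i p f)) = (\<Sum>i\<in>J. - Y p (co X i) * E i p f)"
  proof -
    have "(\<Sum>j\<in>J. co Y j p * (\<Sum>i\<in>J. E j p (co X i) * E i p f)) = (\<Sum>j\<in>J. \<Sum>i\<in>J. co Y j p * E j p (co X i) * E i p f)"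
      by (simp add: sum_distrib_left mult.assoc)
    also have "\<dots> = (\<Sum>i\<in>J. (\<Sum>j\<in>J. co Y j p * E j p (co X i)) * E i p f)"
      by (subst sum.swap) (simp add: sum_distrib_right)
    also have "\<dots> = (\<Sum>i\<in>J. Y p (co X i) * E i p f)" using co[OF Y, of p] by simp
    finally show ?thesis by (simp add: sum_negf)
  qed
  also have "(\<Sum>j\<in>J. co Y j p * (\<Sum>i\<in>J. co X i p * (\<Sum>k\<in>J. c i j k * E k p f)))
     = (\<Sum>k\<in>J. (\<Sum>i\<in>J. \<Sum>j\<in>J. co X i p * co Y j p * c i j k) * E k p f)"
  proof -
    have "(\<Sum>j\<in>J. co Y j p * (\<Sum>i\<in>J. co X i p * (\<Sum>k\<in>J. c i j k * E k p f)))
        = (\<Sum>j\<in>J. \<Sum>i\<in>J. \<Sum>k\<in>J. co X i p * co Y j p * c i j k * E k p f)"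
      by (simp add: sum_distrib_left mult_ac)
    also have "\<dots> = (\<Sum>i\<in>J. \<Sum>j\<in>J. \<Sum>k\<in>J. co X i p * co Y j p * c i j k * E k p f)" by (rule sum.swap)
    also have "\<dots> = (\<Sum>i\<in>J. \<Sum>k\<in>J. \<Sum>j\<in>J. co X i p * co Y j p * c i j k * E k p f)"
      by (rule sum.cong[OF refl], rule sum.swap)
    also have "\<dots> = (\<Sum>k\<in>J. \<Sum>i\<in>J. \<Sum>j\<in>J. co X i p * co Y j p * c i j k * E k p f)" by (rule sum.swap)
    finally show ?thesis by (simp add: sum_distrib_right)
  qed
  finally show "vbracket X Y p f = (\<Sum>k\<in>J. (X p (co Y k) - Y p (co X k)
      + (\<Sum>i\<in>J. \<Sum>j\<in>J. co X i p * co Y j p * c i j k)) * E k p f)"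
    by (simp add: algebra_simps sum.distrib sum_subtractf sum_negf)
qed

text \<open>The metric for which the frame \<open>E\<close> is orthonormal at every point.\<close>

definition metric :: "'a metric_tensor" where
  "metric p u v = (\<Sum>j\<in>J. tc p u j * tc p v j)"

lemma metric_on_co: "metric_on metric X Y = (\<lambda>p. \<Sum>j\<in>J. co X j p * co Y j p)"
  by (simp add: metric_on_def metric_def co_def)

lemma tc_add: 
  assumes u: "u \<in> T p" and v: "v \<in> T p" and j: "j \<in> J"
  shows "tc p (\<lambda>f. u f + v f) j = tc p u j + tc p v j"
proof (rule tc_unique[OF _ T_add[OF u v] j])
  show "u f + v f = (\<Sum>j\<in>J. (tc p u j + tc p v j) * E j p f)" for f
    using tc[OF u, of f] tc[OF v, of f] by (simp add: distrib_right sum.distrib)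
qed

lemma tc_scale:
  assumes u: "u \<in> T p" and j: "j \<in> J"
  shows "tc p (\<lambda>f. a * u f) j = a * tc p u j"
proof (rule tc_unique[OF _ T_scale[OF u] j])
  show "a * u f = (\<Sum>j\<in>J. (a * tc p u j) * E j p f)" for f
    using tc[OF u, of f] by (simp add: sum_distrib_left mult.assoc)
qed

lemma tc_sum:
  assumes "\<And>i. i \<in> I \<Longrightarrow> v i \<in> T p" "j \<in> J"
  shows "tc p (\<lambda>f. \<Sum>i\<in>I. a i * v i f) j = (\<Sum>i\<in>I. a i * tc p (v i) j)"
proof (rule tc_unique[OF _ T_sum_mem[OF assms(1)] assms(2)])
  fix f
  have "(\<Sum>i\<in>I. a i * v i f) = (\<Sum>i\<in>I. a i * (\<Sum>j\<in>J. tc p (v i) j * E j p f))"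
    using tc[OF assms(1)] by (intro sum.cong) auto
  also have "\<dots> = (\<Sum>j\<in>J. (\<Sum>i\<in>I. a i * tc p (v i) j) * E j p f)"
    unfolding sum_distrib_left sum_distrib_right by (subst sum.swap) (simp add: mult.assoc)
  finally show "(\<Sum>i\<in>I. a i * v i f) = (\<Sum>j\<in>J. (\<Sum>i\<in>I. a i * tc p (v i) j) * E j p f)" .
qed auto

lemma riemannian_metric: "riemannian_metric M metric"
  unfolding riemannian_metric_def
proof (intro conjI allI ballI)
  fix p u v w k assume u: "u \<in> T p" and v: "v \<in> T p" and w: "w \<in> T p"
  show "metric p (\<lambda>f. u f + v f) w = metric p u w + metric p v w"
    by (simp add: metric_def tc_add[OF u v] distrib_right sum.distrib)
  show "metric p (\<lambda>f. k * u f) w = k * metric p u w"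
    by (simp add: metric_def tc_scale[OF u] sum_distrib_left mult.assoc)
  show "metric p u w = metric p w u" by (simp add: metric_def mult.commute)
  show "u \<noteq> (\<lambda>_. 0) \<longrightarrow> 0 < metric p u u"
  proof
    assume "u \<noteq> (\<lambda>_. 0)"
    then obtain f where "u f \<noteq> 0" by auto
    then have "(\<Sum>j\<in>J. tc p u j * E j p f) \<noteq> 0" using tc[OF u] by simp
    then obtain j where "j \<in> J" "tc p u j \<noteq> 0" by (metis (no_types, lifting) mult_eq_0_iff sum.neutral)
    then show "0 < metric p u u" unfolding metric_def using finJ
      by (intro sum_pos2[of J j]) (auto simp: zero_less_mult_iff linorder_neq_iff)
  qed
next
  fix X Y assume "X \<in> VF" "Y \<in> VF"
  then show "metric_on metric X Y \<in> S" unfolding metric_on_co by (intro S_sum S_mult co_S)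
qed

text \<open>The Koszul formula for the inner product of \<open>nab (E i) (E j)\<close> with
  \<open>E k\<close>: in an orthonormal frame the metric coefficients are constant and only the
  bracket terms remain.\<close>

definition G :: "'c \<Rightarrow> 'c \<Rightarrow> 'c \<Rightarrow> real" where
  "G i j k = (c i j k - c j k i + c k i j) / 2"

definition nab :: "'a vfield \<Rightarrow> 'a vfield \<Rightarrow> 'a vfield" where
  "nab X Y = comb (\<lambda>k p. X p (co Y k) + (\<Sum>i\<in>J. \<Sum>j\<in>J. co X i p * co Y j p * G i j k))"

context
  fixes X Y assumes X: "X \<in> VF" and Y: "Y \<in> VF"
begin

lemma nab_coef_S: "k \<in> J \<Longrightarrow> (\<lambda>p. X p (co Y k) + (\<Sum>i\<in>J. \<Sum>j\<in>J. co X i p * co Y j p * G i j k)) \<in> S"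
proof (rule S_add)
  show "k \<in> J \<Longrightarrow> (\<lambda>p. X p (co Y k)) \<in> S" by (rule VF_S[OF X co_S[OF Y]])
  show "(\<lambda>p. \<Sum>i\<in>J. \<Sum>j\<in>J. co X i p * co Y j p * G i j k) \<in> S"
    by (rule S_sum, rule S_sum, rule S_mult[OF S_mult[OF co_S[OF X] co_S[OF Y]] S_const])
qed

lemma nab_VF: "nab X Y \<in> VF"
  unfolding nab_def by (rule comb_VF[OF nab_coef_S])

lemma co_nab: "k \<in> J \<Longrightarrow> co (nab X Y) k p = X p (co Y k) + (\<Sum>i\<in>J. \<Sum>j\<in>J. co X i p * co Y j p * G i j k)"
  unfolding nab_def by (rule co_comb[OF nab_coef_S])

lemma VF_vdiff: "vdiff X Y \<in> VF"
proof -
  have "vdiff X Y = vadd X (vmult (\<lambda>_. - 1) Y)" by (simp add: vdiff_def vadd_def vmult_def)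
  then show ?thesis using VF_vadd[OF X VF_vmult[OF S_const Y]] by simp
qed

lemma co_vdiff: "j \<in> J \<Longrightarrow> co (vdiff X Y) j p = co X j p - co Y j p"
proof -
  assume j: "j \<in> J"
  have "vdiff X Y = vadd X (vmult (\<lambda>_. - 1) Y)" by (simp add: vdiff_def vadd_def vmult_def)
  then show ?thesis using co_vadd[OF X VF_vmult[OF S_const Y] j] co_vmult[OF S_const Y j] by simp
qed

end

text \<open>Two identities of \<open>G\<close> carry the proof, both from antisymmetry of
  \<open>c\<close>: \<open>G i j k - G j i k = c i j k\<close> gives freedom from torsion, and
  \<open>G i j k + G i k j = 0\<close> gives compatibility with the metric. The terms with
  derivatives of coefficients are handled by the Leibniz rule.\<close>

lemma levi_civita: "levi_civita M metric nab"
  unfolding levi_civita_def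
proof (intro conjI ballI)
  fix X Y assume "X \<in> VF" "Y \<in> VF"
  then show "nab X Y \<in> VF" by (rule nab_VF)
next
  fix X Y Z assume X: "X \<in> VF" and Y: "Y \<in> VF" and Z: "Z \<in> VF"
  note v = VF_vadd[OF X Y] VF_vadd[OF Y Z] nab_VF[OF X Z] nab_VF[OF Y Z] nab_VF[OF X Y] nab_VF[OF Y X]
  show "nab (vadd X Y) Z = vadd (nab X Z) (nab Y Z)"
  proof (rule VF_eqI)
    fix j p assume j: "j \<in> J"
    show "co (nab (vadd X Y) Z) j p = co (vadd (nab X Z) (nab Y Z)) j p"
      by (simp add: co_nab X Y Z v j co_vadd)
         (simp add: vadd_def distrib_right sum.distrib)
  qed (auto intro: nab_VF VF_vadd X Y Z)
  show "nab X (vadd Y Z) = vadd (nab X Y) (nab X Z)"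
  proof (rule VF_eqI)
    fix j p assume j: "j \<in> J"
    have "co (vadd Y Z) j = (\<lambda>p. co Y j p + co Z j p)" using co_vadd[OF Y Z j] by auto
    then show "co (nab X (vadd Y Z)) j p = co (vadd (nab X Y) (nab X Z)) j p"
      by (simp add: co_nab X Y Z v j co_vadd T_D(1)[OF VF_T[OF X] co_S[OF Y j] co_S[OF Z j]]
         distrib_left distrib_right sum.distrib)
  qed (auto intro: nab_VF VF_vadd X Y Z)
  show "vdiff (nab X Y) (nab Y X) = vbracket X Y"
  proof (rule VF_eqI)
    fix k p assume k: "k \<in> J"
    have "(\<Sum>i\<in>J. \<Sum>j\<in>J. co X i p * co Y j p * G i j k) - (\<Sum>i\<in>J. \<Sum>j\<in>J. co Y i p * co X j p * G i j k)
      = (\<Sum>i\<in>J. \<Sum>j\<in>J. co X i p * co Y j p * G i j k) - (\<Sum>i\<in>J. \<Sum>j\<in>J. co Y j p * co X i p * G j i k)"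
      by (subst (2) sum.swap) simp
    also have "\<dots> = (\<Sum>i\<in>J. \<Sum>j\<in>J. co X i p * co Y j p * (G i j k - G j i k))"
      by (simp add: right_diff_distrib sum_subtractf mult_ac)
    also have "\<dots> = (\<Sum>i\<in>J. \<Sum>j\<in>J. co X i p * co Y j p * c i j k)"
    proof (intro sum.cong refl)
      fix i j assume ij: "i \<in> J" "j \<in> J"
      have "G i j k - G j i k = c i j k"
        unfolding G_def using c_antisym[OF ij k] c_antisym[OF ij(2) k ij(1)] c_antisym[OF k ij] by (simp add: field_simps)
      then show "co X i p * co Y j p * (G i j k - G j i k) = co X i p * co Y j p * c i j k" by simp
    qed
    finally show "co (vdiff (nab X Y) (nab Y X)) k p = co (vbracket X Y) k p"
      by (simp add: co_vdiff v k co_nab X Y co_vbracket)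
  qed (auto intro: nab_VF VF_vdiff VF_vbracket X Y Z)
  show "vapp X (metric_on metric Y Z) = (\<lambda>p. metric_on metric (nab X Y) Z p + metric_on metric Y (nab X Z) p)"
  proof
    fix p
    have "X p (\<lambda>q. \<Sum>j\<in>J. co Y j q * co Z j q) = (\<Sum>j\<in>J. X p (\<lambda>q. co Y j q * co Z j q))"
      by (rule T_sum[OF VF_T[OF X]]) (intro S_mult co_S Y Z)
    also have "\<dots> = (\<Sum>j\<in>J. co Y j p * X p (co Z j) + co Z j p * X p (co Y j))"
      using T_D(3)[OF VF_T[OF X] co_S[OF Y] co_S[OF Z]] by (intro sum.cong) auto
    finally have 1: "X p (\<lambda>q. \<Sum>j\<in>J. co Y j q * co Z j q) = (\<Sum>j\<in>J. co Y j p * X p (co Z j) + co Z j p * X p (co Y j))" .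
    have "(\<Sum>k\<in>J. (\<Sum>i\<in>J. \<Sum>j\<in>J. co X i p * co Y j p * G i j k) * co Z k p + co Y k p * (\<Sum>i\<in>J. \<Sum>j\<in>J. co X i p * co Z j p * G i j k))
      = (\<Sum>k\<in>J. \<Sum>j\<in>J. (\<Sum>i\<in>J. co X i p * G i j k) * co Y j p * co Z k p + (\<Sum>i\<in>J. co X i p * G i j k) * co Y k p * co Z j p)"
      apply (rule sum.cong[OF refl])
      apply (subst sum.swap, subst (2) sum.swap)
      by (simp add: sum.distrib sum_distrib_left sum_distrib_right mult_ac)
    also have "\<dots> = (\<Sum>k\<in>J. \<Sum>j\<in>J. (\<Sum>i\<in>J. co X i p * G i j k) * co Y j p * co Z k p)
       + (\<Sum>k\<in>J. \<Sum>j\<in>J. (\<Sum>i\<in>J. co X i p * G i k j) * co Y j p * co Z k p)"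
      unfolding sum.distrib by (subst (3) sum.swap) (rule refl)
    also have "\<dots> = (\<Sum>k\<in>J. \<Sum>j\<in>J. (\<Sum>i\<in>J. co X i p * (G i j k + G i k j)) * co Y j p * co Z k p)"
      by (simp add: distrib_left distrib_right sum.distrib)
    also have "\<dots> = (\<Sum>k\<in>J. \<Sum>j\<in>J. (\<Sum>i\<in>J. co X i p * 0) * co Y j p * co Z k p)"
    proof -
      have "G i j k + G i k j = 0" if ijk: "i \<in> J" "j \<in> J" "k \<in> J" for i j k
        unfolding G_def using c_antisym[OF ijk] c_antisym[OF ijk(2,3,1)] c_antisym[OF ijk(3,1,2)] by (simp add: field_simps)
      then show ?thesis by simp
    qed
    finally have 2: "(\<Sum>k\<in>J. (\<Sum>i\<in>J. \<Sum>j\<in>J. co X i p * co Y j p * G i j k) * co Z k p + co Y k p * (\<Sum>i\<in>J. \<Sum>j\<in>J. co X i p * co Z j p * G i j k)) = 0"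
      by simp
    have "metric_on metric (nab X Y) Z p + metric_on metric Y (nab X Z) p = (\<Sum>k\<in>J. co Y k p * X p (co Z k) + co Z k p * X p (co Y k))
      + (\<Sum>k\<in>J. (\<Sum>i\<in>J. \<Sum>j\<in>J. co X i p * co Y j p * G i j k) * co Z k p + co Y k p * (\<Sum>i\<in>J. \<Sum>j\<in>J. co X i p * co Z j p * G i j k))"
      unfolding metric_on_co by (simp add: co_nab X Y Z distrib_left distrib_right sum.distrib mult_ac)
    with 1 2 show "vapp X (metric_on metric Y Z) p = metric_on metric (nab X Y) Z p + metric_on metric Y (nab X Z) p"
      by (simp add: vapp_def metric_on_co)
  qed
  fix f assume f: "f \<in> S"
  show "nab (vmult f X) Y = vmult f (nab X Y)"
  proof (rule VF_eqI)
    fix j p assume j: "j \<in> J"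
    show "co (nab (vmult f X) Y) j p = co (vmult f (nab X Y)) j p"
      by (simp add: co_nab X Y v j co_vmult f VF_vmult)
         (simp add: vmult_def distrib_left sum_distrib_left mult.assoc)
  qed (auto intro: nab_VF VF_vmult X Y f)
  show "nab X (vmult f Y) = vadd (vmult (vapp X f) Y) (vmult f (nab X Y))"
  proof (rule VF_eqI)
    fix j p assume j: "j \<in> J"
    have Xf: "vapp X f \<in> S" using VF_S[OF X f] by (simp add: vapp_def)
    have "co (vmult f Y) j = (\<lambda>p. f p * co Y j p)" using co_vmult[OF f Y j] by auto
    then show "co (nab X (vmult f Y)) j p = co (vadd (vmult (vapp X f) Y) (vmult f (nab X Y))) j p"
      by (simp add: co_nab X Y v j co_vmult co_vadd f Xf VF_vmult T_D(3)[OF VF_T[OF X] f co_S[OF Y j]])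
         (simp add: vapp_def distrib_left sum_distrib_left mult_ac)
  qed (use VF_S[OF X f] in \<open>auto intro!: nab_VF VF_vmult VF_vadd X Y f simp: vapp_def\<close>)
qed

end

section \<open>Curvature, Ricci tensor and the soliton equation in the frame\<close>

lemma sum_4_reorder:
  fixes t :: "'a \<Rightarrow> 'a \<Rightarrow> 'a \<Rightarrow> 'a \<Rightarrow> real"
  shows "(\<Sum>m\<in>A. \<Sum>n\<in>A. \<Sum>b\<in>A. \<Sum>a\<in>A. t a b n m) = (\<Sum>a\<in>A. \<Sum>b\<in>A. \<Sum>n\<in>A. \<Sum>m\<in>A. t a b n m)"
proof -
  have "(\<Sum>m\<in>A. \<Sum>n\<in>A. \<Sum>b\<in>A. \<Sum>a\<in>A. t a b n m) = (\<Sum>m\<in>A. \<Sum>n\<in>A. \<Sum>a\<in>A. \<Sum>b\<in>A. t a b n m)"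
    by (rule sum.cong[OF refl], rule sum.cong[OF refl], rule sum.swap)
  also have "\<dots> = (\<Sum>m\<in>A. \<Sum>a\<in>A. \<Sum>n\<in>A. \<Sum>b\<in>A. t a b n m)"
    by (rule sum.cong[OF refl], rule sum.swap)
  also have "\<dots> = (\<Sum>a\<in>A. \<Sum>m\<in>A. \<Sum>n\<in>A. \<Sum>b\<in>A. t a b n m)" by (rule sum.swap)
  also have "\<dots> = (\<Sum>a\<in>A. \<Sum>m\<in>A. \<Sum>b\<in>A. \<Sum>n\<in>A. t a b n m)"
    by (rule sum.cong[OF refl], rule sum.cong[OF refl], rule sum.swap)
  also have "\<dots> = (\<Sum>a\<in>A. \<Sum>b\<in>A. \<Sum>m\<in>A. \<Sum>n\<in>A. t a b n m)"
    by (rule sum.cong[OF refl], rule sum.swap)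
  also have "\<dots> = (\<Sum>a\<in>A. \<Sum>b\<in>A. \<Sum>n\<in>A. \<Sum>m\<in>A. t a b n m)"
    by (rule sum.cong[OF refl], rule sum.cong[OF refl], rule sum.swap)
  finally show ?thesis .
qed

context const_frame
begin

text \<open>The matrix of connection one-forms of the frame, evaluated on \<open>X\<close>.\<close>

definition conn :: "'a vfield \<Rightarrow> 'c \<Rightarrow> 'c \<Rightarrow> 'a \<Rightarrow> real" where
  "conn X m l p = (\<Sum>i\<in>J. co X i p * G i m l)"

lemma conn_S: "X \<in> VF \<Longrightarrow> conn X m l \<in> S"
  unfolding conn_def by (intro S_sum S_mult co_S S_const)

lemma co_nab': "X \<in> VF \<Longrightarrow> Z \<in> VF \<Longrightarrow> l \<in> J \<Longrightarrow> co (nab X Z) l p = X p (co Z l) + (\<Sum>m\<in>J. co Z m p * conn X m l p)"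
  unfolding conn_def sum_distrib_left by (subst sum.swap) (simp add: co_nab mult_ac)

lemma X_conn: "X \<in> VF \<Longrightarrow> Y \<in> VF \<Longrightarrow> X p (conn Y m l) = (\<Sum>i\<in>J. X p (co Y i) * G i m l)"
proof -
  assume X: "X \<in> VF" and Y: "Y \<in> VF"
  have "X p (\<lambda>q. \<Sum>i\<in>J. G i m l * co Y i q) = (\<Sum>i\<in>J. X p (\<lambda>q. G i m l * co Y i q))"
    by (rule T_sum[OF VF_T[OF X]]) (rule S_cmult[OF co_S[OF Y]])
  also have "\<dots> = (\<Sum>i\<in>J. G i m l * X p (co Y i))"
    using T_D(2)[OF VF_T[OF X] co_S[OF Y]] by (intro sum.cong) auto
  finally show ?thesis unfolding conn_def[abs_def] by (simp add: mult.commute)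
qed

definition Riem :: "'c \<Rightarrow> 'c \<Rightarrow> 'c \<Rightarrow> 'c \<Rightarrow> real" where
  "Riem a b n l = (\<Sum>m\<in>J. G b n m * G a m l) - (\<Sum>m\<in>J. G a n m * G b m l) - (\<Sum>m\<in>J. c a b m * G m n l)"

text \<open>Tensoriality in the frame: second derivatives of the coefficients of \<open>Z\<close>
  cancel against the bracket term, first derivatives cancel between the two iterated covariant
  derivatives, and the derivatives of the connection matrix are those in the connection along the
  bracket.\<close>

lemma co_curvature:
  assumes X: "X \<in> VF" and Y: "Y \<in> VF" and Z: "Z \<in> VF" and l: "l \<in> J"
  shows "co (curvature nab X Y Z) l p = (\<Sum>a\<in>J. \<Sum>b\<in>J. \<Sum>n\<in>J. co X a p * co Y b p * co Z n p * Riem a b n l)"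
proof -
  have *: "co (nab X (nab Y Z)) l p = X p (\<lambda>q. Y q (co Z l)) + (\<Sum>m\<in>J. co Z m p * X p (conn Y m l)) + (\<Sum>m\<in>J. conn Y m l p * X p (co Z m))
     + (\<Sum>m\<in>J. Y p (co Z m) * conn X m l p) + (\<Sum>m\<in>J. (\<Sum>n\<in>J. co Z n p * conn Y n m p) * conn X m l p)"
    if X: "X \<in> VF" and Y: "Y \<in> VF" for X Y
  proof -
    have XT: "X p \<in> T p" by (rule VF_T[OF X])
    have "co (nab Y Z) l = (\<lambda>q. Y q (co Z l) + (\<Sum>m\<in>J. co Z m q * conn Y m l q))"
      using co_nab'[OF Y Z l] by auto
    then have "X p (co (nab Y Z) l) = X p (\<lambda>q. Y q (co Z l) + (\<Sum>m\<in>J. co Z m q * conn Y m l q))" by simp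
    also have "\<dots> = X p (\<lambda>q. Y q (co Z l)) + X p (\<lambda>q. \<Sum>m\<in>J. co Z m q * conn Y m l q)"
      by (rule T_D(1)[OF XT VF_S[OF Y co_S[OF Z l]]]) (rule S_sum, rule S_mult[OF co_S[OF Z] conn_S[OF Y]])
    also have "X p (\<lambda>q. \<Sum>m\<in>J. co Z m q * conn Y m l q) = (\<Sum>m\<in>J. X p (\<lambda>q. co Z m q * conn Y m l q))"
      by (rule T_sum[OF XT]) (rule S_mult[OF co_S[OF Z] conn_S[OF Y]])
    also have "\<dots> = (\<Sum>m\<in>J. co Z m p * X p (conn Y m l) + conn Y m l p * X p (co Z m))"
      using T_D(3)[OF XT co_S[OF Z] conn_S[OF Y]] by (intro sum.cong) auto
    finally have 1: "X p (co (nab Y Z) l) = X p (\<lambda>q. Y q (co Z l)) + (\<Sum>m\<in>J. co Z m p * X p (conn Y m l) + conn Y m l p * X p (co Z m))" .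
    show ?thesis unfolding co_nab'[OF X nab_VF[OF Y Z] l] 1
      by (simp add: co_nab'[OF Y Z] distrib_right sum.distrib)
  qed
  have B: "vbracket X Y p (co Z l) = X p (\<lambda>q. Y q (co Z l)) - Y p (\<lambda>q. X q (co Z l))"
    by (simp add: vbracket_def vapp_def)
  have 2: "(\<Sum>m\<in>J. co Z m p * conn (vbracket X Y) m l p) = (\<Sum>m\<in>J. co Z m p * X p (conn Y m l)) - (\<Sum>m\<in>J. co Z m p * Y p (conn X m l))
      + (\<Sum>n\<in>J. co Z n p * (\<Sum>m\<in>J. (\<Sum>a\<in>J. \<Sum>b\<in>J. co X a p * co Y b p * c a b m) * G m n l))"
    unfolding X_conn[OF X Y] X_conn[OF Y X] unfolding conn_def
    by (simp add: co_vbracket X Y left_diff_distrib distrib_right sum.distrib sum_subtractf right_diff_distrib distrib_left)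
  have "co (curvature nab X Y Z) l p = co (nab X (nab Y Z)) l p - co (nab Y (nab X Z)) l p - co (nab (vbracket X Y) Z) l p"
    unfolding curvature_def using X Y Z l by (simp add: co_vdiff VF_vdiff nab_VF VF_vbracket)
  also have "\<dots> = (\<Sum>m\<in>J. (\<Sum>n\<in>J. co Z n p * conn Y n m p) * conn X m l p) - (\<Sum>m\<in>J. (\<Sum>n\<in>J. co Z n p * conn X n m p) * conn Y m l p)
     - (\<Sum>n\<in>J. co Z n p * (\<Sum>m\<in>J. (\<Sum>a\<in>J. \<Sum>b\<in>J. co X a p * co Y b p * c a b m) * G m n l))"
    unfolding *[OF X Y] *[OF Y X] co_nab'[OF VF_vbracket[OF X Y] Z l] B 2
    by (simp add: mult.commute)
  also have "(\<Sum>m\<in>J. (\<Sum>n\<in>J. co Z n p * conn Y n m p) * conn X m l p)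
     = (\<Sum>a\<in>J. \<Sum>b\<in>J. \<Sum>n\<in>J. \<Sum>m\<in>J. co X a p * co Y b p * co Z n p * (G b n m * G a m l))"
    by (rule trans[OF _ sum_4_reorder]) (simp add: conn_def sum_distrib_left sum_distrib_right mult_ac)
  also have "(\<Sum>m\<in>J. (\<Sum>n\<in>J. co Z n p * conn X n m p) * conn Y m l p)
     = (\<Sum>a\<in>J. \<Sum>b\<in>J. \<Sum>n\<in>J. \<Sum>m\<in>J. co X a p * co Y b p * co Z n p * (G a n m * G b m l))"
  proof -
    have "(\<Sum>m\<in>J. (\<Sum>n\<in>J. co Z n p * conn X n m p) * conn Y m l p)
       = (\<Sum>m\<in>J. \<Sum>n\<in>J. \<Sum>a\<in>J. \<Sum>b\<in>J. co X a p * co Y b p * co Z n p * (G a n m * G b m l))"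
      by (simp add: conn_def sum_distrib_left sum_distrib_right mult_ac)
    also have "\<dots> = (\<Sum>m\<in>J. \<Sum>n\<in>J. \<Sum>b\<in>J. \<Sum>a\<in>J. co X a p * co Y b p * co Z n p * (G a n m * G b m l))"
      by (rule sum.cong[OF refl], rule sum.cong[OF refl], rule sum.swap)
    finally show ?thesis by (rule trans[OF _ sum_4_reorder])
  qed
  also have "(\<Sum>n\<in>J. co Z n p * (\<Sum>m\<in>J. (\<Sum>a\<in>J. \<Sum>b\<in>J. co X a p * co Y b p * c a b m) * G m n l))
     = (\<Sum>a\<in>J. \<Sum>b\<in>J. \<Sum>n\<in>J. \<Sum>m\<in>J. co X a p * co Y b p * co Z n p * (c a b m * G m n l))"
  proof -
    have "(\<Sum>n\<in>J. co Z n p * (\<Sum>m\<in>J. (\<Sum>a\<in>J. \<Sum>b\<in>J. co X a p * co Y b p * c a b m) * G m n l))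
       = (\<Sum>m\<in>J. \<Sum>n\<in>J. \<Sum>a\<in>J. \<Sum>b\<in>J. co X a p * co Y b p * co Z n p * (c a b m * G m n l))"
      by (subst sum.swap) (simp add: sum_distrib_left sum_distrib_right mult_ac)
    also have "\<dots> = (\<Sum>m\<in>J. \<Sum>n\<in>J. \<Sum>b\<in>J. \<Sum>a\<in>J. co X a p * co Y b p * co Z n p * (c a b m * G m n l))"
      by (rule sum.cong[OF refl], rule sum.cong[OF refl], rule sum.swap)
    finally show ?thesis by (rule trans[OF _ sum_4_reorder])
  qed
  finally show ?thesis
    by (simp add: Riem_def right_diff_distrib sum_subtractf sum_distrib_left)
qed

text \<open>Makes the choice in \<open>ricci\<close> meaningful: without any orthonormal frame at
  \<open>p\<close> the \<open>SOME\<close> would say nothing.\<close>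

lemma frame_exists: "\<exists>F. orthonormal_frame_at M metric p F"
proof -
  obtain f where f: "bij_betw f {..<card J} J"
    using ex_bij_betw_nat_finite[OF finJ] by (auto simp: atLeast0LessThan)
  have fJ: "i < card J \<Longrightarrow> f i \<in> J" for i using f by (auto simp: bij_betw_def)
  have "orthonormal_frame_at M metric p (card J, \<lambda>i. E (f i))"
    unfolding orthonormal_frame_at_def split
  proof (intro conjI allI impI ballI)
    fix i assume i: "i < card J"
    show "E (f i) \<in> VF" by (rule E_vf[OF fJ[OF i]])
    fix j assume j: "j < card J"
    have "metric p (E (f i) p) (E (f j) p) = (\<Sum>k\<in>J. co (E (f i)) k p * co (E (f j)) k p)"
      by (simp add: metric_def co_def)
    also have "\<dots> = (\<Sum>k\<in>J. if f i = k then (if f j = k then 1 else 0) else 0)"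
      using i j fJ by (intro sum.cong) (auto simp: co_E)
    also have "\<dots> = (if i = j then 1 else 0)"
      using finJ fJ i j f by (auto simp: bij_betw_def inj_on_def)
    finally show "metric p (E (f i) p) (E (f j) p) = (if i = j then 1 else 0)" .
  next
    fix v assume v: "v \<in> T p"
    have "v g = (\<Sum>i<card J. tc p v (f i) * E (f i) p g)" for g
      unfolding tc[OF v, of g] by (rule sum.reindex_bij_betw[OF f, symmetric])
    then show "\<exists>k. v = (\<lambda>g. \<Sum>i<card J. k i * E (f i) p g)"
      by (intro exI[of _ "\<lambda>i. tc p v (f i)"]) auto
  qed
  then show ?thesis by blast
qed

definition Ric :: "'c \<Rightarrow> 'c \<Rightarrow> real" where
  "Ric b n = (\<Sum>a\<in>J. Riem a b n a)"

text \<open>Expand \<open>E a\<close> in the frame \<open>F\<close>; orthonormality identifies the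
  coefficients as \<open>co (F i) a p\<close>. This relation makes the trace in \<open>ricci\<close>
  the same for whichever frame the choice operator returns.\<close>

lemma frame_completeness:
  assumes F: "orthonormal_frame_at M metric p (N, F)" and a: "a \<in> J" and l: "l \<in> J"
  shows "(\<Sum>i<N. co (F i) a p * co (F i) l p) = (if a = l then 1 else 0)"
proof -
  have FV: "\<And>i. i < N \<Longrightarrow> F i \<in> VF" and
    on: "\<And>i j. i < N \<Longrightarrow> j < N \<Longrightarrow> metric p (F i p) (F j p) = (if i = j then 1 else 0)" and
    sp: "\<And>v. v \<in> T p \<Longrightarrow> \<exists>k. v = (\<lambda>f. \<Sum>i<N. k i * F i p f)"
    using F unfolding orthonormal_frame_at_def by auto
  obtain k where k: "E a p = (\<lambda>f. \<Sum>i<N. k i * F i p f)" using sp[OF VF_T[OF E_vf[OF a]]] by blast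
  have e: "co (E a) m p = (\<Sum>i<N. k i * co (F i) m p)" if "m \<in> J" for m
    unfolding co_def k by (rule tc_sum[OF VF_T[OF FV] that]) auto
  have ki: "k i = co (F i) a p" if i: "i < N" for i
  proof -
    have "co (F i) a p = (\<Sum>m\<in>J. if a = m then co (F i) m p else 0)" using a finJ by simp
    also have "\<dots> = (\<Sum>m\<in>J. co (E a) m p * co (F i) m p)" by (rule sum.cong) (auto simp: co_E a)
    also have "\<dots> = (\<Sum>m\<in>J. \<Sum>j<N. k j * (co (F j) m p * co (F i) m p))"
      by (rule sum.cong[OF refl]) (simp add: e sum_distrib_right mult.assoc)
    also have "\<dots> = (\<Sum>j<N. k j * metric p (F j p) (F i p))"
      by (subst sum.swap) (simp add: metric_def co_def sum_distrib_left)
    also have "\<dots> = (\<Sum>j<N. if j = i then k j else 0)" using on i by (intro sum.cong) auto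
    also have "\<dots> = k i" using i by simp
    finally show ?thesis by simp
  qed
  have "(\<Sum>i<N. co (F i) a p * co (F i) l p) = (\<Sum>i<N. k i * co (F i) l p)" using ki by simp
  also have "\<dots> = co (E a) l p" using e[OF l] by simp
  finally show ?thesis using co_E[OF a l] by simp
qed

lemma ricci_eq:
  assumes Y: "Y \<in> VF" and Z: "Z \<in> VF"
  shows "ricci M metric nab Y Z p = (\<Sum>b\<in>J. \<Sum>n\<in>J. co Y b p * co Z n p * Ric b n)"
proof -
  obtain N F where NF: "(SOME F. orthonormal_frame_at M metric p F) = (N, F)" by (metis surj_pair)
  have F: "orthonormal_frame_at M metric p (N, F)"
    using someI_ex[OF frame_exists[of p]] NF by simp
  have FV: "\<And>i. i < N \<Longrightarrow> F i \<in> VF" using F unfolding orthonormal_frame_at_def by auto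
  have "ricci M metric nab Y Z p = (\<Sum>i<N. metric_on metric (curvature nab (F i) Y Z) (F i) p)"
    unfolding ricci_def NF by simp
  also have "\<dots> = (\<Sum>i<N. \<Sum>l\<in>J. (\<Sum>a\<in>J. \<Sum>b\<in>J. \<Sum>n\<in>J. co (F i) a p * co Y b p * co Z n p * Riem a b n l) * co (F i) l p)"
    unfolding metric_on_co by (intro sum.cong refl) (simp add: co_curvature FV Y Z)
  also have "\<dots> = (\<Sum>i<N. \<Sum>l\<in>J. \<Sum>a\<in>J. (co (F i) a p * co (F i) l p) * (\<Sum>b\<in>J. \<Sum>n\<in>J. co Y b p * co Z n p * Riem a b n l))"
    by (simp add: sum_distrib_left sum_distrib_right mult_ac)
  also have "\<dots> = (\<Sum>l\<in>J. \<Sum>i<N. \<Sum>a\<in>J. (co (F i) a p * co (F i) l p) * (\<Sum>b\<in>J. \<Sum>n\<in>J. co Y b p * co Z n p * Riem a b n l))"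
    by (rule sum.swap)
  also have "\<dots> = (\<Sum>l\<in>J. \<Sum>a\<in>J. \<Sum>i<N. (co (F i) a p * co (F i) l p) * (\<Sum>b\<in>J. \<Sum>n\<in>J. co Y b p * co Z n p * Riem a b n l))"
    by (rule sum.cong[OF refl], rule sum.swap)
  also have "\<dots> = (\<Sum>l\<in>J. \<Sum>a\<in>J. (if a = l then \<Sum>b\<in>J. \<Sum>n\<in>J. co Y b p * co Z n p * Riem a b n l else 0))"
    unfolding sum_distrib_right[symmetric]
    by (intro sum.cong refl) (simp add: frame_completeness[OF F])
  also have "\<dots> = (\<Sum>l\<in>J. \<Sum>b\<in>J. \<Sum>n\<in>J. co Y b p * co Z n p * Riem l b n l)" using finJ by simp
  also have "\<dots> = (\<Sum>b\<in>J. \<Sum>l\<in>J. \<Sum>n\<in>J. co Y b p * co Z n p * Riem l b n l)" by (rule sum.swap)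
  also have "\<dots> = (\<Sum>b\<in>J. \<Sum>n\<in>J. \<Sum>l\<in>J. co Y b p * co Z n p * Riem l b n l)"
    by (rule sum.cong[OF refl], rule sum.swap)
  finally show ?thesis by (simp add: Ric_def sum_distrib_left)
qed

text \<open>For nilpotent structure constants the Killing form and the traces of the adjoint
  representation vanish.\<close>

lemma Ric_nilpotent:
  fixes rk :: "'c \<Rightarrow> nat"
  assumes rk: "\<And>i j k. i \<in> J \<Longrightarrow> j \<in> J \<Longrightarrow> k \<in> J \<Longrightarrow> c i j k \<noteq> 0 \<Longrightarrow> rk j < rk k"
    and b: "b \<in> J" and n: "n \<in> J"
  shows "Ric b n = (\<Sum>i\<in>J. \<Sum>m\<in>J. c i m b * c i m n) / 4 - (\<Sum>i\<in>J. \<Sum>m\<in>J. c b i m * c n i m) / 2"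
proof -
  have z1: "c i k k = 0" if "i \<in> J" "k \<in> J" for i k using rk[of i k k] that by force
  have z2: "c k i k = 0" if "i \<in> J" "k \<in> J" for i k using z1[OF that] c_antisym[of k i k] that by simp
  have z3: "c k k i = 0" if "i \<in> J" "k \<in> J" for i k using c_antisym[of k k i] that by simp
  \<comment> \<open>Each of the three structure constants in it repeats an index, which strict
    growth of \<open>rk\<close> and antisymmetry exclude. So the first sum of \<open>Riem\<close>
    drops out of the trace.\<close>
  have tr: "G a m a = 0" if "a \<in> J" "m \<in> J" for a m
    unfolding G_def using z1 z2 z3 that by simp
  \<comment> \<open>These are the terms of the Killing form; a nonzero one would require
    \<open>rk a < rk m\<close> and \<open>rk m < rk a\<close>.\<close>
  have kill: "c b a m * c n m a = 0" if "a \<in> J" "m \<in> J" for a m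
    using rk[of b a m] rk[of n m a] b n that by fastforce
  \<comment> \<open>What separates the summand from the desired one, up to Killing terms. It is
    antisymmetric in \<open>a\<close> and \<open>m\<close>, so it disappears in the double sum over
    both.\<close>
  define r where "r a m = (c n a m + c n m a) * (c b m a - c b a m + c a m b) / 4
      + c a m n * (c b m a + c b a m) / 4" for a m
  have *: "- (G a n m * G b m a) - c a b m * G m n a = c a m b * c a m n / 4 - c b a m * c n a m / 2 + r a m"
    if am: "a \<in> J" "m \<in> J" for a m
  proof -
    have "c a n m = - c n a m" "c m a n = - c a m n" "c m a b = - c a m b" "c a b m = - c b a m" "c m n a = - c n m a"
      by (rule c_antisym; fact am b n)+
    then have e: "G a n m = (- c n a m - c n m a - c a m n) / 2" "G b m a = (c b m a + c a m b - c b a m) / 2"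
      "G m n a = (- c n m a - c n a m + c a m n) / 2" "c a b m = - c b a m"
      unfolding G_def by simp_all
    show ?thesis unfolding e r_def using kill[OF am] by (simp add: field_simps)
  qed
  have "(\<Sum>a\<in>J. \<Sum>m\<in>J. r a m) = 0"
  proof (rule sum_antisym_eq_0)
    fix a m assume am: "a \<in> J" "m \<in> J"
    have "c m a b = - c a m b" "c m a n = - c a m n" by (rule c_antisym; fact am b n)+
    then show "r a m = - r m a" unfolding r_def by (simp add: field_simps)
  qed
  moreover have "Ric b n = (\<Sum>a\<in>J. \<Sum>m\<in>J. - (G a n m * G b m a) - c a b m * G m n a)"
    unfolding Ric_def Riem_def by (intro sum.cong refl) (simp add: tr sum_negf sum_subtractf)
  moreover have "\<dots> = (\<Sum>a\<in>J. \<Sum>m\<in>J. c a m b * c a m n / 4 - c b a m * c n a m / 2 + r a m)"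
    by (intro sum.cong refl) (rule *)
  ultimately show ?thesis by (simp add: sum.distrib sum_subtractf sum_divide_distrib)
qed

text \<open>The Lie derivative of the metric counts the bracket with \<open>X\<close> once in each
  argument. Hence the factor 1/2 in the bracket and the full \<open>d\<close> in the Ricci
  tensor.\<close>

lemma soliton:
  assumes Ric: "\<And>b n. b \<in> J \<Longrightarrow> n \<in> J \<Longrightarrow> Ric b n = (if b = n then lam + d b else 0)"
    and X: "X \<in> VF" and XE: "\<And>j p f. j \<in> J \<Longrightarrow> vbracket X (E j) p f = - (d j / 2) * E j p f"
  shows "ricci_soliton M metric"
proof -
  have "ricci M metric nab Y Z p = lam * metric_on metric Y Z p + lie_derivative_metric metric X Y Z p"
    if Y: "Y \<in> VF" and Z: "Z \<in> VF" for Y Z p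
  proof -
    have br: "co (vbracket X Y) j p = X p (co Y j) - d j / 2 * co Y j p" if Y: "Y \<in> VF" and j: "j \<in> J" for Y j
    proof (rule co_unique[OF VF_vbracket[OF X Y] _ j])
      fix f assume "f \<in> S"
      then show "vbracket X Y p f = (\<Sum>j\<in>J. (X p (co Y j) - d j / 2 * co Y j p) * E j p f)"
        unfolding vbracket_expand[OF X Y \<open>f \<in> S\<close>] sum.distrib[symmetric]
        by (intro sum.cong refl) (simp add: XE algebra_simps)
    qed
    have XT: "X p \<in> T p" by (rule VF_T[OF X])
    have "X p (\<lambda>q. \<Sum>j\<in>J. co Y j q * co Z j q) = (\<Sum>j\<in>J. X p (\<lambda>q. co Y j q * co Z j q))"
      by (rule T_sum[OF XT]) (intro S_mult co_S Y Z)
    also have "\<dots> = (\<Sum>j\<in>J. co Y j p * X p (co Z j) + co Z j p * X p (co Y j))"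
      using T_D(3)[OF XT co_S[OF Y] co_S[OF Z]] by (intro sum.cong) auto
    finally have 1: "vapp X (metric_on metric Y Z) p = (\<Sum>j\<in>J. co Y j p * X p (co Z j) + co Z j p * X p (co Y j))"
      by (simp add: vapp_def metric_on_co)
    have "lie_derivative_metric metric X Y Z p = (\<Sum>j\<in>J. d j * co Y j p * co Z j p)"
      unfolding lie_derivative_metric_def 1 unfolding metric_on_co
      by (simp add: br Y Z sum_subtractf[symmetric] algebra_simps)
    moreover have "ricci M metric nab Y Z p = (\<Sum>b\<in>J. \<Sum>n\<in>J. if b = n then co Y b p * co Z n p * (lam + d b) else 0)"
      unfolding ricci_eq[OF Y Z] by (intro sum.cong refl) (simp add: Ric)
    then have "ricci M metric nab Y Z p = (\<Sum>b\<in>J. co Y b p * co Z b p * (lam + d b))" using finJ by simp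
    ultimately show ?thesis
      by (simp add: metric_on_co sum_distrib_left sum.distrib[symmetric] algebra_simps)
  qed
  then show ?thesis unfolding ricci_soliton_def using riemannian_metric levi_civita X by blast
qed

end

lemma continuous_on_open_vimageE:
  assumes "continuous_on K h" "open Z"
  obtains W where "open W" "W \<inter> K = h -` Z \<inter> K"
proof -
  have "\<exists>A. open A \<and> A \<inter> K = h -` Z \<inter> K"
    using continuous_on_open_invariant[THEN iffD1, rule_format, OF assms] .
  then show ?thesis using that by (elim exE conjE)
qed

section \<open>Gluing local functions over a simply connected space\<close>

text \<open>The pairs \<open>(N, F)\<close> in \<open>\<F>\<close> are functions on open sets that agree up to locally constant
  functions. A lift along \<open>h\<close> continues one of them along the map \<open>h\<close>.\<close>

locale local_functions =
  fixes \<F> :: "('g::topological_space set \<times> ('g \<Rightarrow> real)) set"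
  assumes F_open: "(N, F) \<in> \<F> \<Longrightarrow> open N"
    and F_cover: "\<exists>N F. (N, F) \<in> \<F> \<and> q \<in> N"
    and F_compat: "(N, F) \<in> \<F> \<Longrightarrow> (N', F') \<in> \<F> \<Longrightarrow> q \<in> N \<Longrightarrow> q \<in> N' \<Longrightarrow>
       \<exists>W. open W \<and> q \<in> W \<and> (\<forall>x\<in>W. F x - F' x = F q - F' q)"
begin

definition lift :: "'x::topological_space set \<Rightarrow> ('x \<Rightarrow> 'g) \<Rightarrow> ('x \<Rightarrow> real) \<Rightarrow> bool" where
  "lift K h l \<longleftrightarrow> (\<forall>x\<in>K. \<exists>N F W. (N, F) \<in> \<F> \<and> h x \<in> N \<and> open W \<and> x \<in> W \<and>
     (\<forall>y\<in>W \<inter> K. l y = F (h y) - F (h x) + l x))"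

lemma liftE:
  assumes "lift K h l" "x \<in> K"
  obtains N F W where "(N, F) \<in> \<F>" "h x \<in> N" "open W" "x \<in> W"
    "\<forall>y\<in>W \<inter> K. l y = F (h y) - F (h x) + l x"
  using bspec[OF assms(1)[unfolded lift_def] assms(2)] by (elim exE conjE) (rule that)

text \<open>Compatibility is pulled back along \<open>h\<close>: near \<open>h x\<close> the given
  function and the one recorded in the lift differ by a constant, which cancels in
  increments.\<close>

lemma lift_any:
  assumes l: "lift K h l" and h: "continuous_on K h" and x: "x \<in> K" and F: "(N, F) \<in> \<F>" "h x \<in> N"
  obtains W where "open W" "x \<in> W" "\<And>y. y \<in> W \<Longrightarrow> y \<in> K \<Longrightarrow> l y = F (h y) - F (h x) + l x"
proof -
  obtain N' F' W where W: "(N', F') \<in> \<F>" "h x \<in> N'" "open W" "x \<in> W"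
     "\<forall>y\<in>W \<inter> K. l y = F' (h y) - F' (h x) + l x" using liftE[OF l x] by metis
  obtain Z where Z: "open Z" "h x \<in> Z" "\<forall>z\<in>Z. F z - F' z = F (h x) - F' (h x)"
    using F_compat[OF F(1) W(1) F(2) W(2)] by blast
  obtain W' where W': "open W'" "W' \<inter> K = h -` Z \<inter> K" by (rule continuous_on_open_vimageE[OF h Z(1)])
  have "x \<in> W'" using W' x Z(2) by blast
  moreover have "l y = F (h y) - F (h x) + l x" if y: "y \<in> W \<inter> W'" "y \<in> K" for y
  proof -
    have "h y \<in> Z" using W'(2) y by blast
    then have "F (h y) - F' (h y) = F (h x) - F' (h x)" using Z by blast
    moreover have "l y = F' (h y) - F' (h x) + l x" using W y by blast
    ultimately show ?thesis by simp
  qed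
  ultimately show ?thesis using that[of "W \<inter> W'"] W W' by blast
qed

text \<open>Measured by one common local function, two lifts have the same increments near each
  point, so their difference is locally constant on a connected set.\<close>

lemma lift_diff_const:
  assumes l: "lift K h l" "lift K h l'" and h: "continuous_on K h" and K: "connected K"
  obtains c where "\<And>x. x \<in> K \<Longrightarrow> l' x = l x + c"
proof -
  have "(\<lambda>x. l' x - l x) constant_on K"
  proof (rule locally_constant_imp_constant[OF K])
    fix x assume x: "x \<in> K"
    obtain N F where F: "(N, F) \<in> \<F>" "h x \<in> N" using F_cover by blast
    obtain W where W: "open W" "x \<in> W" "\<And>y. y \<in> W \<Longrightarrow> y \<in> K \<Longrightarrow> l y = F (h y) - F (h x) + l x"
      using lift_any[OF l(1) h x F] by blast
    obtain W' where W': "open W'" "x \<in> W'" "\<And>y. y \<in> W' \<Longrightarrow> y \<in> K \<Longrightarrow> l' y = F (h y) - F (h x) + l' x"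
      using lift_any[OF l(2) h x F] by blast
    have "openin (top_of_set K) (K \<inter> (W \<inter> W'))" using W W' by (auto intro: openin_open_Int)
    moreover have "l' y - l y = l' x - l x" if "y \<in> K \<inter> (W \<inter> W')" for y
      using W(3)[of y] W'(3)[of y] that by simp
    ultimately show "\<exists>T. openin (top_of_set K) T \<and> x \<in> T \<and> (\<forall>y\<in>T. l' y - l y = l' x - l x)"
      using W W' x by (intro exI[of _ "K \<inter> (W \<inter> W')"]) blast
  qed
  then obtain c where "\<And>x. x \<in> K \<Longrightarrow> l' x - l x = c" unfolding constant_on_def by blast
  then show ?thesis using that[of c] by (metis add.commute diff_add_cancel)
qed

lemma lift_comp:
  assumes l: "lift K h l" and g: "continuous_on K' g" "g ` K' \<subseteq> K" and h': "\<And>x. x \<in> K' \<Longrightarrow> h' x = h (g x)"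
  shows "lift K' h' (\<lambda>x. l (g x))"
  unfolding lift_def
proof
  fix x assume x: "x \<in> K'"
  then have gx: "g x \<in> K" using g(2) by blast
  obtain N F W where W: "(N, F) \<in> \<F>" "h (g x) \<in> N" "open W" "g x \<in> W"
     "\<forall>y\<in>W \<inter> K. l y = F (h y) - F (h (g x)) + l (g x)" using liftE[OF l gx] by metis
  obtain W' where W': "open W'" "W' \<inter> K' = g -` W \<inter> K'" by (rule continuous_on_open_vimageE[OF g(1) W(3)])
  have "x \<in> W'" using W' x W(4) by blast
  moreover have "\<forall>y\<in>W' \<inter> K'. l (g y) = F (h' y) - F (h' x) + l (g x)"
  proof
    fix y assume y: "y \<in> W' \<inter> K'"
    then have "g y \<in> W \<inter> K" using W'(2) g(2) by blast
    then show "l (g y) = F (h' y) - F (h' x) + l (g x)" using W(5) h'[OF x] h'[of y] y by simp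
  qed
  ultimately show "\<exists>N F W. (N, F) \<in> \<F> \<and> h' x \<in> N \<and> open W \<and> x \<in> W \<and> (\<forall>y\<in>W \<inter> K'. l (g y) = F (h' y) - F (h' x) + l (g x))"
    using W(1,2) W'(1) h'[OF x] by metis
qed

lemma lift_subset: "lift K h l \<Longrightarrow> K' \<subseteq> K \<Longrightarrow> lift K' h l"
  using lift_comp[of K h l K' id h] by simp

text \<open>The zero function also lifts a constant map, and two lifts differ by a constant.\<close>

lemma lift_of_constant:
  assumes l: "lift K h l" and h: "\<And>x. x \<in> K \<Longrightarrow> h x = a" and K: "connected K" and xy: "x \<in> K" "y \<in> K"
  shows "l x = l y"
proof -
  have "lift K h (\<lambda>x. 0)"
    unfolding lift_def using F_cover h by (metis IntD2 UNIV_I add.right_neutral diff_self open_UNIV)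
  moreover have "continuous_on K h" using h continuous_on_cong continuous_on_const by metis
  ultimately obtain c where "\<And>x. x \<in> K \<Longrightarrow> l x = 0 + c" using lift_diff_const[OF _ l] K by metis
  then show ?thesis using xy by simp
qed

text \<open>On the connected overlap the lifts differ by one constant, and shifting one of them
  makes them agree. The pieces are closed, so a point outside one of them has a neighbourhood on
  which that piece imposes nothing.\<close>

lemma lift_glue:
  assumes l1: "lift K1 h l1" and l2: "lift K2 h l2" and h: "continuous_on (K1 \<union> K2) h"
    and cl: "closed K1" "closed K2" and con: "connected (K1 \<inter> K2)"
  obtains l where "lift (K1 \<union> K2) h l"
proof -
  have h12: "continuous_on K1 h" "continuous_on K2 h" "continuous_on (K1 \<inter> K2) h"
    using h by (auto intro: continuous_on_subset)
  obtain c where c: "\<And>x. x \<in> K1 \<inter> K2 \<Longrightarrow> l2 x = l1 x + c"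
    using lift_diff_const[OF lift_subset[OF l1] lift_subset[OF l2] h12(3) con] by blast
  define l where "l x = (if x \<in> K1 then l1 x else l2 x - c)" for x
  have lK2: "l x = l2 x - c" if "x \<in> K2" for x using c[of x] that by (auto simp: l_def)
  have "lift (K1 \<union> K2) h l"
    unfolding lift_def
  proof
    fix x assume x: "x \<in> K1 \<union> K2"
    obtain N F where F: "(N, F) \<in> \<F>" "h x \<in> N" using F_cover by blast
    have 1: "\<exists>W. open W \<and> x \<in> W \<and> (\<forall>y\<in>W \<inter> K1. l y = F (h y) - F (h x) + l x)"
    proof (cases "x \<in> K1")
      case True
      obtain W where W: "open W" "x \<in> W" "\<And>y. y \<in> W \<Longrightarrow> y \<in> K1 \<Longrightarrow> l1 y = F (h y) - F (h x) + l1 x"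
        using lift_any[OF l1 h12(1) True F] by blast
      have "l y = F (h y) - F (h x) + l x" if "y \<in> W \<inter> K1" for y
        using W(3)[of y] that True unfolding l_def by simp
      then show ?thesis using W(1,2) by blast
    next
      case False
      then show ?thesis using cl(1) by (intro exI[of _ "- K1"]) auto
    qed
    have 2: "\<exists>W. open W \<and> x \<in> W \<and> (\<forall>y\<in>W \<inter> K2. l y = F (h y) - F (h x) + l x)"
    proof (cases "x \<in> K2")
      case True
      obtain W where W: "open W" "x \<in> W" "\<And>y. y \<in> W \<Longrightarrow> y \<in> K2 \<Longrightarrow> l2 y = F (h y) - F (h x) + l2 x"
        using lift_any[OF l2 h12(2) True F] by blast
      have "l y = F (h y) - F (h x) + l x" if "y \<in> W \<inter> K2" for y
        using W(3)[of y] lK2[of y] lK2[OF True] that by simp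
      then show ?thesis using W(1,2) by blast
    next
      case False
      then show ?thesis using cl(2) by (intro exI[of _ "- K2"]) auto
    qed
    obtain W1 W2 where "open W1" "x \<in> W1" "\<forall>y\<in>W1 \<inter> K1. l y = F (h y) - F (h x) + l x"
      "open W2" "x \<in> W2" "\<forall>y\<in>W2 \<inter> K2. l y = F (h y) - F (h x) + l x" using 1 2 by blast
    then have "open (W1 \<inter> W2) \<and> x \<in> W1 \<inter> W2 \<and> (\<forall>y\<in>(W1 \<inter> W2) \<inter> (K1 \<union> K2). l y = F (h y) - F (h x) + l x)" by blast
    with F show "\<exists>N F W. (N, F) \<in> \<F> \<and> h x \<in> N \<and> open W \<and> x \<in> W \<and> (\<forall>y\<in>W \<inter> (K1 \<union> K2). l y = F (h y) - F (h x) + l x)"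
      by blast
  qed
  then show ?thesis by (rule that)
qed

lemma lift_local:
  assumes h: "continuous_on K h" and x: "x \<in> K"
  obtains W where "open W" "x \<in> W" "\<And>K'. K' \<subseteq> K \<Longrightarrow> K' \<subseteq> W \<Longrightarrow> \<exists>l. lift K' h l"
proof -
  obtain N F where F: "(N, F) \<in> \<F>" "h x \<in> N" using F_cover by blast
  obtain W where W: "open W" "W \<inter> K = h -` N \<inter> K" by (rule continuous_on_open_vimageE[OF h F_open[OF F(1)]])
  have "lift K' h (\<lambda>y. F (h y))" if K': "K' \<subseteq> K" "K' \<subseteq> W" for K'
    unfolding lift_def
  proof
    fix y assume "y \<in> K'"
    then have "h y \<in> N" using W(2) K' by blast
    then show "\<exists>N F' U. (N, F') \<in> \<F> \<and> h y \<in> N \<and> open U \<and> y \<in> U \<and> (\<forall>z\<in>U \<inter> K'. F (h z) = F' (h z) - F' (h y) + F (h y))"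
      using F(1) by (intro exI[of _ N] exI[of _ F] exI[of _ UNIV]) auto
  qed
  then show ?thesis using that[of W] W x F(2) by blast
qed

text \<open>Small rectangles have lifts. Bisection by \<open>Bolzano\<close> in the second
  coordinate assembles them to thin vertical strips, and a second bisection in the first coordinate
  joins the strips; each overlap is a segment or a product of intervals, hence connected.\<close>

lemma lift_square:
  fixes h :: "real \<times> real \<Rightarrow> 'g"
  assumes h: "continuous_on ({0..1} \<times> {0..1}) h"
  obtains l where "lift ({0..1} \<times> {0..1}) h l"
proof -
  have strip: "\<exists>d>0. \<exists>l. lift (({x-d..x+d} \<inter> {0..1}) \<times> {0..1}) h l" if x: "0 \<le> x" "x \<le> 1" for x
  proof -
    \<comment> \<open>The width \<open>d\<close> is quantified inside \<open>P\<close>, so that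
      gluing two pieces may pass to the smaller of their widths.\<close>
    define P where "P c e \<longleftrightarrow> (0 \<le> c \<and> e \<le> 1 \<longrightarrow> (\<exists>d>0. \<exists>l. lift (({x-d..x+d} \<inter> {0..1}) \<times> {c..e}) h l))" for c e
    have "P 0 (1::real)"
    proof (rule Bolzano)
      fix a b c :: real assume "P a b" "P b c" "a \<le> b" "b \<le> c"
      show "P a c" unfolding P_def
      proof
        assume ac: "0 \<le> a \<and> c \<le> 1"
        obtain d1 l1 where 1: "d1 > 0" "lift (({x-d1..x+d1} \<inter> {0..1}) \<times> {a..b}) h l1"
          using \<open>P a b\<close> ac \<open>b \<le> c\<close> unfolding P_def by auto
        obtain d2 l2 where 2: "d2 > 0" "lift (({x-d2..x+d2} \<inter> {0..1}) \<times> {b..c}) h l2"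
          using \<open>P b c\<close> ac \<open>a \<le> b\<close> unfolding P_def by auto
        define I where "I = {x-min d1 d2..x+min d1 d2} \<inter> {0..1}"
        have l1: "lift (I \<times> {a..b}) h l1" by (rule lift_subset[OF 1(2)]) (auto simp: I_def)
        have l2: "lift (I \<times> {b..c}) h l2" by (rule lift_subset[OF 2(2)]) (auto simp: I_def)
        have u: "I \<times> {a..b} \<union> I \<times> {b..c} = I \<times> {a..c}" using \<open>a \<le> b\<close> \<open>b \<le> c\<close> by auto
        have i: "I \<times> {a..b} \<inter> I \<times> {b..c} = I \<times> {b}" using \<open>a \<le> b\<close> \<open>b \<le> c\<close> by auto
        have "\<exists>l. lift (I \<times> {a..b} \<union> I \<times> {b..c}) h l"
        proof (rule lift_glue[OF l1 l2])
          show "continuous_on (I \<times> {a..b} \<union> I \<times> {b..c}) h"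
            unfolding u by (rule continuous_on_subset[OF h]) (use ac in \<open>auto simp: I_def\<close>)
          show "connected (I \<times> {a..b} \<inter> I \<times> {b..c})"
            unfolding i unfolding I_def
            by (rule connected_Times[OF convex_connected[OF convex_Int]]) auto
          show "closed (I \<times> {a..b})" "closed (I \<times> {b..c})"
            unfolding I_def by (intro closed_Times closed_Int closed_atLeastAtMost)+
        qed blast
        then have "\<exists>l. lift (({x-min d1 d2..x+min d1 d2} \<inter> {0..1}) \<times> {a..c}) h l"
          unfolding u unfolding I_def .
        moreover have "min d1 d2 > 0" using 1 2 by simp
        ultimately show "\<exists>d>0. \<exists>l. lift (({x-d..x+d} \<inter> {0..1}) \<times> {a..c}) h l" by blast
      qed
    next
      fix t :: real assume t: "0 \<le> t" "t \<le> 1"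
      obtain W where W: "open W" "(x, t) \<in> W" "\<And>K'. K' \<subseteq> {0..1} \<times> {0..1} \<Longrightarrow> K' \<subseteq> W \<Longrightarrow> \<exists>l. lift K' h l"
        by (rule lift_local[OF h, of "(x, t)"]) (use x t in auto)
      obtain A B where AB: "open A" "open B" "x \<in> A" "t \<in> B" "A \<times> B \<subseteq> W" using W(1,2) by (rule open_prod_elim) auto
      obtain d where d: "d > 0" "cball x d \<subseteq> A" using AB open_contains_cball by blast
      obtain e where e: "e > 0" "ball t e \<subseteq> B" using AB open_contains_ball by blast
      have "P a b" if ab: "a \<le> t \<and> t \<le> b \<and> b - a < e" for a b
        unfolding P_def
      proof
        assume "0 \<le> a \<and> b \<le> 1"
        have "{a..b} \<subseteq> ball t e" using ab by (auto simp: dist_real_def)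
        moreover have "{x-d..x+d} \<subseteq> cball x d" by (auto simp: dist_real_def)
        ultimately have "({x-d..x+d} \<inter> {0..1}) \<times> {a..b} \<subseteq> W"
          using AB(5) d(2) e(2) by (meson Sigma_mono inf.coboundedI1 order_trans)
        then have "\<exists>l. lift (({x-d..x+d} \<inter> {0..1}) \<times> {a..b}) h l"
          using \<open>0 \<le> a \<and> b \<le> 1\<close> by (intro W(3)) auto
        then show "\<exists>d>0. \<exists>l. lift (({x-d..x+d} \<inter> {0..1}) \<times> {a..b}) h l" using d(1) by blast
      qed
      then show "\<exists>d>0. \<forall>a b. a \<le> t \<and> t \<le> b \<and> b - a < d \<longrightarrow> P a b" using e(1) by blast
    qed simp
    then show ?thesis by (simp add: P_def)
  qed
  define P where "P a b \<longleftrightarrow> (0 \<le> a \<and> b \<le> 1 \<longrightarrow> (\<exists>l. lift ({a..b} \<times> {0..1}) h l))" for a b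
  have "P 0 (1::real)"
  proof (rule Bolzano)
    fix a b c :: real assume "P a b" "P b c" "a \<le> b" "b \<le> c"
    show "P a c" unfolding P_def
    proof
      assume ac: "0 \<le> a \<and> c \<le> 1"
      obtain l1 where l1: "lift ({a..b} \<times> {0..1}) h l1"
        using \<open>P a b\<close> ac \<open>b \<le> c\<close> unfolding P_def by auto
      obtain l2 where l2: "lift ({b..c} \<times> {0..1}) h l2"
        using \<open>P b c\<close> ac \<open>a \<le> b\<close> unfolding P_def by auto
      have u: "{a..b} \<times> {0..1} \<union> {b..c} \<times> {0..1} = {a..c} \<times> {0..1::real}" using \<open>a \<le> b\<close> \<open>b \<le> c\<close> by auto
      have i: "{a..b} \<times> {0..1} \<inter> {b..c} \<times> {0..1} = {b} \<times> {0..1::real}" using \<open>a \<le> b\<close> \<open>b \<le> c\<close> by auto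
      have "\<exists>l. lift ({a..b} \<times> {0..1} \<union> {b..c} \<times> {0..1}) h l"
      proof (rule lift_glue[OF l1 l2])
        show "continuous_on ({a..b} \<times> {0..1} \<union> {b..c} \<times> {0..1}) h"
          unfolding u by (rule continuous_on_subset[OF h]) (use ac in auto)
        show "connected ({a..b} \<times> {0..1} \<inter> {b..c} \<times> {0..1::real})"
          unfolding i by (intro connected_Times) auto
      qed (auto intro!: closed_Times)
      then show "\<exists>l. lift ({a..c} \<times> {0..1}) h l" unfolding u .
    qed
  next
    fix x :: real assume x: "0 \<le> x" "x \<le> 1"
    obtain d l where d: "d > 0" "lift (({x-d..x+d} \<inter> {0..1}) \<times> {0..1}) h l" using strip[OF x] by blast
    have "P a b" if ab: "a \<le> x \<and> x \<le> b \<and> b - a < d" for a b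
      unfolding P_def by (intro impI exI[of _ l] lift_subset[OF d(2)]) (use ab in auto)
    then show "\<exists>d>0. \<forall>a b. a \<le> x \<and> x \<le> b \<and> b - a < d \<longrightarrow> P a b" using d(1) by blast
  qed simp
  then show ?thesis using that by (auto simp: P_def)
qed

text \<open>A path is treated as a map of the square that ignores the first coordinate, and the lift
  is restricted to one edge.\<close>

lemma lift_path:
  assumes "path \<gamma>"
  obtains l where "lift {0..1} \<gamma> l"
proof -
  have "continuous_on ({0..1} \<times> {0..1}) (\<lambda>p::real\<times>real. \<gamma> (snd p))"
    using assms unfolding path_def by (rule continuous_on_compose2) (auto intro!: continuous_intros)
  then obtain l where "lift ({0..1} \<times> {0..1}) (\<lambda>p::real\<times>real. \<gamma> (snd p)) l" by (rule lift_square)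
  then have "lift {0..1} \<gamma> (\<lambda>t. l (0, t))"
    by (rule lift_comp[where g = "\<lambda>t. (0, t)"]) (auto intro!: continuous_intros)
  then show ?thesis by (rule that)
qed

text \<open>Plays the role of the integral of a closed one-form along \<gamma>. All lifts have the
  same increment, so the choice does not matter.\<close>

definition incr :: "(real \<Rightarrow> 'g) \<Rightarrow> real" where
  "incr \<gamma> = (let l = SOME l. lift {0..1} \<gamma> l in l 1 - l 0)"

lemma incr_eq: "path \<gamma> \<Longrightarrow> lift {0..1} \<gamma> l \<Longrightarrow> incr \<gamma> = l 1 - l 0"
proof -
  assume p: "path \<gamma>" and l: "lift {0..1} \<gamma> l"
  have "lift {0..1} \<gamma> (SOME l. lift {0..1} \<gamma> l)" by (rule someI[of "lift {0..1} \<gamma>", OF l])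
  then obtain c where "\<And>x. x \<in> {0..1} \<Longrightarrow> (SOME l. lift {0..1} \<gamma> l) x = l x + c"
    using lift_diff_const[OF l _ p[unfolded path_def]] connected_Icc by blast
  then show ?thesis by (simp add: incr_def)
qed

lemma lift_restrict:
  assumes "lift {0..1::real} \<gamma> l" "\<And>t. t \<in> {0..1} \<Longrightarrow> \<delta> t = \<gamma> (a + b * t)" "0 \<le> a" "0 \<le> a + b" "a \<le> 1" "a + b \<le> 1" 
  shows "lift {0..1} \<delta> (\<lambda>t. l (a + b * t))"
proof (rule lift_comp[OF assms(1), where g = "\<lambda>t. a + b * t"])
  show "(\<lambda>t. a + b * t) ` {0..1} \<subseteq> {0..1}"
  proof safe
    fix t :: real assume t: "t \<in> {0..1}"
    have e: "a + b * t = (1 - t) * a + t * (a + b)" by (simp add: algebra_simps)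
    have "0 \<le> (1 - t) * a" "0 \<le> t * (a + b)" using t assms(3,4) by (simp_all only: mult_nonneg_nonneg diff_ge_0_iff_ge atLeastAtMost_iff)
    then have "0 \<le> (1 - t) * a + t * (a + b)" by linarith
    moreover have "(1 - t) * a + t * (a + b) \<le> 1" using t assms by (intro convex_bound_le) auto
    ultimately show "a + b * t \<in> {0..1}" unfolding e by auto
  qed
qed (use assms in \<open>auto intro!: continuous_intros\<close>)

section \<open>Path independence over a simply connected space\<close>

context
  assumes sc: "simply_connected (UNIV :: 'g set)"
begin

lemma const_path: "path (\<lambda>t. a :: 'g)"
  unfolding path_def by (rule continuous_on_const)

lemma loops_homotopic:
  "path \<gamma> \<Longrightarrow> pathfinish \<gamma> = pathstart \<gamma> \<Longrightarrow> homotopic_loops UNIV \<gamma> (\<lambda>t. a :: 'g)"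
  using sc const_path[of a] unfolding simply_connected_def by (auto simp: pathfinish_def pathstart_def)

text \<open>\<open>simply_connected\<close> relates any two loops by a free homotopy. Between the
  constant loops at \<open>a\<close> and \<open>b\<close> the base point of such a homotopy travels
  along a path.\<close>

lemma connecting_path:
  obtains \<gamma> where "path \<gamma>" "pathstart \<gamma> = a" "pathfinish \<gamma> = (b :: 'g)"
proof -
  have "homotopic_loops UNIV (\<lambda>t. a) (\<lambda>t. b)"
    by (rule loops_homotopic) (auto simp: const_path pathfinish_def pathstart_def)
  then obtain h :: "real \<times> real \<Rightarrow> 'g" where h: "continuous_on ({0..1} \<times> {0..1}) h" "\<forall>x\<in>{0..1}. h (0, x) = a" "\<forall>x\<in>{0..1}. h (1, x) = b"
    unfolding homotopic_loops by blast
  have "path (\<lambda>s. h (s, 0))" unfolding path_def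
    by (rule continuous_on_compose2[OF h(1)]) (auto intro!: continuous_intros)
  then show ?thesis using that[of "\<lambda>s. h (s, 0)"] h by (simp add: pathfinish_def pathstart_def)
qed

text \<open>Lift a free homotopy from \<gamma> to a constant loop. The two vertical edges of the
  square are the same path because every stage is a loop, so their lifts differ by a constant
  \<open>c\<close>. At the constant end \<open>c = 0\<close>, while at the other end
  \<open>c\<close> is the increment of \<gamma>.\<close>

lemma incr_loop:
  assumes g: "path \<gamma>" "pathfinish \<gamma> = pathstart (\<gamma> :: real \<Rightarrow> 'g)"
  shows "incr \<gamma> = 0"
proof -
  obtain h :: "real \<times> real \<Rightarrow> 'g" where h: "continuous_on ({0..1} \<times> {0..1}) h" "\<forall>x\<in>{0..1}. h (0, x) = \<gamma> x"
     "\<forall>x\<in>{0..1}. h (1, x) = pathstart \<gamma>" "\<forall>t\<in>{0..1}. pathfinish (h \<circ> Pair t) = pathstart (h \<circ> Pair t)"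
    using loops_homotopic[OF g, of "pathstart \<gamma>"] unfolding homotopic_loops by blast
  obtain l where l: "lift ({0..1} \<times> {0..1}) h l" by (rule lift_square[OF h(1)])
  have l0: "lift {0..1} (\<lambda>s. h (s, 0)) (\<lambda>s. l (s, 0))"
    by (rule lift_comp[OF l]) (auto intro!: continuous_intros)
  have l1: "lift {0..1} (\<lambda>s. h (s, 0)) (\<lambda>s. l (s, 1))"
    by (rule lift_comp[OF l]) (use h(4) in \<open>auto intro!: continuous_intros simp: pathfinish_def pathstart_def\<close>)
  have "continuous_on {0..1} (\<lambda>s. h (s, 0))"
    by (rule continuous_on_compose2[OF h(1)]) (auto intro!: continuous_intros)
  then obtain c where c: "\<And>s. s \<in> {0..1} \<Longrightarrow> l (s, 1) = l (s, 0) + c"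
    using lift_diff_const[OF l0 l1] connected_Icc by blast
  have "lift {0..1} (\<lambda>t. h (1, t)) (\<lambda>t. l (1, t))"
    by (rule lift_comp[OF l]) (auto intro!: continuous_intros)
  then have "l (1, 0) = l (1, 1)"
    by (rule lift_of_constant[where a = "pathstart \<gamma>"]) (use h(3) in auto)
  then have "c = 0" using c[of 1] by simp
  moreover have "lift {0..1} \<gamma> (\<lambda>t. l (0, t))"
    by (rule lift_comp[OF l]) (use h(2) in \<open>auto intro!: continuous_intros\<close>)
  then have "incr \<gamma> = l (0, 1) - l (0, 0)" by (rule incr_eq[OF g(1)])
  ultimately show ?thesis using c[of 0] by simp
qed

lemma incr_unique:
  assumes "path \<gamma>" "path \<delta>" "pathstart \<gamma> = pathstart \<delta>" "pathfinish \<gamma> = pathfinish (\<delta> :: real \<Rightarrow> 'g)"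
  shows "incr \<gamma> = incr \<delta>"
proof -
  let ?\<beta> = "\<gamma> +++ reversepath \<delta>"
  have b: "path ?\<beta>" using assms by simp
  obtain l where l: "lift {0..1} ?\<beta> l" by (rule lift_path[OF b])
  have "lift {0..1} \<gamma> (\<lambda>t. l (0 + 1/2 * t))"
    by (rule lift_restrict[OF l]) (auto simp: joinpaths_def)
  from incr_eq[OF assms(1) this] have "incr \<gamma> = l (1/2) - l 0" by simp
  \<comment> \<open>The second half of the joined loop runs through \<delta> backwards, from
    parameter 1 down to 1/2.\<close>
  moreover have "lift {0..1} \<delta> (\<lambda>t. l (1 + (- 1/2) * t))"
    by (rule lift_restrict[OF l])
       (use assms in \<open>auto simp: joinpaths_def reversepath_def pathfinish_def field_simps\<close>)
  from incr_eq[OF assms(2) this] have "incr \<delta> = l (1/2) - l 1" by simp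
  moreover have "l 1 - l 0 = 0" using incr_eq[OF b l] incr_loop[OF b] assms by simp
  ultimately show ?thesis by simp
qed

lemma incr_join:
  assumes "path \<gamma>" "path \<delta>" "pathfinish \<gamma> = pathstart (\<delta> :: real \<Rightarrow> 'g)"
  shows "incr (\<gamma> +++ \<delta>) = incr \<gamma> + incr \<delta>"
proof -
  have b: "path (\<gamma> +++ \<delta>)" using assms by simp
  obtain l where l: "lift {0..1} (\<gamma> +++ \<delta>) l" by (rule lift_path[OF b])
  have "lift {0..1} \<gamma> (\<lambda>t. l (0 + 1/2 * t))"
    by (rule lift_restrict[OF l]) (auto simp: joinpaths_def)
  from incr_eq[OF assms(1) this] have "incr \<gamma> = l (1/2) - l 0" by simp
  moreover have "lift {0..1} \<delta> (\<lambda>t. l (1/2 + 1/2 * t))"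
    by (rule lift_restrict[OF l])
       (use assms in \<open>auto simp: joinpaths_def pathfinish_def pathstart_def field_simps\<close>)
  from incr_eq[OF assms(2) this] have "incr \<delta> = l 1 - l (1/2)" by simp
  ultimately show ?thesis using incr_eq[OF b l] by simp
qed

text \<open>The value at \<open>q\<close> is the increment along any path from a fixed base point.
  Within a path connected neighbourhood the path can be prolonged inside the domain of a single
  local function, whose increment is then added.\<close>

lemma global_function:
  assumes lpc: "\<And>(q::'g) N. open N \<Longrightarrow> q \<in> N \<Longrightarrow> \<exists>W. open W \<and> q \<in> W \<and> W \<subseteq> N \<and> path_connected W"
  obtains f where "\<And>N F q. (N, F) \<in> \<F> \<Longrightarrow> q \<in> N \<Longrightarrow> \<exists>W. open W \<and> q \<in> W \<and> (\<forall>x\<in>W. f x = F x + (f q - F q))"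
proof -
  obtain p0 :: 'g where True by blast
  have "\<exists>\<gamma>. path \<gamma> \<and> pathstart \<gamma> = p0 \<and> pathfinish \<gamma> = q" for q
    using connecting_path[of p0 q] by blast
  then obtain \<gamma> where \<gamma>: "\<And>q. path (\<gamma> q)" "\<And>q. pathstart (\<gamma> q) = p0" "\<And>q. pathfinish (\<gamma> q) = q" by metis
  define f where "f q = incr (\<gamma> q)" for q
  have "\<exists>W. open W \<and> q \<in> W \<and> (\<forall>x\<in>W. f x = F x + (f q - F q))" if F: "(N, F) \<in> \<F>" "q \<in> N" for N F q
  proof -
    obtain W where W: "open W" "q \<in> W" "W \<subseteq> N" "path_connected W" using lpc[OF F_open[OF F(1)] F(2)] by blast
    have "f x = F x + (f q - F q)" if x: "x \<in> W" for x
    proof -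
      obtain \<delta> where \<delta>: "path \<delta>" "path_image \<delta> \<subseteq> W" "pathstart \<delta> = q" "pathfinish \<delta> = x"
        using W(4) x W(2) unfolding path_connected_def by blast
      have "lift {0..1} \<delta> (\<lambda>t. F (\<delta> t))"
        unfolding lift_def
      proof
        fix t :: real assume "t \<in> {0..1}"
        then have "\<delta> t \<in> W" using \<delta>(2) unfolding path_image_def by blast
      then have "\<delta> t \<in> N" using W(3) by blast
        then show "\<exists>N F' U. (N, F') \<in> \<F> \<and> \<delta> t \<in> N \<and> open U \<and> t \<in> U \<and> (\<forall>y\<in>U \<inter> {0..1}. F (\<delta> y) = F' (\<delta> y) - F' (\<delta> t) + F (\<delta> t))"
          using F(1) by (intro exI[of _ N] exI[of _ F] exI[of _ UNIV]) auto
      qed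
      from incr_eq[OF \<delta>(1) this] have "incr \<delta> = F x - F q" using \<delta> by (simp add: pathfinish_def pathstart_def)
      moreover have "f x = incr (\<gamma> q +++ \<delta>)" unfolding f_def by (rule incr_unique) (use \<gamma> \<delta> in auto)
      moreover have "\<dots> = incr (\<gamma> q) + incr \<delta>" by (rule incr_join) (use \<gamma> \<delta> in auto)
      ultimately show ?thesis by (simp add: f_def)
    qed
    then show ?thesis using W by blast
  qed
  then show ?thesis using that by blast
qed

end

end

section \<open>Closed one-forms have global primitives\<close>

context smooth_mfd
begin

lemma locally_path_connected:
  fixes q :: 'm
  assumes N: "open N" "q \<in> N"
  obtains W where "open W" "q \<in> W" "W \<subseteq> N" "path_connected W"
proof -
  obtain U \<phi> where c: "(U, \<phi>) \<in> charts M" "q \<in> U" using chart_at .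
  have oN: "open (U \<inter> N)" using chart_open[OF c(1)] N by blast
  have "openin (top_of_set V) (\<phi> ` (U \<inter> N))" by (rule chart_image_open[OF c(1) N(1)])
  then obtain e where e: "e > 0" "V \<inter> ball (\<phi> q) e \<subseteq> \<phi> ` (U \<inter> N)"
    using c N unfolding openin_contains_ball by (metis Int_commute Int_iff imageI)
  define W where "W = {x \<in> U \<inter> N. \<phi> x \<in> ball (\<phi> q) e}"
  have "W = inv_into U \<phi> ` (V \<inter> ball (\<phi> q) e)"
  proof (intro equalityI subsetI)
    fix x assume "x \<in> W"
    then show "x \<in> inv_into U \<phi> ` (V \<inter> ball (\<phi> q) e)"
      using chart_inv[OF c(1)] chart_in_V[OF c(1)] by (intro image_eqI[of _ _ "\<phi> x"]) (auto simp: W_def)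
  next
    fix x assume "x \<in> inv_into U \<phi> ` (V \<inter> ball (\<phi> q) e)"
    then obtain y where y: "y \<in> V \<inter> ball (\<phi> q) e" "x = inv_into U \<phi> y" by blast
    then obtain z where "z \<in> U \<inter> N" "y = \<phi> z" using e(2) by blast
    then show "x \<in> W" using y chart_inv[OF c(1)] by (simp add: W_def)
  qed
  moreover have "path_connected (inv_into U \<phi> ` (V \<inter> ball (\<phi> q) e))"
  proof (rule path_connected_continuous_image)
    show "continuous_on (V \<inter> ball (\<phi> q) e) (inv_into U \<phi>)"
      by (rule continuous_on_subset[OF homeomorphism_cont2[OF chart_homeo[OF c(1)]]]) (use e in blast)
    show "path_connected (V \<inter> ball (\<phi> q) e)"
      by (intro convex_imp_path_connected convex_Int subspace_imp_convex V convex_ball)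
  qed
  ultimately have "path_connected W" by simp
  moreover have "open W" unfolding W_def
    by (rule chart_preimage_open[OF c(1) open_ball oN]) blast
  moreover have "q \<in> W" "W \<subseteq> N" using N c e by (auto simp: W_def)
  ultimately show ?thesis by (intro that)
qed

end

context const_frame
begin

text \<open>Coordinate derivations are combinations of the frame, so they annihilate
  \<open>h\<close> too, and the Hadamard expansion on a ball of the chart reduces to its constant
  term.\<close>

lemma locally_constant:
  assumes h: "h \<in> S" and N: "open N" "q \<in> N" and E0: "\<And>x i. x \<in> N \<Longrightarrow> i \<in> J \<Longrightarrow> E i x h = 0"
  obtains W where "open W" "q \<in> W" "\<And>x. x \<in> W \<Longrightarrow> h x = h q"
proof -
  obtain U \<phi> where c: "(U, \<phi>) \<in> charts M" "q \<in> U" using chart_at .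
  obtain B where B: "finite B" "B \<subseteq> V" "\<And>w. w \<in> V \<Longrightarrow> w = (\<Sum>b\<in>B. (w \<bullet> b) *\<^sub>R b)"
    using orthonormal_basis_of_subspace[OF V] by metis
  have "openin (top_of_set V) (\<phi> ` (U \<inter> N))" by (rule chart_image_open[OF c(1) N(1)])
  then obtain e where e: "e > 0" "V \<inter> ball (\<phi> q) e \<subseteq> \<phi> ` (U \<inter> N)"
    using c N unfolding openin_contains_ball by (metis Int_commute Int_iff imageI)
  define W where "W = V \<inter> ball (\<phi> q) e"
  have qV: "\<phi> q \<in> V" by (rule chart_in_V[OF c])
  let ?h = "h \<circ> inv_into U \<phi>"
  have sh: "smooth_on V W ?h" by (rule smooth_on_subset[OF S_D[OF h c(1)]]) (use e W_def in auto)
  have dd0: "dd b ?h x = 0" if b: "b \<in> B" and x: "x \<in> W" for b x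
  proof -
    obtain z where z: "z \<in> U \<inter> N" "x = \<phi> z" using x e(2) W_def by blast
    have v: "(\<lambda>f. if f \<in> S then dd b (f \<circ> inv_into U \<phi>) (\<phi> z) else 0) \<in> T z"
      by (rule chart_derivation[OF c(1)]) (use z b B in auto)
    have "dd b ?h x = (\<Sum>j\<in>J. tc z (\<lambda>f. if f \<in> S then dd b (f \<circ> inv_into U \<phi>) (\<phi> z) else 0) j * E j z h)"
      using tc[OF v, of h] h z(2) by simp
    also have "\<dots> = 0" using E0 z(1) by simp
    finally show ?thesis .
  qed
  have const: "?h x = ?h (\<phi> q)" if x: "x \<in> W" for x
  proof -
    have "ray_integral (\<phi> q) 0 (dd b ?h) x = 0" if "b \<in> B" for b
    proof -
      have "ray_integral (\<phi> q) 0 (dd b ?h) x = integral {0..1::real} (\<lambda>t. 0)"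
        unfolding ray_integral_def
        by (rule integral_cong) (use dd0[OF that] ray_in_W[OF V qV W_def x] in simp)
      then show ?thesis by simp
    qed
    then show ?thesis using hadamard[OF V qV W_def B sh x] by simp
  qed
  have "open {x \<in> U. \<phi> x \<in> ball (\<phi> q) e}"
    by (rule chart_preimage_open[OF c(1) open_ball chart_open[OF c(1)] order_refl])
  moreover have "h x = h q" if x: "x \<in> {x \<in> U. \<phi> x \<in> ball (\<phi> q) e}" for x
  proof -
    have xU: "x \<in> U" and "\<phi> x \<in> W" using x chart_in_V[OF c(1)] by (auto simp: W_def)
    from const[OF this(2)] show ?thesis unfolding o_def chart_inv[OF c(1) xU] chart_inv[OF c] .
  qed
  moreover have "q \<in> {x \<in> U. \<phi> x \<in> ball (\<phi> q) e}" using c(2) e(1) by simp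
  ultimately show ?thesis by (intro that)
qed

section \<open>Primitives of a closed one-form given by its frame coefficients\<close>

context
  fixes a :: "'c \<Rightarrow> 'a \<Rightarrow> real"
  assumes aS: "\<And>j. j \<in> J \<Longrightarrow> a j \<in> S"
    and closed: "\<And>i j p. i \<in> J \<Longrightarrow> j \<in> J \<Longrightarrow> E i p (a j) - E j p (a i) = (\<Sum>k\<in>J. c i j k * a k p)"
begin

text \<open>The one-form whose value on \<open>E j\<close> is \<open>a j\<close>; the assumption
  \<open>closed\<close> says that its exterior derivative vanishes on pairs of frame fields.\<close>

definition form :: "'a vfield \<Rightarrow> 'a \<Rightarrow> real" where
  "form X q = (\<Sum>j\<in>J. co X j q * a j q)"

lemma form_S: "X \<in> VF \<Longrightarrow> form X \<in> S"
  unfolding form_def by (rule S_sum, rule S_mult[OF co_S aS])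

text \<open>The exterior derivative is tensorial: derivatives of the coefficients of
  \<open>X\<close> and \<open>Y\<close> are absorbed by the bracket, and what remains is closedness
  on the frame. Its use is to pass from the frame to coordinate fields.\<close>

lemma form_closed:
  assumes X: "X \<in> VF" and Y: "Y \<in> VF"
  shows "X p (form Y) - Y p (form X) = form (vbracket X Y) p"
proof -
  have *: "X p (form Y) = (\<Sum>j\<in>J. a j p * X p (co Y j)) + (\<Sum>i\<in>J. \<Sum>j\<in>J. co X i p * co Y j p * E i p (a j))"
    if X: "X \<in> VF" and Y: "Y \<in> VF" for X Y
  proof -
    have XT: "X p \<in> T p" by (rule VF_T[OF X])
    have "X p (form Y) = (\<Sum>j\<in>J. X p (\<lambda>q. co Y j q * a j q))"
      unfolding form_def[abs_def] by (rule T_sum[OF XT], rule S_mult[OF co_S[OF Y] aS])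
    also have "\<dots> = (\<Sum>j\<in>J. co Y j p * X p (a j) + a j p * X p (co Y j))"
      using T_D(3)[OF XT co_S[OF Y] aS] by (intro sum.cong) auto
    also have "\<dots> = (\<Sum>j\<in>J. a j p * X p (co Y j)) + (\<Sum>j\<in>J. \<Sum>i\<in>J. co X i p * co Y j p * E i p (a j))"
      using co[OF X, of p] by (simp add: sum.distrib sum_distrib_left mult_ac)
    finally show ?thesis using sum.swap[of _ J J] by simp
  qed
  have "(\<Sum>i\<in>J. \<Sum>j\<in>J. co Y i p * co X j p * E i p (a j)) = (\<Sum>i\<in>J. \<Sum>j\<in>J. co X i p * co Y j p * E j p (a i))"
    by (subst sum.swap) (simp add: mult_ac)
  then have "X p (form Y) - Y p (form X) = (\<Sum>j\<in>J. a j p * (X p (co Y j) - Y p (co X j)))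
     + (\<Sum>i\<in>J. \<Sum>j\<in>J. co X i p * co Y j p * (E i p (a j) - E j p (a i)))"
    unfolding *[OF X Y] *[OF Y X] by (simp add: right_diff_distrib sum_subtractf)
  also have "(\<Sum>i\<in>J. \<Sum>j\<in>J. co X i p * co Y j p * (E i p (a j) - E j p (a i)))
     = (\<Sum>i\<in>J. \<Sum>j\<in>J. \<Sum>k\<in>J. co X i p * co Y j p * c i j k * a k p)"
    by (intro sum.cong refl) (simp add: closed sum_distrib_left mult.assoc)
  also have "\<dots> = (\<Sum>i\<in>J. \<Sum>k\<in>J. \<Sum>j\<in>J. co X i p * co Y j p * c i j k * a k p)"
    by (rule sum.cong[OF refl], rule sum.swap)
  also have "\<dots> = (\<Sum>k\<in>J. \<Sum>i\<in>J. \<Sum>j\<in>J. co X i p * co Y j p * c i j k * a k p)" by (rule sum.swap)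
  also have "(\<Sum>j\<in>J. a j p * (X p (co Y j) - Y p (co X j))) + \<dots> = form (vbracket X Y) p"
    unfolding form_def sum.distrib[symmetric]
    by (intro sum.cong refl, simp add: co_vbracket[OF X Y] flip: sum_distrib_right) (simp add: algebra_simps)
  finally show ?thesis .
qed

text \<open>Closedness is known in a noncommuting frame, whereas \<open>poincare\<close> speaks
  about commuting coordinate directions. Coordinate fields bridge the two: their brackets vanish
  near \<open>p\<close>, so \<open>form_closed\<close> yields symmetric partial derivatives. At the
  end the frame fields are expanded in coordinate fields.\<close>

lemma local_primitive:
  obtains N F where "open N" "p \<in> N" "F \<in> S" "\<And>q i. q \<in> N \<Longrightarrow> i \<in> J \<Longrightarrow> E i q F = a i q"
proof -
  obtain U \<phi> where c: "(U, \<phi>) \<in> charts M" "p \<in> U" using chart_at .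
  obtain B where B: "finite B" "B \<subseteq> V" "\<And>w. w \<in> V \<Longrightarrow> w = (\<Sum>b\<in>B. (w \<bullet> b) *\<^sub>R b)"
    and orth: "\<And>b c. b \<in> B \<Longrightarrow> c \<in> B \<Longrightarrow> b \<bullet> c = (if b = c then 1 else 0)"
    using orthonormal_basis_of_subspace[OF V] by metis
  obtain \<eta> N where \<eta>: "\<eta> \<in> S" "open N" "p \<in> N" "N \<subseteq> U" "\<And>q. q \<in> N \<Longrightarrow> \<eta> q = 1"
    and ext: "\<And>g. smooth_on V (\<phi> ` U) g \<Longrightarrow> (\<lambda>q. if q \<in> U then \<eta> q * g (\<phi> q) else 0) \<in> S"
    by (rule manifold_bump[OF c(1) chart_open[OF c(1)] order_refl c(2)]) blast
  \<comment> \<open>Coordinate fields multiplied by a bump function, so as to be global vector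
    fields; on \<open>N\<close> they are the genuine coordinate fields.\<close>
  define D where "D b q f = (if q \<in> U then \<eta> q * (if f \<in> S then dd b (f \<circ> inv_into U \<phi>) (\<phi> q) else 0) else 0)" for b q f
  have bV: "b \<in> V" if "b \<in> B" for b using that B by blast
  have DVF: "D b \<in> VF" if b: "b \<in> B" for b
    unfolding vector_fields_def vapp_def
  proof (intro CollectI conjI allI ballI)
    fix q show "D b q \<in> T q"
    proof (cases "q \<in> U")
      case True
      have "D b q = (\<lambda>f. \<eta> q * (if f \<in> S then dd b (f \<circ> inv_into U \<phi>) (\<phi> q) else 0))"
        using True by (auto simp: D_def)
      then show ?thesis using T_scale[OF chart_derivation[OF c(1) True bV[OF b]]] by simp
    next
      case False
      then have "D b q = (\<lambda>f. 0)" by (auto simp: D_def)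
      then show ?thesis using T_zero by simp
    qed
  next
    fix f assume f: "f \<in> S"
    have "(\<lambda>q. D b q f) = (\<lambda>q. if q \<in> U then \<eta> q * dd b (f \<circ> inv_into U \<phi>) (\<phi> q) else 0)"
      using f by (auto simp: D_def)
    then show "(\<lambda>q. D b q f) \<in> S"
      using ext[OF smooth_on_dd[OF V chart_image[OF c(1)] S_D[OF f c(1)] bV[OF b]]] by simp
  qed
  have DN: "D b q f = dd b (f \<circ> inv_into U \<phi>) (\<phi> q)" if "q \<in> N" "f \<in> S" for b q f
    using that \<eta> by (auto simp: D_def)
  have oN: "openin (top_of_set V) (\<phi> ` N)" by (rule chart_image_open_sub[OF c(1) \<eta>(2,4)])
  have D2: "D b q (vapp (D b') f) = dd b (dd b' (f \<circ> inv_into U \<phi>)) (\<phi> q)"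
    if "q \<in> N" "f \<in> S" "b \<in> B" "b' \<in> B" for b b' q f
  proof -
    have "vapp (D b') f \<in> S" unfolding vapp_def by (rule VF_S[OF DVF]) (use that in auto)
    then have "D b q (vapp (D b') f) = dd b (vapp (D b') f \<circ> inv_into U \<phi>) (\<phi> q)" by (rule DN[OF that(1)])
    also have "\<dots> = dd b (dd b' (f \<circ> inv_into U \<phi>)) (\<phi> q)"
      by (rule dd_cong[OF V oN]) (use that bV \<eta>(4) DN chart_inv[OF c(1)] in \<open>auto simp: vapp_def\<close>)
    finally show ?thesis .
  qed
  \<comment> \<open>Symmetry of second derivatives, valid on \<open>N\<close> where the cut-off is
    identically 1.\<close>
  have br0: "co (vbracket (D b) (D b')) k q = 0" if "q \<in> N" "b \<in> B" "b' \<in> B" "k \<in> J" for b b' k q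
  proof (rule co_unique[OF VF_vbracket[OF DVF DVF] _ that(4)])
    fix f assume f: "f \<in> S"
    have "smooth_on V (\<phi> ` N) (f \<circ> inv_into U \<phi>)" by (rule smooth_on_subset[OF S_D[OF f c(1)]]) (use \<eta> in auto)
    then have "dd b (dd b' (f \<circ> inv_into U \<phi>)) (\<phi> q) = dd b' (dd b (f \<circ> inv_into U \<phi>)) (\<phi> q)"
      by (rule dd_commute[OF V oN]) (use that bV in auto)
    then show "vbracket (D b) (D b') q f = (\<Sum>j\<in>J. 0 * E j q f)"
      using D2[OF that(1) f] that by (simp add: vbracket_def)
  qed (use that in auto)
  obtain e where e: "e > 0" "V \<inter> ball (\<phi> p) e \<subseteq> \<phi> ` N"
    using oN \<eta>(3) unfolding openin_contains_ball by (metis Int_commute imageI)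
  define W where "W = V \<inter> ball (\<phi> p) e"
  have pV: "\<phi> p \<in> V" by (rule chart_in_V[OF c])
  have NW: "\<exists>q\<in>N. x = \<phi> q" if "x \<in> W" for x using that e(2) W_def by blast
  have sW: "smooth_on V W (f \<circ> inv_into U \<phi>)" if "f \<in> S" for f
    by (rule smooth_on_subset[OF S_D[OF that c(1)]]) (use NW \<eta>(4) in auto)
  obtain F' where F': "smooth_on V W F'" "\<And>b x. b \<in> B \<Longrightarrow> x \<in> W \<Longrightarrow> dd b F' x = (form (D b) \<circ> inv_into U \<phi>) x"
  proof (rule poincare[OF V pV W_def B, of "\<lambda>b. form (D b) \<circ> inv_into U \<phi>"])
    show "smooth_on V W (form (D b) \<circ> inv_into U \<phi>)" if "b \<in> B" for b by (rule sW[OF form_S[OF DVF[OF that]]])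
    fix b b' x assume b: "b \<in> B" "b' \<in> B" and x: "x \<in> W"
    obtain q where q: "q \<in> N" "x = \<phi> q" using NW[OF x] by blast
    have "form (vbracket (D b') (D b)) q = 0" unfolding form_def using br0[OF q(1) b(2,1)] by simp
    then have "D b' q (form (D b)) = D b q (form (D b'))"
      using form_closed[OF DVF[OF b(2)] DVF[OF b(1)], of q] by simp
    then show "dd b' (form (D b) \<circ> inv_into U \<phi>) x = dd b (form (D b') \<circ> inv_into U \<phi>) x"
      using DN[OF q(1) form_S[OF DVF]] b q(2) by simp
  qed (use orth in auto)
  define D' where "D' = {q \<in> N. \<phi> q \<in> ball (\<phi> p) e}"
  have D': "open D'" "D' \<subseteq> U" "p \<in> D'"
    using chart_preimage_open[OF c(1) open_ball \<eta>(2,4)] \<eta>(3,4) e(1) unfolding D'_def by auto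
  have D'W: "\<phi> ` D' \<subseteq> W" using chart_in_V[OF c(1)] D'(2) unfolding D'_def W_def by auto
  obtain \<eta>' N' where \<eta>': "open N'" "p \<in> N'" "N' \<subseteq> D'" "\<And>q. q \<in> N' \<Longrightarrow> \<eta>' q = 1"
    and ext': "\<And>g. smooth_on V (\<phi> ` D') g \<Longrightarrow> (\<lambda>q. if q \<in> D' then \<eta>' q * g (\<phi> q) else 0) \<in> S"
    by (rule manifold_bump[OF c(1) D']) blast
  \<comment> \<open>The primitive exists only on a ball in the chart; a second bump function makes
    it an element of \<open>S\<close> without changing it on \<open>N'\<close>.\<close>
  define F where "F q = (if q \<in> D' then \<eta>' q * F' (\<phi> q) else 0)" for q
  have FS: "F \<in> S" unfolding F_def by (rule ext'[OF smooth_on_subset[OF F'(1) D'W]])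
  have oN': "openin (top_of_set V) (\<phi> ` N')"
    by (rule chart_image_open_sub[OF c(1) \<eta>'(1)]) (use \<eta>'(3) D'(2) in auto)
  have DF: "dd b (F \<circ> inv_into U \<phi>) (\<phi> q) = form (D b) q" if q: "q \<in> N'" and b: "b \<in> B" for q b
  proof -
    have "dd b (F \<circ> inv_into U \<phi>) (\<phi> q) = dd b F' (\<phi> q)"
    proof (rule dd_cong[OF V oN'])
      fix y assume "y \<in> \<phi> ` N'"
      then obtain z where z: "z \<in> N'" "y = \<phi> z" by blast
      then have "z \<in> D'" "z \<in> U" using \<eta>'(3) D'(2) by auto
      then show "(F \<circ> inv_into U \<phi>) y = F' y" using \<eta>'(4)[OF z(1)] z(2) chart_inv[OF c(1), of z] by (simp add: F_def)
    qed (use q bV[OF b] in auto)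
    also have "\<dots> = form (D b) q"
      using F'(2)[OF b, of "\<phi> q"] q \<eta>'(3) D'W D'(2) chart_inv[OF c(1), of q] by (auto simp: subset_iff)
    finally show ?thesis .
  qed
  have "E i q F = a i q" if q: "q \<in> N'" and i: "i \<in> J" for q i
  proof -
    have qU: "q \<in> U" "q \<in> N" using q \<eta>'(3) D'(2) by (auto simp: D'_def)
    obtain w where w: "w \<in> V" "\<And>f. f \<in> S \<Longrightarrow> E i q f = dd w (f \<circ> inv_into U \<phi>) (\<phi> q)"
      using tangent_vector_in_chart[OF VF_T[OF E_vf[OF i]] c(1) qU(1)] by blast
    have Ei: "E i q f = (\<Sum>b\<in>B. (w \<bullet> b) * dd b (f \<circ> inv_into U \<phi>) (\<phi> q))" if f: "f \<in> S" for f
    proof -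
      have "dd (\<Sum>b\<in>B. (w \<bullet> b) *\<^sub>R b) (f \<circ> inv_into U \<phi>) (\<phi> q) = (\<Sum>b\<in>B. (w \<bullet> b) *\<^sub>R dd b (f \<circ> inv_into U \<phi>) (\<phi> q))"
        by (rule dd_sum_direction[OF V chart_in_V[OF c(1) qU(1)] smooth_on_differentiable[OF V chart_image[OF c(1)] S_D[OF f c(1)]]])
           (use qU bV in auto)
      then show ?thesis using w(2)[OF f] B(3)[OF w(1)] by simp
    qed
    have coEi: "co (E i) k q = (\<Sum>b\<in>B. (w \<bullet> b) * co (D b) k q)" if k: "k \<in> J" for k
    proof (rule co_unique[OF E_vf[OF i] _ k])
      fix f assume f: "f \<in> S"
      have "E i q f = (\<Sum>b\<in>B. (w \<bullet> b) * D b q f)" using Ei[OF f] DN[OF qU(2) f] by simp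
      also have "\<dots> = (\<Sum>b\<in>B. \<Sum>k\<in>J. (w \<bullet> b) * co (D b) k q * E k q f)"
        using co[OF DVF, of _ q f] by (simp add: sum_distrib_left mult.assoc)
      also have "\<dots> = (\<Sum>k\<in>J. (\<Sum>b\<in>B. (w \<bullet> b) * co (D b) k q) * E k q f)"
        by (subst sum.swap) (simp add: sum_distrib_right)
      finally show "E i q f = (\<Sum>k\<in>J. (\<Sum>b\<in>B. (w \<bullet> b) * co (D b) k q) * E k q f)" .
    qed
    have "E i q F = (\<Sum>b\<in>B. (w \<bullet> b) * form (D b) q)" using Ei[OF FS] DF[OF q] by simp
    also have "\<dots> = (\<Sum>b\<in>B. \<Sum>k\<in>J. (w \<bullet> b) * co (D b) k q * a k q)"
      by (simp add: form_def sum_distrib_left mult.assoc)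
    also have "\<dots> = (\<Sum>k\<in>J. (\<Sum>b\<in>B. (w \<bullet> b) * co (D b) k q) * a k q)"
      by (subst sum.swap) (simp add: sum_distrib_right)
    also have "\<dots> = (\<Sum>k\<in>J. co (E i) k q * a k q)" using coEi by simp
    also have "\<dots> = (\<Sum>k\<in>J. if i = k then a k q else 0)" by (intro sum.cong) (auto simp: co_E i)
    also have "\<dots> = a i q" using i finJ by simp
    finally show ?thesis .
  qed
  then show ?thesis using that[of N' F] \<eta>' FS by blast
qed

text \<open>Two local primitives have a difference annihilated by the frame, hence locally constant,
  so the gluing over a simply connected space applies to the family of all local primitives.\<close>

lemma global_primitive:
  assumes sc: "simply_connected (UNIV :: 'a set)"
  obtains f where "f \<in> S" "\<And>q i. i \<in> J \<Longrightarrow> E i q f = a i q"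
proof -
  define \<F> where "\<F> = {(N, F). open N \<and> F \<in> S \<and> (\<forall>q\<in>N. \<forall>i\<in>J. E i q F = a i q)}"
  interpret local_functions \<F>
  proof
    show "open N" if "(N, F) \<in> \<F>" for N F using that by (simp add: \<F>_def)
    show "\<exists>N F. (N, F) \<in> \<F> \<and> q \<in> N" for q
    proof (rule local_primitive[of q])
      fix N F assume F: "open N" "q \<in> N" "F \<in> S" "\<And>x i. x \<in> N \<Longrightarrow> i \<in> J \<Longrightarrow> E i x F = a i x"
      then have "(N, F) \<in> \<F>" unfolding \<F>_def by simp
      with F(2) show "\<exists>N F. (N, F) \<in> \<F> \<and> q \<in> N" by blast
    qed
    fix N F N' F' q assume F: "(N, F) \<in> \<F>" "(N', F') \<in> \<F>" "q \<in> N" "q \<in> N'"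
    have FS: "F \<in> S" "F' \<in> S" using F by (auto simp: \<F>_def)
    obtain W where "open W" "q \<in> W" "\<And>x. x \<in> W \<Longrightarrow> F x - F' x = F q - F' q"
    proof (rule locally_constant[OF S_diff[OF FS], of "N \<inter> N'" q])
      show "open (N \<inter> N')" "q \<in> N \<inter> N'" using F by (auto simp: \<F>_def)
      fix x i assume "x \<in> N \<inter> N'" "i \<in> J"
      then show "E i x (\<lambda>x. F x - F' x) = 0"
        using F T_diff[OF VF_T[OF E_vf] FS] by (auto simp: \<F>_def)
    qed blast
    then show "\<exists>W. open W \<and> q \<in> W \<and> (\<forall>x\<in>W. F x - F' x = F q - F' q)" by blast
  qed
  obtain f where f: "\<And>N F q. (N, F) \<in> \<F> \<Longrightarrow> q \<in> N \<Longrightarrow> \<exists>W. open W \<and> q \<in> W \<and> (\<forall>x\<in>W. f x = F x + (f q - F q))"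
  proof (rule global_function[OF sc])
    fix q :: 'a and N assume "open N" "q \<in> N"
    then show "\<exists>W. open W \<and> q \<in> W \<and> W \<subseteq> N \<and> path_connected W"
      using locally_path_connected[of N q] by metis
  qed (erule that)
  have loc: "\<exists>W F k. open W \<and> q \<in> W \<and> F \<in> S \<and> (\<forall>x\<in>W. f x = F x + k) \<and> (\<forall>i\<in>J. E i q F = a i q)" for q
  proof -
    obtain N F where F: "(N, F) \<in> \<F>" "q \<in> N" using F_cover[of q] by blast
    obtain W where "open W" "q \<in> W" "\<forall>x\<in>W. f x = F x + (f q - F q)" using f[OF F] by blast
    moreover have "F \<in> S" "\<forall>i\<in>J. E i q F = a i q" using F by (auto simp: \<F>_def)
    ultimately show ?thesis by blast
  qed
  have fS: "f \<in> S"
  proof (rule S_local)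
    fix q
    obtain W F k where "open W" "q \<in> W" "F \<in> S" "\<forall>x\<in>W. f x = F x + k" using loc[of q] by blast
    then show "\<exists>N h. open N \<and> q \<in> N \<and> h \<in> S \<and> (\<forall>x\<in>N. f x = h x)"
      using S_add[OF _ S_const, of F k] by blast
  qed
  moreover have "E i q f = a i q" if i: "i \<in> J" for q i
  proof -
    obtain W F k where W: "open W" "q \<in> W" "F \<in> S" "\<forall>x\<in>W. f x = F x + k" "\<forall>i\<in>J. E i q F = a i q" using loc[of q] by blast
    have v: "E i q \<in> T q" by (rule VF_T[OF E_vf[OF i]])
    have "E i q f = E i q (\<lambda>x. F x + k)"
      by (rule T_local[OF v fS S_add[OF W(3) S_const] W(1,2)]) (use W in auto)
    also have "\<dots> = E i q F" using T_D(1)[OF v W(3) S_const] T_const[OF v] by simp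
    finally show ?thesis using W i by simp
  qed
  ultimately show ?thesis by (rule that)
qed

end

section \<open>The soliton vector field\<close>

lemma jacobi:
  assumes ijl: "i \<in> J" "j \<in> J" "l \<in> J" and k: "k \<in> J"
  shows "(\<Sum>m\<in>J. c i j m * c m l k) + (\<Sum>m\<in>J. c j l m * c m i k) + (\<Sum>m\<in>J. c l i m * c m j k) = 0"
proof -
  \<comment> \<open>One point suffices, because the structure coefficients are constants and the
    Jacobi identity may be evaluated anywhere.\<close>
  obtain p :: 'a where True by blast
  have co2: "co (vbracket (vbracket (E i) (E j)) (E l)) k p = (\<Sum>m\<in>J. c i j m * c m l k)"
    if "i \<in> J" "j \<in> J" "l \<in> J" for i j l
  proof -
    have XV: "vbracket (E i) (E j) \<in> VF" by (intro VF_vbracket E_vf that)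
    have 1: "co (E l) k = (\<lambda>p. if l = k then 1 else 0)" using co_E[OF that(3) k] by auto
    have 2: "co (vbracket (E i) (E j)) k = (\<lambda>p. c i j k)" using co_vbracket_E[OF that(1,2) k] by auto
    have "co (vbracket (vbracket (E i) (E j)) (E l)) k p
      = (\<Sum>m\<in>J. \<Sum>n\<in>J. co (vbracket (E i) (E j)) m p * co (E l) n p * c m n k)"
      unfolding co_vbracket[OF XV E_vf[OF that(3)] k] 1 2
      using T_const[OF VF_T[OF XV]] T_const[OF VF_T[OF E_vf[OF that(3)]]] by simp
    also have "\<dots> = (\<Sum>m\<in>J. \<Sum>n\<in>J. if l = n then c i j m * c m n k else 0)"
      by (intro sum.cong refl) (simp add: co_vbracket_E co_E that)
    finally show ?thesis using finJ that by simp
  qed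
  define Z where "Z = vadd (vbracket (vbracket (E i) (E j)) (E l))
     (vadd (vbracket (vbracket (E j) (E l)) (E i)) (vbracket (vbracket (E l) (E i)) (E j)))"
  have V3: "vbracket (vbracket (E x) (E y)) (E z) \<in> VF" if "x \<in> J" "y \<in> J" "z \<in> J" for x y z
    by (intro VF_vbracket E_vf that)
  have br: "vbracket (vbracket X Y) Z p f = X p (vapp Y (vapp Z f)) - Y p (vapp X (vapp Z f))
      - Z p (vapp X (vapp Y f)) + Z p (vapp Y (vapp X f))"
    if X: "X \<in> VF" and Y: "Y \<in> VF" and Z: "Z \<in> VF" and f: "f \<in> S" for X Y Z f
  proof -
    have *: "vapp (vbracket X Y) f = (\<lambda>q. vapp X (vapp Y f) q - vapp Y (vapp X f) q)"
      by (simp add: vbracket_def vapp_def)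
    have "Z p (vapp (vbracket X Y) f) = Z p (vapp X (vapp Y f)) - Z p (vapp Y (vapp X f))"
      unfolding * by (rule T_diff[OF VF_T[OF Z]]) (use VF_S X Y f in \<open>auto simp: vapp_def\<close>)
    then show ?thesis unfolding vbracket_def[of "vbracket X Y"] by (simp add: vbracket_def)
  qed
  have "Z \<in> VF" unfolding Z_def by (intro VF_vadd V3 ijl)
  then have "co Z k p = 0"
  proof (rule co_unique[OF _ _ k])
    fix f assume f: "f \<in> S"
    show "Z p f = (\<Sum>j\<in>J. 0 * E j p f)"
      unfolding Z_def vadd_def by (simp add: br E_vf ijl f)
  qed
  moreover have "co Z k p = (\<Sum>m\<in>J. c i j m * c m l k) + ((\<Sum>m\<in>J. c j l m * c m i k) + (\<Sum>m\<in>J. c l i m * c m j k))"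
    unfolding Z_def by (simp add: co_vadd VF_vadd V3 ijl k co2)
  ultimately show ?thesis by simp
qed

text \<open>For \<open>X\<close> with coefficients \<open>f\<close>, the bracket with
  \<open>E j\<close> has \<open>k\<close>-th coefficient
  \<open>(\<Sum>i\<in>J. f i p * c i j k) - E j p (f k)\<close>. The requirement thus prescribes all
  frame derivatives of \<open>f k\<close> in terms of those \<open>f i\<close> with
  \<open>rk i < rk k\<close>. The system is solved by induction on the rank, one closed form at a
  time.\<close>

lemma soliton_field:
  fixes rk :: "'c \<Rightarrow> nat" and \<delta> :: "'c \<Rightarrow> real"
  assumes sc: "simply_connected (UNIV :: 'a set)"
    and rk: "\<And>i j k. i \<in> J \<Longrightarrow> j \<in> J \<Longrightarrow> k \<in> J \<Longrightarrow> c i j k \<noteq> 0 \<Longrightarrow> rk j < rk k"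
    and der: "\<And>i j k. i \<in> J \<Longrightarrow> j \<in> J \<Longrightarrow> k \<in> J \<Longrightarrow> c i j k \<noteq> 0 \<Longrightarrow> \<delta> i + \<delta> j = \<delta> k"
  obtains X where "X \<in> VF" "\<And>j p f. j \<in> J \<Longrightarrow> vbracket X (E j) p f = - \<delta> j * E j p f"
proof -
  have rk': "rk i < rk k" if "i \<in> J" "j \<in> J" "k \<in> J" "c i j k \<noteq> 0" for i j k
    using rk[of j i k] c_antisym[of i j k] that by simp
  have "\<exists>f. (\<forall>k\<in>J. f k \<in> S) \<and> (\<forall>k\<in>J. rk k < n \<longrightarrow> (\<forall>j\<in>J. \<forall>p. E j p (f k) = (\<Sum>i\<in>J. f i p * c i j k) + (if j = k then \<delta> k else 0)))" for n
  proof (induction n)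
    case 0
    show ?case by (intro exI[of _ "\<lambda>k p. 0"]) simp
  next
    case (Suc n)
    then obtain f where fS: "\<And>k. k \<in> J \<Longrightarrow> f k \<in> S"
      and f: "\<And>k j p. k \<in> J \<Longrightarrow> rk k < n \<Longrightarrow> j \<in> J \<Longrightarrow> E j p (f k) = (\<Sum>i\<in>J. f i p * c i j k) + (if j = k then \<delta> k else 0)"
      by blast
    \<comment> \<open>The prescribed value of \<open>E j\<close> on the next coefficient
      \<open>f k\<close>, as a one-form for each \<open>k\<close>.\<close>
    define a where "a k j p = (\<Sum>i\<in>J. c i j k * f i p) + (if j = k then \<delta> k else 0)" for k j p
    have aS: "a k j \<in> S" if "j \<in> J" for k j
      unfolding a_def by (rule S_add[OF S_sum[OF S_cmult[OF fS]] S_const])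
    have "\<exists>u\<in>S. \<forall>q. \<forall>i\<in>J. E i q u = a k i q" if k: "k \<in> J" "rk k = n" for k
    proof -
      have closed: "E l p (a k j) - E j p (a k l) = (\<Sum>m\<in>J. c l j m * a k m p)" if lj: "l \<in> J" "j \<in> J" for l j p
      proof -
        have Ea: "E l p (a k j) = (\<Sum>m\<in>J. (\<Sum>i\<in>J. c m l i * c i j k) * f m p) + c l j k * \<delta> l"
          if lj: "l \<in> J" "j \<in> J" for l j
        proof -
          have v: "E l p \<in> T p" by (rule VF_T[OF E_vf[OF lj(1)]])
          have "E l p (a k j) = E l p (\<lambda>p. \<Sum>i\<in>J. c i j k * f i p) + E l p (\<lambda>p. if j = k then \<delta> k else 0)"
            unfolding a_def[abs_def] by (rule T_D(1)[OF v S_sum[OF S_cmult[OF fS]] S_const])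
          also have "\<dots> = (\<Sum>i\<in>J. E l p (\<lambda>p. c i j k * f i p))"
            using T_const[OF v] T_sum[OF v, of J "\<lambda>i p. c i j k * f i p"] S_cmult[OF fS] by simp
          also have "\<dots> = (\<Sum>i\<in>J. c i j k * ((\<Sum>m\<in>J. f m p * c m l i) + (if l = i then \<delta> i else 0)))"
          proof (rule sum.cong[OF refl])
            fix i assume i: "i \<in> J"
            have "c i j k = 0 \<or> E l p (f i) = (\<Sum>m\<in>J. f m p * c m l i) + (if l = i then \<delta> i else 0)"
            proof (cases "c i j k = 0")
              case False
              then have "rk i < n" using rk'[OF i lj(2) k(1)] k(2) by simp
              from f[OF i this lj(1)] show ?thesis by blast
            qed simp
            then show "E l p (\<lambda>p. c i j k * f i p) = c i j k * ((\<Sum>m\<in>J. f m p * c m l i) + (if l = i then \<delta> i else 0))"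
              using T_D(2)[OF v fS[OF i]] by auto
          qed
          also have "\<dots> = (\<Sum>i\<in>J. \<Sum>m\<in>J. c m l i * c i j k * f m p) + (\<Sum>i\<in>J. if l = i then c i j k * \<delta> i else 0)"
            unfolding distrib_left sum.distrib
            by (intro arg_cong2[of _ _ _ _ "(+)"] sum.cong refl) (simp_all add: sum_distrib_left mult_ac)
          also have "(\<Sum>i\<in>J. \<Sum>m\<in>J. c m l i * c i j k * f m p) = (\<Sum>m\<in>J. (\<Sum>i\<in>J. c m l i * c i j k) * f m p)"
            by (subst sum.swap) (simp add: sum_distrib_right)
          finally show ?thesis using finJ lj by simp
        qed
        \<comment> \<open>The Jacobi identity is the integrability condition for the part that is
          linear in the earlier coefficients.\<close>
        have coef: "(\<Sum>i\<in>J. c m l i * c i j k) - (\<Sum>i\<in>J. c m j i * c i l k) = (\<Sum>i\<in>J. c l j i * c m i k)" if m: "m \<in> J" for m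
        proof -
          have "(\<Sum>i\<in>J. c l j i * c i m k) = - (\<Sum>i\<in>J. c l j i * c m i k)"
            unfolding sum_negf[symmetric] by (rule sum.cong[OF refl]) (use c_antisym[OF _ m k(1)] in simp)
          moreover have "(\<Sum>i\<in>J. c j m i * c i l k) = - (\<Sum>i\<in>J. c m j i * c i l k)"
            unfolding sum_negf[symmetric] by (rule sum.cong[OF refl]) (use c_antisym[OF lj(2) m] in simp)
          ultimately show ?thesis using jacobi[OF m lj k(1)] by simp
        qed
        have "(\<Sum>m\<in>J. c l j m * a k m p) = (\<Sum>m\<in>J. \<Sum>i\<in>J. c l j m * c i m k * f i p) + (\<Sum>m\<in>J. if m = k then c l j m * \<delta> k else 0)"
          unfolding a_def distrib_left sum.distrib
          by (intro arg_cong2[of _ _ _ _ "(+)"] sum.cong refl) (simp_all add: sum_distrib_left mult_ac)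
        also have "(\<Sum>m\<in>J. \<Sum>i\<in>J. c l j m * c i m k * f i p) = (\<Sum>i\<in>J. (\<Sum>m\<in>J. c l j m * c i m k) * f i p)"
          by (subst sum.swap) (simp add: sum_distrib_right)
        also have "\<dots> = (\<Sum>i\<in>J. ((\<Sum>m\<in>J. c i l m * c m j k) - (\<Sum>m\<in>J. c i j m * c m l k)) * f i p)"
          by (rule sum.cong[OF refl]) (simp add: coef)
        also have "(\<Sum>m\<in>J. if m = k then c l j m * \<delta> k else 0) = c l j k * \<delta> k" using k finJ by simp
        \<comment> \<open>The derivation property is the integrability condition for the constant
          part.\<close>
        also have "c l j k * \<delta> k = c l j k * \<delta> l - c j l k * \<delta> j"
        proof (cases "c l j k = 0")
          case False
          then have "\<delta> k = \<delta> l + \<delta> j" using der[OF lj k(1)] by simp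
          then show ?thesis using c_antisym[OF lj k(1)] by (simp add: algebra_simps)
        qed (use c_antisym[OF lj k(1)] in simp)
        finally show ?thesis unfolding Ea[OF lj] Ea[OF lj(2,1)]
          by (simp add: left_diff_distrib sum_subtractf)
      qed
      show ?thesis
        by (rule global_primitive[of "a k", OF aS closed sc]) blast+
    qed
    then obtain u where u: "\<And>k. k \<in> J \<Longrightarrow> rk k = n \<Longrightarrow> u k \<in> S"
      "\<And>k q i. k \<in> J \<Longrightarrow> rk k = n \<Longrightarrow> i \<in> J \<Longrightarrow> E i q (u k) = a k i q" by metis
    \<comment> \<open>Replacing the coefficients of rank \<open>n\<close> leaves the earlier
      equations intact: an \<open>f i\<close> enters the equation of \<open>f k\<close> with nonzero
      coefficient only if \<open>rk i < rk k\<close>.\<close>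
    define f' where "f' k = (if rk k = n then u k else f k)" for k
    have "E j p (f' k) = (\<Sum>i\<in>J. f' i p * c i j k) + (if j = k then \<delta> k else 0)"
      if k: "k \<in> J" "rk k < Suc n" and j: "j \<in> J" for k j p
    proof -
      have "(\<Sum>i\<in>J. f' i p * c i j k) = (\<Sum>i\<in>J. f i p * c i j k)"
      proof (rule sum.cong[OF refl])
        fix i assume i: "i \<in> J"
        have "c i j k = 0 \<or> f' i = f i" using rk'[OF i j k(1)] k(2) by (auto simp: f'_def)
        then show "f' i p * c i j k = f i p * c i j k" by auto
      qed
      then show ?thesis using f[OF k(1) _ j] u(2)[OF k(1) _ j] k(2)
        by (cases "rk k = n") (auto simp: f'_def a_def mult.commute)
    qed
    moreover have "f' k \<in> S" if "k \<in> J" for k using fS u that by (simp add: f'_def)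
    ultimately show ?case by blast
  qed
  from this[of "Suc (Max (rk ` J))"] obtain f where f0: "\<forall>k\<in>J. f k \<in> S"
    "\<forall>k\<in>J. rk k < Suc (Max (rk ` J)) \<longrightarrow> (\<forall>j\<in>J. \<forall>p. E j p (f k) = (\<Sum>i\<in>J. f i p * c i j k) + (if j = k then \<delta> k else 0))"
    by (elim exE conjE)
  have rkM: "rk k < Suc (Max (rk ` J))" if "k \<in> J" for k using finJ that by (simp add: less_Suc_eq_le)
  have fS: "\<And>k. k \<in> J \<Longrightarrow> f k \<in> S"
    and f: "\<And>k j p. k \<in> J \<Longrightarrow> j \<in> J \<Longrightarrow> E j p (f k) = (\<Sum>i\<in>J. f i p * c i j k) + (if j = k then \<delta> k else 0)"
    using f0 rkM by blast+
  have XV: "comb f \<in> VF" by (rule comb_VF[OF fS])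
  have "vbracket (comb f) (E j) p g = - \<delta> j * E j p g" if j: "j \<in> J" for j p g
  proof -
    have BV: "vbracket (comb f) (E j) \<in> VF" by (rule VF_vbracket[OF XV E_vf[OF j]])
    have cob: "co (vbracket (comb f) (E j)) k p = (if j = k then - \<delta> j else 0)" if k: "k \<in> J" for k
    proof -
      have 1: "co (E j) k = (\<lambda>p. if j = k then 1 else 0)" using co_E[OF j k] by auto
      have 2: "co (comb f) k = f k" using co_comb[OF fS k] by auto
      have "(\<Sum>i\<in>J. \<Sum>m\<in>J. co (comb f) i p * co (E j) m p * c i m k) = (\<Sum>i\<in>J. \<Sum>m\<in>J. if j = m then f i p * c i m k else 0)"
        by (intro sum.cong refl) (simp add: co_E[OF j] co_comb[OF fS])
      also have "\<dots> = (\<Sum>i\<in>J. f i p * c i j k)" using finJ j by simp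
      finally have 3: "(\<Sum>i\<in>J. \<Sum>m\<in>J. co (comb f) i p * co (E j) m p * c i m k) = (\<Sum>i\<in>J. f i p * c i j k)" .
      show ?thesis unfolding co_vbracket[OF XV E_vf[OF j] k] 3 unfolding 1 2 f[OF k j]
        using T_const[OF VF_T[OF XV]] by simp
    qed
    have "vbracket (comb f) (E j) p g = (\<Sum>k\<in>J. if j = k then - \<delta> j * E k p g else 0)"
      unfolding co[OF BV, of p g] by (intro sum.cong refl) (simp add: cob)
    then show ?thesis using finJ j by simp
  qed
  then show ?thesis using that[OF XV] by blast
qed

end

section \<open>Left-invariant fields on a Lie group\<close>

locale lie_grp = smooth_mfd M
  for M :: "('m::{t2_space, second_countable_topology}, 'e::euclidean_space) manifold" +
  fixes mul :: "'m \<Rightarrow> 'm \<Rightarrow> 'm" and e :: 'm and iv :: "'m \<Rightarrow> 'm"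
  assumes lie: "lie_group M mul e iv"
begin

lemma grp: "group mul e iv" using lie by (simp add: lie_group_def)

lemma mul_assoc: "mul (mul a b) c = mul a (mul b c)"
proof -
  interpret group mul e iv by (rule grp)
  show ?thesis by (rule assoc)
qed

lemma mul_simps [simp]: "mul e a = a" "mul a e = a" "mul (iv a) a = e" "mul a (iv a) = e"
  "mul (iv a) (mul a b) = b" "mul a (mul (iv a) b) = b"
proof -
  interpret group mul e iv by (rule grp)
  show *: "mul e a = a" "mul a e = a" "mul (iv a) a = e" "mul a (iv a) = e" by simp_all
  show "mul (iv a) (mul a b) = b" "mul a (mul (iv a) b) = b"
    using * by (simp_all flip: mul_assoc)
qed

lemma VV: "subspace (V \<times> V)" by (rule subspace_Times[OF V V])

text \<open>The product \<open>mul a b\<close> may leave any fixed chart of the target, so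
  smoothness is checked near each pair, where one chart around the product serves.\<close>

lemma S_mul2:
  assumes f: "f \<in> S" and c: "(U, \<phi>) \<in> charts M" and d: "(W, \<psi>) \<in> charts M"
  shows "smooth_on (V \<times> V) (\<phi> ` U \<times> \<psi> ` W) (\<lambda>z. f (mul (inv_into U \<phi> (fst z)) (inv_into W \<psi> (snd z))))"
proof (rule smooth_on_local[OF VV openin_Times[OF chart_image[OF c] chart_image[OF d]]])
  fix z assume "z \<in> \<phi> ` U \<times> \<psi> ` W"
  then obtain a b where ab: "a \<in> U" "b \<in> W" "z = (\<phi> a, \<psi> b)" by auto
  obtain Y \<xi> where y: "(Y, \<xi>) \<in> charts M" "mul a b \<in> Y" using chart_at .
  let ?m = "\<lambda>(a, b). mul a b"
  have sm: "smooth_map (product_manifold M M) M ?m" using lie by (simp add: lie_group_def)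
  have "continuous_on UNIV ?m" using sm unfolding smooth_map_def by blast
  then have "open (?m -` Y)" using chart_open[OF y(1)] by (rule open_vimage[rotated])
  then have "open (?m -` Y \<inter> (U \<times> W))" using chart_open[OF c] chart_open[OF d] by (intro open_Int open_Times)
  moreover have "(a, b) \<in> ?m -` Y \<inter> (U \<times> W)" using ab y by simp
  ultimately obtain A B where AB: "open A" "open B" "a \<in> A" "b \<in> B" "A \<times> B \<subseteq> ?m -` Y \<inter> (U \<times> W)"
    by (rule open_prod_elim) auto
  have sub: "A \<subseteq> U" "B \<subseteq> W" using AB by auto
  let ?N = "\<phi> ` A \<times> \<psi> ` B"
  have oN: "openin (top_of_set (V \<times> V)) ?N"
    using openin_Times[OF chart_image_open_sub[OF c AB(1) sub(1)] chart_image_open_sub[OF d AB(2) sub(2)]] .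
  let ?t = "\<xi> \<circ> ?m \<circ> inv_into (U \<times> W) (map_prod \<phi> \<psi>)"
  have "(U \<times> W, map_prod \<phi> \<psi>) \<in> charts (product_manifold M M)" using c d by (auto simp: product_manifold_def)
  then have "smooth_on (V \<times> V) (map_prod \<phi> \<psi> ` ((U \<times> W) \<inter> ?m -` Y)) ?t"
    using sm y(1) unfolding smooth_map_def by (fastforce simp: product_manifold_def)
  moreover have "?N \<subseteq> map_prod \<phi> \<psi> ` ((U \<times> W) \<inter> ?m -` Y)"
  proof
    fix z assume "z \<in> ?N"
    then obtain a' b' where "a' \<in> A" "b' \<in> B" "z = map_prod \<phi> \<psi> (a', b')" by auto
    then show "z \<in> map_prod \<phi> \<psi> ` ((U \<times> W) \<inter> ?m -` Y)" using AB(5) by blast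
  qed
  ultimately have st: "smooth_on (V \<times> V) ?N ?t" by (rule smooth_on_subset)
  have inj: "inj_on (map_prod \<phi> \<psi>) (U \<times> W)"
    by (rule map_prod_inj_on[OF chart_inj[OF c] chart_inj[OF d]])
  have t: "?t (\<phi> a', \<psi> b') = \<xi> (mul a' b')" if "a' \<in> A" "b' \<in> B" for a' b'
  proof -
    have "(a', b') \<in> U \<times> W" using that sub by blast
    from inv_into_f_f[OF inj this] show ?thesis by simp
  qed
  have sm_t: "smooth_on (V \<times> V) ?N (\<lambda>z. (f \<circ> inv_into Y \<xi>) (?t z))"
  proof (rule smooth_on_compose[OF VV oN V chart_image[OF y(1)] _ st S_D[OF f y(1)]])
    show "?t ` ?N \<subseteq> \<xi> ` Y" using t AB(5) by auto
  qed
  have eq: "(f \<circ> inv_into Y \<xi>) (?t z) = f (mul (inv_into U \<phi> (fst z)) (inv_into W \<psi> (snd z)))" if "z \<in> ?N" for z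
  proof -
    obtain a' b' where z: "a' \<in> A" "b' \<in> B" "z = (\<phi> a', \<psi> b')" using \<open>z \<in> ?N\<close> by auto
    have "mul a' b' \<in> Y" using AB(5) z by auto
    then have "(f \<circ> inv_into Y \<xi>) (?t z) = f (mul a' b')"
      using t[OF z(1,2)] chart_inv[OF y(1)] z(3) by simp
    moreover have "inv_into U \<phi> (\<phi> a') = a'" "inv_into W \<psi> (\<psi> b') = b'"
      using z sub chart_inv[OF c, of a'] chart_inv[OF d, of b'] by blast+
    ultimately show ?thesis using z(3) by simp
  qed
  have "smooth_on (V \<times> V) ?N (\<lambda>z. f (mul (inv_into U \<phi> (fst z)) (inv_into W \<psi> (snd z))))"
    by (rule iffD1[OF smooth_on_cong[OF oN] sm_t], rule eq)
  then show "\<exists>N. openin (top_of_set (V \<times> V)) N \<and> z \<in> N \<and> N \<subseteq> \<phi> ` U \<times> \<psi> ` W \<and>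
      smooth_on (V \<times> V) N (\<lambda>z. f (mul (inv_into U \<phi> (fst z)) (inv_into W \<psi> (snd z))))"
    using oN ab AB sub by (intro exI[of _ ?N]) auto
qed

lemma S_left_translate:
  assumes f: "f \<in> S"
  shows "f \<circ> mul a \<in> S"
  unfolding smooth_functions_def
proof safe
  fix W \<psi> assume d: "(W, \<psi>) \<in> charts M"
  obtain U \<phi> where c: "(U, \<phi>) \<in> charts M" "a \<in> U" using chart_at .
  have "smooth_on V (\<psi> ` W) (\<lambda>y. (\<phi> a, 0) + (0, y))"
    by (intro smooth_on_add smooth_on_const smooth_on_bounded_linear bounded_linear_Pair bounded_linear_zero bounded_linear_ident)
  then have p: "smooth_on V (\<psi> ` W) (\<lambda>y. (\<phi> a, y))" by simp
  have "smooth_on V (\<psi> ` W) (\<lambda>y. (\<lambda>z. f (mul (inv_into U \<phi> (fst z)) (inv_into W \<psi> (snd z)))) (\<phi> a, y))"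
    by (rule smooth_on_compose[OF V chart_image[OF d] VV openin_Times[OF chart_image[OF c(1)] chart_image[OF d]] _ p S_mul2[OF f c(1) d]])
       (use c in auto)
  then show "smooth_on V (\<psi> ` W) (f \<circ> mul a \<circ> inv_into W \<psi>)"
    using chart_inv[OF c] by (simp add: o_def)
qed

lemma S_left_translate_iff: "f \<circ> mul a \<in> S \<longleftrightarrow> f \<in> S"
proof
  assume "f \<circ> mul a \<in> S"
  from S_left_translate[OF this, of "iv a"] show "f \<in> S" by (simp add: o_def)
qed (rule S_left_translate)

text \<open>In charts this is a partial derivative of the smooth two-variable function from
  \<open>S_mul2\<close>, in the direction \<open>(0, w)\<close>, restricted to the slice through the
  identity. It makes the left-invariant extension of a tangent vector at \<open>e\<close> a smooth
  field.\<close>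

lemma S_left_push:
  assumes u: "u \<in> T e" and f: "f \<in> S"
  shows "(\<lambda>p. u (f \<circ> mul p)) \<in> S"
  unfolding smooth_functions_def
proof safe
  fix U \<phi> assume c: "(U, \<phi>) \<in> charts M"
  obtain W \<psi> where d: "(W, \<psi>) \<in> charts M" "e \<in> W" using chart_at .
  obtain w where w: "w \<in> V" "\<And>h. h \<in> S \<Longrightarrow> u h = dd w (h \<circ> inv_into W \<psi>) (\<psi> e)"
    using tangent_vector_in_chart[OF u d] by blast
  let ?H = "\<lambda>z. f (mul (inv_into U \<phi> (fst z)) (inv_into W \<psi> (snd z)))"
  have o: "openin (top_of_set (V \<times> V)) (\<phi> ` U \<times> \<psi> ` W)"
    by (rule openin_Times[OF chart_image[OF c] chart_image[OF d(1)]])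
  have H: "smooth_on (V \<times> V) (\<phi> ` U \<times> \<psi> ` W) (dd (0, w) ?H)"
    by (rule smooth_on_dd[OF VV o S_mul2[OF f c d(1)]]) (use w subspace_0[OF V] in auto)
  have "smooth_on V (\<phi> ` U) (\<lambda>x. (0, \<psi> e) + (x, 0))"
    by (intro smooth_on_add smooth_on_const smooth_on_bounded_linear bounded_linear_Pair bounded_linear_zero bounded_linear_ident)
  then have p: "smooth_on V (\<phi> ` U) (\<lambda>x. (x, \<psi> e))" by simp
  have "smooth_on V (\<phi> ` U) (\<lambda>x. dd (0, w) ?H (x, \<psi> e))"
    by (rule smooth_on_compose[OF V chart_image[OF c] VV o _ p H]) (use d in auto)
  moreover have "dd (0, w) ?H (x, \<psi> e) = ((\<lambda>p. u (f \<circ> mul p)) \<circ> inv_into U \<phi>) x" for x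
    using w(2)[OF S_left_translate[OF f]] by (simp add: dd_def o_def)
  ultimately show "smooth_on V (\<phi> ` U) ((\<lambda>p. u (f \<circ> mul p)) \<circ> inv_into U \<phi>)"
    by (simp add: o_def)
qed

lemma left_push_T:
  assumes v: "v \<in> T p"
  shows "left_push mul a v \<in> T (mul a p)"
  unfolding tangent_space_def left_push_def
proof (intro CollectI conjI ballI allI impI)
  fix f h assume f: "f \<in> S" and h: "h \<in> S"
  note fh = S_left_translate[OF f, of a] S_left_translate[OF h, of a]
  show "v ((\<lambda>x. f x + h x) \<circ> mul a) = v (f \<circ> mul a) + v (h \<circ> mul a)"
    using T_D(1)[OF v fh] by (simp add: o_def)
  show "v ((\<lambda>x. f x * h x) \<circ> mul a) = f (mul a p) * v (h \<circ> mul a) + h (mul a p) * v (f \<circ> mul a)"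
    using T_D(3)[OF v fh] by (simp add: o_def)
next
  fix k f assume f: "f \<in> S"
  show "v ((\<lambda>x. k * f x) \<circ> mul a) = k * v (f \<circ> mul a)"
    using T_D(2)[OF v S_left_translate[OF f]] by (simp add: o_def)
next
  fix f assume "f \<notin> S"
  then show "v (f \<circ> mul a) = 0" using T_D(4)[OF v] S_left_translate_iff by blast
qed

abbreviation "LI \<equiv> left_invariant_fields M mul"

lemma LI_D: "X \<in> LI \<Longrightarrow> X \<in> VF" "X \<in> LI \<Longrightarrow> X (mul a p) f = X p (f \<circ> mul a)"
  by (auto simp: left_invariant_fields_def left_push_def)

lemma LI_of_tangent:
  assumes u: "u \<in> T e"
  shows "(\<lambda>p. left_push mul p u) \<in> LI"
proof -
  have "left_push mul p u \<in> T p" for p using left_push_T[OF u, of p] by simp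
  moreover have "vapp (\<lambda>p. left_push mul p u) f \<in> S" if "f \<in> S" for f
    using S_left_push[OF u that] by (simp add: vapp_def left_push_def)
  ultimately show ?thesis
    unfolding left_invariant_fields_def vector_fields_def by (auto simp: left_push_def o_def mul_assoc)
qed

text \<open>A tangent vector at \<open>p\<close> is translated to \<open>e\<close>, extended
  left-invariantly and expanded in the basis. Conversely a linear relation at one point is carried
  to every other point by a translation, so it is a relation between the fields.\<close>

lemma frame_of_LI_basis:
  fixes E :: "'j \<Rightarrow> 'm vfield"
  assumes J: "finite J" and E: "\<And>j. j \<in> J \<Longrightarrow> E j \<in> LI"
    and span: "\<And>X. X \<in> LI \<Longrightarrow> \<exists>c. X = (\<lambda>p f. \<Sum>j\<in>J. c j * E j p f)"
    and indep: "\<And>c j. (\<And>p f. (\<Sum>j\<in>J. c j * E j p f) = 0) \<Longrightarrow> j \<in> J \<Longrightarrow> c j = 0"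
  shows "frame_mfd M J E"
proof
  show "finite J" by (rule J)
  show "E j \<in> VF" if "j \<in> J" for j by (rule LI_D(1)[OF E[OF that]])
  show "\<exists>c. v = (\<lambda>f. \<Sum>j\<in>J. c j * E j p f)" if v: "v \<in> T p" for v p
  proof -
    have u: "left_push mul (iv p) v \<in> T e" using left_push_T[OF v, of "iv p"] by simp
    obtain c where c: "(\<lambda>q. left_push mul q (left_push mul (iv p) v)) = (\<lambda>p f. \<Sum>j\<in>J. c j * E j p f)"
      using span[OF LI_of_tangent[OF u]] by blast
    have "left_push mul p (left_push mul (iv p) v) = v" by (simp add: left_push_def o_def)
    then have "v = (\<lambda>f. \<Sum>j\<in>J. c j * E j p f)" using fun_cong[OF c, of p] by simp
    then show ?thesis by blast
  qed
  fix c j p assume 0: "\<And>f. f \<in> S \<Longrightarrow> (\<Sum>j\<in>J. c j * E j p f) = 0" and j: "j \<in> J"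
  show "c j = 0"
  proof (rule indep[OF _ j])
    fix q f
    show "(\<Sum>j\<in>J. c j * E j q f) = 0"
    proof (cases "f \<in> S")
      case True
      have q: "mul (mul q (iv p)) p = q" by (simp add: mul_assoc)
      have "E j q f = E j p (f \<circ> mul (mul q (iv p)))" if "j \<in> J" for j
        using LI_D(2)[OF E[OF that], of "mul q (iv p)" p f] by (simp only: q)
      then have "(\<Sum>j\<in>J. c j * E j q f) = (\<Sum>j\<in>J. c j * E j p (f \<circ> mul (mul q (iv p))))" by simp
      then show ?thesis using 0[OF S_left_translate[OF True]] by simp
    next
      case False
      then have "E j q f = 0" if "j \<in> J" for j using T_D(4)[OF VF_T[OF LI_D(1)[OF E[OF that]]]] by blast
      then show ?thesis by simp
    qed
  qed
qed

text \<open>The algebraic criterion that a Ricci operator equal to a scalar plus a diagonal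
  derivation suffices. The expression in \<open>ric\<close> is the Ricci tensor of the metric making
  \<open>E\<close> orthonormal, by nilpotency encoded in \<open>rk\<close>; \<open>d / 2\<close> is
  the derivation fed into \<open>soliton_field\<close>.\<close>

theorem nilsoliton:
  fixes E :: "'j \<Rightarrow> 'm vfield" and c :: "'j \<Rightarrow> 'j \<Rightarrow> 'j \<Rightarrow> real" and rk :: "'j \<Rightarrow> nat"
  assumes J: "finite J" and E: "\<And>j. j \<in> J \<Longrightarrow> E j \<in> LI"
    and span: "\<And>X. X \<in> LI \<Longrightarrow> \<exists>c. X = (\<lambda>p f. \<Sum>j\<in>J. c j * E j p f)"
    and indep: "\<And>c j. (\<And>p f. (\<Sum>j\<in>J. c j * E j p f) = 0) \<Longrightarrow> j \<in> J \<Longrightarrow> c j = 0"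
    and c: "\<And>i j p f. i \<in> J \<Longrightarrow> j \<in> J \<Longrightarrow> vbracket (E i) (E j) p f = (\<Sum>k\<in>J. c i j k * E k p f)"
    and rk: "\<And>i j k. i \<in> J \<Longrightarrow> j \<in> J \<Longrightarrow> k \<in> J \<Longrightarrow> c i j k \<noteq> 0 \<Longrightarrow> rk j < rk k"
    and der: "\<And>i j k. i \<in> J \<Longrightarrow> j \<in> J \<Longrightarrow> k \<in> J \<Longrightarrow> c i j k \<noteq> 0 \<Longrightarrow> d i + d j = d k"
    and ric: "\<And>b n. b \<in> J \<Longrightarrow> n \<in> J \<Longrightarrow>
       (\<Sum>i\<in>J. \<Sum>m\<in>J. c i m b * c i m n) / 4 - (\<Sum>i\<in>J. \<Sum>m\<in>J. c b i m * c n i m) / 2 = (if b = n then lam + d b else 0)"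
    and sc: "simply_connected (UNIV :: 'm set)"
  shows "\<exists>g. left_invariant_metric M mul g \<and> ricci_soliton M g"
proof -
  interpret frame_mfd M J E
  proof (rule frame_of_LI_basis[OF J E span])
    show "c j = 0" if "\<And>p f. (\<Sum>j\<in>J. c j * E j p f) = 0" "j \<in> J" for c j by (rule indep[OF that])
  qed
  interpret const_frame M J E c by unfold_locales (rule c)
  obtain X where X: "X \<in> VF" "\<And>j p f. j \<in> J \<Longrightarrow> vbracket X (E j) p f = - (d j / 2) * E j p f"
  proof (rule soliton_field[OF sc, of rk "\<lambda>j. d j / 2"])
    show "d i / 2 + d j / 2 = d k / 2" if "i \<in> J" "j \<in> J" "k \<in> J" "c i j k \<noteq> 0" for i j k
      using der[OF that] by simp
  qed (use rk in auto)
  have "ricci_soliton M metric"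
  proof (rule soliton[of lam d, OF _ X])
    fix b n assume bn: "b \<in> J" "n \<in> J"
    show "Ric b n = (if b = n then lam + d b else 0)"
      using Ric_nilpotent[of rk, OF rk bn] ric[OF bn] by simp
  qed
  moreover have "left_invariant_metric M mul metric"
    unfolding left_invariant_metric_def
  proof (intro conjI allI ballI riemannian_metric)
    fix a p u v assume u: "u \<in> T p" and v: "v \<in> T p"
    \<comment> \<open>The frame is left-invariant, so left translation does not change frame
      coefficients, and the metric depends on nothing else.\<close>
    have tc_push: "tc (mul a p) (left_push mul a u) j = tc p u j" if u: "u \<in> T p" and j: "j \<in> J" for u j
    proof (rule tc_unique[OF _ left_push_T[OF u] j])
      fix f assume "f \<in> S"
      show "left_push mul a u f = (\<Sum>j\<in>J. tc p u j * E j (mul a p) f)"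
        unfolding left_push_def tc[OF u, of "f \<circ> mul a"] by (rule sum.cong) (simp_all add: LI_D(2)[OF E])
    qed
    show "metric (mul a p) (left_push mul a u) (left_push mul a v) = metric p u v"
      unfolding metric_def by (rule sum.cong) (simp_all add: tc_push u v)
  qed
  ultimately show ?thesis by blast
qed

end

section \<open>The nilsoliton weights of a finite strict order\<close>

definition balanced :: "('v \<times> 'v) set \<Rightarrow> bool" where
  "balanced L \<longleftrightarrow> (\<forall>a b c x. (a, x) \<in> L \<and> (x, c) \<in> L \<and> (a, b) \<in> L \<and> (b, c) \<in> L \<longrightarrow>
     (x, b) \<in> L \<or> (b, x) \<in> L \<or> (L `` {x} = L `` {b} \<and> L\<inverse> `` {x} = L\<inverse> `` {b}))"

locale balanced_order =
  fixes L :: "('v \<times> 'v) set"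
  assumes fin: "finite L" and tr: "trans L" and irr: "(a, a) \<notin> L" and bal: "balanced L"
begin

definition between :: "'v \<Rightarrow> 'v \<Rightarrow> 'v set" where
  "between a c = {x. (a, x) \<in> L \<and> (x, c) \<in> L}"

text \<open>An element of \<open>Field L\<close> counts as its own sibling. This keeps the
  denominator of \<tau> positive and the exponents in \<open>w\<close> well defined.\<close>

definition sib :: "'v \<Rightarrow> 'v set" where
  "sib b = {x \<in> Field L. L `` {x} = L `` {b} \<and> L\<inverse> `` {x} = L\<inverse> `` {b}}"

definition \<tau> :: "'v \<Rightarrow> real" where
  "\<tau> b = 1 / real (card (L\<inverse> `` {b}) + card (L `` {b}) + card (sib b))"

text \<open>Each class of siblings in the interval contributes the factor \<open>\<tau>\<close> once.\<close>

definition w :: "'v \<Rightarrow> 'v \<Rightarrow> real" where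
  "w a c = (\<Prod>x\<in>between a c. \<tau> x powr (1 / real (card (sib x))))"

lemma fin_Field: "finite (Field L)" using fin by (rule finite_Field)

lemma fin_between: "finite (between a c)"
  by (rule finite_subset[OF _ fin_Field]) (auto simp: between_def Field_def)

lemma fin_sib: "finite (sib b)"
  by (rule finite_subset[OF _ fin_Field]) (auto simp: sib_def)

lemma L_trans: "(a, b) \<in> L \<Longrightarrow> (b, c) \<in> L \<Longrightarrow> (a, c) \<in> L"
  using tr by (rule transD)

lemma asym: "(a, b) \<in> L \<Longrightarrow> (b, a) \<notin> L"
  using L_trans irr by blast

context
  fixes b assumes b: "b \<in> Field L"
begin

lemma card_sib: "card (sib b) > 0"
  using b fin_sib[of b] by (auto simp: card_gt_0_iff sib_def)

lemma \<tau>_pos: "\<tau> b > 0"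
  unfolding \<tau>_def using card_sib by simp

lemma \<tau>_eq: "\<tau> b * (real (card (L\<inverse> `` {b})) + real (card (L `` {b})) + real (card (sib b))) = 1"
  unfolding \<tau>_def using card_sib by simp

end

lemma sib_eq: "x \<in> sib b \<Longrightarrow> sib x = sib b" and \<tau>_sib: "x \<in> sib b \<Longrightarrow> \<tau> x = \<tau> b"
proof -
  show *: "x \<in> sib b \<Longrightarrow> sib x = sib b" by (auto simp: sib_def)
  show "x \<in> sib b \<Longrightarrow> \<tau> x = \<tau> b" using * by (simp add: \<tau>_def) (simp add: sib_def)
qed

lemma w_pos: "w a c > 0"
  unfolding w_def by (rule prod_pos) (auto simp: between_def Field_def intro!: \<tau>_pos powr_gt_zero[THEN iffD2] less_imp_neq[symmetric])

context
  fixes a b c assumes ab: "(a, b) \<in> L" and bc: "(b, c) \<in> L"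
begin

text \<open>The one place where balance enters. An inner element of the interval is below
  \<open>b\<close>, above \<open>b\<close>, or a sibling of \<open>b\<close>; siblings share
  predecessors and successors with \<open>b\<close>, so they do lie in the interval.\<close>

lemma between_split:
  "between a c = between a b \<union> between b c \<union> sib b" "between a b \<inter> between b c = {}"
  "(between a b \<union> between b c) \<inter> sib b = {}"
proof -
  have sub: "x \<in> between a b \<union> between b c \<union> sib b" if x: "x \<in> between a c" for x
  proof -
    have "(x, b) \<in> L \<or> (b, x) \<in> L \<or> (L `` {x} = L `` {b} \<and> L\<inverse> `` {x} = L\<inverse> `` {b})"
      using bal ab bc x unfolding balanced_def between_def by blast
    then show ?thesis using x by (auto simp: between_def sib_def Field_def)
  qed
  have sib: "x \<in> between a c" if "x \<in> sib b" for x using that ab bc unfolding sib_def between_def by blast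
  have "between a b \<subseteq> between a c" "between b c \<subseteq> between a c"
    unfolding between_def using L_trans[OF ab] L_trans[OF _ bc] by blast+
  then show "between a c = between a b \<union> between b c \<union> sib b"
    using sub sib by blast
  show "between a b \<inter> between b c = {}" using asym by (auto simp: between_def)
  show "(between a b \<union> between b c) \<inter> sib b = {}"
    using irr by (auto simp: between_def sib_def)
qed

text \<open>The interval of \<open>a\<close> and \<open>c\<close> gains the class of siblings of
  \<open>b\<close>, whose equal factors, each a root of \<open>\<tau> b\<close> of order the class
  size, multiply to \<open>\<tau> b\<close>. The result holds for every intermediate
  \<open>b\<close>, which is the consistency required of the scaling.\<close>

lemma w_mult: "w a c = \<tau> b * (w a b * w b c)"
proof -
  have bF: "b \<in> Field L" using ab by (auto simp: Field_def)
  let ?f = "\<lambda>x. \<tau> x powr (1 / real (card (sib x)))"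
  have "w a c = prod ?f (between a b \<union> between b c) * prod ?f (sib b)"
    unfolding w_def between_split(1)
    by (rule prod.union_disjoint) (use fin_between fin_sib between_split(3) in auto)
  also have "prod ?f (between a b \<union> between b c) = w a b * w b c"
    unfolding w_def by (rule prod.union_disjoint) (use fin_between between_split(2) in auto)
  also have "prod ?f (sib b) = (\<Prod>x\<in>sib b. \<tau> b powr (1 / real (card (sib b))))"
    by (rule prod.cong) (auto simp: sib_eq \<tau>_sib)
  also have "\<dots> = (\<tau> b powr (1 / real (card (sib b)))) powr real (card (sib b))"
    using \<tau>_pos[OF bF] by (simp add: powr_realpow)
  also have "\<dots> = \<tau> b" using \<tau>_pos[OF bF] card_sib[OF bF] by (simp add: powr_powr)
  finally show ?thesis by simp
qed

lemma sum_\<tau>_between: "sum \<tau> (between a c) = sum \<tau> (between a b) + sum \<tau> (between b c) + real (card (sib b)) * \<tau> b"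
proof -
  have "sum \<tau> (between a c) = sum \<tau> (between a b \<union> between b c) + sum \<tau> (sib b)"
    unfolding between_split(1)
    by (rule sum.union_disjoint) (use fin_between fin_sib between_split(3) in auto)
  also have "sum \<tau> (between a b \<union> between b c) = sum \<tau> (between a b) + sum \<tau> (between b c)"
    by (rule sum.union_disjoint) (use fin_between between_split(2) in auto)
  also have "sum \<tau> (sib b) = (\<Sum>x\<in>sib b. \<tau> b)" by (rule sum.cong) (auto simp: \<tau>_sib)
  finally show ?thesis by simp
qed

text \<open>The vertex \<open>b\<close> itself lies in the long interval and in neither short one.
  This makes interval size a rank function that grows under multiplication.\<close>

lemma between_card: "card (between a b) < card (between a c)" "card (between b c) < card (between a c)"
proof -
  have "b \<in> between a c" "b \<notin> between a b" "b \<notin> between b c" using ab bc irr by (auto simp: between_def)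
  then show "card (between a b) < card (between a c)" "card (between b c) < card (between a c)"
    using between_split(1) by (auto intro!: psubset_card_mono fin_between fin_sib)
qed

end

text \<open>Structure constants of the associative product in the normalised basis: the product of
  \<open>E_ab / sqrt (w a b)\<close> and \<open>E_by / sqrt (w b y)\<close> is
  \<open>sqrt (w a y / (w a b * w b y))\<close> times the normalised \<open>E_ay\<close>, and the
  quotient under the root is \<open>\<tau> b\<close>. The \<open>Inr\<close> indices stand for
  differences at extra arrows, whose products vanish.\<close>

fun \<alpha> :: "('v \<times> 'v) + 'a \<Rightarrow> ('v \<times> 'v) + 'a \<Rightarrow> ('v \<times> 'v) + 'a \<Rightarrow> real" where
  "\<alpha> (Inl (a, b)) (Inl (x, y)) (Inl (u, v)) = (if b = x \<and> u = a \<and> v = y then sqrt (\<tau> b) else 0)"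
| "\<alpha> _ _ _ = 0"

lemma \<alpha>_cases:
  assumes "\<alpha> i j k \<noteq> 0"
  obtains a b y where "i = Inl (a, b)" "j = Inl (b, y)" "k = Inl (a, y)"
  using assms by (cases "(i, j, k)" rule: \<alpha>.cases) (auto split: if_splits)

definition c where "c i j k = \<alpha> i j k - \<alpha> j i k"

fun rk :: "('v \<times> 'v) + 'a \<Rightarrow> nat" where
  "rk (Inl (a, b)) = card (between a b)"
| "rk (Inr _) = 0"

text \<open>The Ricci eigenvalue plus 1/2. Central directions from extra arrows have Ricci
  eigenvalue 0, hence the value 1/2.\<close>

fun d :: "('v \<times> 'v) + 'a \<Rightarrow> real" where
  "d (Inl (a, b)) = 1 / 2 + (sum \<tau> (between a b) - real (card (L `` {b})) * \<tau> b - real (card (L\<inverse> `` {a})) * \<tau> a) / 2"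
| "d (Inr _) = 1 / 2"

section \<open>Rank, derivation and Ricci tensor of these structure constants\<close>

context
  fixes X :: "'a set" and J :: "(('v \<times> 'v) + 'a) set"
  assumes X: "finite X" and J_def: "J = Inl ` L \<union> Inr ` X"
begin

lemma finJ: "finite J" unfolding J_def using fin X by simp

lemma \<alpha>_J:
  assumes "i \<in> J" "j \<in> J" "\<alpha> i j k \<noteq> 0"
  obtains a b y where "(a, b) \<in> L" "(b, y) \<in> L" "i = Inl (a, b)" "j = Inl (b, y)" "k = Inl (a, y)"
proof (rule \<alpha>_cases[OF assms(3)])
  fix a b y assume *: "i = Inl (a, b)" "j = Inl (b, y)" "k = Inl (a, y)"
  then have "(a, b) \<in> L" "(b, y) \<in> L" using assms(1,2) unfolding J_def by auto
  with * show thesis by (intro that)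
qed

lemma c_nonzero: "c i j k \<noteq> 0 \<Longrightarrow> \<alpha> i j k \<noteq> 0 \<or> \<alpha> j i k \<noteq> 0"
  by (auto simp: c_def)

lemma rk_less:
  assumes "i \<in> J" "j \<in> J" "c i j k \<noteq> 0"
  shows "rk j < rk k"
proof -
  consider "\<alpha> i j k \<noteq> 0" | "\<alpha> j i k \<noteq> 0" using c_nonzero[OF assms(3)] by (elim disjE)
  then show ?thesis
  proof cases
    case 1
    from \<alpha>_J[OF assms(1,2) 1] show ?thesis using between_card(2) by (metis rk.simps(1))
  next
    case 2
    from \<alpha>_J[OF assms(2,1) 2] show ?thesis using between_card(1) by (metis rk.simps(1))
  qed
qed

lemma d_additive:
  assumes "i \<in> J" "j \<in> J" "c i j k \<noteq> 0"
  shows "d i + d j = d k"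
proof -
  \<comment> \<open>The terms at \<open>a\<close> and \<open>y\<close> cancel. What is left at
    \<open>b\<close> is \<open>\<tau> b\<close> times the number of predecessors, successors and
    siblings, which is 1 by the choice of \<tau> and compensates the surplus 1/2.\<close>
  have main: "d (Inl (a, b)) + d (Inl (b, y)) = d (Inl (a, y))" if ab: "(a, b) \<in> L" "(b, y) \<in> L" for a b y
  proof -
    have "b \<in> Field L" using ab by (auto simp: Field_def)
    from \<tau>_eq[OF this] have "real (card (L\<inverse> `` {b})) * \<tau> b + real (card (L `` {b})) * \<tau> b + real (card (sib b)) * \<tau> b = 1"
      by (simp add: algebra_simps)
    then show ?thesis using sum_\<tau>_between[OF ab] by (simp add: field_simps)
  qed
  consider "\<alpha> i j k \<noteq> 0" | "\<alpha> j i k \<noteq> 0" using c_nonzero[OF assms(3)] by (elim disjE)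
  then show ?thesis
  proof cases
    case 1
    from \<alpha>_J[OF assms(1,2) 1] show ?thesis using main by metis
  next
    case 2
    from \<alpha>_J[OF assms(2,1) 2] show ?thesis using main by (metis add.commute)
  qed
qed

text \<open>Reduces a double sum over basis elements to a sum over the single vertex that
  parametrises its nonzero terms.\<close>

lemma sum_sq_support:
  fixes f :: "'i \<Rightarrow> 'i \<Rightarrow> real"
  assumes A: "finite A" and inj: "inj_on (\<lambda>z. (s z, t z)) K" and st: "\<And>z. z \<in> K \<Longrightarrow> s z \<in> A \<and> t z \<in> A"
    and z: "\<And>i m. i \<in> A \<Longrightarrow> m \<in> A \<Longrightarrow> f i m \<noteq> 0 \<Longrightarrow> \<exists>z\<in>K. i = s z \<and> m = t z"
  shows "(\<Sum>i\<in>A. \<Sum>m\<in>A. f i m) = (\<Sum>z\<in>K. f (s z) (t z))"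
proof -
  let ?g = "\<lambda>z. (s z, t z)"
  have "(\<Sum>i\<in>A. \<Sum>m\<in>A. f i m) = (\<Sum>p\<in>A \<times> A. f (fst p) (snd p))"
    by (simp add: sum.cartesian_product case_prod_unfold)
  also have "\<dots> = (\<Sum>p\<in>?g ` K. f (fst p) (snd p))"
  proof (rule sum.mono_neutral_right)
    show "?g ` K \<subseteq> A \<times> A" using st by auto
    show "\<forall>p\<in>A \<times> A - ?g ` K. f (fst p) (snd p) = 0" using z by fastforce
  qed (use A in simp)
  also have "\<dots> = (\<Sum>z\<in>K. f (s z) (t z))" using inj by (simp add: sum.reindex)
  finally show ?thesis .
qed

context
  fixes p q assumes pq: "(p, q) \<in> L"
begin

text \<open>The basis element of \<open>(p, q)\<close> arises as a product once for each vertex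
  strictly between \<open>p\<close> and \<open>q\<close>. The two companion sums below count its
  products as a left and as a right factor, one for each successor of \<open>q\<close> or
  predecessor of \<open>p\<close>.\<close>

lemma \<alpha>_sum_target: "(\<Sum>i\<in>J. \<Sum>m\<in>J. \<alpha> i m (Inl (p, q)) * \<alpha> i m (Inl (p, q))) = sum \<tau> (between p q)"
proof -
  have "(\<Sum>i\<in>J. \<Sum>m\<in>J. \<alpha> i m (Inl (p, q)) * \<alpha> i m (Inl (p, q)))
    = (\<Sum>z\<in>between p q. \<alpha> (Inl (p, z) :: ('v \<times> 'v) + 'a) (Inl (z, q)) (Inl (p, q)) * \<alpha> (Inl (p, z) :: ('v \<times> 'v) + 'a) (Inl (z, q)) (Inl (p, q)))"
  proof (rule sum_sq_support[OF finJ, of "\<lambda>z. Inl (p, z)" "\<lambda>z. Inl (z, q)"])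
    fix i m assume im: "i \<in> J" "m \<in> J" "\<alpha> i m (Inl (p, q)) * \<alpha> i m (Inl (p, q)) \<noteq> 0"
    then have "\<alpha> i m (Inl (p, q)) \<noteq> 0" by simp
    from \<alpha>_J[OF im(1,2) this] obtain a b y where "(a, b) \<in> L" "(b, y) \<in> L" "i = Inl (a, b)" "m = Inl (b, y)"
      "Inl (p, q) = (Inl (a, y) :: ('v \<times> 'v) + 'a)" .
    then show "\<exists>z\<in>between p q. i = Inl (p, z) \<and> m = Inl (z, q)" unfolding between_def by auto
  qed (auto simp: inj_on_def between_def J_def)
  also have "\<dots> = sum \<tau> (between p q)"
  proof (rule sum.cong[OF refl])
    fix z assume "z \<in> between p q"
    then have "\<tau> z > 0" by (intro \<tau>_pos) (auto simp: between_def Field_def)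
    then show "\<alpha> (Inl (p, z) :: ('v \<times> 'v) + 'a) (Inl (z, q)) (Inl (p, q)) * \<alpha> (Inl (p, z) :: ('v \<times> 'v) + 'a) (Inl (z, q)) (Inl (p, q)) = \<tau> z"
      by simp
  qed
  finally show ?thesis .
qed

lemma \<alpha>_sum_left: "(\<Sum>i\<in>J. \<Sum>m\<in>J. \<alpha> (Inl (p, q)) i m * \<alpha> (Inl (p, q)) i m) = real (card (L `` {q})) * \<tau> q"
proof -
  have q: "\<tau> q > 0" by (rule \<tau>_pos) (use pq in \<open>auto simp: Field_def\<close>)
  have pJ: "Inl (p, q) \<in> J" using pq by (simp add: J_def)
  have "(\<Sum>i\<in>J. \<Sum>m\<in>J. \<alpha> (Inl (p, q)) i m * \<alpha> (Inl (p, q)) i m)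
    = (\<Sum>z\<in>L `` {q}. \<alpha> (Inl (p, q) :: ('v \<times> 'v) + 'a) (Inl (q, z)) (Inl (p, z)) * \<alpha> (Inl (p, q) :: ('v \<times> 'v) + 'a) (Inl (q, z)) (Inl (p, z)))"
  proof (rule sum_sq_support[OF finJ, of "\<lambda>z. Inl (q, z)" "\<lambda>z. Inl (p, z)"])
    fix i m assume im: "i \<in> J" "m \<in> J" "\<alpha> (Inl (p, q)) i m * \<alpha> (Inl (p, q)) i m \<noteq> 0"
    then have "\<alpha> (Inl (p, q)) i m \<noteq> 0" by simp
    from \<alpha>_J[OF pJ im(1) this] obtain a b y where "(b, y) \<in> L" "i = Inl (b, y)" "m = Inl (a, y)"
      "Inl (p, q) = (Inl (a, b) :: ('v \<times> 'v) + 'a)" .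
    then show "\<exists>z\<in>L `` {q}. i = Inl (q, z) \<and> m = Inl (p, z)" by auto
  next
    fix z assume "z \<in> L `` {q}"
    then show "Inl (q, z) \<in> J \<and> Inl (p, z) \<in> J" using L_trans[OF pq] by (auto simp: J_def)
  qed (auto simp: inj_on_def)
  also have "\<dots> = (\<Sum>z\<in>L `` {q}. \<tau> q)" using q by (intro sum.cong) auto
  finally show ?thesis by simp
qed

lemma \<alpha>_sum_right: "(\<Sum>i\<in>J. \<Sum>m\<in>J. \<alpha> i (Inl (p, q)) m * \<alpha> i (Inl (p, q)) m) = real (card (L\<inverse> `` {p})) * \<tau> p"
proof -
  have p: "\<tau> p > 0" by (rule \<tau>_pos) (use pq in \<open>auto simp: Field_def\<close>)
  have pJ: "Inl (p, q) \<in> J" using pq by (simp add: J_def)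
  have "(\<Sum>i\<in>J. \<Sum>m\<in>J. \<alpha> i (Inl (p, q)) m * \<alpha> i (Inl (p, q)) m)
    = (\<Sum>z\<in>L\<inverse> `` {p}. \<alpha> (Inl (z, p) :: ('v \<times> 'v) + 'a) (Inl (p, q)) (Inl (z, q)) * \<alpha> (Inl (z, p) :: ('v \<times> 'v) + 'a) (Inl (p, q)) (Inl (z, q)))"
  proof (rule sum_sq_support[OF finJ, of "\<lambda>z. Inl (z, p)" "\<lambda>z. Inl (z, q)"])
    fix i m assume im: "i \<in> J" "m \<in> J" "\<alpha> i (Inl (p, q)) m * \<alpha> i (Inl (p, q)) m \<noteq> 0"
    then have "\<alpha> i (Inl (p, q)) m \<noteq> 0" by simp
    from \<alpha>_J[OF im(1) pJ this] obtain a b y where "(a, b) \<in> L" "i = Inl (a, b)" "m = Inl (a, y)"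
      "Inl (p, q) = (Inl (b, y) :: ('v \<times> 'v) + 'a)" .
    then show "\<exists>z\<in>L\<inverse> `` {p}. i = Inl (z, p) \<and> m = Inl (z, q)" by auto
  next
    fix z assume "z \<in> L\<inverse> `` {p}"
    then show "Inl (z, p) \<in> J \<and> Inl (z, q) \<in> J" using L_trans[OF _ pq] by (auto simp: J_def)
  qed (auto simp: inj_on_def)
  also have "\<dots> = (\<Sum>z\<in>L\<inverse> `` {p}. \<tau> p)" using p by (intro sum.cong) auto
  finally show ?thesis by simp
qed

end

lemma ricci_diagonal:
  assumes b: "b \<in> J" and n: "n \<in> J"
  shows "(\<Sum>i\<in>J. \<Sum>m\<in>J. c i m b * c i m n) / 4 - (\<Sum>i\<in>J. \<Sum>m\<in>J. c b i m * c n i m) / 2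
     = (if b = n then - 1 / 2 + d b else 0)"
proof -
  \<comment> \<open>Otherwise two elements could be multiplied in both orders, forcing
    \<open>x < y\<close> and \<open>y < x\<close>.\<close>
  have 1: "\<alpha> i m b * \<alpha> m i n = 0" if im: "i \<in> J" "m \<in> J" for i m b n
  proof (rule ccontr)
    assume "\<alpha> i m b * \<alpha> m i n \<noteq> 0"
    then have nz: "\<alpha> i m b \<noteq> 0" "\<alpha> m i n \<noteq> 0" by auto
    obtain x y z where "(x, y) \<in> L" "(y, z) \<in> L" "i = Inl (x, y)" "m = Inl (y, z)" using \<alpha>_J[OF im nz(1)] by metis
    moreover obtain x' y' z' where "m = Inl (x', y')" "i = Inl (y', z')" using \<alpha>_J[OF im(2,1) nz(2)] by metis
    ultimately show False using asym by auto
  qed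
  \<comment> \<open>Multiplying \<open>i\<close> on the left moves its initial vertex strictly down,
    multiplying it on the right keeps that vertex, so the results cannot coincide. With
    \<open>1\<close>, all mixed products of \<alpha> in the quadratic sums are gone.\<close>
  have 2: "\<alpha> b i m * \<alpha> i n m = 0" if im: "i \<in> J" "b \<in> J" "n \<in> J" for i m b n
  proof (rule ccontr)
    assume "\<alpha> b i m * \<alpha> i n m \<noteq> 0"
    then have nz: "\<alpha> b i m \<noteq> 0" "\<alpha> i n m \<noteq> 0" by auto
    obtain x y z where "(x, y) \<in> L" "i = Inl (y, z)" "m = Inl (x, z)" using \<alpha>_J[OF im(2,1) nz(1)] by metis
    moreover obtain x' y' z' where "i = Inl (x', y')" "m = Inl (x', z')" using \<alpha>_J[OF im(1,3) nz(2)] by metis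
    ultimately show False using irr by auto
  qed
  have A: "(\<Sum>i\<in>J. \<Sum>m\<in>J. c i m b * c i m n) = 2 * (\<Sum>i\<in>J. \<Sum>m\<in>J. \<alpha> i m b * \<alpha> i m n)"
  proof -
    have "(\<Sum>i\<in>J. \<Sum>m\<in>J. c i m b * c i m n) = (\<Sum>i\<in>J. \<Sum>m\<in>J. \<alpha> i m b * \<alpha> i m n + \<alpha> m i b * \<alpha> m i n)"
    proof (intro sum.cong refl)
      fix i m assume im: "i \<in> J" "m \<in> J"
      have "c i m b * c i m n = \<alpha> i m b * \<alpha> i m n - \<alpha> i m b * \<alpha> m i n - \<alpha> m i b * \<alpha> i m n + \<alpha> m i b * \<alpha> m i n"
        by (simp add: c_def algebra_simps)
      then show "c i m b * c i m n = \<alpha> i m b * \<alpha> i m n + \<alpha> m i b * \<alpha> m i n"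
        unfolding 1[OF im, of b n] 1[OF im(2,1), of b n] by simp
    qed
    also have "\<dots> = (\<Sum>i\<in>J. \<Sum>m\<in>J. \<alpha> i m b * \<alpha> i m n) + (\<Sum>i\<in>J. \<Sum>m\<in>J. \<alpha> m i b * \<alpha> m i n)"
      by (simp add: sum.distrib)
    also have "(\<Sum>i\<in>J. \<Sum>m\<in>J. \<alpha> m i b * \<alpha> m i n) = (\<Sum>i\<in>J. \<Sum>m\<in>J. \<alpha> i m b * \<alpha> i m n)" by (rule sum.swap)
    finally show ?thesis by simp
  qed
  have B: "(\<Sum>i\<in>J. \<Sum>m\<in>J. c b i m * c n i m) = (\<Sum>i\<in>J. \<Sum>m\<in>J. \<alpha> b i m * \<alpha> n i m) + (\<Sum>i\<in>J. \<Sum>m\<in>J. \<alpha> i b m * \<alpha> i n m)"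
    unfolding sum.distrib[symmetric]
  proof (intro sum.cong refl)
    fix i m assume im: "i \<in> J" "m \<in> J"
    have "c b i m * c n i m = \<alpha> b i m * \<alpha> n i m - \<alpha> b i m * \<alpha> i n m - \<alpha> n i m * \<alpha> i b m + \<alpha> i b m * \<alpha> i n m"
      by (simp add: c_def algebra_simps)
    then show "c b i m * c n i m = \<alpha> b i m * \<alpha> n i m + \<alpha> i b m * \<alpha> i n m"
      unfolding 2[OF im(1) b n, of m] 2[OF im(1) n b, of m] by simp
  qed
  show ?thesis
  proof (cases "b = n")
    case True
    from b consider p q where "(p, q) \<in> L" "b = Inl (p, q)" | x where "b = Inr x" unfolding J_def by auto
    then show ?thesis
    proof cases
      case 1
      have db: "d b = 1 / 2 + (sum \<tau> (between p q) - real (card (L `` {q})) * \<tau> q - real (card (L\<inverse> `` {p})) * \<tau> p) / 2"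
        unfolding 1(2) by simp
      show ?thesis unfolding A B db using True
          \<alpha>_sum_target[OF 1(1), folded 1(2)] \<alpha>_sum_left[OF 1(1), folded 1(2)] \<alpha>_sum_right[OF 1(1), folded 1(2)]
        by (simp add: field_simps)
    next
      case (2 x)
      have "\<alpha> i m b = 0" "\<alpha> b i m = 0" "\<alpha> i b m = 0" for i m using 2 \<alpha>_cases by blast+
      moreover have "d b = 1 / 2" unfolding 2 by simp
      ultimately show ?thesis unfolding A B using True by simp
    qed
  next
    case False
    \<comment> \<open>Any two arguments of a nonzero \<alpha> determine the third, so distinct basis
      elements never meet in a common term and the Ricci tensor is diagonal.\<close>
    have z1: "\<alpha> i m b * \<alpha> i m n = 0" for i m
    proof (rule ccontr)
      assume "\<alpha> i m b * \<alpha> i m n \<noteq> 0"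
      then have nz: "\<alpha> i m b \<noteq> 0" "\<alpha> i m n \<noteq> 0" by auto
      show False using \<alpha>_cases[OF nz(1)] \<alpha>_cases[OF nz(2)] False by (metis Pair_inject sum.inject(1))
    qed
    have z2: "\<alpha> b i m * \<alpha> n i m = 0" for i m
    proof (rule ccontr)
      assume "\<alpha> b i m * \<alpha> n i m \<noteq> 0"
      then have nz: "\<alpha> b i m \<noteq> 0" "\<alpha> n i m \<noteq> 0" by auto
      show False using \<alpha>_cases[OF nz(1)] \<alpha>_cases[OF nz(2)] False by (metis Pair_inject sum.inject(1))
    qed
    have z3: "\<alpha> i b m * \<alpha> i n m = 0" for i m
    proof (rule ccontr)
      assume "\<alpha> i b m * \<alpha> i n m \<noteq> 0"
      then have nz: "\<alpha> i b m \<noteq> 0" "\<alpha> i n m \<noteq> 0" by auto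
      show False using \<alpha>_cases[OF nz(1)] \<alpha>_cases[OF nz(2)] False by (metis Pair_inject sum.inject(1))
    qed
    show ?thesis unfolding A B z1 z2 z3 using False by simp
  qed
qed

end

end

section \<open>Paths and array quivers\<close>

definition edges :: "('v, 'a) quiver \<Rightarrow> ('v \<times> 'v) set" where
  "edges Q = (\<lambda>a. (src Q a, tgt Q a)) ` arrows Q"

definition paths_between :: "('v, 'a) quiver \<Rightarrow> 'v \<Rightarrow> 'v \<Rightarrow> 'a list set" where
  "paths_between Q a b = {p. is_path Q p \<and> path_src Q p = a \<and> path_tgt Q p = b}"

lemma is_path_append:
  assumes "is_path Q p" "is_path Q q"
  shows "is_path Q (p @ q) \<longleftrightarrow> path_tgt Q p = path_src Q q"
  using assms by (auto simp: is_path_def successively_append_iff path_src_def path_tgt_def)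

lemma path_append_ends:
  assumes "p \<noteq> []" "q \<noteq> []"
  shows "path_src Q (p @ q) = path_src Q p" "path_tgt Q (p @ q) = path_tgt Q q"
  using assms by (auto simp: path_src_def path_tgt_def)

lemma is_path_appendD: "is_path Q (p @ q) \<Longrightarrow> p \<noteq> [] \<Longrightarrow> q \<noteq> [] \<Longrightarrow>
   is_path Q p \<and> is_path Q q \<and> path_tgt Q p = path_src Q q"
  by (auto simp: is_path_def successively_append_iff path_src_def path_tgt_def)

lemma is_path_single: "is_path Q [\<alpha>] \<longleftrightarrow> \<alpha> \<in> arrows Q"
  by (simp add: is_path_def)

lemma path_not_Nil: "is_path Q p \<Longrightarrow> p \<noteq> []"
  by (simp add: is_path_def)

lemma path_in_trancl: "is_path Q p \<Longrightarrow> (path_src Q p, path_tgt Q p) \<in> (edges Q)\<^sup>+"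
proof (induction p)
  case (Cons \<alpha> p)
  have e: "(src Q \<alpha>, tgt Q \<alpha>) \<in> edges Q" using Cons.prems by (auto simp: edges_def is_path_def)
  show ?case
  proof (cases "p = []")
    case True
    then show ?thesis using e by (auto simp: path_src_def path_tgt_def)
  next
    case False
    have "is_path Q p" "tgt Q \<alpha> = path_src Q p"
      using is_path_appendD[of Q "[\<alpha>]" p] Cons.prems False by (auto simp: path_tgt_def)
    then show ?thesis using Cons.IH e False
      by (auto simp: path_src_def path_tgt_def intro: trancl_into_trancl2)
  qed
qed (simp add: is_path_def)

lemma trancl_path: "(a, b) \<in> (edges Q)\<^sup>+ \<Longrightarrow> \<exists>p. p \<in> paths_between Q a b"
proof (induction rule: trancl_induct)
  case (base y)
  then obtain \<alpha> where "\<alpha> \<in> arrows Q" "a = src Q \<alpha>" "y = tgt Q \<alpha>" by (auto simp: edges_def)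
  then show ?case by (intro exI[of _ "[\<alpha>]"]) (simp add: paths_between_def is_path_single path_src_def path_tgt_def)
next
  case (step y z)
  then obtain p where p: "p \<in> paths_between Q a y" by blast
  obtain \<alpha> where "\<alpha> \<in> arrows Q" "y = src Q \<alpha>" "z = tgt Q \<alpha>" using step(2) by (auto simp: edges_def)
  then show ?case using p is_path_append[of Q p "[\<alpha>]"]
    by (intro exI[of _ "p @ [\<alpha>]"]) (auto simp: paths_between_def is_path_single path_src_def path_tgt_def is_path_def)
qed

text \<open>Inner elements of an interval are targets of relations, hence chosen elements of their
  columns. Elements chosen in the same column have the same predecessors and the same successors,
  and elements chosen in different columns are comparable.\<close>

lemma array_balanced:
  assumes "array_hasse_quiver Q"
  shows "balanced ((edges Q)\<^sup>+)"
proof -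
  obtain P r where ar: "array_taos P r" and hq: "hasse_quiver P r Q"
    using assms by (auto simp: array_hasse_quiver_def)
  obtain k n m col ch where k: "2 \<le> (k::nat)"
    and nm: "\<forall>i \<in> {1..k}. 1 \<le> n i \<and> 1 \<le> m i \<and> m i \<le> (n i :: nat)"
    and P: "P = (\<Union>i \<in> {1..k}. col i)" and dis: "disjoint_family_on col {1..k}"
    and ch: "\<forall>i \<in> {1..k}. ch i \<subseteq> col i \<and> card (ch i) = m i"
    and r: "r = (\<Union>i \<in> {1..<k}. col i \<times> ch (Suc i))\<^sup>+"
    using ar unfolding array_taos_def by (elim exE conjE) blast
  define A where "A = (\<Union>i \<in> {1..<k}. col i \<times> ch (Suc i))"
  \<comment> \<open>The transitive closure in closed form: from any element of a column to the
    chosen elements of every later column.\<close>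
  define R where "R = {(x, y). \<exists>i j. 1 \<le> i \<and> i < j \<and> j \<le> k \<and> x \<in> col i \<and> y \<in> ch j}"
  have ch_col: "y \<in> col i" if "y \<in> ch i" "1 \<le> i" "i \<le> k" for y i using ch that by auto
  have col_eq: "i = j" if "x \<in> col i" "x \<in> col j" "1 \<le> i" "i \<le> k" "1 \<le> j" "j \<le> k" for x i j
    using dis that unfolding disjoint_family_on_def by (metis IntI atLeastAtMost_iff empty_iff)
  have AR: "A\<^sup>+ = R"
  proof (intro equalityI subrelI)
    fix x y assume "(x, y) \<in> A\<^sup>+"
    then show "(x, y) \<in> R"
    proof (induction rule: trancl_induct)
      case (base y)
      then obtain i where "i \<in> {1..<k}" "x \<in> col i" "y \<in> ch (Suc i)" by (auto simp: A_def)
      then have "1 \<le> i \<and> i < Suc i \<and> Suc i \<le> k \<and> x \<in> col i \<and> y \<in> ch (Suc i)" by simp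
      then show ?case unfolding R_def by blast
    next
      case (step y z)
      then obtain i j where ij: "1 \<le> i" "i < j" "j \<le> k" "x \<in> col i" "y \<in> ch j" by (auto simp: R_def)
      obtain l where l: "l \<in> {1..<k}" "y \<in> col l" "z \<in> ch (Suc l)" using step(2) by (auto simp: A_def)
      have "l = j" using col_eq[of y l j] ch_col[of y j] ij l by auto
      then have "1 \<le> i \<and> i < Suc j \<and> Suc j \<le> k \<and> x \<in> col i \<and> z \<in> ch (Suc j)" using ij l by simp
      then show ?case unfolding R_def by blast
    qed
  next
    fix x y assume "(x, y) \<in> R"
    then obtain i j where ij: "1 \<le> i" "i < j" "j \<le> k" "x \<in> col i" "y \<in> ch j" by (auto simp: R_def)
    have "Suc i \<le> j" using ij by simp
    then have "j \<le> k \<longrightarrow> (\<forall>y \<in> ch j. (x, y) \<in> A\<^sup>+)"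
    proof (induction rule: dec_induct)
      case base
      have "(x, y) \<in> A" if "y \<in> ch (Suc i)" for y using ij that unfolding A_def by auto
      then show ?case by blast
    next
      case (step j)
      show ?case
      proof (intro impI ballI)
        fix y assume j: "Suc j \<le> k" and y: "y \<in> ch (Suc j)"
        have jk: "1 \<le> j" "j \<le> k" using step j ij by auto
        \<comment> \<open>The bound \<open>1 \<le> m j\<close> supplies a chosen element in each
          intermediate column, through which the chain can pass.\<close>
        then have "card (ch j) \<ge> 1" using ch nm by auto
        then obtain z where z: "z \<in> ch j" by (metis One_nat_def Suc_le_eq card_gt_0_iff ex_in_conv)
        have "(x, z) \<in> A\<^sup>+" using step.IH j z by auto
        moreover have "(z, y) \<in> A" using ch_col[OF z jk] y j jk by (auto simp: A_def)
        ultimately show "(x, y) \<in> A\<^sup>+" by (rule trancl_into_trancl)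
      qed
    qed
    then show "(x, y) \<in> A\<^sup>+" using ij by blast
  qed
  have "edges Q \<subseteq> A\<^sup>+"
    using hq r unfolding hasse_quiver_def covers_def edges_def A_def by auto
  then have sub1: "(edges Q)\<^sup>+ \<subseteq> A\<^sup>+" by (metis trancl_mono_subset trancl_id trans_trancl)
  \<comment> \<open>Generating pairs join neighbouring columns, and an element in between would need
    a column index strictly between \<open>i\<close> and \<open>Suc i\<close>. So all of them
    survive as arrows of the Hasse quiver.\<close>
  have "A \<subseteq> edges Q"
  proof (rule subrelI)
    fix a b assume ab: "(a, b) \<in> A"
    then obtain i where i: "i \<in> {1..<k}" "a \<in> col i" "b \<in> ch (Suc i)" by (auto simp: A_def)
    have bc: "b \<in> col (Suc i)" using ch_col[OF i(3)] i by auto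
    have "covers P r a b"
      unfolding covers_def
    proof (intro conjI notI)
      show "a \<in> P" using P i by auto
      show "b \<in> P" using P bc i by auto
      show "(a, b) \<in> r" unfolding r A_def[symmetric] using ab by (rule r_into_trancl)
      show False if "a = b" using that col_eq[of a i "Suc i"] i bc by auto
      assume "\<exists>t\<in>P - {a, b}. (a, t) \<in> r \<and> (t, b) \<in> r"
      then obtain t where t: "(a, t) \<in> R" "(t, b) \<in> R" using r AR A_def by auto
      obtain i1 j1 where 1: "1 \<le> i1" "i1 < j1" "j1 \<le> k" "a \<in> col i1" "t \<in> ch j1" using t(1) by (auto simp: R_def)
      obtain i2 j2 where 2: "1 \<le> i2" "i2 < j2" "j2 \<le> k" "t \<in> col i2" "b \<in> ch j2" using t(2) by (auto simp: R_def)
      have "i1 = i" using col_eq[of a i1 i] 1 i by auto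
      moreover have "j1 = i2" using col_eq[of t j1 i2] ch_col[of t j1] 1 2 by auto
      moreover have "j2 = Suc i" using col_eq[of b j2 "Suc i"] ch_col[of b j2] 2 bc i by auto
      ultimately show False using 1 2 by simp
    qed
    then obtain \<alpha> where "\<alpha> \<in> arrows Q" "src Q \<alpha> = a" "tgt Q \<alpha> = b"
      using hq unfolding hasse_quiver_def by blast
    then show "(a, b) \<in> edges Q" by (auto simp: edges_def)
  qed
  then have "A\<^sup>+ \<subseteq> (edges Q)\<^sup>+" by (rule trancl_mono_subset)
  with sub1 AR have L: "(edges Q)\<^sup>+ = R" by blast
  show ?thesis unfolding L balanced_def
  proof (intro allI impI)
    fix a b c x assume *: "(a, x) \<in> R \<and> (x, c) \<in> R \<and> (a, b) \<in> R \<and> (b, c) \<in> R"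
    have tgt: "\<exists>j. 1 \<le> j \<and> j \<le> k \<and> z \<in> ch j" if yz: "(y, z) \<in> R" for y z
    proof -
      obtain i j where "1 \<le> i" "i < j" "j \<le> k" "z \<in> ch j" using yz unfolding R_def by blast
      then show ?thesis by (intro exI[of _ j]) simp
    qed
    obtain i where i: "1 \<le> i" "i \<le> k" "x \<in> ch i" using tgt * by blast
    obtain j where j: "1 \<le> j" "j \<le> k" "b \<in> ch j" using tgt * by blast
    have xi: "x \<in> col i" and bj: "b \<in> col j" using ch_col i j by auto
    have out: "(y, z) \<in> R \<longleftrightarrow> (\<exists>l. i < l \<and> l \<le> k \<and> z \<in> ch l)" if "y \<in> col i" "1 \<le> i" "i \<le> k" for y z i
    proof
      assume "(y, z) \<in> R"
      then obtain i' l where l: "1 \<le> i'" "i' < l" "l \<le> k" "y \<in> col i'" "z \<in> ch l" unfolding R_def by blast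
      have "i' = i" using col_eq[OF l(4) that(1)] l that by simp
      then show "\<exists>l. i < l \<and> l \<le> k \<and> z \<in> ch l" using l by blast
    qed (use that in \<open>unfold R_def, blast\<close>)
    have inn: "(z, y) \<in> R \<longleftrightarrow> (\<exists>l. 1 \<le> l \<and> l < i \<and> z \<in> col l)" if "y \<in> ch i" "1 \<le> i" "i \<le> k" for y z i
    proof
      assume "(z, y) \<in> R"
      then obtain l i' where l: "1 \<le> l" "l < i'" "i' \<le> k" "z \<in> col l" "y \<in> ch i'" unfolding R_def by blast
      have "y \<in> col i'" "y \<in> col i" using ch_col l that by auto
      then have "i' = i" using col_eq[of y i' i] l that by simp
      then show "\<exists>l. 1 \<le> l \<and> l < i \<and> z \<in> col l" using l by blast
    qed (use that in \<open>unfold R_def, blast\<close>)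
    consider "i < j" | "j < i" | "i = j" by linarith
    then show "(x, b) \<in> R \<or> (b, x) \<in> R \<or> (R `` {x} = R `` {b} \<and> R\<inverse> `` {x} = R\<inverse> `` {b})"
    proof cases
      case 1 then show ?thesis using i j xi by (auto simp: R_def)
    next
      case 2 then show ?thesis using i j bj by (auto simp: R_def)
    next
      case 3
      have "R `` {x} = R `` {b}" using out[OF xi i(1,2)] out[OF bj j(1,2)] 3 by auto
      moreover have "R\<inverse> `` {x} = R\<inverse> `` {b}" using inn[OF i(3,1,2)] inn[OF j(3,1,2)] 3 by auto
      ultimately show ?thesis by blast
    qed
  qed
qed

lemma path_algebra_product_elems:
  assumes "is_path Q p" "is_path Q q"
  shows "rmul (path_algebra Q) (path_elem p) (path_elem q) =
    (if path_tgt Q p = path_src Q q then path_elem (p @ q) else (\<lambda>_. 0))"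
proof
  fix s
  have ne: "p \<noteq> []" "q \<noteq> []" using assms by (auto simp: is_path_def)
  have "(\<Sum>i\<in>{1..<length s}. path_elem p (take i s) * path_elem q (drop i s)) = (if s = p @ q then 1 else 0)"
  proof (cases "s = p @ q")
    case True
    have "(\<Sum>i\<in>{1..<length s}. path_elem p (take i s) * path_elem q (drop i s)) = (\<Sum>i\<in>{length p}. 1)"
    proof (rule sum.mono_neutral_cong_right)
      show "\<forall>i\<in>{1..<length s} - {length p}. path_elem p (take i s) * path_elem q (drop i s) = 0"
        by (auto simp: path_elem_def)
      show "{length p} \<subseteq> {1..<length s}" using True ne by (auto simp: Suc_le_eq)
    qed (use True in \<open>auto simp: path_elem_def\<close>)
    then show ?thesis using True by simp
  next
    case False
    have z: "path_elem p (take i s) * path_elem q (drop i s) = 0" for i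
      using False by (auto simp: path_elem_def)
    show ?thesis unfolding z using False by simp
  qed
  then show "rmul (path_algebra Q) (path_elem p) (path_elem q) s =
      (if path_tgt Q p = path_src Q q then path_elem (p @ q) else (\<lambda>_. 0)) s"
    using is_path_append[OF assms] by (auto simp: path_algebra_def path_elem_def)
qed

text \<open>Two vertices inside one interval give two paths of length at least two with common ends,
  which the hypothesis on parallel paths forces into a single component. Paths never change
  component, so predecessors and successors of the two vertices can be computed in that component,
  where \<open>array_balanced\<close> applies.\<close>

lemma components_balanced:
  assumes "components_array_condition Q"
  shows "balanced ((edges Q)\<^sup>+)"
proof -
  obtain C where C: "algebraic_components Q C" and ar: "\<forall>B \<in> C. array_hasse_quiver (arrow_subquiver Q B)"
    and par: "\<And>B B' p p'. B \<in> C \<Longrightarrow> B' \<in> C \<Longrightarrow> is_path (arrow_subquiver Q B) p \<Longrightarrow> is_path (arrow_subquiver Q B') p' \<Longrightarrow>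
       2 \<le> length p \<Longrightarrow> 2 \<le> length p' \<Longrightarrow> path_src Q p = path_src Q p' \<Longrightarrow> path_tgt Q p = path_tgt Q p' \<Longrightarrow> B = B'"
  proof -
    obtain C where C: "algebraic_components Q C" "\<forall>B \<in> C. array_hasse_quiver (arrow_subquiver Q B)"
      "\<forall>B \<in> C. \<forall>B' \<in> C. B \<noteq> B' \<longrightarrow>
           \<not> (\<exists>p p'. is_path (arrow_subquiver Q B) p \<and> is_path (arrow_subquiver Q B') p' \<and>
                 2 \<le> length p \<and> 2 \<le> length p' \<and>
                 path_src Q p = path_src Q p' \<and> path_tgt Q p = path_tgt Q p')"
      using assms unfolding components_array_condition_def by (elim exE conjE)
    have "B = B'" if "B \<in> C" "B' \<in> C" "is_path (arrow_subquiver Q B) p" "is_path (arrow_subquiver Q B') p'"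
       "2 \<le> length p" "2 \<le> length p'" "path_src Q p = path_src Q p'" "path_tgt Q p = path_tgt Q p'" for B B' p p'
    proof (rule ccontr)
      assume "B \<noteq> B'"
      with C(3)[rule_format, OF that(1,2)] show False using that(3-8) by (metis (full_types))
    qed
    with C(1,2) show ?thesis by (rule that)
  qed
  have orth: "\<forall>B \<in> C. \<forall>B' \<in> C. B \<noteq> B' \<longrightarrow>
        (\<forall>x \<in> rcarrier (path_algebra (arrow_subquiver Q B)).
         \<forall>y \<in> rcarrier (path_algebra (arrow_subquiver Q B')). rmul (path_algebra Q) x y = (\<lambda>_. 0))"
    using C unfolding algebraic_components_def by (elim conjE)
  have un: "\<Union> C = arrows Q" using C by (simp add: algebraic_components_def)
  let ?S = "arrow_subquiver Q"
  have sub_path: "is_path (?S B) p \<longleftrightarrow> is_path Q p \<and> set p \<subseteq> B" if "B \<in> C" for B p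
    using un that by (auto simp: is_path_def arrow_subquiver_def)
  have ends: "path_src (?S B) p = path_src Q p" "path_tgt (?S B) p = path_tgt Q p" for B p
    by (auto simp: path_src_def path_tgt_def arrow_subquiver_def)
  \<comment> \<open>Composable arrows from different components would have a nonzero product,
    against the direct sum decomposition of the algebra.\<close>
  have consec: "B = B'" if "B \<in> C" "B' \<in> C" "\<alpha> \<in> B" "\<beta> \<in> B'" "tgt Q \<alpha> = src Q \<beta>" for B B' \<alpha> \<beta>
  proof (rule ccontr)
    assume ne: "B \<noteq> B'"
    have 1: "is_path Q [\<alpha>]" "is_path Q [\<beta>]" using that un by (auto simp: is_path_single)
    have "path_elem [\<alpha>] \<in> rcarrier (path_algebra (?S B))" "path_elem [\<beta>] \<in> rcarrier (path_algebra (?S B'))"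
      using that by (auto simp: path_algebra_def path_elem_def is_path_def arrow_subquiver_def)
    then have "rmul (path_algebra Q) (path_elem [\<alpha>]) (path_elem [\<beta>]) = (\<lambda>_. 0)"
      by (rule orth[rule_format, OF that(1,2) ne])
    then have "path_elem [\<alpha>, \<beta>] = (\<lambda>_. 0)"
      using path_algebra_product_elems[OF 1] that(5) by (simp add: path_src_def path_tgt_def)
    then have "path_elem [\<alpha>, \<beta>] [\<alpha>, \<beta>] = 0" by simp
    then show False by (simp add: path_elem_def)
  qed
  have "disjoint C" using C by (simp add: algebraic_components_def)
  then have uniq: "X = Y" if "X \<in> C" "Y \<in> C" "z \<in> X" "z \<in> Y" for X Y z
    using that by (metis disjointD disjoint_iff)
  have in_comp: "set p \<subseteq> B" if "is_path Q p" "B \<in> C" "set p \<inter> B \<noteq> {}" for p B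
    using that
  proof (induction p)
    case (Cons \<alpha> p)
    show ?case
    proof (cases "p = []")
      case True then show ?thesis using Cons.prems by auto
    next
      case False
      have p: "is_path Q p" "tgt Q \<alpha> = src Q (hd p)"
        using is_path_appendD[of Q "[\<alpha>]" p] Cons.prems(1) False by (auto simp: path_src_def path_tgt_def)
      have "\<alpha> \<in> arrows Q" "hd p \<in> arrows Q" using Cons.prems(1) False by (auto simp: is_path_def)
      then obtain B1 B2 where B12: "B1 \<in> C" "\<alpha> \<in> B1" "B2 \<in> C" "hd p \<in> B2" using un by blast
      have "B1 = B2" by (rule consec[OF B12(1,3,2,4) p(2)])

      show ?thesis
      proof (cases "\<alpha> \<in> B")
        case True
        then have "hd p \<in> B" using uniq[OF B12(1) Cons.prems(2) B12(2)] \<open>B1 = B2\<close> B12 by simp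
        then have "set p \<inter> B \<noteq> {}" using False by (metis disjoint_iff hd_in_set)
        then show ?thesis using Cons.IH p(1) Cons.prems(2) True by simp
      next
        case f: False
        then have "set p \<inter> B \<noteq> {}" using Cons.prems(3) by auto
        then have "set p \<subseteq> B" using Cons.IH p(1) Cons.prems(2) by blast
        then have "hd p \<in> B" using False by auto
        then have "B = B2" using uniq[OF Cons.prems(2) B12(3)] B12(4) by blast
        then show ?thesis using f B12 \<open>B1 = B2\<close> by blast
      qed
    qed
  qed simp
  show ?thesis unfolding balanced_def
  proof (intro allI impI, elim conjE)
    let ?L = "(edges Q)\<^sup>+"
    fix a b c x assume L: "(a, x) \<in> ?L" "(x, c) \<in> ?L" "(a, b) \<in> ?L" "(b, c) \<in> ?L"
    from L obtain p q p' q' where p: "p \<in> paths_between Q a x" "q \<in> paths_between Q x c" "p' \<in> paths_between Q a b" "q' \<in> paths_between Q b c"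
      using trancl_path by meson
    have cat: "s @ t \<in> paths_between Q u z \<and> 2 \<le> length (s @ t)" if "s \<in> paths_between Q u y" "t \<in> paths_between Q y z" for s t u y z
    proof -
      have "s \<noteq> []" "t \<noteq> []" using that by (auto simp: paths_between_def is_path_def)
      then have "1 \<le> length s" "1 \<le> length t" by (auto simp: Suc_le_eq)
      then show ?thesis using that is_path_append[of Q s t] path_append_ends[of s t Q] \<open>s \<noteq> []\<close> \<open>t \<noteq> []\<close>
        by (auto simp: paths_between_def)
    qed
    have comp: "\<exists>B\<in>C. set s \<subseteq> B" if "is_path Q s" for s
    proof -
      have "hd s \<in> arrows Q" "hd s \<in> set s" using that by (auto simp: is_path_def)
      then obtain B where "B \<in> C" "hd s \<in> B" using un by blast
      then show ?thesis using in_comp[OF that] \<open>hd s \<in> set s\<close> by blast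
    qed
    have pq: "is_path Q (p @ q)" and pq': "is_path Q (p' @ q')" using cat p by (auto simp: paths_between_def)
    obtain B where B: "B \<in> C" "set (p @ q) \<subseteq> B" using comp[OF pq] by blast
    obtain B' where B': "B' \<in> C" "set (p' @ q') \<subseteq> B'" using comp[OF pq'] by blast
    have "B = B'"
      by (rule par[OF B(1) B'(1), of "p @ q" "p' @ q'"])
         (use cat[OF p(1,2)] cat[OF p(3,4)] B B' sub_path in \<open>auto simp: paths_between_def\<close>)
    let ?M = "(edges (?S B))\<^sup>+"
    have inM: "(u, v) \<in> ?M" if "s \<in> paths_between Q u v" "set s \<subseteq> B" for s u v
      using path_in_trancl[of "?S B" s] sub_path[OF B(1), of s] that ends by (auto simp: paths_between_def)
    have MsubL: "?M \<subseteq> ?L"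
    proof (rule trancl_mono_subset)
      show "edges (?S B) \<subseteq> edges Q" using un B(1) by (auto simp: edges_def arrow_subquiver_def)
    qed
    have M: "(a, x) \<in> ?M" "(x, c) \<in> ?M" "(a, b) \<in> ?M" "(b, c) \<in> ?M"
      using inM p B B' \<open>B = B'\<close> by auto
    \<comment> \<open>A vertex at which some path in \<open>B\<close> ends may also lie in other
      components. But any continuation, appended to that path, forms a path meeting
      \<open>B\<close>, and so stays in \<open>B\<close>. The mirror image \<open>pred\<close>
      prepends instead.\<close>
    have succ: "?L `` {y} = ?M `` {y}" if s: "s \<in> paths_between Q u y" "set s \<subseteq> B" for s u y
    proof (intro equalityI subsetI)
      fix z assume "z \<in> ?L `` {y}"
      then have "(y, z) \<in> ?L" by simp
      from trancl_path[OF this] obtain t where t: "t \<in> paths_between Q y z" by (elim exE)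
      have "is_path Q (s @ t)" using cat[OF s(1) t] by (simp add: paths_between_def)
      moreover have "s \<noteq> []" using s by (auto simp: paths_between_def is_path_def)
      then have "set (s @ t) \<inter> B \<noteq> {}" using s(2) by (cases s) auto
      ultimately have "set (s @ t) \<subseteq> B" using in_comp[OF _ B(1)] by blast
      then show "z \<in> ?M `` {y}" using inM[OF t] by auto
    next
      fix z assume "z \<in> ?M `` {y}"
      then have "(y, z) \<in> ?M" by simp
      then have "(y, z) \<in> ?L" using MsubL by (rule subsetD[rotated])
      then show "z \<in> ?L `` {y}" by simp
    qed
    have pred: "?L\<inverse> `` {y} = ?M\<inverse> `` {y}" if s: "s \<in> paths_between Q y u" "set s \<subseteq> B" for s u y
    proof (intro equalityI subsetI)
      fix z assume "z \<in> ?L\<inverse> `` {y}"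
      then have "(z, y) \<in> ?L" by simp
      from trancl_path[OF this] obtain t where t: "t \<in> paths_between Q z y" by (elim exE)
      have "is_path Q (t @ s)" using cat[OF t s(1)] by (simp add: paths_between_def)
      moreover have "s \<noteq> []" using s by (auto simp: paths_between_def is_path_def)
      then have "set (t @ s) \<inter> B \<noteq> {}" using s(2) by (cases s) auto
      ultimately have "set (t @ s) \<subseteq> B" using in_comp[OF _ B(1)] by blast
      then show "z \<in> ?M\<inverse> `` {y}" using inM[OF t] by auto
    next
      fix z assume "z \<in> ?M\<inverse> `` {y}"
      then have "(z, y) \<in> ?M" by simp
      then have "(z, y) \<in> ?L" using MsubL by (rule subsetD[rotated])
      then show "z \<in> ?L\<inverse> `` {y}" by simp
    qed
    have "balanced ?M" using array_balanced ar B(1) by blast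
    then have "(x, b) \<in> ?M \<or> (b, x) \<in> ?M \<or> (?M `` {x} = ?M `` {b} \<and> ?M\<inverse> `` {x} = ?M\<inverse> `` {b})"
      using M unfolding balanced_def by blast
    moreover have LM: "?L `` {x} = ?M `` {x}" "?L `` {b} = ?M `` {b}" "?L\<inverse> `` {x} = ?M\<inverse> `` {x}" "?L\<inverse> `` {b} = ?M\<inverse> `` {b}"
      using succ[OF p(1)] succ[OF p(3)] pred[OF p(2)] pred[OF p(4)] B B' \<open>B = B'\<close> by auto
    ultimately show "(x, b) \<in> ?L \<or> (b, x) \<in> ?L \<or> (?L `` {x} = ?L `` {b} \<and> ?L\<inverse> `` {x} = ?L\<inverse> `` {b})"
      unfolding LM using subsetD[OF MsubL] by (elim disjE) auto
  qed
qed

section \<open>The quotient of the path algebra\<close>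

lemma path_algebra_simps:
  "rcarrier (path_algebra Q) = {x. \<forall>p. x p \<noteq> 0 \<longrightarrow> is_path Q p}"
  "radd (path_algebra Q) x y = (\<lambda>p. x p + y p)"
  "rscale (path_algebra Q) c x = (\<lambda>p. c * x p)"
  by (simp_all add: path_algebra_def)

lemma rmul_path_algebra:
  "rmul (path_algebra Q) x y p = (if is_path Q p then \<Sum>i \<in> {1..<length p}. x (take i p) * y (drop i p) else 0)"
  by (simp add: path_algebra_def)

lemma rmul_path_algebra_linear:
  "rmul (path_algebra Q) (\<lambda>p. x p + x' p) y = (\<lambda>p. rmul (path_algebra Q) x y p + rmul (path_algebra Q) x' y p)"
  "rmul (path_algebra Q) x (\<lambda>p. y p + y' p) = (\<lambda>p. rmul (path_algebra Q) x y p + rmul (path_algebra Q) x y' p)"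
  "rmul (path_algebra Q) (\<lambda>p. x p - x' p) y = (\<lambda>p. rmul (path_algebra Q) x y p - rmul (path_algebra Q) x' y p)"
  "rmul (path_algebra Q) x (\<lambda>p. y p - y' p) = (\<lambda>p. rmul (path_algebra Q) x y p - rmul (path_algebra Q) x y' p)"
  "rmul (path_algebra Q) (\<lambda>p. a * x p) y = (\<lambda>p. a * rmul (path_algebra Q) x y p)"
  "rmul (path_algebra Q) x (\<lambda>p. a * y p) = (\<lambda>p. a * rmul (path_algebra Q) x y p)"
  by (auto simp: rmul_path_algebra algebra_simps sum.distrib sum_subtractf sum_distrib_left)

lemma carrier_add:
  assumes "x \<in> rcarrier (path_algebra Q)" "y \<in> rcarrier (path_algebra Q)"
  shows "(\<lambda>p. x p + y p) \<in> rcarrier (path_algebra Q)"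
  unfolding path_algebra_simps
proof (intro CollectI allI impI)
  fix p assume "x p + y p \<noteq> 0"
  then have "x p \<noteq> 0 \<or> y p \<noteq> 0" by auto
  then show "is_path Q p" using assms unfolding path_algebra_simps by blast
qed

lemma carrier_scale: "x \<in> rcarrier (path_algebra Q) \<Longrightarrow> (\<lambda>p. k * x p) \<in> rcarrier (path_algebra Q)"
  by (auto simp: path_algebra_simps)

lemma rmul_carrier: "rmul (path_algebra Q) x y \<in> rcarrier (path_algebra Q)"
  by (auto simp: path_algebra_simps rmul_path_algebra)

locale path_ideal =
  fixes Q :: "('v, 'a) quiver" and I :: "('a list \<Rightarrow> real) set"
  assumes I: "two_sided_ideal (path_algebra Q) I"
begin

abbreviation "A \<equiv> path_algebra Q"

lemma I_add: "x \<in> I \<Longrightarrow> y \<in> I \<Longrightarrow> (\<lambda>p. x p + y p) \<in> I"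
  and I_scale: "x \<in> I \<Longrightarrow> (\<lambda>p. c * x p) \<in> I"
  and I_mul: "a \<in> rcarrier A \<Longrightarrow> x \<in> I \<Longrightarrow> rmul A a x \<in> I" "a \<in> rcarrier A \<Longrightarrow> x \<in> I \<Longrightarrow> rmul A x a \<in> I"
  and I_sub: "x \<in> I \<Longrightarrow> x \<in> rcarrier A"
  using I unfolding two_sided_ideal_def path_algebra_simps(2,3) by blast+

lemma I_zero: "(\<lambda>p. 0) \<in> I"
proof -
  obtain x where "x \<in> I" using I unfolding two_sided_ideal_def by blast
  from I_scale[OF this, of 0] show ?thesis by simp
qed

lemma I_diff: "x \<in> I \<Longrightarrow> y \<in> I \<Longrightarrow> (\<lambda>p. x p - y p) \<in> I"
  using I_add[OF _ I_scale[of y "-1"], of x] by simp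

definition coset where "coset x = {radd A x j | j. j \<in> I}"

lemma coset_iff: "y \<in> coset x \<longleftrightarrow> (\<lambda>p. y p - x p) \<in> I"
proof
  assume "y \<in> coset x"
  then show "(\<lambda>p. y p - x p) \<in> I" by (auto simp: coset_def path_algebra_simps)
next
  assume *: "(\<lambda>p. y p - x p) \<in> I"
  have "y = radd A x (\<lambda>p. y p - x p)" by (simp add: path_algebra_simps)
  with * show "y \<in> coset x" unfolding coset_def by blast
qed

lemma coset_self: "x \<in> coset x"
  by (simp add: coset_iff I_zero)

lemma coset_eq_iff: "coset x = coset y \<longleftrightarrow> (\<lambda>p. x p - y p) \<in> I"
proof
  assume "coset x = coset y"
  then have "x \<in> coset y" using coset_self by blast
  then show "(\<lambda>p. x p - y p) \<in> I" by (simp add: coset_iff)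
next
  assume xy: "(\<lambda>p. x p - y p) \<in> I"
  have "z \<in> coset x \<longleftrightarrow> z \<in> coset y" for z
    using I_add[OF _ xy, of "\<lambda>p. z p - x p"] I_diff[OF _ xy, of "\<lambda>p. z p - y p"] by (auto simp: coset_iff)
  then show "coset x = coset y" by blast
qed

abbreviation "B \<equiv> ralg_quotient A I"

text \<open>The operations of \<open>ralg_quotient\<close> are formed setwise. Elements of the ideal
  are added to scalar multiples and products there, because these alone need not fill a whole coset:
  the multiple by 0 would be a single function.\<close>

lemma quotient_ops:
  "rcarrier B = coset ` rcarrier A"
  "radd B (coset x) (coset y) = coset (\<lambda>p. x p + y p)"
  "rscale B c (coset x) = coset (\<lambda>p. c * x p)"
  "x \<in> rcarrier A \<Longrightarrow> y \<in> rcarrier A \<Longrightarrow> rmul B (coset x) (coset y) = coset (rmul A x y)"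
proof -
  show "rcarrier B = coset ` rcarrier A" by (simp add: ralg_quotient_def coset_def)
  show "radd B (coset x) (coset y) = coset (\<lambda>p. x p + y p)"
  proof (intro equalityI subsetI)
    fix z assume "z \<in> radd B (coset x) (coset y)"
    then obtain x' y' where "x' \<in> coset x" "y' \<in> coset y" "z = (\<lambda>p. x' p + y' p)"
      by (auto simp: ralg_quotient_def path_algebra_simps)
    then show "z \<in> coset (\<lambda>p. x p + y p)"
      using I_add[of "\<lambda>p. x' p - x p" "\<lambda>p. y' p - y p"] by (simp add: coset_iff algebra_simps)
  next
    fix z assume "z \<in> coset (\<lambda>p. x p + y p)"
    then have "(\<lambda>p. z p - y p) \<in> coset x" by (simp add: coset_iff algebra_simps)
    moreover have "z = radd A (\<lambda>p. z p - y p) y" by (simp add: path_algebra_simps)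
    ultimately show "z \<in> radd B (coset x) (coset y)"
      using coset_self[of y] unfolding ralg_quotient_def by auto
  qed
  show "rscale B c (coset x) = coset (\<lambda>p. c * x p)"
  proof (intro equalityI subsetI)
    fix z assume "z \<in> rscale B c (coset x)"
    then obtain x' j where "x' \<in> coset x" "j \<in> I" "z = (\<lambda>p. c * x' p + j p)"
      by (auto simp: ralg_quotient_def path_algebra_simps)
    then show "z \<in> coset (\<lambda>p. c * x p)"
      using I_add[OF I_scale[of "\<lambda>p. x' p - x p" c], of j] by (simp add: coset_iff algebra_simps)
  next
    fix z assume "z \<in> coset (\<lambda>p. c * x p)"
    then have "(\<lambda>p. z p - c * x p) \<in> I" by (simp add: coset_iff)
    moreover have "z = radd A (rscale A c x) (\<lambda>p. z p - c * x p)" by (simp add: path_algebra_simps)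
    ultimately show "z \<in> rscale B c (coset x)"
      using coset_self[of x] unfolding ralg_quotient_def by auto
  qed
  assume xy: "x \<in> rcarrier A" "y \<in> rcarrier A"
  show "rmul B (coset x) (coset y) = coset (rmul A x y)"
  proof (intro equalityI subsetI)
    fix z assume "z \<in> rmul B (coset x) (coset y)"
    then obtain x' y' j where *: "(\<lambda>p. x' p - x p) \<in> I" "(\<lambda>p. y' p - y p) \<in> I" "j \<in> I" "z = (\<lambda>p. rmul A x' y' p + j p)"
      by (auto simp: ralg_quotient_def path_algebra_simps coset_iff)
    have "y' = (\<lambda>p. y p + (y' p - y p))" by simp
    moreover have "(\<lambda>p. y p + (y' p - y p)) \<in> rcarrier A"
      by (rule carrier_add[OF xy(2) I_sub[OF *(2)]])
    ultimately have y': "y' \<in> rcarrier A" by simp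
    \<comment> \<open>The difference of the products is split as
      \<open>(x' - x) y' + x (y' - y)\<close>, which needs \<open>y'\<close> in the carrier.\<close>
    have "(\<lambda>p. rmul A (\<lambda>p. x' p - x p) y' p + rmul A x (\<lambda>p. y' p - y p) p + j p) \<in> I"
      by (intro I_add I_mul xy y' *)
    then show "z \<in> coset (rmul A x y)"
      unfolding coset_iff *(4) rmul_path_algebra_linear by (simp add: algebra_simps)
  next
    fix z assume "z \<in> coset (rmul A x y)"
    then have "(\<lambda>p. z p - rmul A x y p) \<in> I" by (simp add: coset_iff)
    moreover have "z = radd A (rmul A x y) (\<lambda>p. z p - rmul A x y p)" by (simp add: path_algebra_simps)
    ultimately show "z \<in> rmul B (coset x) (coset y)"
      using coset_self[of x] coset_self[of y] unfolding ralg_quotient_def by auto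
  qed
qed

end

section \<open>Left-invariant fields as a quotient of the path algebra\<close>

context lie_grp
begin

lemma LI_vadd: "X \<in> LI \<Longrightarrow> Y \<in> LI \<Longrightarrow> vadd X Y \<in> LI"
  unfolding left_invariant_fields_def using VF_vadd by (auto simp: vadd_def left_push_def)

lemma LI_vmult: "X \<in> LI \<Longrightarrow> vmult (\<lambda>_. k) X \<in> LI"
  unfolding left_invariant_fields_def using VF_vmult[OF S_const] by (auto simp: vmult_def left_push_def)

lemma LI_vbracket:
  assumes X: "X \<in> LI" and Y: "Y \<in> LI"
  shows "vbracket X Y \<in> LI"
proof -
  have *: "vapp Z f \<circ> mul a = vapp Z (f \<circ> mul a)" if "Z \<in> LI" for Z f a
    using LI_D(2)[OF that] by (auto simp: vapp_def)
  have "vbracket X Y (mul a p) = left_push mul a (vbracket X Y p)" for a p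
    by (rule ext) (simp add: vbracket_def left_push_def LI_D(2)[OF X] LI_D(2)[OF Y] *[OF X] *[OF Y])
  then show ?thesis using VF_vbracket LI_D(1) X Y unfolding left_invariant_fields_def by blast
qed

text \<open>\<Psi> is the quotient map followed by the inverse of the given isomorphism: a
  surjection from path algebra elements onto left-invariant fields with kernel \<open>I\<close>. It
  allows work with representatives instead of cosets from here on.\<close>

lemma LI_of_path_algebra:
  fixes Q :: "('v, 'a) quiver"
  assumes I: "two_sided_ideal (path_algebra Q) I"
    and iso: "ralg_isomorphic (lie_algebra_of M mul) (commutator_algebra (ralg_quotient (path_algebra Q) I))"
  obtains \<Psi> where "\<And>x. x \<in> rcarrier (path_algebra Q) \<Longrightarrow> \<Psi> x \<in> LI"
    "\<And>X. X \<in> LI \<Longrightarrow> \<exists>x\<in>rcarrier (path_algebra Q). X = \<Psi> x"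
    "\<And>x y. x \<in> rcarrier (path_algebra Q) \<Longrightarrow> y \<in> rcarrier (path_algebra Q) \<Longrightarrow> \<Psi> (\<lambda>p. x p + y p) = vadd (\<Psi> x) (\<Psi> y)"
    "\<And>x k. x \<in> rcarrier (path_algebra Q) \<Longrightarrow> \<Psi> (\<lambda>p. k * x p) = vmult (\<lambda>_. k) (\<Psi> x)"
    "\<And>x y. x \<in> rcarrier (path_algebra Q) \<Longrightarrow> y \<in> rcarrier (path_algebra Q) \<Longrightarrow>
       \<Psi> (\<lambda>p. rmul (path_algebra Q) x y p - rmul (path_algebra Q) y x p) = vbracket (\<Psi> x) (\<Psi> y)"
    "\<And>x y. x \<in> rcarrier (path_algebra Q) \<Longrightarrow> y \<in> rcarrier (path_algebra Q) \<Longrightarrow> \<Psi> x = \<Psi> y \<longleftrightarrow> (\<lambda>p. x p - y p) \<in> I"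
proof -
  interpret path_ideal Q I by unfold_locales (rule I)
  obtain \<phi> where bij: "bij_betw \<phi> LI (rcarrier B)"
    and add: "\<And>X Y. X \<in> LI \<Longrightarrow> Y \<in> LI \<Longrightarrow> \<phi> (vadd X Y) = radd B (\<phi> X) (\<phi> Y)"
    and scale: "\<And>k X. X \<in> LI \<Longrightarrow> \<phi> (vmult (\<lambda>_. k) X) = rscale B k (\<phi> X)"
    and br: "\<And>X Y. X \<in> LI \<Longrightarrow> Y \<in> LI \<Longrightarrow> \<phi> (vbracket X Y) = radd B (rmul B (\<phi> X) (\<phi> Y)) (rscale B (- 1) (rmul B (\<phi> Y) (\<phi> X)))"
    using iso unfolding ralg_isomorphic_def lie_algebra_of_def commutator_algebra_def by auto
  define \<Psi> where "\<Psi> x = inv_into LI \<phi> (coset x)" for x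
  have inj: "inj_on \<phi> LI" using bij by (rule bij_betw_imp_inj_on)
  have im: "\<phi> ` LI = coset ` rcarrier A" using bij_betw_imp_surj_on[OF bij] quotient_ops(1) by simp
  have mem: "coset x \<in> \<phi> ` LI" if "x \<in> rcarrier A" for x unfolding im using that by blast
  have \<Psi>LI: "\<Psi> x \<in> LI" if "x \<in> rcarrier A" for x
    unfolding \<Psi>_def by (rule inv_into_into[OF mem[OF that]])
  have \<phi>\<Psi>: "\<phi> (\<Psi> x) = coset x" if "x \<in> rcarrier A" for x
    unfolding \<Psi>_def by (rule f_inv_into_f[OF mem[OF that]])
  have \<Psi>eq: "\<Psi> x = X" if "x \<in> rcarrier A" "X \<in> LI" "\<phi> X = coset x" for x X
    using inj_onD[OF inj, of "\<Psi> x" X] \<phi>\<Psi>[OF that(1)] \<Psi>LI[OF that(1)] that by simp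
  show ?thesis
  proof (rule that[of \<Psi>])
    fix x y k assume x: "x \<in> rcarrier A"
    show "\<Psi> x \<in> LI" by (rule \<Psi>LI[OF x])
    show "\<Psi> (\<lambda>p. k * x p) = vmult (\<lambda>_. k) (\<Psi> x)"
      by (rule \<Psi>eq[OF carrier_scale[OF x] LI_vmult[OF \<Psi>LI[OF x]]]) (simp add: scale \<Psi>LI x \<phi>\<Psi> quotient_ops)
    assume y: "y \<in> rcarrier A"
    show "\<Psi> (\<lambda>p. x p + y p) = vadd (\<Psi> x) (\<Psi> y)"
      by (rule \<Psi>eq[OF carrier_add[OF x y] LI_vadd[OF \<Psi>LI[OF x] \<Psi>LI[OF y]]]) (simp add: add \<Psi>LI x y \<phi>\<Psi> quotient_ops)
    have "(\<lambda>p. rmul A x y p - rmul A y x p) \<in> rcarrier A"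
      using carrier_add[OF rmul_carrier[of Q x y] carrier_scale[OF rmul_carrier[of Q y x], of "-1"]] by simp
    then show "\<Psi> (\<lambda>p. rmul A x y p - rmul A y x p) = vbracket (\<Psi> x) (\<Psi> y)"
      by (rule \<Psi>eq[OF _ LI_vbracket[OF \<Psi>LI[OF x] \<Psi>LI[OF y]]])
         (simp add: br \<Psi>LI x y \<phi>\<Psi> quotient_ops)
    have "\<Psi> x = \<Psi> y \<longleftrightarrow> coset x = coset y"
      using \<phi>\<Psi>[OF x] \<phi>\<Psi>[OF y] \<Psi>_def by metis
    then show "\<Psi> x = \<Psi> y \<longleftrightarrow> (\<lambda>p. x p - y p) \<in> I" by (simp add: coset_eq_iff)
  next
    fix X assume X: "X \<in> LI"
    then obtain x where "x \<in> rcarrier A" "\<phi> X = coset x" using im by blast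
    then show "\<exists>x\<in>rcarrier A. X = \<Psi> x" using \<Psi>eq X by blast
  qed
qed

end

section \<open>The Hasse quiver with extra parallel arrows and its ideal\<close>

locale ext_quiver =
  fixes P :: "'v set" and r :: "('v \<times> 'v) set" and Q Q' :: "('v, 'a) quiver"
  assumes finP: "finite P" and taos: "taos P r" and hasse: "hasse_quiver P r Q"
    and extension: "multiple_arrow_extension Q Q'"
begin

abbreviation "L \<equiv> (edges Q)\<^sup>+"
abbreviation "A \<equiv> path_algebra Q'"

definition "X = arrows Q' - arrows Q"

lemma
  shows finX: "finite X" and arrows_Q': "arrows Q' = arrows Q \<union> X"
    and src_Q': "\<alpha> \<in> arrows Q \<Longrightarrow> src Q' \<alpha> = src Q \<alpha>"
    and tgt_Q': "\<alpha> \<in> arrows Q \<Longrightarrow> tgt Q' \<alpha> = tgt Q \<alpha>"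
    and X_parallel: "\<epsilon> \<in> X \<Longrightarrow> \<exists>\<alpha>\<in>arrows Q. src Q' \<epsilon> = src Q' \<alpha> \<and> tgt Q' \<epsilon> = tgt Q' \<alpha>"
proof -
  obtain E where E: "finite E" "arrows Q \<inter> E = {}" "arrows Q' = arrows Q \<union> E"
    "\<forall>\<alpha> \<in> arrows Q. src Q' \<alpha> = src Q \<alpha> \<and> tgt Q' \<alpha> = tgt Q \<alpha>"
    "\<forall>\<alpha>\<^sub>1 \<in> E. \<exists>\<alpha>\<^sub>2 \<in> arrows Q. src Q' \<alpha>\<^sub>1 = src Q \<alpha>\<^sub>2 \<and> tgt Q' \<alpha>\<^sub>1 = tgt Q \<alpha>\<^sub>2"
    using extension unfolding multiple_arrow_extension_def by (elim conjE exE)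
  have XE: "X = E" using E(2,3) unfolding X_def by blast
  show "finite X" "arrows Q' = arrows Q \<union> X" using E XE by auto
  show "\<alpha> \<in> arrows Q \<Longrightarrow> src Q' \<alpha> = src Q \<alpha>" "\<alpha> \<in> arrows Q \<Longrightarrow> tgt Q' \<alpha> = tgt Q \<alpha>" using E by auto
  show "\<epsilon> \<in> X \<Longrightarrow> \<exists>\<alpha>\<in>arrows Q. src Q' \<epsilon> = src Q' \<alpha> \<and> tgt Q' \<epsilon> = tgt Q' \<alpha>"
    using E(4,5) XE by metis
qed

lemma arrow_covers: "\<alpha> \<in> arrows Q \<Longrightarrow> covers P r (src Q \<alpha>) (tgt Q \<alpha>)"
  and arrow_unique: "\<alpha> \<in> arrows Q \<Longrightarrow> \<beta> \<in> arrows Q \<Longrightarrow> src Q \<alpha> = src Q \<beta> \<Longrightarrow> tgt Q \<alpha> = tgt Q \<beta> \<Longrightarrow> \<alpha> = \<beta>"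
  using hasse unfolding hasse_quiver_def by blast+

lemma L_r: "(a, b) \<in> L \<Longrightarrow> (a, b) \<in> r"
proof -
  have "edges Q \<subseteq> r" using arrow_covers by (auto simp: edges_def covers_def)
  moreover have "r\<^sup>+ = r" using taos by (simp add: taos_def)
  ultimately show "(a, b) \<in> L \<Longrightarrow> (a, b) \<in> r" using trancl_mono by metis
qed

text \<open>A Hasse quiver has at most one arrow for each pair of elements of the finite set
  \<open>P\<close>.\<close>

lemma fin_arrows: "finite (arrows Q)"
proof (rule finite_imageD)
  show "finite ((\<lambda>a. (src Q a, tgt Q a)) ` arrows Q)"
    by (rule finite_subset[of _ "P \<times> P"]) (use arrow_covers finP in \<open>auto simp: covers_def\<close>)
  show "inj_on (\<lambda>a. (src Q a, tgt Q a)) (arrows Q)" using arrow_unique by (auto simp: inj_on_def)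
qed

lemma finL: "finite L"
  by (rule finite_subset[of _ "P \<times> P"]) (use L_r taos finP in \<open>auto simp: taos_def\<close>)

text \<open>\<open>r\<close> may well be reflexive, but arrows join distinct elements. A cycle would
  contain an arrow from \<open>a\<close> to some \<open>y \<noteq> a\<close> and a way back inside
  \<open>r\<close>, against antisymmetry.\<close>

lemma L_irrefl: "(a, a) \<notin> L"
proof
  assume "(a, a) \<in> L"
  then obtain y where y: "(a, y) \<in> edges Q" "(y, a) \<in> (edges Q)\<^sup>*" by (meson tranclD)
  have ay: "(a, y) \<in> r" "a \<noteq> y" using y(1) arrow_covers by (auto simp: edges_def covers_def)
  then have "(y, a) \<in> L" using y(2) by (simp add: rtrancl_eq_or_trancl)
  then have "(y, a) \<in> r" by (rule L_r)
  with ay taos show False by (auto simp: taos_def antisym_def)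
qed

text \<open>Consequently an arrow is never parallel to a path of length at least two, although
  \<open>I\<close> by its definition identifies only the long paths with each other.\<close>

lemma not_covers: "(a, t) \<in> L \<Longrightarrow> (t, b) \<in> L \<Longrightarrow> \<not> covers P r a b"
proof -
  assume L: "(a, t) \<in> L" "(t, b) \<in> L"
  then have "t \<noteq> a" "t \<noteq> b" using L_irrefl by auto
  moreover have "(a, t) \<in> r" "(t, b) \<in> r" using L L_r by auto
  moreover have "t \<in> P" using \<open>(a, t) \<in> r\<close> taos by (auto simp: taos_def)
  ultimately show ?thesis unfolding covers_def by blast
qed

lemma edges_Q': "edges Q' = edges Q"
proof -
  have "(src Q' \<epsilon>, tgt Q' \<epsilon>) \<in> edges Q" if "\<epsilon> \<in> X" for \<epsilon>
    using X_parallel[OF that] src_Q' tgt_Q' by (auto simp: edges_def)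
  moreover have "(src Q' \<alpha>, tgt Q' \<alpha>) = (src Q \<alpha>, tgt Q \<alpha>)" if "\<alpha> \<in> arrows Q" for \<alpha> using src_Q' tgt_Q' that by simp
  ultimately show ?thesis unfolding edges_def arrows_Q' image_Un by (auto cong: image_cong)
qed

lemma path_ends_Q': "is_path Q p \<Longrightarrow> path_src Q' p = path_src Q p \<and> path_tgt Q' p = path_tgt Q p"
  by (auto simp: is_path_def path_src_def path_tgt_def src_Q' tgt_Q' subset_iff)

lemma is_path_Q': "is_path Q p \<Longrightarrow> is_path Q' p"
proof (induction p)
  case (Cons \<alpha> p)
  show ?case
  proof (cases "p = []")
    case True then show ?thesis using Cons.prems arrows_Q' by (auto simp: is_path_def)
  next
    case False
    have 1: "is_path Q [\<alpha>]" "is_path Q p" "path_tgt Q [\<alpha>] = path_src Q p"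
      using is_path_appendD[of Q "[\<alpha>]" p] Cons.prems False by auto
    have "is_path Q' [\<alpha>]" using 1(1) arrows_Q' by (auto simp: is_path_single)
    moreover have "path_tgt Q' [\<alpha>] = path_src Q' p" using path_ends_Q'[OF 1(1)] path_ends_Q'[OF 1(2)] 1(3) by simp
    ultimately show ?thesis using is_path_append[of Q' "[\<alpha>]" p] Cons.IH[OF 1(2)] by simp
  qed
qed (simp add: is_path_def)

lemma Q'_path_L: "s \<in> paths_between Q' a b \<Longrightarrow> (a, b) \<in> L"
  using path_in_trancl[of Q' s] by (auto simp: paths_between_def edges_Q')

text \<open>Sources of successive arrows strictly increase in \<open>L\<close>, so a path repeats no
  arrow.\<close>

lemma finite_paths: "finite {p. is_path Q' p}"
proof -
  have "distinct p \<and> (\<forall>\<beta>\<in>set p. \<beta> = hd p \<or> (src Q' (hd p), src Q' \<beta>) \<in> L)" if "is_path Q' p" for p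
    using that
  proof (induction p)
    case (Cons \<alpha> p)
    show ?case
    proof (cases "p = []")
      case False
      have p: "is_path Q' [\<alpha>]" "is_path Q' p" "tgt Q' \<alpha> = src Q' (hd p)"
        using is_path_appendD[of Q' "[\<alpha>]" p] Cons.prems False by (auto simp: path_src_def path_tgt_def)
      have e: "(src Q' \<alpha>, src Q' (hd p)) \<in> L"
      proof -
        have "(src Q' \<alpha>, tgt Q' \<alpha>) \<in> edges Q'" using p(1) by (auto simp: is_path_single edges_def)
        then show ?thesis using p(3) edges_Q' by auto
      qed
      have *: "(src Q' \<alpha>, src Q' \<beta>) \<in> L" if "\<beta> \<in> set p" for \<beta>
        using Cons.IH[OF p(2)] that e trancl_trans[OF e] by auto
      then have "\<alpha> \<notin> set p" using L_irrefl by blast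
      then show ?thesis using Cons.IH[OF p(2)] * by simp
    qed simp
  qed simp
  then have "{p. is_path Q' p} \<subseteq> {p. set p \<subseteq> arrows Q' \<and> distinct p}" by (auto simp: is_path_def)
  moreover have "finite (arrows Q')" using fin_arrows finX arrows_Q' by simp
  ultimately show ?thesis using finite_subset finite_subset_distinct by blast
qed

lemma finite_paths_between: "finite (paths_between Q' a b)"
  by (rule finite_subset[OF _ finite_paths]) (auto simp: paths_between_def)

text \<open>Chosen in \<open>Q\<close> and not in \<open>Q'\<close>, so that for a covering pair it
  is the original arrow and never an extra one.\<close>

definition std_path :: "'v \<Rightarrow> 'v \<Rightarrow> 'a list" where
  "std_path a b = (SOME p. p \<in> paths_between Q a b)"

lemma std_path: "(a, b) \<in> L \<Longrightarrow> std_path a b \<in> paths_between Q a b"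
  unfolding std_path_def by (rule someI_ex[OF trancl_path])

lemma std_path': "(a, b) \<in> L \<Longrightarrow> std_path a b \<in> paths_between Q' a b"
  using std_path is_path_Q' path_ends_Q' by (fastforce simp: paths_between_def)

lemma long_path_split:
  assumes "s \<in> paths_between Q' a b" "2 \<le> length s"
  obtains t where "(a, t) \<in> L" "(t, b) \<in> L"
proof -
  obtain \<alpha> s' where s: "s = \<alpha> # s'" "s' \<noteq> []" using assms(2) by (cases s) (auto simp: Suc_le_eq)
  have p: "is_path Q' [\<alpha>]" "is_path Q' s'" "path_tgt Q' [\<alpha>] = path_src Q' s'"
    using is_path_appendD[of Q' "[\<alpha>]" s'] assms(1) s by (auto simp: paths_between_def)
  have "(a, path_src Q' s') \<in> L" "(path_src Q' s', b) \<in> L"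
    using path_in_trancl[OF p(1)] path_in_trancl[OF p(2)] p(3) assms(1) s
    by (auto simp: paths_between_def edges_Q' path_src_def path_tgt_def)
  then show ?thesis by (rule that)
qed

text \<open>A standard path of length one would be an arrow, that is a covering pair, but the given
  long path has an intermediate vertex.\<close>

lemma std_path_long:
  assumes "s \<in> paths_between Q' a b" "2 \<le> length s"
  shows "2 \<le> length (std_path a b)"
proof (rule ccontr)
  assume n: "\<not> 2 \<le> length (std_path a b)"
  have p: "std_path a b \<in> paths_between Q a b" by (rule std_path[OF Q'_path_L[OF assms(1)]])
  then have "std_path a b \<noteq> []" by (auto simp: paths_between_def is_path_def)
  then obtain \<alpha> where \<alpha>: "std_path a b = [\<alpha>]" using n by (cases "std_path a b") (auto simp: Suc_le_eq)
  then have "covers P r a b" using p arrow_covers[of \<alpha>] by (auto simp: paths_between_def is_path_single path_src_def path_tgt_def)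
  then show False using long_path_split[OF assms] not_covers by metis
qed

lemma std_path_arrow:
  assumes "\<alpha> \<in> arrows Q"
  shows "std_path (src Q \<alpha>) (tgt Q \<alpha>) = [\<alpha>]"
proof -
  let ?p = "std_path (src Q \<alpha>) (tgt Q \<alpha>)"
  have "(src Q \<alpha>, tgt Q \<alpha>) \<in> L" using assms by (auto simp: edges_def)
  note p = std_path[OF this] std_path'[OF this]
  have "\<not> 2 \<le> length ?p" using long_path_split[OF p(2)] not_covers arrow_covers[OF assms] by metis
  moreover have "?p \<noteq> []" using p(1) by (auto simp: paths_between_def is_path_def)
  ultimately obtain \<beta> where \<beta>: "?p = [\<beta>]" by (cases ?p) (auto simp: Suc_le_eq)
  then have "\<beta> = \<alpha>" using p(1) assms arrow_unique[of \<beta> \<alpha>] by (auto simp: paths_between_def is_path_single path_src_def path_tgt_def)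
  with \<beta> show ?thesis by simp
qed

text \<open>The splittings of paths from \<open>u\<close> to \<open>v\<close> are grouped by their
  left or by their right factor. In each grouping the inner sum runs over all paths between two
  fixed vertices, so it vanishes when the corresponding factor belongs to
  \<open>ker\<close>.\<close>

lemma sum_product:
  fixes x y :: "'a list \<Rightarrow> real"
  shows "(\<Sum>s\<in>paths_between Q' u v. rmul A x y s) =
      (\<Sum>q\<in>{q. is_path Q' q \<and> path_src Q' q = u}. \<Sum>t\<in>paths_between Q' (path_tgt Q' q) v. x q * y t)"
    and "(\<Sum>s\<in>paths_between Q' u v. rmul A x y s) =
      (\<Sum>t\<in>{t. is_path Q' t \<and> path_tgt Q' t = v}. \<Sum>q\<in>paths_between Q' u (path_src Q' t). x q * y t)"
proof -
  define D where "D = {(q, t). is_path Q' q \<and> is_path Q' t \<and> path_src Q' q = u \<and> path_tgt Q' q = path_src Q' t \<and> path_tgt Q' t = v}"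
  have "(\<Sum>s\<in>paths_between Q' u v. rmul A x y s) = (\<Sum>s\<in>paths_between Q' u v. \<Sum>i\<in>{1..<length s}. x (take i s) * y (drop i s))"
    by (rule sum.cong) (auto simp: rmul_path_algebra paths_between_def)
  also have "\<dots> = (\<Sum>(s, i)\<in>(SIGMA s:paths_between Q' u v. {1..<length s}). x (take i s) * y (drop i s))"
    by (rule sum.Sigma) (auto simp: finite_paths_between)
  also have "\<dots> = (\<Sum>(q, t)\<in>D. x q * y t)"
  proof (rule sum.reindex_bij_witness[where i = "\<lambda>(q, t). (q @ t, length q)" and j = "\<lambda>(s, i). (take i s, drop i s)"])
    fix z assume "z \<in> (SIGMA s:paths_between Q' u v. {1..<length s})"
    then obtain s i where z: "z = (s, i)" "s \<in> paths_between Q' u v" "1 \<le> i" "i < length s" by auto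
    have ne: "take i s \<noteq> []" "drop i s \<noteq> []" using z by auto
    have sp: "take i s @ drop i s = s" by simp
    show "(case (case z of (s, i) \<Rightarrow> (take i s, drop i s)) of (q, t) \<Rightarrow> (q @ t, length q)) = z" using z by simp
    show "(case z of (s, i) \<Rightarrow> (take i s, drop i s)) \<in> D"
      using is_path_appendD[of Q' "take i s" "drop i s", OF _ ne] path_append_ends[OF ne, of Q'] z
      by (auto simp: D_def paths_between_def)
    show "(case (case z of (s, i) \<Rightarrow> (take i s, drop i s)) of (q, t) \<Rightarrow> x q * y t) = (case z of (s, i) \<Rightarrow> x (take i s) * y (drop i s))"
      using z by simp
  next
    fix z assume "z \<in> D"
    then obtain q t where z: "z = (q, t)" "is_path Q' q" "is_path Q' t" "path_src Q' q = u" "path_tgt Q' q = path_src Q' t" "path_tgt Q' t = v"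
      by (auto simp: D_def)
    have ne: "q \<noteq> []" "t \<noteq> []" using z by (auto simp: is_path_def)
    show "(case (case z of (q, t) \<Rightarrow> (q @ t, length q)) of (s, i) \<Rightarrow> (take i s, drop i s)) = z" using z by simp
    show "(case z of (q, t) \<Rightarrow> (q @ t, length q)) \<in> (SIGMA s:paths_between Q' u v. {1..<length s})"
      using z ne is_path_append[OF z(2,3)] path_append_ends[OF ne, of Q'] by (auto simp: paths_between_def Suc_le_eq)
  qed
  finally have *: "(\<Sum>s\<in>paths_between Q' u v. rmul A x y s) = (\<Sum>(q, t)\<in>D. x q * y t)" .
  have D1: "D = (SIGMA q:{q. is_path Q' q \<and> path_src Q' q = u}. paths_between Q' (path_tgt Q' q) v)"
    by (auto simp: D_def paths_between_def)
  have fin: "finite {q. is_path Q' q \<and> path_src Q' q = u}" "finite {t. is_path Q' t \<and> path_tgt Q' t = v}"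
    using finite_subset[OF _ finite_paths] by auto
  show "(\<Sum>s\<in>paths_between Q' u v. rmul A x y s) =
      (\<Sum>q\<in>{q. is_path Q' q \<and> path_src Q' q = u}. \<Sum>t\<in>paths_between Q' (path_tgt Q' q) v. x q * y t)"
    unfolding * D1 by (rule sum.Sigma[symmetric]) (auto simp: fin finite_paths_between)
  have D2: "D = (\<lambda>(t, q). (q, t)) ` (SIGMA t:{t. is_path Q' t \<and> path_tgt Q' t = v}. paths_between Q' u (path_src Q' t))"
    by (auto simp: D_def paths_between_def image_iff)
  have "(\<Sum>(q, t)\<in>D. x q * y t) = (\<Sum>(t, q)\<in>(SIGMA t:{t. is_path Q' t \<and> path_tgt Q' t = v}. paths_between Q' u (path_src Q' t)). x q * y t)"
    unfolding D2 by (subst sum.reindex) (auto simp: inj_on_def intro!: sum.cong)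
  also have "\<dots> = (\<Sum>t\<in>{t. is_path Q' t \<and> path_tgt Q' t = v}. \<Sum>q\<in>paths_between Q' u (path_src Q' t). x q * y t)"
    by (rule sum.Sigma[symmetric]) (auto simp: fin finite_paths_between)
  finally show "(\<Sum>s\<in>paths_between Q' u v. rmul A x y s) =
      (\<Sum>t\<in>{t. is_path Q' t \<and> path_tgt Q' t = v}. \<Sum>q\<in>paths_between Q' u (path_src Q' t). x q * y t)"
    unfolding * .
qed

text \<open>An explicit ideal containing \<open>I\<close>, cut out by linear functionals: the
  coefficient sums over parallel paths and the coefficients at extra arrows. \<open>I\<close> is
  defined as an intersection, so these functionals are what certifies that the quotient is large
  enough.\<close>

definition ker :: "('a list \<Rightarrow> real) set" where
  "ker = {x \<in> rcarrier A. (\<forall>a b. (\<Sum>p\<in>paths_between Q' a b. x p) = 0) \<and> (\<forall>\<epsilon>\<in>X. x [\<epsilon>] = 0)}"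

lemma ker_ideal: "two_sided_ideal A ker"
  unfolding two_sided_ideal_def
proof (intro conjI ballI allI)
  show "ker \<noteq> {}" by (auto simp: ker_def path_algebra_simps intro!: exI[of _ "\<lambda>p. 0"])
  show "ker \<subseteq> rcarrier A" by (auto simp: ker_def)
  fix x assume x: "x \<in> ker"
  show "radd A x y \<in> ker" if y: "y \<in> ker" for y
  proof -
    have "(\<lambda>p. x p + y p) \<in> rcarrier A" using x y by (intro carrier_add) (auto simp: ker_def)
    then show ?thesis using x y by (simp add: ker_def path_algebra_simps(2) sum.distrib)
  qed
  show "rscale A c x \<in> ker" for c using x by (auto simp: ker_def path_algebra_simps simp flip: sum_distrib_left)
  fix a assume "a \<in> rcarrier A"
  have single: "rmul A y z [\<epsilon>] = 0" for y z \<epsilon> by (simp add: rmul_path_algebra)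
  have "(\<Sum>s\<in>paths_between Q' u v. rmul A a x s) = 0" for u v
    unfolding sum_product(1) using x by (simp add: ker_def flip: sum_distrib_left)
  then show "rmul A a x \<in> ker" by (simp add: ker_def rmul_carrier single)
  have "(\<Sum>s\<in>paths_between Q' u v. rmul A x a s) = 0" for u v
    unfolding sum_product(2) using x by (simp add: ker_def flip: sum_distrib_right)
  then show "rmul A x a \<in> ker" by (simp add: ker_def rmul_carrier single)
qed

abbreviation "I \<equiv> parallel_path_ideal Q'"

definition gens :: "('a list \<Rightarrow> real) set" where
  "gens = {(\<lambda>p. path_elem w\<^sub>1 p - path_elem w\<^sub>2 p) | w\<^sub>1 w\<^sub>2.
        is_path Q' w\<^sub>1 \<and> is_path Q' w\<^sub>2 \<and> 2 \<le> length w\<^sub>1 \<and> 2 \<le> length w\<^sub>2 \<and>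
        path_src Q' w\<^sub>1 = path_src Q' w\<^sub>2 \<and> path_tgt Q' w\<^sub>1 = path_tgt Q' w\<^sub>2}"

lemma I_eq: "I = \<Inter> {J. two_sided_ideal A J \<and> gens \<subseteq> J}"
  unfolding parallel_path_ideal_def ideal_generated_def gens_def ..

lemma sum_path_elem: "(\<Sum>p\<in>paths_between Q' a b. path_elem w p) = (if w \<in> paths_between Q' a b then 1 else 0)"
  using finite_paths_between by (simp add: path_elem_def)

lemma path_elem_carrier: "is_path Q' w \<Longrightarrow> path_elem w \<in> rcarrier A"
  by (auto simp: path_algebra_simps path_elem_def)

lemma gens_ker: "gens \<subseteq> ker"
proof
  fix x assume "x \<in> gens"
  then obtain w1 w2 where w: "x = (\<lambda>p. path_elem w1 p - path_elem w2 p)" "is_path Q' w1" "is_path Q' w2" "2 \<le> length w1" "2 \<le> length w2"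
        "path_src Q' w1 = path_src Q' w2" "path_tgt Q' w1 = path_tgt Q' w2" unfolding gens_def by blast
  have "w1 \<in> paths_between Q' a b \<longleftrightarrow> w2 \<in> paths_between Q' a b" for a b using w by (simp add: paths_between_def)
  then have "(\<Sum>p\<in>paths_between Q' a b. x p) = 0" for a b by (simp add: w(1) sum_subtractf sum_path_elem)
  moreover have "x [\<epsilon>] = 0" for \<epsilon> using w by (auto simp: path_elem_def)
  moreover have "x \<in> rcarrier A" using w by (auto simp: path_algebra_simps path_elem_def)
  ultimately show "x \<in> ker" by (simp add: ker_def)
qed

lemma I_memD: "z \<in> I \<Longrightarrow> two_sided_ideal A J \<Longrightarrow> gens \<subseteq> J \<Longrightarrow> z \<in> J"
  unfolding I_eq by blast

lemma I_memI: "(\<And>J. two_sided_ideal A J \<Longrightarrow> gens \<subseteq> J \<Longrightarrow> z \<in> J) \<Longrightarrow> z \<in> I"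
  unfolding I_eq by blast

lemma I_ker: "z \<in> I \<Longrightarrow> z \<in> ker"
  by (rule I_memD[OF _ ker_ideal gens_ker])

lemma I_ideal: "two_sided_ideal A I"
  unfolding two_sided_ideal_def
proof (intro conjI ballI allI subsetI)
  have "(\<lambda>p. 0) \<in> I"
    by (rule I_memI, rule path_ideal.I_zero) (simp add: path_ideal_def)
  then show "I \<noteq> {}" by blast
  fix x assume x: "x \<in> I"
  \<comment> \<open>\<open>ker\<close> belongs to the family being intersected, which keeps
    \<open>I\<close> inside the carrier.\<close>
  show "x \<in> rcarrier A" using I_ker[OF x] by (simp add: ker_def)
  show "radd A x y \<in> I" if y: "y \<in> I" for y
  proof (rule I_memI)
    fix J assume J: "two_sided_ideal A J" "gens \<subseteq> J"
    show "radd A x y \<in> J" using J(1) I_memD[OF x J] I_memD[OF y J] unfolding two_sided_ideal_def by blast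
  qed
  show "rscale A c x \<in> I" for c
  proof (rule I_memI)
    fix J assume J: "two_sided_ideal A J" "gens \<subseteq> J"
    show "rscale A c x \<in> J" using J(1) I_memD[OF x J] unfolding two_sided_ideal_def by blast
  qed
  fix a assume a: "a \<in> rcarrier A"
  show "rmul A a x \<in> I" "rmul A x a \<in> I"
  proof -
    have *: "rmul A a x \<in> J \<and> rmul A x a \<in> J" if J: "two_sided_ideal A J" "gens \<subseteq> J" for J
      using J(1) I_memD[OF x J] a unfolding two_sided_ideal_def by blast
    show "rmul A a x \<in> I" by (rule I_memI) (rule *[THEN conjunct1])
    show "rmul A x a \<in> I" by (rule I_memI) (rule *[THEN conjunct2])
  qed
qed

lemma parallel_I:
  assumes "s \<in> paths_between Q' a b" "t \<in> paths_between Q' a b" "2 \<le> length s" "2 \<le> length t"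
  shows "(\<lambda>p. path_elem s p - path_elem t p) \<in> I"
proof -
  have "(\<lambda>p. path_elem s p - path_elem t p) \<in> gens"
    unfolding gens_def by (intro CollectI exI[of _ s] exI[of _ t] conjI refl) (use assms in \<open>simp_all add: paths_between_def\<close>)
  then show ?thesis by (intro I_memI) (rule subsetD)
qed

end

section \<open>A basis of the quotient with the nilsoliton structure constants\<close>

locale balanced_quiver = ext_quiver P r Q Q'
  for P :: "'v set" and r :: "('v \<times> 'v) set" and Q Q' :: "('v, 'a) quiver" +
  assumes bal: "balanced L"
begin

sublocale balanced_order "(edges Q)\<^sup>+"
  by unfold_locales (use finL L_irrefl bal in auto)

sublocale ideal: path_ideal Q' I
  by unfold_locales (rule I_ideal)

definition J where "J = Inl ` L \<union> Inr ` X"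

lemma finite_J: "finite J"
  by (rule finJ[OF finX J_def])

fun bas :: "('v \<times> 'v) + 'a \<Rightarrow> 'a list \<Rightarrow> real" where
  "bas (Inl (a, b)) = (\<lambda>p. 1 / sqrt (w a b) * path_elem (std_path a b) p)"
| "bas (Inr \<epsilon>) = (\<lambda>p. path_elem [\<epsilon>] p - path_elem (std_path (src Q' \<epsilon>) (tgt Q' \<epsilon>)) p)"

lemma extra_arrow:
  assumes "\<epsilon> \<in> X"
  shows "[\<epsilon>] \<in> paths_between Q' (src Q' \<epsilon>) (tgt Q' \<epsilon>)"
    "std_path (src Q' \<epsilon>) (tgt Q' \<epsilon>) \<in> paths_between Q' (src Q' \<epsilon>) (tgt Q' \<epsilon>)"
proof -
  show *: "[\<epsilon>] \<in> paths_between Q' (src Q' \<epsilon>) (tgt Q' \<epsilon>)"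
    using assms arrows_Q' by (auto simp: paths_between_def is_path_single path_src_def path_tgt_def)
  show "std_path (src Q' \<epsilon>) (tgt Q' \<epsilon>) \<in> paths_between Q' (src Q' \<epsilon>) (tgt Q' \<epsilon>)"
    by (rule std_path'[OF Q'_path_L[OF *]])
qed

lemma carrier_diff: "x \<in> rcarrier A \<Longrightarrow> y \<in> rcarrier A \<Longrightarrow> (\<lambda>p. x p - y p) \<in> rcarrier A"
  using carrier_add[OF _ carrier_scale[of y Q' "-1"], of x] by simp

lemma path_elem_between: "s \<in> paths_between Q' a b \<Longrightarrow> path_elem s \<in> rcarrier A"
  by (simp add: paths_between_def path_elem_carrier)

lemma bas_carrier: "j \<in> J \<Longrightarrow> bas j \<in> rcarrier A"
proof -
  assume "j \<in> J"
  then consider a b where "(a, b) \<in> L" "j = Inl (a, b)" | \<epsilon> where "\<epsilon> \<in> X" "j = Inr \<epsilon>" by (auto simp: J_def)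
  then show ?thesis
  proof cases
    case 1
    show ?thesis unfolding 1(2) bas.simps by (rule carrier_scale[OF path_elem_between[OF std_path'[OF 1(1)]]])
  next
    case 2
    show ?thesis unfolding 2(2) bas.simps by (rule carrier_diff; rule path_elem_between[OF extra_arrow(1)[OF 2(1)]] path_elem_between[OF extra_arrow(2)[OF 2(1)]])
  qed
qed

lemma append_between:
  assumes "s \<in> paths_between Q' a b" "t \<in> paths_between Q' b y"
  shows "s @ t \<in> paths_between Q' a y" "2 \<le> length (s @ t)"
proof -
  have ne: "s \<noteq> []" "t \<noteq> []" using assms by (auto simp: paths_between_def is_path_def)
  then show "s @ t \<in> paths_between Q' a y"
    using assms is_path_append[of Q' s t] path_append_ends[OF ne, of Q'] by (auto simp: paths_between_def)
  show "2 \<le> length (s @ t)" using ne by (cases s; cases t) auto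
qed

lemma product_elems:
  assumes "s \<in> paths_between Q' a b" "t \<in> paths_between Q' x y"
  shows "rmul A (path_elem s) (path_elem t) = (if b = x then path_elem (s @ t) else (\<lambda>_. 0))"
  using path_algebra_product_elems[of Q' s t] assms by (auto simp: paths_between_def)

text \<open>The parallel paths may be single arrows, so their difference need not lie in
  \<open>I\<close>. Multiplication by a further path makes both of length at least two, and then the
  difference does, or else both products vanish.\<close>

lemma parallel_product:
  assumes s: "s \<in> paths_between Q' a b" "s' \<in> paths_between Q' a b" and t: "t \<in> paths_between Q' x y"
  shows "rmul A (\<lambda>p. path_elem s p - path_elem s' p) (path_elem t) \<in> I"
    "rmul A (path_elem t) (\<lambda>p. path_elem s p - path_elem s' p) \<in> I"
proof -
  show "rmul A (\<lambda>p. path_elem s p - path_elem s' p) (path_elem t) \<in> I"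
    unfolding rmul_path_algebra_linear product_elems[OF s(1) t] product_elems[OF s(2) t]
    using parallel_I[of "s @ t" a y "s' @ t"] append_between[of s a b t y] append_between[of s' a b t y] s t ideal.I_zero
    by auto
  show "rmul A (path_elem t) (\<lambda>p. path_elem s p - path_elem s' p) \<in> I"
    unfolding rmul_path_algebra_linear product_elems[OF t s(1)] product_elems[OF t s(2)]
    using parallel_I[of "t @ s" x b "t @ s'"] append_between[of t x a s b] append_between[of t x a s' b] s t ideal.I_zero
    by auto
qed

lemma sum_\<alpha>_Inr: "i = Inr \<epsilon> \<or> j = Inr \<epsilon> \<Longrightarrow> (\<Sum>k\<in>J. \<alpha> i j k * bas k p) = 0"
  by (rule sum.neutral) auto

lemma bas_mul:
  assumes i: "i \<in> J" and j: "j \<in> J"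
  shows "(\<lambda>p. rmul A (bas i) (bas j) p - (\<Sum>k\<in>J. \<alpha> i j k * bas k p)) \<in> I"
proof -
  consider a b x y where "(a, b) \<in> L" "i = Inl (a, b)" "(x, y) \<in> L" "j = Inl (x, y)"
    | \<epsilon> where "\<epsilon> \<in> X" "i = Inr \<epsilon>" | a b \<epsilon> where "(a, b) \<in> L" "i = Inl (a, b)" "\<epsilon> \<in> X" "j = Inr \<epsilon>"
    using i j unfolding J_def by auto
  then show ?thesis
  proof cases
    case 1
    let ?k = "1 / sqrt (w a b) * (1 / sqrt (w x y))"
    have prod: "rmul A (bas i) (bas j) = (\<lambda>p. ?k * rmul A (path_elem (std_path a b)) (path_elem (std_path x y)) p)"
      unfolding 1 bas.simps rmul_path_algebra_linear by simp
    show ?thesis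
    proof (cases "b = x")
      case True
      have ay: "(a, y) \<in> L" using trancl_trans[OF 1(1)] 1(3) True by simp
      have s: "(\<Sum>k\<in>J. \<alpha> i j k * bas k p) = sqrt (\<tau> b) * bas (Inl (a, y)) p" for p
      proof -
        have "\<alpha> i j k * bas k p = (if k = Inl (a, y) then sqrt (\<tau> b) * bas k p else 0)" for k
          unfolding 1(2,4) by (cases "(i, j, k)" rule: \<alpha>.cases) (auto simp: 1(2,4) True)
        then have "(\<Sum>k\<in>J. \<alpha> i j k * bas k p) = (\<Sum>k\<in>J. if k = Inl (a, y) then sqrt (\<tau> b) * bas k p else 0)" by simp
        also have "\<dots> = sqrt (\<tau> b) * bas (Inl (a, y)) p" using finite_J ay by (simp add: J_def)
        finally show ?thesis .
      qed
      have "b \<in> Field L" by (rule FieldI2[OF 1(1)])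
      then have "sqrt (\<tau> b) > 0" using \<tau>_pos by simp
      moreover have "(x, y) \<in> L" "(a, x) \<in> L" using 1 True by auto
      then have "sqrt (w a y) = sqrt (\<tau> b) * (sqrt (w a b) * sqrt (w x y))"
        using w_mult[of a x y] True by (simp add: real_sqrt_mult)
      \<comment> \<open>The recursion \<open>w_mult\<close> for the scaling factors is exactly what
        turns the normalisation of the two factors into \<open>sqrt (\<tau> b)\<close> times that of
        the product.\<close>
      ultimately have k: "sqrt (\<tau> b) * (1 / sqrt (w a y)) = ?k" by (simp add: field_simps)
      have "(\<lambda>p. ?k * (path_elem (std_path a b @ std_path x y) p - path_elem (std_path a y) p)) \<in> I"
      proof (rule ideal.I_scale, rule parallel_I)
        have p: "std_path a b \<in> paths_between Q' a b" "std_path x y \<in> paths_between Q' b y"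
          using std_path'[OF 1(1)] std_path'[OF 1(3)] True by auto
        show "std_path a b @ std_path x y \<in> paths_between Q' a y" "2 \<le> length (std_path a b @ std_path x y)"
          using append_between[OF p] by auto
        then show "2 \<le> length (std_path a y)" by (rule std_path_long)
        show "std_path a y \<in> paths_between Q' a y" by (rule std_path'[OF ay])
      qed
      moreover have "rmul A (bas i) (bas j) p - (\<Sum>k\<in>J. \<alpha> i j k * bas k p) =
         ?k * (path_elem (std_path a b @ std_path x y) p - path_elem (std_path a y) p)" for p
        unfolding s prod product_elems[OF std_path'[OF 1(1)] std_path'[OF 1(3)]] bas.simps mult.assoc[symmetric] k[unfolded mult.assoc[symmetric]]
        using True by (simp add: right_diff_distrib)
      ultimately show ?thesis by simp
    next
      case False
      have "\<alpha> i j k = 0" for k using False 1 \<alpha>_cases[of i j k] by auto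
      then show ?thesis unfolding prod product_elems[OF std_path'[OF 1(1)] std_path'[OF 1(3)]]
        using False ideal.I_zero by simp
    qed
  next
    case (2 \<epsilon>)
    have *: "rmul A (bas i) (path_elem t) \<in> I" if "t \<in> paths_between Q' x y" for t x y
      unfolding 2 bas.simps by (rule parallel_product(1)[OF extra_arrow[OF 2(1)] that])
    have "rmul A (bas i) (bas j) \<in> I"
    proof (cases j)
      case (Inl xy)
      then obtain x y where xy: "(x, y) \<in> L" "j = Inl (x, y)" using j by (auto simp: J_def)
      show ?thesis unfolding xy(2) bas.simps(1) rmul_path_algebra_linear by (rule ideal.I_scale[OF *[OF std_path'[OF xy(1)]]])
    next
      case (Inr \<epsilon>')
      then have "\<epsilon>' \<in> X" using j by (auto simp: J_def)
      note e = extra_arrow[OF this]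
      show ?thesis unfolding Inr bas.simps(2) rmul_path_algebra_linear by (rule ideal.I_diff[OF *[OF e(1)] *[OF e(2)]])
    qed
    then show ?thesis using sum_\<alpha>_Inr[of i \<epsilon> j] 2(2) by simp
  next
    case (3 a b \<epsilon>)
    have "rmul A (bas i) (bas j) \<in> I"
      unfolding 3(2,4) bas.simps rmul_path_algebra_linear(5)
      by (rule ideal.I_scale[OF parallel_product(2)[OF extra_arrow[OF 3(3)] std_path'[OF 3(1)]]])
    then show ?thesis using sum_\<alpha>_Inr[of i \<epsilon> j] 3(4) by simp
  qed
qed

lemma bas_bracket:
  assumes i: "i \<in> J" and j: "j \<in> J"
  shows "(\<lambda>p. rmul A (bas i) (bas j) p - rmul A (bas j) (bas i) p - (\<Sum>k\<in>J. c i j k * bas k p)) \<in> I"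
  using ideal.I_diff[OF bas_mul[OF i j] bas_mul[OF j i]]
  by (simp add: c_def left_diff_distrib sum_subtractf algebra_simps)

text \<open>The functionals defining \<open>ker\<close> separate the basis: the coefficient at an
  extra arrow detects the \<open>Inr\<close> elements, as standard paths use only arrows of
  \<open>Q\<close>, and the coefficient sum over paths from \<open>x\<close> to \<open>y\<close>
  detects the \<open>Inl\<close> elements, as differences of parallel paths sum to 0.\<close>

lemma bas_independent:
  assumes I: "(\<lambda>p. \<Sum>j\<in>J. a j * bas j p) \<in> I" and k: "k \<in> J"
  shows "a k = 0"
proof -
  note ker = I_ker[OF I, unfolded ker_def]
  from k consider \<epsilon> where "\<epsilon> \<in> X" "k = Inr \<epsilon>" | x y where "(x, y) \<in> L" "k = Inl (x, y)" by (auto simp: J_def)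
  then show ?thesis
  proof cases
    case (1 \<epsilon>)
    have std: "path_elem (std_path x y) [\<epsilon>] = 0" if "(x, y) \<in> L" for x y
    proof -
      have "std_path x y \<noteq> [\<epsilon>]"
        using std_path[OF that] 1(1) is_path_single[of Q \<epsilon>] by (auto simp: paths_between_def X_def)
      then show ?thesis by (auto simp: path_elem_def)
    qed
    have "bas j [\<epsilon>] = (if j = k then 1 else 0)" if "j \<in> J" for j
    proof (cases j)
      case (Inl z)
      then show ?thesis using that std 1(2) by (cases z) (auto simp: J_def)
    next
      case (Inr \<epsilon>')
      then have "\<epsilon>' \<in> X" using that by (auto simp: J_def)
      then show ?thesis using std[OF Q'_path_L[OF extra_arrow(1)]] Inr 1(2) by (auto simp: path_elem_def)
    qed
    then have "(\<Sum>j\<in>J. a j * bas j [\<epsilon>]) = (\<Sum>j\<in>J. if j = k then a j else 0)" by (intro sum.cong) auto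
    also have "\<dots> = a k" using k finite_J by simp
    finally show ?thesis using ker 1(1) by simp
  next
    case (2 x y)
    have "(\<Sum>p\<in>paths_between Q' x y. bas j p) = (if j = k then 1 / sqrt (w x y) else 0)" if "j \<in> J" for j
    proof (cases j)
      case (Inl z)
      obtain x' y' where "z = (x', y')" by (cases z)
      with Inl that have z: "(x', y') \<in> L" "j = Inl (x', y')" by (auto simp: J_def)
      have "std_path x' y' \<in> paths_between Q' x y \<longleftrightarrow> x' = x \<and> y' = y"
        using std_path'[OF z(1)] by (auto simp: paths_between_def)
      then show ?thesis unfolding z(2) 2(2) bas.simps sum_distrib_left[symmetric] sum_path_elem by auto
    next
      case (Inr \<epsilon>')
      then have "\<epsilon>' \<in> X" using that by (auto simp: J_def)
      note e = extra_arrow[OF this]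
      have "[\<epsilon>'] \<in> paths_between Q' x y \<longleftrightarrow> std_path (src Q' \<epsilon>') (tgt Q' \<epsilon>') \<in> paths_between Q' x y"
        using e by (auto simp: paths_between_def)
      then show ?thesis unfolding Inr 2(2) bas.simps sum_subtractf sum_path_elem by simp
    qed
    then have "(\<Sum>j\<in>J. a j * (\<Sum>p\<in>paths_between Q' x y. bas j p)) = (\<Sum>j\<in>J. if j = k then a j * (1 / sqrt (w x y)) else 0)"
      by (intro sum.cong) auto
    also have "\<dots> = a k * (1 / sqrt (w x y))" using k finite_J by simp
    also have "(\<Sum>j\<in>J. a j * (\<Sum>p\<in>paths_between Q' x y. bas j p)) = (\<Sum>p\<in>paths_between Q' x y. \<Sum>j\<in>J. a j * bas j p)"
      unfolding sum_distrib_left by (rule sum.swap)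
    also have "\<dots> = 0" using ker by simp
    finally show ?thesis using w_pos[of x y] by simp
  qed
qed

text \<open>A long path is congruent to the standard path with its ends, an arrow of
  \<open>Q\<close> is itself a standard path, and an extra arrow is its \<open>Inr\<close> basis
  element plus the standard path parallel to it.\<close>

lemma bas_span:
  assumes s: "is_path Q' s"
  shows "\<exists>a. (\<lambda>p. path_elem s p - (\<Sum>j\<in>J. a j * bas j p)) \<in> I"
proof -
  let ?a = "path_src Q' s" and ?b = "path_tgt Q' s"
  have sb: "s \<in> paths_between Q' ?a ?b" using s by (simp add: paths_between_def)
  have ab: "(?a, ?b) \<in> L" by (rule Q'_path_L[OF sb])
  have std: "(\<Sum>j\<in>J. (if j = Inl (?a, ?b) then sqrt (w ?a ?b) else 0) * bas j p) = path_elem (std_path ?a ?b) p" for p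
  proof -
    have "(\<Sum>j\<in>J. (if j = Inl (?a, ?b) then sqrt (w ?a ?b) else 0) * bas j p) = (\<Sum>j\<in>J. if j = Inl (?a, ?b) then sqrt (w ?a ?b) * bas j p else 0)"
      by (intro sum.cong) auto
    also have "\<dots> = sqrt (w ?a ?b) * bas (Inl (?a, ?b)) p" using finite_J ab by (simp add: J_def)
    finally show ?thesis using w_pos[of ?a ?b] by simp
  qed
  show ?thesis
  proof (cases "2 \<le> length s")
    case True
    have "(\<lambda>p. path_elem s p - path_elem (std_path ?a ?b) p) \<in> I"
      by (rule parallel_I[OF sb std_path'[OF ab] True std_path_long[OF sb True]])
    then show ?thesis
      by (intro exI[of _ "\<lambda>j. if j = Inl (?a, ?b) then sqrt (w ?a ?b) else 0"]) (simp only: std)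
  next
    case False
    then obtain \<alpha>' where \<alpha>': "s = [\<alpha>']" using path_not_Nil[OF s] by (cases s) (auto simp: Suc_le_eq)
    then have arr: "\<alpha>' \<in> arrows Q'" and e: "?a = src Q' \<alpha>'" "?b = tgt Q' \<alpha>'"
      using s by (auto simp: is_path_single path_src_def path_tgt_def)
    show ?thesis
    proof (cases "\<alpha>' \<in> arrows Q")
      case True
      have "std_path ?a ?b = s" using std_path_arrow[OF True] src_Q'[OF True] tgt_Q'[OF True] e \<alpha>' by simp
      then show ?thesis using ideal.I_zero std
        by (intro exI[of _ "\<lambda>j. if j = Inl (?a, ?b) then sqrt (w ?a ?b) else 0"]) (simp only: diff_self)
    next
      case False
      then have X: "\<alpha>' \<in> X" using arr by (simp add: X_def)
      have r: "(\<Sum>j\<in>J. (if j = Inr \<alpha>' then 1 else 0) * bas j p) = bas (Inr \<alpha>') p" for p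
      proof -
        have "(\<Sum>j\<in>J. (if j = Inr \<alpha>' then 1 else 0) * bas j p) = (\<Sum>j\<in>J. if j = Inr \<alpha>' then bas j p else 0)"
          by (intro sum.cong) auto
        then show ?thesis using finite_J X by (simp add: J_def)
      qed
      have "path_elem s p - (\<Sum>j\<in>J. ((if j = Inr \<alpha>' then 1 else 0) + (if j = Inl (?a, ?b) then sqrt (w ?a ?b) else 0)) * bas j p) = 0" for p
        unfolding distrib_right sum.distrib r std unfolding bas.simps e unfolding \<alpha>' by simp
      then show ?thesis using ideal.I_zero
        by (intro exI[of _ "\<lambda>j. (if j = Inr \<alpha>' then 1 else 0) + (if j = Inl (?a, ?b) then sqrt (w ?a ?b) else 0)"]) (simp only:)
    qed
  qed
qed

text \<open>The basis \<open>bas\<close> is carried by \<Psi> to a basis of left-invariant fields: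
  congruences modulo \<open>I\<close> become equations between fields, and relations between fields
  become membership in \<open>I\<close>. All hypotheses of \<open>nilsoliton\<close> are then
  statements about the order \<open>L\<close>.\<close>

lemma soliton_on_group:
  fixes G :: "('g::{t2_space, second_countable_topology}, 'e::euclidean_space) manifold"
    and mul :: "'g \<Rightarrow> 'g \<Rightarrow> 'g" and e :: 'g and iv :: "'g \<Rightarrow> 'g"
  assumes lie: "lie_group G mul e iv" and sc: "simply_connected (UNIV :: 'g set)"
    and iso: "ralg_isomorphic (lie_algebra_of G mul) (quotient_lie_algebra Q')"
  shows "\<exists>g. left_invariant_metric G mul g \<and> ricci_soliton G g"
proof -
  interpret g: lie_grp G mul e iv
    by unfold_locales (use lie in \<open>simp_all add: lie_group_def\<close>)
  show ?thesis
  proof (rule g.LI_of_path_algebra[OF I_ideal iso[unfolded quotient_lie_algebra_def]])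
    fix \<Psi> :: "('a list \<Rightarrow> real) \<Rightarrow> 'g vfield"
    assume \<Psi>: "\<And>x. x \<in> rcarrier A \<Longrightarrow> \<Psi> x \<in> g.LI"
      "\<And>X. X \<in> g.LI \<Longrightarrow> \<exists>x\<in>rcarrier A. X = \<Psi> x"
      and \<Psi>_add: "\<And>x y. x \<in> rcarrier A \<Longrightarrow> y \<in> rcarrier A \<Longrightarrow> \<Psi> (\<lambda>p. x p + y p) = vadd (\<Psi> x) (\<Psi> y)"
      and \<Psi>_scale: "\<And>x k. x \<in> rcarrier A \<Longrightarrow> \<Psi> (\<lambda>p. k * x p) = vmult (\<lambda>_. k) (\<Psi> x)"
      and \<Psi>_br: "\<And>x y. x \<in> rcarrier A \<Longrightarrow> y \<in> rcarrier A \<Longrightarrow>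
         \<Psi> (\<lambda>p. rmul A x y p - rmul A y x p) = vbracket (\<Psi> x) (\<Psi> y)"
      and \<Psi>_eq: "\<And>x y. x \<in> rcarrier A \<Longrightarrow> y \<in> rcarrier A \<Longrightarrow> \<Psi> x = \<Psi> y \<longleftrightarrow> (\<lambda>p. x p - y p) \<in> I"
    have zero: "(\<lambda>p. 0) \<in> rcarrier A" by (simp add: path_algebra_simps)
    have csum: "(\<lambda>p. \<Sum>j\<in>K. a j * x j p) \<in> rcarrier A" if "\<And>j. j \<in> K \<Longrightarrow> x j \<in> rcarrier A" for K :: "'k set" and a x
      using that
    proof (induction K rule: infinite_finite_induct)
      case (insert i K)
      then have "(\<lambda>p. a i * x i p + (\<Sum>j\<in>K. a j * x j p)) \<in> rcarrier A"
        by (intro carrier_add carrier_scale) auto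
      with insert show ?case by simp
    qed (use zero in simp_all)
    have \<Psi>_zero: "\<Psi> (\<lambda>p. 0) = (\<lambda>p f. 0)" using \<Psi>_scale[OF zero, of 0] by (simp add: vmult_def)
    have \<Psi>_sum: "\<Psi> (\<lambda>p. \<Sum>j\<in>K. a j * x j p) = (\<lambda>p f. \<Sum>j\<in>K. a j * \<Psi> (x j) p f)"
      if "finite K" "\<And>j. j \<in> K \<Longrightarrow> x j \<in> rcarrier A" for K :: "'k set" and a x
      using that
    proof (induction K)
      case (insert i K)
      have "\<Psi> (\<lambda>p. a i * x i p + (\<Sum>j\<in>K. a j * x j p)) = vadd (\<Psi> (\<lambda>p. a i * x i p)) (\<Psi> (\<lambda>p. \<Sum>j\<in>K. a j * x j p))"
        by (rule \<Psi>_add) (use insert in \<open>auto intro: carrier_scale csum\<close>)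
      with insert show ?case by (simp add: \<Psi>_scale vadd_def vmult_def)
    qed (simp add: \<Psi>_zero)
    have \<Psi>_bas: "\<Psi> (\<lambda>p. \<Sum>j\<in>J. a j * bas j p) = (\<lambda>p f. \<Sum>j\<in>J. a j * \<Psi> (bas j) p f)" for a
      by (rule \<Psi>_sum[OF finite_J bas_carrier])
    show ?thesis
    proof (rule g.nilsoliton[of J "\<lambda>j. \<Psi> (bas j)" c rk d "- 1 / 2"])
      show "finite J" by (rule finite_J)
      show "\<Psi> (bas j) \<in> g.LI" if "j \<in> J" for j by (rule \<Psi>(1)[OF bas_carrier[OF that]])
      show "simply_connected (UNIV :: 'g set)" by (rule sc)
      show "rk j < rk k" if "i \<in> J" "j \<in> J" "k \<in> J" "c i j k \<noteq> 0" for i j k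
        by (rule rk_less[OF finX J_def that(1,2,4)])
      show "d i + d j = d k" if "i \<in> J" "j \<in> J" "k \<in> J" "c i j k \<noteq> 0" for i j k
        by (rule d_additive[OF finX J_def that(1,2,4)])
      show "(\<Sum>i\<in>J. \<Sum>m\<in>J. c i m b * c i m n) / 4 - (\<Sum>i\<in>J. \<Sum>m\<in>J. c b i m * c n i m) / 2
         = (if b = n then - 1 / 2 + d b else 0)" if "b \<in> J" "n \<in> J" for b n
        by (rule ricci_diagonal[OF finX J_def that])
      show "a j = 0" if 0: "\<And>p f. (\<Sum>j\<in>J. a j * \<Psi> (bas j) p f) = 0" and j: "j \<in> J" for a j
      proof (rule bas_independent[OF _ j])
        have "\<Psi> (\<lambda>p. \<Sum>j\<in>J. a j * bas j p) = \<Psi> (\<lambda>p. 0)" unfolding \<Psi>_bas \<Psi>_zero using 0 by simp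
        then show "(\<lambda>p. \<Sum>j\<in>J. a j * bas j p) \<in> I"
          using \<Psi>_eq[OF csum[of J bas a, OF bas_carrier] zero] by simp
      qed
      show "vbracket (\<Psi> (bas i)) (\<Psi> (bas j)) p f = (\<Sum>k\<in>J. c i j k * \<Psi> (bas k) p f)" if ij: "i \<in> J" "j \<in> J" for i j p f
      proof -
        have "\<Psi> (\<lambda>p. rmul A (bas i) (bas j) p - rmul A (bas j) (bas i) p) = \<Psi> (\<lambda>p. \<Sum>k\<in>J. c i j k * bas k p)"
          by (rule \<Psi>_eq[THEN iffD2, OF _ _ bas_bracket[OF ij]])
             (auto intro: carrier_diff rmul_carrier csum bas_carrier)
        then show ?thesis unfolding \<Psi>_br[OF bas_carrier[OF ij(1)] bas_carrier[OF ij(2)]] \<Psi>_bas by (rule fun_cong[OF fun_cong])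
      qed
      fix Y assume "Y \<in> g.LI"
      then obtain x where x: "x \<in> rcarrier A" "Y = \<Psi> x" using \<Psi>(2) by blast
      let ?P = "{s. is_path Q' s}"
      have "\<forall>s\<in>?P. \<exists>a. \<Psi> (path_elem s) = (\<lambda>p f. \<Sum>j\<in>J. a j * \<Psi> (bas j) p f)"
      proof
        fix s assume s: "s \<in> ?P"
        then obtain a where "(\<lambda>p. path_elem s p - (\<Sum>j\<in>J. a j * bas j p)) \<in> I" using bas_span by blast
        then have "\<Psi> (path_elem s) = \<Psi> (\<lambda>p. \<Sum>j\<in>J. a j * bas j p)"
          using \<Psi>_eq[OF path_elem_carrier csum[of J bas a, OF bas_carrier]] s by simp
        then show "\<exists>a. \<Psi> (path_elem s) = (\<lambda>p f. \<Sum>j\<in>J. a j * \<Psi> (bas j) p f)" unfolding \<Psi>_bas by blast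
      qed
      then obtain a where a: "\<And>s. s \<in> ?P \<Longrightarrow> \<Psi> (path_elem s) = (\<lambda>p f. \<Sum>j\<in>J. a s j * \<Psi> (bas j) p f)"
        unfolding bchoice_iff by blast
      \<comment> \<open>Only finitely many paths exist, so an element of the path algebra is a
        finite combination of paths and spanning can be checked on single paths.\<close>
      have xs: "x = (\<lambda>p. \<Sum>s\<in>?P. x s * path_elem s p)"
      proof
        fix p
        have "(\<Sum>s\<in>?P. x s * path_elem s p) = (\<Sum>s\<in>?P. if s = p then x s else 0)" by (intro sum.cong) (auto simp: path_elem_def)
        also have "\<dots> = x p" using finite_paths x(1) by (auto simp: path_algebra_simps)
        finally show "x p = (\<Sum>s\<in>?P. x s * path_elem s p)" by simp
      qed
      have "Y = (\<lambda>p f. \<Sum>s\<in>?P. x s * \<Psi> (path_elem s) p f)"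
        unfolding x(2) by (subst xs, rule \<Psi>_sum[OF finite_paths]) (simp add: path_elem_carrier)
      also have "\<dots> = (\<lambda>p f. \<Sum>s\<in>?P. \<Sum>j\<in>J. x s * a s j * \<Psi> (bas j) p f)"
      proof (rule ext, rule ext, rule sum.cong[OF refl])
        fix p f s assume s: "s \<in> ?P"
        show "x s * \<Psi> (path_elem s) p f = (\<Sum>j\<in>J. x s * a s j * \<Psi> (bas j) p f)"
          unfolding a[OF s] by (simp add: sum_distrib_left mult.assoc)
      qed
      also have "\<dots> = (\<lambda>p f. \<Sum>j\<in>J. (\<Sum>s\<in>?P. x s * a s j) * \<Psi> (bas j) p f)"
        by (intro ext, subst sum.swap) (simp add: sum_distrib_right)
      finally show "\<exists>c. Y = (\<lambda>p f. \<Sum>j\<in>J. c j * \<Psi> (bas j) p f)"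
        by (intro exI[of _ "\<lambda>j. \<Sum>s\<in>?P. x s * a s j"])
    qed
  qed
qed

end

theorem theorem1p4:
  fixes P :: "'v set" and r :: "('v \<times> 'v) set"
    and Q Q' :: "('v, 'a) quiver"
    and G :: "('g::{t2_space, second_countable_topology}, 'e::euclidean_space) manifold"
    and mul :: "'g \<Rightarrow> 'g \<Rightarrow> 'g" and e :: 'g and iv :: "'g \<Rightarrow> 'g"
  assumes "finite P" and "taos P r" and "hasse_quiver P r Q"
    and "array_hasse_quiver Q \<or> components_array_condition Q"
    and "multiple_arrow_extension Q Q'"
    and "lie_group G mul e iv" and "simply_connected (UNIV :: 'g set)"
    and "ralg_isomorphic (lie_algebra_of G mul) (quotient_lie_algebra Q')"
  shows "\<exists>g. left_invariant_metric G mul g \<and> ricci_soliton G g"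
proof -
  have "balanced ((edges Q)\<^sup>+)"
    using assms(4) array_balanced components_balanced by blast
  then interpret balanced_quiver P r Q Q'
    by unfold_locales (use assms in auto)
  show ?thesis by (rule soliton_on_group[OF assms(6-8)])
qed

end
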